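(* Let $N>2$ be an integer. Let $V$ be a radially symmetric, locally Lipschitz continuous function on $\mathbb{R}^N\setminus\{0\}$ such that for some $c_1>0$ and some $a_0,a_\infty$ with $$a_0<2,\qquad a_\infty>\max\left\{0,1+\frac{a_0}{2}\right\},$$ one has $$V(x)\le \frac{c_1}{|x|^{a_0}(1+|x|^{a_\infty-a_0})},\qquad x\in\mathbb{R}^N\setminus\{0\}.$$ Let $p>1$ satisfy $$p\in\left(\frac{N-a_\infty}{N-2},\frac{N-a_0}{N-2}\right)\cap\left(\max\{2^*(a_\infty)-1,0\},\ 2^*(a_0)-1\right).$$ Then, for $k\in(0,k_p)$, problem $(P_k)$ admits a radially symmetric solution $u>u_{k,V}$, where $u_{k,V}$ is the minimal solution of $(P_k)$, and both $u$ and $u_{k,V}$ are classical solutions of $$-\Delta u=Vu^p\ \text{ in }\mathbb{R}^N\setminus\{0\},\qquad \lim_{|x|\to+\infty}u(x)=0.$$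
   Context: $2^*(t)=\frac{2N-2t}{N-2}$ for $t\in\mathbb{R}$. For $k>0$, $(P_k)$ denotes the problem $$-\Delta u=Vu^p+k\delta_0\ \text{ in }\mathbb{R}^N,\qquad \lim_{|x|\to+\infty}u(x)=0,$$ where $\delta_0$ is the Dirac mass at the origin. A (weak) solution of $(P_k)$ is a nonnegative $u\in L^1_{loc}(\mathbb{R}^N)$ such that $Vu^p\in L^1(\mathbb{R}^N)$, $\lim_{r\to+\infty}\sup_{x\in\mathbb{R}^N\setminus B_r(0)}u(x)=0$, and $\int_{\mathbb{R}^N}u(-\Delta)\xi\,dx=\int_{\mathbb{R}^N}Vu^p\xi\,dx+k\xi(0)$ for all $\xi\in C^{1,1}_c(\mathbb{R}^N)$. The minimal solution $u_{k,V}$ of $(P_k)$ is the positive solution with $u_{k,V}\le u$ for every positive solution $u$ of $(P_k)$; it exists for $k\in(0,k_p)$. $\mathbb{G}[f](x)=\int_{\mathbb{R}^N}G(x,y)f(y)\,dy$ is the Green operator of $-\Delta$ in $\mathbb{R}^N$, with Green kernel $G(x,y)=c_N|x-y|^{2-N}$ ($c_N>0$ the normalizing constant), and $\mathbb{G}[\delta_0](x)=c_N|x|^{2-N}$. Let $c_2>0$ denote a constant such that $\mathbb{G}[V\,\mathbb{G}[\delta_0]^p]\le c_2\,\mathbb{G}[\delta_0]$ in $\mathbb{R}^N\setminus\{0\}$, and set $k_p=(c_2p)^{-\frac{1}{p-1}}\frac{p-1}{p}$.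
   Formalization: The formal theorem additionally assumes that V is nonnegative and not identically zero on R^N\{0}; without this the claim is false, e.g. for V = 0 the only solution of (P_k) is k G[δ_0], and for V ≤ 0 solutions are unique, so no larger solution exists. *)

theory Defs
  imports "HOL-Analysis.Analysis"
begin

text \<open>Throughout, the space is \<open>real^'n\<close> and \<open>N = CARD('n)\<close>.\<close>

definition radially_symmetric :: "(real^'n \<Rightarrow> real) \<Rightarrow> bool" where
  "radially_symmetric f \<longleftrightarrow> (\<forall>x y. norm x = norm y \<longrightarrow> f x = f y)"

definition locally_lipschitz_on :: "(real^'n) set \<Rightarrow> (real^'n \<Rightarrow> real) \<Rightarrow> bool" where
  "locally_lipschitz_on S f \<longleftrightarrow>
     (\<forall>x\<in>S. \<exists>r>0. \<exists>L. L-lipschitz_on (ball x r \<inter> S) f)"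

definition two_star :: "nat \<Rightarrow> real \<Rightarrow> real" where
  "two_star N t = (2 * real N - 2 * t) / (real N - 2)"


subsection \<open>Differential operators and function classes\<close>

definition partial_deriv :: "'n \<Rightarrow> (real^'n \<Rightarrow> real) \<Rightarrow> real^'n \<Rightarrow> real" where
  "partial_deriv i f x = deriv (\<lambda>t. f (x + t *\<^sub>R axis i 1)) 0"

text \<open>For a \<open>C\<^sup>1\<^sup>,\<^sup>1\<close> function the second partial derivatives exist almost everywhere;
  elsewhere the value of \<open>deriv\<close> is unspecified, which does not affect integrals.\<close>

definition laplacian :: "(real^'n \<Rightarrow> real) \<Rightarrow> real^'n \<Rightarrow> real" where
  "laplacian f x = (\<Sum>i\<in>UNIV. partial_deriv i (partial_deriv i f) x)"

text \<open>Because of the compact support, a locally Lipschitz gradient is globally Lipschitz.\<close>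

definition C11_compact_support :: "(real^'n \<Rightarrow> real) \<Rightarrow> bool" where
  "C11_compact_support \<xi> \<longleftrightarrow>
     (\<exists>g. (\<forall>x. GDERIV \<xi> x :> g x) \<and> (\<exists>L. L-lipschitz_on UNIV g)) \<and>
     compact (closure {x. \<xi> x \<noteq> 0})"

text \<open>Intended for open \<open>S\<close>; \<open>g\<close> is the gradient and \<open>H\<close> the Hessian.\<close>

definition C2_on :: "(real^'n) set \<Rightarrow> (real^'n \<Rightarrow> real) \<Rightarrow> bool" where
  "C2_on S f \<longleftrightarrow>
     (\<exists>(g :: real^'n \<Rightarrow> real^'n) (H :: real^'n \<Rightarrow> real^'n^'n).
        (\<forall>x\<in>S. GDERIV f x :> g x \<and> (g has_derivative (\<lambda>h. H x *v h)) (at x)) \<and>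
        continuous_on S H)"

definition L1_loc :: "(real^'n \<Rightarrow> real) \<Rightarrow> bool" where
  "L1_loc f \<longleftrightarrow> (\<forall>K. compact K \<longrightarrow> set_integrable lebesgue K f)"


subsection \<open>The Green operator\<close>

text \<open>\<open>N \<omega>\<^sub>N\<close> is the surface measure of the unit sphere, where \<open>\<omega>\<^sub>N\<close> is the volume of the unit
  ball; this normalization gives \<open>- \<Delta> G(\<cdot>, y) = \<delta>\<^sub>y\<close>.\<close>

definition green_const :: "nat \<Rightarrow> real" where
  "green_const N = 1 / (real N * (real N - 2) * unit_ball_vol (real N))"

definition green_kernel :: "real^'n \<Rightarrow> real^'n \<Rightarrow> real" where
  "green_kernel x y = green_const CARD('n) * norm (x - y) powr (2 - real CARD('n))"

definition green_op :: "(real^'n \<Rightarrow> real) \<Rightarrow> real^'n \<Rightarrow> real" where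
  "green_op f x = (LINT y|lebesgue. green_kernel x y * f y)"

definition green_dirac :: "real^'n \<Rightarrow> real" where
  "green_dirac x = green_const CARD('n) * norm x powr (2 - real CARD('n))"

definition k_threshold :: "real \<Rightarrow> real \<Rightarrow> real" where
  "k_threshold c2 p = (c2 * p) powr (- 1 / (p - 1)) * ((p - 1) / p)"


subsection \<open>Solutions\<close>

text \<open>The supremum is taken in \<open>ereal\<close>, so that it is \<open>\<infinity>\<close> when \<open>u\<close> is unbounded.
  The real values of \<open>V\<close> and \<open>u\<close> at the origin are irrelevant.\<close>

definition weak_solution ::
    "(real^'n \<Rightarrow> real) \<Rightarrow> real \<Rightarrow> real \<Rightarrow> (real^'n \<Rightarrow> real) \<Rightarrow> bool" where
  "weak_solution V p k u \<longleftrightarrow>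
     (\<forall>x. 0 \<le> u x) \<and>
     L1_loc u \<and>
     integrable lebesgue (\<lambda>x. V x * u x powr p) \<and>
     ((\<lambda>r. SUP x\<in>- ball 0 r. ereal (u x)) \<longlongrightarrow> 0) at_top \<and>
     (\<forall>\<xi>. C11_compact_support \<xi> \<longrightarrow>
        (LINT x|lebesgue. u x * (- laplacian \<xi> x)) =
        (LINT x|lebesgue. V x * u x powr p * \<xi> x) + k * \<xi> 0)"

definition positive_weak_solution ::
    "(real^'n \<Rightarrow> real) \<Rightarrow> real \<Rightarrow> real \<Rightarrow> (real^'n \<Rightarrow> real) \<Rightarrow> bool" where
  "positive_weak_solution V p k u \<longleftrightarrow> weak_solution V p k u \<and> (\<forall>x. x \<noteq> 0 \<longrightarrow> 0 < u x)"

text \<open>Weak solutions are elements of \<open>L\<^sup>1\<^sub>l\<^sub>o\<^sub>c\<close> and can be changed arbitrarily on null sets, so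
  the comparison must be almost everywhere: no function is minimal for the
  everywhere-pointwise order.\<close>

definition minimal_solution ::
    "(real^'n \<Rightarrow> real) \<Rightarrow> real \<Rightarrow> real \<Rightarrow> (real^'n \<Rightarrow> real) \<Rightarrow> bool" where
  "minimal_solution V p k v \<longleftrightarrow>
     positive_weak_solution V p k v \<and>
     (\<forall>u. positive_weak_solution V p k u \<longrightarrow> (AE x in lebesgue. v x \<le> u x))"

definition classical_solution ::
    "(real^'n \<Rightarrow> real) \<Rightarrow> real \<Rightarrow> (real^'n \<Rightarrow> real) \<Rightarrow> bool" where
  "classical_solution V p u \<longleftrightarrow>
     C2_on (- {0}) u \<and>
     (\<forall>x. x \<noteq> 0 \<longrightarrow> - laplacian u x = V x * u x powr p) \<and>
     (u \<longlongrightarrow> 0) at_infinity"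

end

theory Submission
  imports Defs "HOL-Complex_Analysis.Great_Picard"
begin

text \<open>Write \<open>\<Gamma>\<close> for the fundamental solution \<open>G[\<delta>\<^sub>0]\<close>. Off the origin, a function \<open>w(\<Gamma>(x))\<close> solves
  \<open>- \<Delta>u = V u\<^sup>p\<close> iff \<open>w'' = - q w\<^sup>p\<close> on \<open>(0,\<infinity>)\<close>, where \<open>q\<close> is \<open>V\<close>, as a function of \<open>\<Gamma>\<close>, divided by
  \<open>|\<nabla>\<Gamma>|\<^sup>2\<close>. Decay at infinity becomes \<open>w(0) = 0\<close> and the Dirac mass becomes \<open>w'(\<infinity>) = k\<close>, so that
  the radial form of the problem is the integral equation
  \<open>w(s) = k s + \<integral> min(s,t) q(t) w(t)\<^sup>p dt\<close>. The growth conditions on \<open>V\<close> and \<open>p\<close> say that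
  \<open>\<integral> q t\<^sup>p\<close> and \<open>\<integral> q t\<^bsup>(p+1)/2\<^esup>\<close> are finite, and the bound on \<open>G[V \<Gamma>\<^sup>p]\<close> gives
  \<open>\<integral> q t\<^sup>p \<le> c\<^sub>2\<close>.

  The minimal solution is the limit of the monotone iteration started at \<open>k s\<close>, which stays below
  some \<open>\<lambda> s\<close> with \<open>\<lambda> < b\<^sup>* = (c\<^sub>2 p)\<^bsup>-1/(p-1)\<^esup>\<close>. The second one is found by shooting from \<open>w(0) = 0\<close>,
  \<open>w'(0) = b\<close>. Let \<open>K(b) = w'(\<infinity>)\<close>. The condition \<open>k < k\<^sub>p\<close> gives \<open>K(b\<^sup>*) > k\<close>. A maximizer of
  \<open>\<integral> q \<phi>\<^bsup>p+1\<^esup>\<close> on the unit ball of the energy space yields, for \<open>q\<close> cut off at some \<open>R\<close>, a positive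
  solution with \<open>w'(\<infinity>) = 0\<close>, and its slope \<open>b\<close> at \<open>0\<close> satisfies \<open>K(b) \<le> 0\<close>. Hence \<open>K(b) = k\<close>
  for some \<open>b \<ge> b\<^sup>*\<close>, and this solution is larger than the minimal one because its slope at \<open>0\<close>
  exceeds \<open>\<lambda>\<close>.

  A weak solution need not be radial. To compare it with the iterates, test its equation with
  functions whose Laplacian is the difference of two radial mollifiers supported between level sets
  of \<open>\<Gamma>\<close>: the mollified difference is then monotone in the scale, and at infinite scale it is
  nonnegative.\<close>

section \<open>A Volterra equation\<close>

text \<open>Passing to y = w/s makes the shooting problem regular at s = 0: the source is f y^p with
  the integrable weight f = q t^p, the initial slope is the limit b of y at 0, and y \<le> b. This
  gives K(b) \<ge> b - m b^p with m = \<integral> q t^p \<le> c_2. The slope at which K is compared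
  with k is the maximizer of b - c_2 b^p, and k_p is the maximum, so the threshold is the best one
  that this estimate can give. The same number separates the two solutions: the minimal one has a
  slope at 0 below it, the second one does not. Hence no variational characterization of the second
  solution is needed, only some b_0 with K(b_0) \<le> 0; the cut-off at R is harmless for this,
  because the source removed beyond R could only lower the slope further. In space the obstacle is
  the test functions: a C^{1,1} function has second derivatives only almost everywhere, so Green's
  identity rests on the differentiability almost everywhere of Lipschitz functions. The weak formula
  and the comparison are stated for the linear problem with a given source, which covers solutions
  and iterates alike.\<close>

definition primitive :: "(real \<Rightarrow> real) \<Rightarrow> real \<Rightarrow> real" where
  "primitive f s = (LINT t|lborel. (if t \<le> s then f t else 0))"

lemma integrable_if_pred:
  fixes f :: "real \<Rightarrow> real"
  assumes "integrable lborel f" and [measurable]: "Measurable.pred borel P"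
  shows "integrable lborel (\<lambda>t. if P t then f t else 0)"
  by (rule Bochner_Integration.integrable_bound[OF assms(1)]) (use assms(1) in auto)

lemma primitive_split:
  assumes f: "integrable lborel f" and a: "a \<le> s"
  shows "primitive f s = primitive f a + integral {a..s} f"
proof -
  have 1: "set_integrable lborel {..a} f" "set_integrable lborel {a<..s} f" "set_integrable lborel {a..s} f"
    unfolding set_integrable_def using f by (intro integrable_mult_indicator; simp)+
  have F: "primitive f x = (LBINT t:{..x}. f t)" for x
    unfolding primitive_def set_lebesgue_integral_def by (intro Bochner_Integration.integral_cong) auto
  have "{..s} = {..a} \<union> {a<..s}" using a by auto
  then have "primitive f s = primitive f a + (LBINT t:{a<..s}. f t)"
    unfolding F using set_integral_Un[OF _ 1(1) 1(2)] by (simp add: disjoint_iff)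
  also have "(LBINT t:{a<..s}. f t) = (LBINT t:{a..s}. f t)"
    unfolding set_lebesgue_integral_def using f
    by (intro integral_cong_AE)
       (auto intro!: AE_I[where N="{a}"] simp: indicator_def)
  also have "\<dots> = integral {a..s} f" using 1 by (intro set_borel_integral_eq_integral)
  finally show ?thesis .
qed

text \<open>The integrand may be singular at 0, so the fundamental theorem of calculus is applied on
  [s/2, s + 1] only; the mass to the left of s/2 is a constant.\<close>

lemma primitive_deriv:
  assumes f: "integrable lborel f" and c: "continuous_on {0<..} f" and s: "0 < s"
  shows "(primitive f has_real_derivative f s) (at s)"
proof -
  let ?a = "s / 2"
  have c: "continuous_on {?a..s + 1} f"
    by (rule continuous_on_subset[OF c]) (use s in auto)
  have "((\<lambda>x. integral {?a..x} f) has_real_derivative f s) (at s within {?a..s+1})"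
    by (rule integral_has_real_derivative[OF c]) (use s in auto)
  then have "((\<lambda>x. primitive f ?a + integral {?a..x} f) has_real_derivative f s) (at s within {?a..s+1})"
    by (auto intro!: derivative_eq_intros)
  then have "(primitive f has_real_derivative f s) (at s within {?a..s+1})"
    by (rule has_field_derivative_transform_within[OF _ zero_less_one])
       (use s in \<open>auto simp: primitive_split[OF f, of ?a, symmetric]\<close>)
  moreover have "at s within {?a..s+1} = at s"
    by (rule at_within_interior) (use s in auto)
  ultimately show ?thesis by simp
qed

text \<open>Mean value theorem. The intermediate point exceeds a, so the derivative rule for
  \<open>powr\<close> is needed at positive arguments only, even when a = 0.\<close>

lemma powr_diff_le:
  fixes a b M p :: real
  assumes "0 \<le> a" "a \<le> b" "b \<le> M" "1 \<le> p"
  shows "b powr p - a powr p \<le> p * M powr (p - 1) * (b - a)"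
proof (cases "a = b")
  case False
  then have ab: "a < b" using assms by simp
  have "continuous_on {a..b} (\<lambda>x. x powr p)"
    using assms by (intro continuous_on_powr') (auto intro!: continuous_intros)
  moreover have D: "((\<lambda>x. x powr p) has_real_derivative p * x powr (p - 1)) (at x)" if "a < x" for x
    using that assms by (intro has_real_derivative_powr) auto
  ultimately obtain l z where z: "a < z" "z < b" "((\<lambda>x. x powr p) has_real_derivative l) (at z)"
      "b powr p - a powr p = (b - a) * l"
    using MVT[OF ab, of "\<lambda>x. x powr p"] by (metis real_differentiable_def)
  have "l = p * z powr (p - 1)" using z D[of z] DERIV_unique by blast
  moreover have "z powr (p - 1) \<le> M powr (p - 1)" using z assms by (intro powr_mono2) auto
  ultimately show ?thesis using z assms ab
    by (simp add: mult.commute mult_left_mono mult_mono)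
qed simp

text \<open>For \<open>w'' = - f (w/s)\<^sup>p\<close> with \<open>w(0) = 0\<close> and \<open>w'(0) = b\<close>, the quotient \<open>y(s) = w(s)/s\<close> satisfies
  \<open>y = volterra_op M b y\<close> as long as \<open>0 \<le> y \<le> M\<close>; the clipping makes the nonlinearity globally Lipschitz.\<close>

locale volterra =
  fixes f :: "real \<Rightarrow> real" and p :: real
  assumes f_int: "integrable lborel f"
    and f_nonneg: "\<And>t. 0 \<le> f t"
    and f_zero: "\<And>t. t \<le> 0 \<Longrightarrow> f t = 0"
    and f_cont: "continuous_on {0<..} f"
    and p1: "1 < p"
begin

abbreviation F :: "real \<Rightarrow> real" where "F \<equiv> primitive f"

definition clip :: "real \<Rightarrow> real \<Rightarrow> real" where
  "clip M y = (min M (max 0 y)) powr p"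

text \<open>Integrating w'' = - f y^p twice gives w(s) = b s - \<integral>_0^s (s - t) f y^p dt;
  division by s produces the kernel (1 - t/s)^+, which is at most 1 for t > 0.\<close>

definition volterra_op :: "real \<Rightarrow> real \<Rightarrow> (real \<Rightarrow> real) \<Rightarrow> real \<Rightarrow> real" where
  "volterra_op M b y s = b - (LINT t|lborel. max 0 (1 - t / s) * f t * clip M (y t))"

lemma f_measurable [measurable]: "f \<in> borel_measurable borel"
  using f_int by auto

lemma F_measurable [measurable]: "F \<in> borel_measurable borel"
  unfolding primitive_def[abs_def] by measurable

lemma clip_measurable [measurable]: "clip M \<in> borel_measurable borel"
  unfolding clip_def[abs_def] by measurable

lemma weighted_integrable:
  assumes [measurable]: "g \<in> borel_measurable borel" and "\<And>t. 0 < t \<Longrightarrow> \<bar>g t\<bar> \<le> C"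
  shows "integrable lborel (\<lambda>t. f t * g t)"
proof (rule Bochner_Integration.integrable_bound)
  show "integrable lborel (\<lambda>t. C * f t)" using f_int by simp
  show "AE t in lborel. norm (f t * g t) \<le> norm (C * f t)"
  proof (intro always_eventually allI)
    fix t show "norm (f t * g t) \<le> norm (C * f t)"
    proof (cases "t \<le> 0")
      case False
      then have "\<bar>g t\<bar> \<le> \<bar>C\<bar>" using assms(2)[of t] by linarith
      then show ?thesis using mult_right_mono[OF _ f_nonneg[of t], of "\<bar>g t\<bar>" "\<bar>C\<bar>"] f_nonneg[of t]
        by (simp add: abs_mult mult.commute)
    qed (simp add: f_zero)
  qed
qed measurable

lemma F_le: "F s \<le> integral\<^sup>L lborel f"
  unfolding primitive_def
proof (rule integral_mono)
  show "integrable lborel (\<lambda>t. if t \<le> s then f t else 0)"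
    using weighted_integrable[of "\<lambda>t. if t \<le> s then 1 else 0" 1] by (simp add: if_distrib cong: if_cong)
qed (use f_int f_nonneg in auto)

lemma F_nonneg: "0 \<le> F s"
  unfolding primitive_def by (intro integral_nonneg_AE always_eventually) (auto simp: f_nonneg)

lemma F_deriv: "0 < s \<Longrightarrow> (F has_real_derivative f s) (at s)"
  using f_int f_cont by (rule primitive_deriv)

text \<open>With the weight \<open>exp (L F)\<close>, \<open>L\<close> large, the Volterra operator is a contraction.\<close>

lemma exp_weight_bound:
  assumes "0 < L" "0 < s"
  shows "(LINT t|lborel. (if t \<le> s then f t * exp (L * F t) else 0)) \<le> exp (L * F s) / L"
proof -
  \<comment> \<open>\<open>F\<close> is differentiated at positive arguments only, so exp (L F) / L
    is treated on [a n, s] and a n then tends to 0; the shift by 2 keeps a n below s.\<close>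
  define a where "a n = s / (real n + 2)" for n
  have a: "0 < a n" "a n \<le> s" for n using assms by (auto simp: a_def field_simps)
  have lim: "a \<longlonglongrightarrow> 0"
    unfolding a_def by real_asymp
  let ?g = "\<lambda>t. f t * exp (L * F t)"
  have e_bd: "\<bar>exp (L * F t)\<bar> \<le> exp (L * integral\<^sup>L lborel f)" for t using F_le assms by simp
  have gi: "integrable lborel ?g" by (rule weighted_integrable[OF _ e_bd]) measurable
  have bd: "(LBINT t:{a n..s}. ?g t) \<le> exp (L * F s) / L" for n
  proof -
    have "(?g has_integral (exp (L * F s) / L - exp (L * F (a n)) / L)) {a n..s}"
    proof (rule fundamental_theorem_of_calculus)
      fix x assume "x \<in> {a n..s}"
      then have "0 < x" using a[of n] by auto
      then have "((\<lambda>x. exp (L * F x) / L) has_real_derivative ?g x) (at x)"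
        using assms by (auto intro!: derivative_eq_intros F_deriv)
      then show "((\<lambda>x. exp (L * F x) / L) has_vector_derivative ?g x) (at x within {a n..s})"
        by (simp add: has_field_derivative_at_within has_real_derivative_iff_has_vector_derivative[symmetric])
    qed (use a in auto)
    moreover have "set_integrable lborel {a n..s} ?g"
      unfolding set_integrable_def using gi by (intro integrable_mult_indicator) simp_all
    ultimately have "(LBINT t:{a n..s}. ?g t) = exp (L * F s) / L - exp (L * F (a n)) / L"
      by (simp add: set_borel_integral_eq_integral(2) integral_unique)
    then show ?thesis using assms by simp
  qed
  have "(\<lambda>n. (LBINT t:{a n..s}. ?g t)) \<longlonglongrightarrow> (LINT t|lborel. (if t \<le> s then ?g t else 0))"
    unfolding set_lebesgue_integral_def
  proof (rule integral_dominated_convergence)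
    show "integrable lborel ?g" by (rule gi)
    show "AE t in lborel. (\<lambda>n. indicat_real {a n..s} t *\<^sub>R ?g t) \<longlonglongrightarrow> (if t \<le> s then ?g t else 0)"
    proof (intro always_eventually allI)
      fix t show "(\<lambda>n. indicat_real {a n..s} t *\<^sub>R ?g t) \<longlonglongrightarrow> (if t \<le> s then ?g t else 0)"
      proof (cases "t \<le> 0")
        case False
        then have "\<forall>\<^sub>F n in sequentially. a n < t" using lim by (auto intro: order_tendstoD)
        then show ?thesis
          by (intro tendsto_eventually, eventually_elim) (auto simp: indicator_def)
      qed (simp add: f_zero)
    qed
  qed (auto simp: indicator_def f_nonneg)
  then show ?thesis by (rule LIMSEQ_le_const2) (use bd in auto)
qed

lemma clip_bounded: "0 \<le> M \<Longrightarrow> \<bar>clip M y\<bar> \<le> M powr p"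
  unfolding clip_def using p1 by (simp add: powr_mono2)

lemma clip_nonneg: "0 \<le> clip M y" unfolding clip_def by simp

lemma clip_lipschitz:
  assumes "0 \<le> M" shows "\<bar>clip M y - clip M z\<bar> \<le> p * M powr (p - 1) * \<bar>y - z\<bar>"
proof -
  have *: "\<bar>clip M y - clip M z\<bar> \<le> p * M powr (p - 1) * \<bar>y - z\<bar>" if "z \<le> y" for y z
  proof -
    let ?a = "min M (max 0 z)" and ?b = "min M (max 0 y)"
    have "?b powr p - ?a powr p \<le> p * M powr (p - 1) * (?b - ?a)"
      using that assms p1 by (intro powr_diff_le) auto
    also have "\<dots> \<le> p * M powr (p - 1) * \<bar>y - z\<bar>"
      using that p1 by (intro mult_left_mono) auto
    finally have "?b powr p - ?a powr p \<le> p * M powr (p - 1) * \<bar>y - z\<bar>" .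
    moreover have "?a powr p \<le> ?b powr p" using that p1 assms by (intro powr_mono2) auto
    ultimately show ?thesis unfolding clip_def by simp
  qed
  show ?thesis
  proof (cases "z \<le> y")
    case False
    then have "z \<ge> y" by simp
    from *[OF this] show ?thesis by (subst (1 2) abs_minus_commute)
  qed (rule *)
qed

lemma kernel_integrable:
  assumes [measurable]: "y \<in> borel_measurable borel" and "0 \<le> M" "0 < s"
  shows "integrable lborel (\<lambda>t. max 0 (1 - t / s) * f t * clip M (y t))"
proof -
  have "integrable lborel (\<lambda>t. f t * (max 0 (1 - t / s) * clip M (y t)))"
  proof (rule weighted_integrable[of _ "M powr p"])
    fix t :: real assume "0 < t"
    then have "\<bar>max 0 (1 - t / s)\<bar> \<le> 1" using assms by auto
    then show "\<bar>max 0 (1 - t / s) * clip M (y t)\<bar> \<le> M powr p"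
      using mult_mono[OF _ clip_bounded[OF assms(2)], of "\<bar>max 0 (1 - t / s)\<bar>" 1 "y t"] by (simp add: abs_mult)
  qed measurable
  then show ?thesis by (simp add: mult_ac)
qed

text \<open>With L = p M^(p-1), the Lipschitz constant of \<open>clip M\<close>, the difference is
  at most |b - c| + L D \<integral>_0^s f exp (2 L F), and this integral is at most exp (2 L F(s)) /
  (2 L). The 2 in the exponent is what makes the contraction factor 1/2.\<close>

lemma volterra_op_contraction:
  assumes [measurable]: "y \<in> borel_measurable borel" "z \<in> borel_measurable borel"
    and M: "0 < M" and s: "0 < s"
    and D: "\<And>t. 0 < t \<Longrightarrow> t \<le> s \<Longrightarrow> \<bar>y t - z t\<bar> \<le> D * exp (2 * (p * M powr (p - 1)) * F t)"
    and "0 \<le> D"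
  shows "\<bar>volterra_op M b y s - volterra_op M c z s\<bar> \<le> \<bar>b - c\<bar> + D / 2 * exp (2 * (p * M powr (p - 1)) * F s)"
proof -
  define L where "L = p * M powr (p - 1)"
  have L: "0 < L" using M p1 by (simp add: L_def)
  let ?e = "\<lambda>t. exp (2 * L * F t)"
  have "\<bar>\<integral>t. max 0 (1 - t / s) * f t * clip M (y t) - max 0 (1 - t / s) * f t * clip M (z t) \<partial>lborel\<bar>
    \<le> (\<integral>t. L * D * (if t \<le> s then f t * ?e t else 0) \<partial>lborel)"
  proof (rule integral_abs_bound_integral)
    have "\<bar>exp (2 * L * F t)\<bar> \<le> exp (2 * L * integral\<^sup>L lborel f)" for t using F_le L by simp
    then have "integrable lborel (\<lambda>t. f t * (if t \<le> s then exp (2 * L * F t) else 0))"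
      by (intro weighted_integrable[where C="exp (2 * L * integral\<^sup>L lborel f)"]) auto
    then show "integrable lborel (\<lambda>t. L * D * (if t \<le> s then f t * ?e t else 0))"
      by (intro integrable_mult_right) (simp add: if_distrib[of "\<lambda>x. f _ * x"] cong: if_cong)
    fix t
    show "\<bar>max 0 (1 - t / s) * f t * clip M (y t) - max 0 (1 - t / s) * f t * clip M (z t)\<bar>
       \<le> L * D * (if t \<le> s then f t * ?e t else 0)"
    proof (cases "0 < t \<and> t \<le> s")
      case True
      have "\<bar>max 0 (1 - t / s) * f t * clip M (y t) - max 0 (1 - t / s) * f t * clip M (z t)\<bar>
        = max 0 (1 - t / s) * (f t * \<bar>clip M (y t) - clip M (z t)\<bar>)"
        using f_nonneg[of t] by (simp add: abs_mult flip: right_diff_distrib)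
      also have "\<dots> \<le> 1 * (f t * (L * (D * ?e t)))"
      proof (intro mult_mono)
        show "max 0 (1 - t / s) \<le> 1" using True by simp
        have "\<bar>clip M (y t) - clip M (z t)\<bar> \<le> L * \<bar>y t - z t\<bar>" unfolding L_def using M by (intro clip_lipschitz) simp
        also have "\<dots> \<le> L * (D * ?e t)" using D[of t] True L by (intro mult_left_mono) (auto simp: L_def)
        finally show "\<bar>clip M (y t) - clip M (z t)\<bar> \<le> L * (D * ?e t)" .
      qed (use f_nonneg L assms in auto)
      finally show ?thesis using True by (simp add: mult_ac)
    next
      case False
      then have "f t = 0 \<or> max 0 (1 - t / s) = 0" using s f_zero by (auto simp: field_simps)
      then show ?thesis using f_nonneg L assms by auto
    qed
  qed (use kernel_integrable s M in auto)
  also have "\<dots> \<le> L * D * (exp (2 * L * F s) / (2 * L))"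
    unfolding integral_mult_right_zero
    using exp_weight_bound[of "2 * L" s] L s \<open>0 \<le> D\<close> by (intro mult_left_mono) auto
  also have "\<dots> = D / 2 * ?e s" using L by (simp add: field_simps)
  finally have "\<bar>\<integral>t. max 0 (1 - t / s) * f t * clip M (y t) - max 0 (1 - t / s) * f t * clip M (z t) \<partial>lborel\<bar> \<le> D / 2 * ?e s" .
  moreover have "volterra_op M b y s - volterra_op M c z s = (b - c) -
     (\<integral>t. max 0 (1 - t / s) * f t * clip M (y t) - max 0 (1 - t / s) * f t * clip M (z t) \<partial>lborel)"
    unfolding volterra_op_def using kernel_integrable s M by simp
  ultimately show ?thesis unfolding L_def by linarith
qed

lemma volterra_op_measurable [measurable]:
  assumes [measurable]: "y \<in> borel_measurable borel"
  shows "volterra_op M b y \<in> borel_measurable borel"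
  unfolding volterra_op_def[abs_def] by measurable

lemma volterra_op_bounds:
  assumes [measurable]: "y \<in> borel_measurable borel" and "0 < M" "0 < s"
  shows "volterra_op M b y s \<le> b" "b - integral\<^sup>L lborel f * M powr p \<le> volterra_op M b y s"
proof -
  have "0 \<le> (LINT t|lborel. max 0 (1 - t / s) * f t * clip M (y t))"
    by (intro integral_nonneg_AE always_eventually) (auto simp: f_nonneg clip_nonneg)
  then show "volterra_op M b y s \<le> b" by (simp add: volterra_op_def)
  have "(LINT t|lborel. max 0 (1 - t / s) * f t * clip M (y t)) \<le> (LINT t|lborel. f t * M powr p)"
  proof (rule integral_mono)
    fix t
    show "max 0 (1 - t / s) * f t * clip M (y t) \<le> f t * M powr p"
    proof (cases "t \<le> 0")
      case False
      then have "max 0 (1 - t / s) \<le> 1" using assms by auto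
      moreover have "clip M (y t) \<le> M powr p" using clip_bounded[of M "y t"] assms by auto
      ultimately have "max 0 (1 - t / s) * f t * clip M (y t) \<le> 1 * f t * M powr p"
        using f_nonneg clip_nonneg by (intro mult_mono) auto
      then show ?thesis by simp
    qed (simp add: f_zero)
  qed (use kernel_integrable assms f_int in auto)
  then show "b - integral\<^sup>L lborel f * M powr p \<le> volterra_op M b y s" by (simp add: volterra_op_def)
qed

text \<open>Picard iteration from the constant b. In the weight exp (L F) the bound on successive
  differences halves at each step, so the iterates converge at every s > 0.\<close>

lemma volterra_exists:
  assumes M: "0 < M"
  obtains y where "y \<in> borel_measurable borel" "\<And>s. 0 < s \<Longrightarrow> y s = volterra_op M b y s"
proof -
  define Y where "Y n = ((volterra_op M b) ^^ n) (\<lambda>_. b)" for n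
  have Ym[measurable]: "Y n \<in> borel_measurable borel" for n
    by (induction n) (auto simp: Y_def)
  define C where "C = integral\<^sup>L lborel f * M powr p"
  have C: "0 \<le> C" unfolding C_def using f_nonneg by simp
  define L where "L = 2 * (p * M powr (p - 1))"
  have L: "0 < L" using M p1 by (simp add: L_def)
  have st: "\<bar>Y (Suc n) s - Y n s\<bar> \<le> C / 2 ^ n * exp (L * F s)" if "0 < s" for n s
    using that
  proof (induction n arbitrary: s)
    case 0
    have "\<bar>Y 1 s - Y 0 s\<bar> \<le> C" using volterra_op_bounds[of "\<lambda>_. b" M s b] 0 M by (simp add: Y_def C_def)
    also have "\<dots> \<le> C * exp (L * F s)" using C L F_nonneg[of s] by (simp add: mult_le_cancel_left1)
    finally show ?case by simp
  next
    case (Suc n)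
    have "\<bar>volterra_op M b (Y (Suc n)) s - volterra_op M b (Y n) s\<bar> \<le> \<bar>b - b\<bar> + (C / 2 ^ n) / 2 * exp (L * F s)"
      unfolding L_def
    proof (rule volterra_op_contraction)
      fix t :: real assume "0 < t"
      from Suc.IH[OF this] show "\<bar>Y (Suc n) t - Y n t\<bar> \<le> C / 2 ^ n * exp (2 * (p * M powr (p - 1)) * F t)"
        by (simp add: L_def)
    qed (use Suc.prems M C in auto)
    then show ?case by (simp add: Y_def)
  qed
  \<comment> \<open>\<open>lim\<close> keeps the limit measurable. The value 0 for s \<le> 0 does
    not enter the equation, since f vanishes there.\<close>
  define y where "y s = (if 0 < s then lim (\<lambda>n. Y n s) else 0)" for s
  have conv: "(\<lambda>n. Y n s) \<longlonglongrightarrow> y s" if "0 < s" for s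
  proof -
    have "summable (\<lambda>n. Y (Suc n) s - Y n s)"
    proof (rule summable_comparison_test')
      show "summable (\<lambda>n. (C * exp (L * F s)) * (1 / 2) ^ n)"
        by (intro summable_mult summable_geometric) simp
      show "\<And>n. 0 \<le> n \<Longrightarrow> norm (Y (Suc n) s - Y n s) \<le> (C * exp (L * F s)) * (1 / 2) ^ n"
        using st[OF that] by (simp add: power_divide mult_ac)
    qed
    from summable_LIMSEQ[OF this] have "(\<lambda>n. Y n s - Y 0 s) \<longlonglongrightarrow> (\<Sum>n. Y (Suc n) s - Y n s)"
      by (subst (asm) sum_lessThan_telescope)
    from tendsto_add[OF this tendsto_const[of "Y 0 s"]] have "convergent (\<lambda>n. Y n s)"
      by (auto simp: convergent_def)
    then show ?thesis using that by (simp add: y_def convergent_LIMSEQ_iff)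
  qed
  have [measurable]: "y \<in> borel_measurable borel"
    unfolding y_def[abs_def] by measurable
  moreover have "y s = volterra_op M b y s" if s: "0 < s" for s
  proof -
    have "(\<lambda>n. LINT t|lborel. max 0 (1 - t / s) * f t * clip M (Y n t)) \<longlonglongrightarrow>
        (LINT t|lborel. max 0 (1 - t / s) * f t * clip M (y t))"
    proof (rule integral_dominated_convergence)
      show "integrable lborel (\<lambda>t. f t * M powr p)" using f_int by simp
      show "AE t in lborel. (\<lambda>n. max 0 (1 - t / s) * f t * clip M (Y n t)) \<longlonglongrightarrow> max 0 (1 - t / s) * f t * clip M (y t)"
      proof (intro always_eventually allI)
        fix t
        show "(\<lambda>n. max 0 (1 - t / s) * f t * clip M (Y n t)) \<longlonglongrightarrow> max 0 (1 - t / s) * f t * clip M (y t)"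
        proof (cases "0 < t")
          case True
          have "(\<lambda>n. p * M powr (p - 1) * \<bar>Y n t - y t\<bar>) \<longlonglongrightarrow> p * M powr (p - 1) * \<bar>y t - y t\<bar>"
            by (intro tendsto_intros conv True)
          then have l0: "(\<lambda>n. p * M powr (p - 1) * \<bar>Y n t - y t\<bar>) \<longlonglongrightarrow> 0" by simp
          have "(\<lambda>n. clip M (Y n t) - clip M (y t)) \<longlonglongrightarrow> 0"
          proof (rule Lim_null_comparison[OF _ l0], intro always_eventually allI)
            fix n show "norm (clip M (Y n t) - clip M (y t)) \<le> p * M powr (p - 1) * \<bar>Y n t - y t\<bar>"
              unfolding real_norm_def by (rule clip_lipschitz) (rule less_imp_le[OF M])
          qed
          then have "(\<lambda>n. clip M (Y n t)) \<longlonglongrightarrow> clip M (y t)" by (rule LIM_zero_cancel)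
          then show ?thesis by (intro tendsto_intros)
        qed (simp add: f_zero)
      qed
      fix n
      show "AE t in lborel. norm (max 0 (1 - t / s) * f t * clip M (Y n t)) \<le> f t * M powr p"
      proof (intro always_eventually allI)
        fix t
        show "norm (max 0 (1 - t / s) * f t * clip M (Y n t)) \<le> f t * M powr p"
        proof (cases "t \<le> 0")
          case False
          then have "max 0 (1 - t / s) \<le> 1" using s by auto
          moreover have "clip M (Y n t) \<le> M powr p" using clip_bounded[of M "Y n t"] M by auto
          ultimately have "max 0 (1 - t / s) * f t * clip M (Y n t) \<le> 1 * f t * M powr p"
            using f_nonneg clip_nonneg by (intro mult_mono) auto
          then show ?thesis using f_nonneg clip_nonneg by (simp add: abs_mult)
        qed (simp add: f_zero)
      qed
    qed measurable
    then have "(\<lambda>n. volterra_op M b (Y n) s) \<longlonglongrightarrow> volterra_op M b y s" unfolding volterra_op_def by (intro tendsto_intros)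
    then have "(\<lambda>n. Y (Suc n) s) \<longlonglongrightarrow> volterra_op M b y s" by (simp add: Y_def)
    moreover have "(\<lambda>n. Y (Suc n) s) \<longlonglongrightarrow> y s" using conv[OF s] by (rule LIMSEQ_Suc)
    ultimately show ?thesis by (rule LIMSEQ_unique[symmetric])
  qed
  ultimately show ?thesis by (rule that)
qed

text \<open>The kernel at s sees only t \<le> s, so the equation is required on (0,R] only. With b =
  c this is uniqueness on an initial interval, and in this form it applies to a solution whose
  weight has been cut off at R. The bound improves from 2|b - c| + C to 2|b - c| + C/2^n, since 2|b
  - c| is the fixed point of the map taking D to |b - c| + D/2.\<close>

lemma volterra_dependence:
  assumes [measurable]: "y \<in> borel_measurable borel" "z \<in> borel_measurable borel"
    and M: "0 < M"
    and y: "\<And>s. 0 < s \<Longrightarrow> s \<le> R \<Longrightarrow> y s = volterra_op M b y s"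
    and z: "\<And>s. 0 < s \<Longrightarrow> s \<le> R \<Longrightarrow> z s = volterra_op M c z s"
    and s: "0 < s" "s \<le> R"
  shows "\<bar>y s - z s\<bar> \<le> 2 * \<bar>b - c\<bar> * exp (2 * (p * M powr (p - 1)) * F s)"
proof -
  define L where "L = 2 * (p * M powr (p - 1))"
  have L: "0 < L" using M p1 by (simp add: L_def)
  define C where "C = \<bar>b - c\<bar> + integral\<^sup>L lborel f * M powr p"
  have C: "0 \<le> C" unfolding C_def using f_nonneg by simp
  have e: "1 \<le> exp (L * F t)" for t using L F_nonneg by simp
  have *: "\<bar>y s - z s\<bar> \<le> (2 * \<bar>b - c\<bar> + C / 2 ^ n) * exp (L * F s)" if "0 < s" "s \<le> R" for n s
    using that
  proof (induction n arbitrary: s)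
    case 0
    have "\<bar>y s - z s\<bar> \<le> C" using volterra_op_bounds[of y M s b] volterra_op_bounds[of z M s c] y[of s] z[of s] 0 M
      by (auto simp: C_def)
    also have "\<dots> \<le> (2 * \<bar>b - c\<bar> + C) * exp (L * F s)"
      using mult_mono[of C "2 * \<bar>b - c\<bar> + C" 1 "exp (L * F s)"] C e by simp
    finally show ?case by simp
  next
    case (Suc n)
    have "\<bar>volterra_op M b y s - volterra_op M c z s\<bar> \<le> \<bar>b - c\<bar> + (2 * \<bar>b - c\<bar> + C / 2 ^ n) / 2 * exp (L * F s)"
      unfolding L_def using Suc.prems M C by (intro volterra_op_contraction) (auto intro!: Suc.IH simp flip: L_def)
    also have "\<dots> \<le> \<bar>b - c\<bar> * exp (L * F s) + (2 * \<bar>b - c\<bar> + C / 2 ^ n) / 2 * exp (L * F s)"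
      using mult_left_mono[OF e[of s], of "\<bar>b - c\<bar>"] by simp
    also have "\<dots> = (2 * \<bar>b - c\<bar> + C / 2 ^ Suc n) * exp (L * F s)" by (simp add: field_simps)
    finally show ?case using y[of s] z[of s] Suc.prems by simp
  qed
  have lim: "(\<lambda>n. (2 * \<bar>b - c\<bar> + C / 2 ^ n) * exp (L * F s)) \<longlonglongrightarrow> (2 * \<bar>b - c\<bar> + 0) * exp (L * F s)"
    by (intro tendsto_intros) (auto intro!: LIMSEQ_divide_realpow_zero)
  have "\<bar>y s - z s\<bar> \<le> (2 * \<bar>b - c\<bar> + 0) * exp (L * F s)"
    by (rule LIMSEQ_le_const[OF lim]) (use *[OF s] in blast)
  then show ?thesis by (simp add: L_def)
qed

end

section \<open>The kernel \<open>min s t\<close>\<close>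

definition tail :: "(real \<Rightarrow> ennreal) \<Rightarrow> real \<Rightarrow> ennreal" where
  "tail a x = (\<integral>\<^sup>+t. (if x < t then a t else 0) \<partial>lborel)"

text \<open>\<open>min s t\<close> is the Green function of -w'' on the half-line with w(0) = 0 and
  zero slope at infinity. Values in \<open>ennreal\<close> let Tonelli's theorem apply without
  integrability conditions.\<close>

definition potential :: "(real \<Rightarrow> ennreal) \<Rightarrow> real \<Rightarrow> ennreal" where
  "potential a s = (\<integral>\<^sup>+t. ennreal (min s t) * a t \<partial>lborel)"

lemma tail_measurable [measurable]:
  assumes [measurable]: "a \<in> borel_measurable borel"
  shows "tail a \<in> borel_measurable borel"
  unfolding tail_def[abs_def] by measurable

lemma potential_measurable [measurable]:
  assumes [measurable]: "a \<in> borel_measurable borel"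
  shows "potential a \<in> borel_measurable borel"
  unfolding potential_def[abs_def] by measurable

text \<open>\<open>min s t\<close> is the length of the set of x with 0 < x < s and x < t.
  Exchanging the integrals writes the potential as the integral of its derivative, the tail of the
  source.\<close>

lemma potential_eq_tail:
  assumes [measurable]: "a \<in> borel_measurable borel"
  shows "potential a s = (\<integral>\<^sup>+x. (if 0 < x \<and> x < s then tail a x else 0) \<partial>lborel)"
proof -
  have "ennreal (min s t) = (\<integral>\<^sup>+x. (if 0 < x \<and> x < s \<and> x < t then 1 else 0) \<partial>lborel)" for t
  proof -
    have "(\<integral>\<^sup>+x. (if 0 < x \<and> x < s \<and> x < t then 1 else 0) \<partial>lborel) = (\<integral>\<^sup>+x. indicator {0<..<min s t} x \<partial>lborel)"
      by (intro nn_integral_cong) (auto simp: indicator_def)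
    also have "\<dots> = ennreal (min s t)"
    proof (cases "0 \<le> min s t")
      case False
      then have "{0<..<min s t} = {}" "ennreal (min s t) = 0"
        by (auto simp: ennreal_neg simp del: min_less_iff_conj)
      then show ?thesis by (metis emeasure_empty nn_integral_indicator sets.empty_sets)
    qed simp
    finally show ?thesis by simp
  qed
  then have "potential a s = (\<integral>\<^sup>+t. \<integral>\<^sup>+x. (if 0 < x \<and> x < s \<and> x < t then a t else 0) \<partial>lborel \<partial>lborel)"
    unfolding potential_def by (simp flip: nn_integral_multc) (intro nn_integral_cong, auto)
  also have "\<dots> = (\<integral>\<^sup>+x. \<integral>\<^sup>+t. (if 0 < x \<and> x < s \<and> x < t then a t else 0) \<partial>lborel \<partial>lborel)"
    by (rule lborel_pair.Fubini') measurable
  also have "\<dots> = (\<integral>\<^sup>+x. (if 0 < x \<and> x < s then tail a x else 0) \<partial>lborel)"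
    unfolding tail_def by (intro nn_integral_cong) auto
  finally show ?thesis .
qed

text \<open>By the tail representation the energy pairing of two sources is the L^2 product of the
  derivatives of their potentials, which makes the Cauchy-Schwarz inequality available.\<close>

lemma energy_eq_tail:
  assumes [measurable]: "a \<in> borel_measurable borel" "c \<in> borel_measurable borel"
  shows "(\<integral>\<^sup>+s. c s * potential a s \<partial>lborel) =
    (\<integral>\<^sup>+x. (if 0 < x then tail c x else 0) * (if 0 < x then tail a x else 0) \<partial>lborel)"
proof -
  have "(\<integral>\<^sup>+s. c s * potential a s \<partial>lborel) =
     (\<integral>\<^sup>+s. \<integral>\<^sup>+x. c s * (if 0 < x \<and> x < s then tail a x else 0) \<partial>lborel \<partial>lborel)"
    by (simp add: potential_eq_tail nn_integral_cmult)
  also have "\<dots> = (\<integral>\<^sup>+x. \<integral>\<^sup>+s. c s * (if 0 < x \<and> x < s then tail a x else 0) \<partial>lborel \<partial>lborel)"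
    by (rule lborel_pair.Fubini') measurable
  also have "\<dots> = (\<integral>\<^sup>+x. (if 0 < x then tail c x else 0) * (if 0 < x then tail a x else 0) \<partial>lborel)"
  proof (intro nn_integral_cong)
    fix x :: real
    have "(\<integral>\<^sup>+s. c s * (if 0 < x \<and> x < s then tail a x else 0) \<partial>lborel) =
      (\<integral>\<^sup>+s. (if x < s then c s else 0) * (if 0 < x then tail a x else 0) \<partial>lborel)"
      by (intro nn_integral_cong) auto
    also have "\<dots> = tail c x * (if 0 < x then tail a x else 0)"
      unfolding tail_def by (rule nn_integral_multc) measurable
    finally show "(\<integral>\<^sup>+s. c s * (if 0 < x \<and> x < s then tail a x else 0) \<partial>lborel) =
      (if 0 < x then tail c x else 0) * (if 0 < x then tail a x else 0)" by auto
  qed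
  finally show ?thesis .
qed

lemma energy_Cauchy_Schwarz:
  assumes [measurable]: "a \<in> borel_measurable borel" "c \<in> borel_measurable borel"
  shows "(\<integral>\<^sup>+s. c s * potential a s \<partial>lborel)\<^sup>2 \<le>
    (\<integral>\<^sup>+s. c s * potential c s \<partial>lborel) * (\<integral>\<^sup>+s. a s * potential a s \<partial>lborel)"
  unfolding energy_eq_tail[OF assms] energy_eq_tail[OF assms(1) assms(1)] energy_eq_tail[OF assms(2) assms(2)]
  unfolding power2_eq_square
  by (rule Cauchy_Schwarz_nn_integral[unfolded power2_eq_square]) measurable

text \<open>The increment d is the integral of the tail over [s,s'), so Cauchy-Schwarz against an
  indicator gives Hoelder continuity with exponent 1/2. A separate summand d avoids the truncated
  subtraction of \<open>ennreal\<close>.\<close>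

lemma potential_holder:
  assumes [measurable]: "a \<in> borel_measurable borel" and "0 \<le> s" "s \<le> s'"
  obtains d where "potential a s' = potential a s + d"
    "d\<^sup>2 \<le> ennreal (s' - s) * (\<integral>\<^sup>+s. a s * potential a s \<partial>lborel)"
proof -
  define d where "d = (\<integral>\<^sup>+x. (if s \<le> x \<and> x < s' then 1 else 0) * (if 0 < x then tail a x else 0) \<partial>lborel)"
  have "potential a s' = (\<integral>\<^sup>+x. (if 0 < x \<and> x < s then tail a x else 0) +
      (if s \<le> x \<and> x < s' then 1 else 0) * (if 0 < x then tail a x else 0) \<partial>lborel)"
    unfolding potential_eq_tail[OF assms(1)] using assms by (intro nn_integral_cong) auto
  also have "\<dots> = potential a s + d"
    unfolding potential_eq_tail[OF assms(1)] d_def by (rule nn_integral_add) measurable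
  finally have 1: "potential a s' = potential a s + d" .
  have "(\<integral>\<^sup>+x. (if s \<le> x \<and> x < s' then 1 else 0)\<^sup>2 \<partial>lborel) = (\<integral>\<^sup>+x. indicator {s..<s'} x \<partial>lborel)"
    by (intro nn_integral_cong) (auto simp: indicator_def)
  also have "\<dots> = ennreal (s' - s)" using assms by simp
  finally have 2: "(\<integral>\<^sup>+x. (if s \<le> x \<and> x < s' then 1 else 0)\<^sup>2 \<partial>lborel) = ennreal (s' - s)" .
  have "d\<^sup>2 \<le> ennreal (s' - s) * (\<integral>\<^sup>+s. a s * potential a s \<partial>lborel)"
    unfolding d_def energy_eq_tail[OF assms(1) assms(1)] 2[symmetric]
    unfolding power2_eq_square
    by (rule Cauchy_Schwarz_nn_integral[unfolded power2_eq_square]) measurable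
  with 1 show ?thesis by (rule that)
qed

text \<open>Strict convexity of x^(p+1): the graph lies above its tangent at y. The mean value
  theorem on either side of y covers a zero argument. Strictness is what later identifies two
  functions from equality of integrals.\<close>

lemma powr_bernoulli:
  fixes x y p :: real
  assumes "0 \<le> x" "0 \<le> y" "0 < p" "x \<noteq> y"
  shows "(p + 1) * y powr p * (x - y) < x powr (p + 1) - y powr (p + 1)"
proof -
  have M: "\<exists>z. a < z \<and> z < b \<and> b powr (p + 1) - a powr (p + 1) = (b - a) * ((p + 1) * z powr p)"
    if "0 \<le> a" "a < b" for a b :: real
  proof -
    have "continuous_on {a..b} (\<lambda>x. x powr (p + 1))"
      using assms that by (intro continuous_on_powr') (auto intro!: continuous_intros)
    moreover have D: "((\<lambda>x. x powr (p + 1)) has_real_derivative (p + 1) * x powr p) (at x)" if "a < x" for x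
      using has_real_derivative_powr[of x "p + 1"] that \<open>0 \<le> a\<close> by simp
    ultimately obtain l z where z: "a < z" "z < b" "((\<lambda>x. x powr (p + 1)) has_real_derivative l) (at z)"
        "b powr (p + 1) - a powr (p + 1) = (b - a) * l"
      using MVT[OF \<open>a < b\<close>, of "\<lambda>x. x powr (p + 1)"] by (metis real_differentiable_def)
    then show ?thesis using D[of z] DERIV_unique by blast
  qed
  show ?thesis
  proof (cases "x < y")
    case True
    obtain z where z: "x < z" "z < y" "y powr (p + 1) - x powr (p + 1) = (y - x) * ((p + 1) * z powr p)"
      using M[OF assms(1) True] by blast
    have "z powr p < y powr p" using z assms by (intro powr_less_mono2) auto
    then have "(y - x) * ((p + 1) * z powr p) < (y - x) * ((p + 1) * y powr p)"
      using True assms by (intro mult_strict_left_mono) auto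
    then show ?thesis using z(3) by (simp add: algebra_simps)
  next
    case False
    then have xy: "y < x" using assms by simp
    obtain z where z: "y < z" "z < x" "x powr (p + 1) - y powr (p + 1) = (x - y) * ((p + 1) * z powr p)"
      using M[OF assms(2) xy] by blast
    have "y powr p < z powr p" using z assms by (intro powr_less_mono2) auto
    then have "(x - y) * ((p + 1) * y powr p) < (x - y) * ((p + 1) * z powr p)"
      using xy assms by (intro mult_strict_left_mono) auto
    then show ?thesis using z(3) by (simp add: algebra_simps)
  qed
qed

section \<open>A positive solution with zero slope at infinity\<close>

text \<open>The bound \<phi> \<le> t^(1/2) turns \<phi>^(p+1) into t^((p+1)/2), so
  \<open>q_int\<close> bounds the functional on the unit ball; \<open>q_zero\<close> provides the
  bounded interval on which Arzela-Ascoli is applied.\<close>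

locale subcritical_weight =
  fixes q :: "real \<Rightarrow> real" and p R :: real
  assumes q_meas [measurable]: "q \<in> borel_measurable borel"
    and q_nonneg: "\<And>t. 0 \<le> q t"
    and q_zero: "\<And>t. t \<le> 0 \<or> R < t \<Longrightarrow> q t = 0"
    and q_int: "integrable lborel (\<lambda>t. q t * t powr ((p + 1) / 2))"
    and q_nontrivial: "\<not> (AE t in lborel. q t = 0)"
    and p1: "1 < p"
begin

text \<open>The bound \<open>t\<^bsup>1/2\<^esup>\<close> holds on the unit ball \<open>\<integral> |\<phi>'|\<^sup>2 \<le> 1\<close>, \<open>\<phi>(0) = 0\<close>, of the energy space.
  \<open>pairing\<close> is the energy scalar product of the potentials of the sources \<open>q \<theta>\<^sup>p\<close> and \<open>q \<phi>\<^sup>p\<close>.\<close>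

definition admissible :: "(real \<Rightarrow> real) \<Rightarrow> bool" where
  "admissible \<phi> \<longleftrightarrow> \<phi> \<in> borel_measurable borel \<and> (\<forall>t>0. 0 \<le> \<phi> t \<and> \<phi> t \<le> t powr (1/2))"

definition source_potential :: "(real \<Rightarrow> real) \<Rightarrow> real \<Rightarrow> real" where
  "source_potential \<phi> s = (LINT t|lborel. min s t * (q t * \<phi> t powr p))"

definition pairing :: "(real \<Rightarrow> real) \<Rightarrow> (real \<Rightarrow> real) \<Rightarrow> real" where
  "pairing \<theta> \<phi> = (LINT t|lborel. (q t * \<theta> t powr p) * source_potential \<phi> t)"

definition power_energy :: "(real \<Rightarrow> real) \<Rightarrow> real" where
  "power_energy \<phi> = (LINT t|lborel. q t * \<phi> t powr (p + 1))"

definition B :: real where "B = (LINT t|lborel. q t * t powr ((p + 1) / 2))"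

lemma admissible_powr_le: "admissible \<phi> \<Longrightarrow> 0 < t \<Longrightarrow> 0 \<le> a \<Longrightarrow> \<phi> t powr a \<le> t powr (a / 2)"
  using powr_mono2[of a "\<phi> t" "t powr (1/2)"] by (simp add: admissible_def powr_powr)

lemma source_potential_measurable [measurable]:
  assumes [measurable]: "\<phi> \<in> borel_measurable borel"
  shows "source_potential \<phi> \<in> borel_measurable borel"
  unfolding source_potential_def[abs_def] by measurable

text \<open>The minimum lies below the geometric mean. This splits the kernel so that potentials of
  admissible functions again grow at most like s^(1/2).\<close>

lemma min_powr_le:
  fixes s t :: real assumes "0 \<le> s" "0 < t"
  shows "min s t \<le> s powr (1/2) * t powr (1/2)"
proof -
  have "min s t = min s t powr (1/2) * min s t powr (1/2)"
    using assms by (simp add: powr_half_sqrt)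
  also have "\<dots> \<le> s powr (1/2) * t powr (1/2)"
    using assms by (intro mult_mono powr_mono2) auto
  finally show ?thesis .
qed

lemma source_potential_integrand:
  assumes "admissible \<phi>" "0 \<le> s"
  shows "0 \<le> min s t * (q t * \<phi> t powr p)"
    "min s t * (q t * \<phi> t powr p) \<le> s powr (1/2) * (q t * t powr ((p + 1) / 2))"
proof -
  have "0 \<le> min s t * (q t * \<phi> t powr p) \<and>
    min s t * (q t * \<phi> t powr p) \<le> s powr (1/2) * (q t * t powr ((p + 1) / 2))"
  proof (cases "t \<le> 0")
    case False
    then have t: "0 < t" by simp
    have "min s t * (q t * \<phi> t powr p) \<le> (s powr (1/2) * t powr (1/2)) * (q t * t powr (p / 2))"
      using min_powr_le[OF assms(2) t] admissible_powr_le[OF assms(1) t, of p] p1 q_nonneg[of t] assms t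
      by (intro mult_mono) auto
    also have "\<dots> = s powr (1/2) * (q t * t powr ((p + 1) / 2))"
      using t by (simp add: add_divide_distrib powr_add)
    finally show ?thesis using assms t q_nonneg[of t] by auto
  qed (simp add: q_zero)
  then show "0 \<le> min s t * (q t * \<phi> t powr p)"
    "min s t * (q t * \<phi> t powr p) \<le> s powr (1/2) * (q t * t powr ((p + 1) / 2))" by auto
qed

lemma source_potential_int:
  assumes [simp]: "admissible \<phi>" and "0 \<le> s"
  shows "integrable lborel (\<lambda>t. min s t * (q t * \<phi> t powr p))"
proof (rule Bochner_Integration.integrable_bound)
  show "integrable lborel (\<lambda>t. s powr (1/2) * (q t * t powr ((p + 1) / 2)))" using q_int by simp
  have [measurable]: "\<phi> \<in> borel_measurable borel" using assms by (simp add: admissible_def)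
  show "(\<lambda>t. min s t * (q t * \<phi> t powr p)) \<in> borel_measurable lborel" by measurable
qed (use source_potential_integrand[OF assms] q_nonneg in auto)

lemma source_potential_bounds:
  assumes "admissible \<phi>" "0 \<le> s"
  shows "0 \<le> source_potential \<phi> s" "source_potential \<phi> s \<le> s powr (1/2) * B"
proof -
  show "0 \<le> source_potential \<phi> s" unfolding source_potential_def
    by (intro integral_nonneg_AE always_eventually allI source_potential_integrand assms)
  have "source_potential \<phi> s \<le> (LINT t|lborel. s powr (1/2) * (q t * t powr ((p + 1) / 2)))"
    unfolding source_potential_def using q_int by (intro integral_mono source_potential_integrand assms source_potential_int) simp
  then show "source_potential \<phi> s \<le> s powr (1/2) * B" by (simp add: B_def)
qed

lemma pairing_integrand:
  assumes "admissible \<phi>" "admissible \<theta>"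
  shows "0 \<le> (q t * \<theta> t powr p) * source_potential \<phi> t"
    "(q t * \<theta> t powr p) * source_potential \<phi> t \<le> B * (q t * t powr ((p + 1) / 2))"
proof -
  have "0 \<le> (q t * \<theta> t powr p) * source_potential \<phi> t \<and> (q t * \<theta> t powr p) * source_potential \<phi> t \<le>
      B * (q t * t powr ((p + 1) / 2))"
  proof (cases "t \<le> 0")
    case False
    then have t: "0 < t" by simp
    have "(q t * \<theta> t powr p) * source_potential \<phi> t \<le> (q t * t powr (p / 2)) * (t powr (1/2) * B)"
      using admissible_powr_le[OF assms(2) t, of p] source_potential_bounds[OF assms(1), of t] p1 q_nonneg[of t] t
      by (intro mult_mono) auto
    also have "\<dots> = B * (q t * t powr ((p + 1) / 2))"
      using t by (simp add: add_divide_distrib powr_add)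
    finally show ?thesis using assms t q_nonneg[of t] source_potential_bounds[OF assms(1), of t] by auto
  qed (simp add: q_zero)
  then show "0 \<le> (q t * \<theta> t powr p) * source_potential \<phi> t"
    "(q t * \<theta> t powr p) * source_potential \<phi> t \<le> B * (q t * t powr ((p + 1) / 2))" by auto
qed

lemma pairing_int:
  assumes [measurable_dest]: "admissible \<phi>" "admissible \<theta>"
  shows "integrable lborel (\<lambda>t. (q t * \<theta> t powr p) * source_potential \<phi> t)"
proof (rule Bochner_Integration.integrable_bound)
  show "integrable lborel (\<lambda>t. B * (q t * t powr ((p + 1) / 2)))" using q_int by simp
  have [measurable]: "\<phi> \<in> borel_measurable borel" "\<theta> \<in> borel_measurable borel" using assms by (auto simp: admissible_def)
  show "(\<lambda>t. (q t * \<theta> t powr p) * source_potential \<phi> t) \<in> borel_measurable lborel" by measurable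
  have "0 \<le> B" unfolding B_def by (intro integral_nonneg_AE) (auto simp: q_nonneg)
  then show "AE t in lborel. norm (q t * \<theta> t powr p * source_potential \<phi> t) \<le> norm (B * (q t * t powr ((p + 1) / 2)))"
    using pairing_integrand[OF assms] q_nonneg by auto
qed

lemma admissible_integral:
  assumes "admissible \<phi>" "admissible \<theta>"
  shows "integrable lborel (\<lambda>t. q t * \<phi> t powr p * \<theta> t)"
    and "AE t in lborel. norm (q t * \<phi> t powr p * \<theta> t) \<le> q t * t powr ((p + 1) / 2)"
proof -
  have [measurable]: "\<phi> \<in> borel_measurable borel" "\<theta> \<in> borel_measurable borel" using assms by (auto simp: admissible_def)
  have *: "\<bar>q t * \<phi> t powr p * \<theta> t\<bar> \<le> q t * t powr ((p + 1) / 2)" for t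
  proof (cases "t \<le> 0")
    case False
    then have t: "0 < t" by simp
    have "q t * \<phi> t powr p * \<theta> t \<le> q t * t powr (p / 2) * t powr (1/2)"
      using admissible_powr_le[OF assms(1) t, of p] assms(2) p1 q_nonneg[of t] t
      by (intro mult_mono) (auto simp: admissible_def)
    also have "\<dots> = q t * t powr ((p + 1) / 2)"
      using t by (simp add: add_divide_distrib powr_add)
    finally show ?thesis using assms t q_nonneg[of t] by (auto simp: admissible_def abs_mult)
  qed (simp add: q_zero)
  then show "AE t in lborel. norm (q t * \<phi> t powr p * \<theta> t) \<le> q t * t powr ((p + 1) / 2)" by simp
  show "integrable lborel (\<lambda>t. q t * \<phi> t powr p * \<theta> t)"
  proof (rule Bochner_Integration.integrable_bound[OF q_int])
    show "AE t in lborel. norm (q t * \<phi> t powr p * \<theta> t) \<le> norm (q t * t powr ((p + 1) / 2))"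
      using * q_nonneg by auto
  qed measurable
qed

lemma power_energy_eq:
  assumes "admissible \<phi>"
  shows "power_energy \<phi> = (LINT t|lborel. q t * \<phi> t powr p * \<phi> t)"
    "integrable lborel (\<lambda>t. q t * \<phi> t powr (p + 1))"
proof -
  have *: "q t * \<phi> t powr (p + 1) = q t * \<phi> t powr p * \<phi> t" for t
  proof (cases "t \<le> 0")
    case False
    then have "0 \<le> \<phi> t" using assms by (simp add: admissible_def)
    then show ?thesis using p1 by (cases "\<phi> t = 0") (auto simp: powr_add)
  qed (simp add: q_zero)
  show "power_energy \<phi> = (LINT t|lborel. q t * \<phi> t powr p * \<phi> t)"
    "integrable lborel (\<lambda>t. q t * \<phi> t powr (p + 1))"
    using admissible_integral[OF assms assms] by (simp_all add: power_energy_def *)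
qed

lemma power_energy_le: "admissible \<phi> \<Longrightarrow> power_energy \<phi> \<le> B"
  unfolding B_def power_energy_eq(1) using admissible_integral[of \<phi> \<phi>] q_int
  by (intro integral_mono_AE) (auto elim: eventually_mono)

text \<open>The gap between the functional and its tangent at \<phi>, written as one integral with
  nonnegative integrand: its sign drives the iteration upwards, and its vanishing forces \<theta> =
  \<phi> almost everywhere on {q \<noteq> 0}.\<close>

lemma power_energy_convex:
  assumes "admissible \<phi>" "admissible \<theta>"
  shows "power_energy \<theta> - power_energy \<phi> - (p + 1) * ((LINT t|lborel. q t * \<phi> t powr p * \<theta> t) - power_energy \<phi>) =
     (LINT t|lborel. q t * (\<theta> t powr (p + 1) - \<phi> t powr (p + 1) - (p + 1) * \<phi> t powr p * (\<theta> t - \<phi> t)))" (is "?L = ?R")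
    and "integrable lborel (\<lambda>t. q t * (\<theta> t powr (p + 1) - \<phi> t powr (p + 1) - (p + 1) * \<phi> t powr p * (\<theta> t - \<phi> t)))"
    and "0 \<le> q t * (\<theta> t powr (p + 1) - \<phi> t powr (p + 1) - (p + 1) * \<phi> t powr p * (\<theta> t - \<phi> t))"
proof -
  have eq: "q t * (\<theta> t powr (p + 1) - \<phi> t powr (p + 1) - (p + 1) * \<phi> t powr p * (\<theta> t - \<phi> t)) =
    q t * \<theta> t powr (p + 1) - q t * \<phi> t powr (p + 1) - (p + 1) * (q t * \<phi> t powr p * \<theta> t - q t * \<phi> t powr p * \<phi> t)" for t
    by (simp add: algebra_simps)
  show "?L = ?R" unfolding eq power_energy_eq(1)[OF assms(1)]
    using admissible_integral[OF assms] admissible_integral[OF assms(1,1)] power_energy_eq[OF assms(1)]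
        power_energy_eq[OF assms(2)]
    by (simp add: power_energy_def)
  show "integrable lborel (\<lambda>t. q t * (\<theta> t powr (p + 1) - \<phi> t powr (p + 1) - (p + 1) * \<phi> t powr p * (\<theta> t - \<phi> t)))"
    unfolding eq using admissible_integral[OF assms] admissible_integral[OF assms(1,1)] power_energy_eq[OF assms(1)]
        power_energy_eq[OF assms(2)]
    by simp
  show "0 \<le> q t * (\<theta> t powr (p + 1) - \<phi> t powr (p + 1) - (p + 1) * \<phi> t powr p * (\<theta> t - \<phi> t))"
  proof (cases "t \<le> 0 \<or> \<theta> t = \<phi> t")
    case False
    then have "0 \<le> \<phi> t" "0 \<le> \<theta> t" "\<theta> t \<noteq> \<phi> t" using assms by (auto simp: admissible_def)
    then show ?thesis using powr_bernoulli[of "\<theta> t" "\<phi> t" p] p1 q_nonneg[of t] by auto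
  qed (auto simp: q_zero)
qed

section \<open>Energy inequalities for the potentials of power sources\<close>

definition source :: "(real \<Rightarrow> real) \<Rightarrow> real \<Rightarrow> ennreal" where "source \<phi> t = ennreal (q t * \<phi> t powr p)"

lemma source_measurable [measurable]: "\<phi> \<in> borel_measurable borel \<Longrightarrow> source \<phi> \<in> borel_measurable borel"
  unfolding source_def[abs_def] by measurable

lemma potential_eq_source_potential:
  assumes "admissible \<phi>" "0 \<le> s"
  shows "potential (source \<phi>) s = ennreal (source_potential \<phi> s)"
proof -
  have "potential (source \<phi>) s = (\<integral>\<^sup>+t. ennreal (min s t * (q t * \<phi> t powr p)) \<partial>lborel)"
    unfolding potential_def source_def
  proof (intro nn_integral_cong)
    fix t show "ennreal (min s t) * ennreal (q t * \<phi> t powr p) = ennreal (min s t * (q t * \<phi> t powr p))"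
      using assms q_nonneg[of t] q_zero[of t] by (cases "t \<le> 0") (auto simp: ennreal_mult'')
  qed
  also have "\<dots> = ennreal (source_potential \<phi> s)"
    unfolding source_potential_def using source_potential_int[OF assms] source_potential_integrand[OF assms]
        by (intro nn_integral_eq_integral) auto
  finally show ?thesis .
qed

lemma energy_eq_pairing:
  assumes "admissible \<phi>" "admissible \<theta>"
  shows "(\<integral>\<^sup>+s. source \<theta> s * potential (source \<phi>) s \<partial>lborel) = ennreal (pairing \<theta> \<phi>)"
proof -
  have "(\<integral>\<^sup>+s. source \<theta> s * potential (source \<phi>) s \<partial>lborel) = (\<integral>\<^sup>+s. ennreal ((q s * \<theta> s powr p) * source_potential \<phi> s) \<partial>lborel)"
  proof (intro nn_integral_cong)
    fix t show "source \<theta> t * potential (source \<phi>) t = ennreal ((q t * \<theta> t powr p) * source_potential \<phi> t)"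
    proof (cases "t \<le> 0")
      case False
      then show ?thesis using potential_eq_source_potential[OF assms(1), of t] q_nonneg[of t] source_potential_bounds[OF
          assms(1), of t]
        by (simp add: source_def ennreal_mult)
    qed (simp add: q_zero source_def)
  qed
  also have "\<dots> = ennreal (pairing \<theta> \<phi>)"
    unfolding pairing_def using pairing_int[OF assms] pairing_integrand[OF assms] by (intro nn_integral_eq_integral) auto
  finally show ?thesis .
qed

lemma pairing_nonneg: "admissible \<phi> \<Longrightarrow> admissible \<theta> \<Longrightarrow> 0 \<le> pairing \<theta> \<phi>"
  unfolding pairing_def by (intro integral_nonneg_AE always_eventually allI pairing_integrand)

lemma pairing_Cauchy_Schwarz:
  assumes "admissible \<phi>" "admissible \<theta>"
  shows "pairing \<theta> \<phi> \<le> sqrt (pairing \<theta> \<theta>) * sqrt (pairing \<phi> \<phi>)"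
proof -
  have [measurable]: "\<phi> \<in> borel_measurable borel" "\<theta> \<in> borel_measurable borel" using assms by (auto simp: admissible_def)
  have "(ennreal (pairing \<theta> \<phi>))\<^sup>2 \<le> ennreal (pairing \<theta> \<theta>) * ennreal (pairing \<phi> \<phi>)"
    using energy_Cauchy_Schwarz[of "source \<phi>" "source \<theta>"] by (simp add: energy_eq_pairing assms)
  then have "(pairing \<theta> \<phi>)\<^sup>2 \<le> pairing \<theta> \<theta> * pairing \<phi> \<phi>"
    using pairing_nonneg assms by (simp add: ennreal_power ennreal_mult[symmetric])
  then show ?thesis by (simp add: real_le_rsqrt real_sqrt_mult[symmetric])
qed

lemma source_potential_holder:
  assumes "admissible \<phi>" "0 \<le> s" "s \<le> s'"
  shows "source_potential \<phi> s \<le> source_potential \<phi> s'" "source_potential \<phi> s' - source_potential \<phi> s \<le>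
      sqrt (s' - s) * sqrt (pairing \<phi> \<phi>)"
proof -
  have [measurable]: "\<phi> \<in> borel_measurable borel" using assms by (auto simp: admissible_def)
  obtain d where d: "potential (source \<phi>) s' = potential (source \<phi>) s + d"
    "d\<^sup>2 \<le> ennreal (s' - s) * (\<integral>\<^sup>+s. source \<phi> s * potential (source \<phi>) s \<partial>lborel)"
    by (rule potential_holder[of "source \<phi>" s s']) (use assms in auto)
  have e: "ennreal (source_potential \<phi> s') = ennreal (source_potential \<phi> s) + d"
    using d(1) assms by (simp add: potential_eq_source_potential)
  then have "d \<noteq> top" by auto
  then obtain r where r: "0 \<le> r" "d = ennreal r" by (cases d) auto
  have "ennreal (source_potential \<phi> s') = ennreal (source_potential \<phi> s + r)"
      using e r source_potential_bounds[OF assms(1,2)] by simp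
  then have pr: "source_potential \<phi> s' = source_potential \<phi> s + r"
    using ennreal_inj[of "source_potential \<phi> s'" "source_potential \<phi> s + r"] source_potential_bounds(1)[OF assms(1), of
        s'] source_potential_bounds(1)[OF assms(1,2)] assms r
    by (simp del: ennreal_plus)
  then show "source_potential \<phi> s \<le> source_potential \<phi> s'" using r by simp
  have "ennreal r ^ 2 \<le> ennreal (s' - s) * ennreal (pairing \<phi> \<phi>)"
    using d(2) r assms by (simp add: energy_eq_pairing)
  then have "r\<^sup>2 \<le> (s' - s) * pairing \<phi> \<phi>" using r assms pairing_nonneg[OF assms(1,1)]
    by (simp add: ennreal_power ennreal_mult[symmetric])
  then show "source_potential \<phi> s' - source_potential \<phi> s \<le> sqrt (s' - s) * sqrt (pairing \<phi> \<phi>)"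
    using pr by (simp add: real_le_rsqrt real_sqrt_mult[symmetric])
qed

lemma source_potential_0: "source_potential \<phi> 0 = 0"
proof -
  have "min 0 t * (q t * \<phi> t powr p) = 0" for t using q_zero[of t] by (cases "t \<le> 0") auto
  then show ?thesis unfolding source_potential_def by (simp only: integral_zero)
qed

lemma source_potential_pos:
  assumes "admissible \<phi>" "\<And>t. 0 < t \<Longrightarrow> 0 < \<phi> t" "0 < s"
  shows "0 < source_potential \<phi> s"
proof (rule ccontr)
  assume "\<not> 0 < source_potential \<phi> s"
  then have "source_potential \<phi> s = 0" using source_potential_bounds(1)[OF assms(1), of s] assms by simp
  then have "AE t in lborel. min s t * (q t * \<phi> t powr p) = 0"
    unfolding source_potential_def using source_potential_int[OF assms(1), of s] source_potential_integrand(1)[OF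
        assms(1), of s] assms
    by (subst (asm) integral_nonneg_eq_0_iff_AE) auto
  then have "AE t in lborel. q t = 0"
  proof eventually_elim
    case (elim t)
    then show ?case using assms(2)[of t] q_zero[of t] assms(3) by (cases "t \<le> 0") (auto simp: min_def split: if_splits)
  qed
  then show False using q_nontrivial by simp
qed

lemma pairing_pos:
  assumes "admissible \<phi>" "admissible \<theta>" "\<And>t. 0 < t \<Longrightarrow> 0 < \<phi> t" "\<And>t. 0 < t \<Longrightarrow> 0 < \<theta> t"
  shows "0 < pairing \<theta> \<phi>"
proof (rule ccontr)
  assume "\<not> 0 < pairing \<theta> \<phi>"
  then have "pairing \<theta> \<phi> = 0" using pairing_nonneg[OF assms(1,2)] by simp
  then have "AE t in lborel. (q t * \<theta> t powr p) * source_potential \<phi> t = 0"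
    unfolding pairing_def using pairing_int[OF assms(1,2)] pairing_integrand(1)[OF assms(1,2)]
    by (subst (asm) integral_nonneg_eq_0_iff_AE) auto
  then have "AE t in lborel. q t = 0"
  proof eventually_elim
    case (elim t)
    then show ?case using assms(4)[of t] q_zero[of t] source_potential_pos[OF assms(1,3), of t] by (cases "t \<le> 0") auto
  qed
  then show False using q_nontrivial by simp
qed

section \<open>The power method and its limit\<close>

text \<open>Iterating this map is the power method for the maximization of \<open>power_energy\<close>: it increases
  \<open>power_energy\<close> by convexity, and its images are equicontinuous.\<close>

definition normalized_potential :: "(real \<Rightarrow> real) \<Rightarrow> real \<Rightarrow> real" where
  "normalized_potential \<phi> s = source_potential \<phi> s / sqrt (pairing \<phi> \<phi>)"

definition pos_admissible :: "(real \<Rightarrow> real) \<Rightarrow> bool" where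
  "pos_admissible \<phi> \<longleftrightarrow> admissible \<phi> \<and> (\<forall>t>0. 0 < \<phi> t)"

lemma pairing_pos_admissible: "pos_admissible \<phi> \<Longrightarrow> 0 < pairing \<phi> \<phi>"
  unfolding pos_admissible_def by (intro pairing_pos) auto

lemma pos_admissible_normalized_potential:
  assumes "pos_admissible \<phi>" shows "pos_admissible (normalized_potential \<phi>)"
proof -
  have a: "admissible \<phi>" and i: "0 < pairing \<phi> \<phi>" using assms pairing_pos_admissible by (auto simp: pos_admissible_def)
  have [measurable]: "\<phi> \<in> borel_measurable borel" using a by (auto simp: admissible_def)
  have "source_potential \<phi> t \<le> t powr (1/2) * sqrt (pairing \<phi> \<phi>)" if "0 < t" for t
    using source_potential_holder(2)[OF a, of 0 t] that by (simp add: source_potential_0 powr_half_sqrt)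
  moreover have "0 < source_potential \<phi> t" if "0 < t" for t using assms that
      by (intro source_potential_pos) (auto simp: pos_admissible_def)
  moreover have "normalized_potential \<phi> \<in> borel_measurable borel" unfolding normalized_potential_def[abs_def] by measurable
  ultimately show ?thesis using i unfolding pos_admissible_def admissible_def normalized_potential_def
    by (auto simp: divide_le_eq less_imp_le)
qed

lemma normalized_potential_holder:
  assumes "pos_admissible \<phi>" "0 \<le> s" "0 \<le> s'"
  shows "\<bar>normalized_potential \<phi> s' - normalized_potential \<phi> s\<bar> \<le> sqrt \<bar>s' - s\<bar>"
proof -
  have a: "admissible \<phi>" and i: "0 < pairing \<phi> \<phi>" using assms pairing_pos_admissible by (auto simp: pos_admissible_def)
  have *: "\<bar>normalized_potential \<phi> s' - normalized_potential \<phi> s\<bar> \<le> sqrt \<bar>s' - s\<bar>" if "0 \<le> s" "s \<le> s'" for s s'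
    using source_potential_holder[OF a that] i that
        by (simp add: normalized_potential_def diff_divide_distrib[symmetric] divide_le_eq)
  show ?thesis
  proof (cases "s \<le> s'")
    case False
    then have "s' \<le> s" by simp
    from *[OF assms(3) this] show ?thesis by (subst (1 2) abs_minus_commute)
  qed (use * assms in auto)
qed

lemma pairing_normalized_potential:
  assumes "pos_admissible \<phi>"
  shows "(LINT t|lborel. q t * \<phi> t powr p * normalized_potential \<phi> t) = sqrt (pairing \<phi> \<phi>)"
proof -
  have "(LINT t|lborel. q t * \<phi> t powr p * normalized_potential \<phi> t) = pairing \<phi> \<phi> / sqrt (pairing \<phi> \<phi>)"
    unfolding normalized_potential_def pairing_def by simp
  then show ?thesis using pairing_pos_admissible[OF assms] by (simp add: real_div_sqrt)
qed

text \<open>Tangent inequality at \<phi>. The potential of the source is the gradient of the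
  functional in the energy space, up to a factor, so this is the step in the direction of steepest
  ascent; its linear term is the energy norm \<open>sqrt (pairing \<phi> \<phi>)\<close>.\<close>

lemma power_energy_normalized_ge:
  assumes "pos_admissible \<phi>"
  shows "power_energy \<phi> + (p + 1) * (sqrt (pairing \<phi> \<phi>) - power_energy \<phi>) \<le> power_energy (normalized_potential \<phi>)"
proof -
  have a: "admissible \<phi>" "admissible (normalized_potential \<phi>)" using assms pos_admissible_normalized_potential
      by (auto simp: pos_admissible_def)
  have "0 \<le> power_energy (normalized_potential \<phi>) - power_energy \<phi> - (p + 1) * ((LINT t|lborel. q t * \<phi> t powr p *
      normalized_potential \<phi> t) - power_energy \<phi>)"
    unfolding power_energy_convex(1)[OF a] by (intro integral_nonneg_AE always_eventually allI power_energy_convex(3) a)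
  then show ?thesis by (simp add: pairing_normalized_potential[OF assms])
qed

text \<open>With \<psi> the normalized potential of \<phi>, one factor of \<psi>^(p+1) is replaced
  by its definition, leaving \<open>pairing \<psi> \<phi>\<close> over the energy norm belonging to
  \<phi>; Cauchy-Schwarz leaves the norm belonging to \<psi>. Hence the gain in the tangent
  inequality at \<psi> is nonnegative.\<close>

lemma power_energy_normalized_le:
  assumes "pos_admissible \<phi>"
  shows "power_energy (normalized_potential \<phi>) \<le> sqrt (pairing (normalized_potential \<phi>) (normalized_potential \<phi>))"
proof -
  have a: "admissible \<phi>" "admissible (normalized_potential \<phi>)" and i: "0 < pairing \<phi> \<phi>"
      using assms pos_admissible_normalized_potential pairing_pos_admissible by (auto simp: pos_admissible_def)
  have "power_energy (normalized_potential \<phi>) = pairing (normalized_potential \<phi>) \<phi> / sqrt (pairing \<phi> \<phi>)"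
    unfolding power_energy_eq(1)[OF a(2)] pairing_def[of "normalized_potential \<phi>"] integral_divide_zero[symmetric]
    by (intro Bochner_Integration.integral_cong) (auto simp: normalized_potential_def)
  also have "\<dots> \<le> sqrt (pairing (normalized_potential \<phi>) (normalized_potential \<phi>))"
    using pairing_Cauchy_Schwarz[OF a] i by (simp add: divide_le_eq)
  finally show ?thesis .
qed

lemma power_energy_pos:
  assumes "pos_admissible \<phi>" shows "0 < power_energy \<phi>"
proof (rule ccontr)
  have a: "admissible \<phi>" using assms by (auto simp: pos_admissible_def)
  assume "\<not> 0 < power_energy \<phi>"
  moreover have "0 \<le> power_energy \<phi>" unfolding power_energy_def by (intro integral_nonneg_AE) (auto simp: q_nonneg)
  ultimately have "power_energy \<phi> = 0" by simp
  then have "AE t in lborel. q t * \<phi> t powr (p + 1) = 0"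
    unfolding power_energy_def using power_energy_eq(2)[OF a] q_nonneg by (subst (asm) integral_nonneg_eq_0_iff_AE) auto
  then have "AE t in lborel. q t = 0"
  proof eventually_elim
    case (elim t)
    have "0 < t \<Longrightarrow> 0 < \<phi> t" using assms by (simp add: pos_admissible_def)
    then show ?case using elim q_zero[of t] by (cases "t \<le> 0") auto
  qed
  then show False using q_nontrivial by simp
qed

text \<open>The integrands are dominated by q t^((p+1)/2); since q vanishes beyond R, convergence on
  (0,R] is enough.\<close>

lemma admissible_integral_limit:
  assumes f: "\<And>n. admissible (f n)" "admissible f'" and h: "\<And>n. admissible (h n)" "admissible h'"
    and fl: "\<And>t. 0 < t \<Longrightarrow> t \<le> R \<Longrightarrow> (\<lambda>n. f n t) \<longlonglongrightarrow> f' t"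
    and hl: "\<And>t. 0 < t \<Longrightarrow> t \<le> R \<Longrightarrow> (\<lambda>n. h n t) \<longlonglongrightarrow> h' t"
  shows "(\<lambda>n. LINT t|lborel. q t * f n t powr p * h n t) \<longlonglongrightarrow> (LINT t|lborel. q t * f' t powr p * h' t)"
proof (rule integral_dominated_convergence)
  show "integrable lborel (\<lambda>t. q t * t powr ((p + 1) / 2))" by (rule q_int)
  show "AE t in lborel. (\<lambda>n. q t * f n t powr p * h n t) \<longlonglongrightarrow> q t * f' t powr p * h' t"
  proof (intro always_eventually allI)
    fix t show "(\<lambda>n. q t * f n t powr p * h n t) \<longlonglongrightarrow> q t * f' t powr p * h' t"
    proof (cases "0 < t \<and> t \<le> R")
      case True
      then show ?thesis using f(1) p1
        by (intro tendsto_intros fl hl tendsto_powr2) (auto simp: admissible_def)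
    next
      case False
      then have "q t = 0" using q_zero[of t] by auto
      then show ?thesis by simp
    qed
  qed
qed (use admissible_integral[OF f(1) h(1)] admissible_integral(1)[OF f(2) h(2)] in auto)

lemma source_potential_limit:
  assumes f: "\<And>n. admissible (f n)" "admissible f'"
    and fl: "\<And>t. 0 < t \<Longrightarrow> t \<le> R \<Longrightarrow> (\<lambda>n. f n t) \<longlonglongrightarrow> f' t" and s: "0 \<le> s"
  shows "(\<lambda>n. source_potential (f n) s) \<longlonglongrightarrow> source_potential f' s"
  unfolding source_potential_def
proof (rule integral_dominated_convergence)
  show "integrable lborel (\<lambda>t. s powr (1/2) * (q t * t powr ((p + 1) / 2)))" using q_int by simp
  show "AE t in lborel. (\<lambda>n. min s t * (q t * f n t powr p)) \<longlonglongrightarrow> min s t * (q t * f' t powr p)"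
  proof (intro always_eventually allI)
    fix t show "(\<lambda>n. min s t * (q t * f n t powr p)) \<longlonglongrightarrow> min s t * (q t * f' t powr p)"
    proof (cases "0 < t \<and> t \<le> R")
      case True
      then show ?thesis using f(1) p1
        by (intro tendsto_intros fl tendsto_powr2) (auto simp: admissible_def)
    next
      case False
      then have "q t = 0" using q_zero[of t] by auto
      then show ?thesis by simp
    qed
  qed
qed (use source_potential_integrand[OF f(1) s] source_potential_int[OF f(1) s] source_potential_int[OF f(2) s] in auto)

text \<open>Along the iteration the values P n increase and are bounded, and (p+1) (N n - P n) is at
  most P (n+1) - P n, so the norms N n have the same limit M. For a limit point f and its rescaled
  potential \<eta> the convexity gap is then 0, and strict convexity gives \<eta> = f almost
  everywhere on {q \<noteq> 0}, which is the Euler-Lagrange equation.\<close>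

lemma eigenfunction:
  obtains \<eta> M where "admissible \<eta>" "0 < M" "power_energy \<eta> = M" "\<And>s. 0 \<le> s \<Longrightarrow> source_potential \<eta> s = M * \<eta> s"
proof -
  \<comment> \<open>\<open>Suc n\<close>: every term is itself a normalized potential, hence
    vanishes at 0 and is Hoelder continuous with a common constant.\<close>
  define \<phi> where "\<phi> n = (normalized_potential ^^ Suc n) (\<lambda>t. t powr (1/2))" for n
  have g0: "pos_admissible (\<lambda>t. t powr (1/2))" by (auto simp: pos_admissible_def admissible_def)
  have gn: "pos_admissible ((normalized_potential ^^ n) (\<lambda>t. t powr (1/2)))" for n
    by (induction n) (use g0 pos_admissible_normalized_potential in auto)
  have pos_admissible: "pos_admissible (\<phi> n)" for n unfolding \<phi>_def by (rule gn)
  have admissible: "admissible (\<phi> n)" for n using pos_admissible by (simp add: pos_admissible_def)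
  have \<phi>_Suc: "\<phi> (Suc n) = normalized_potential (\<phi> n)" for n by (simp add: \<phi>_def)
  have \<phi>_normalized_potential: "\<exists>\<theta>. pos_admissible \<theta> \<and> \<phi> n = normalized_potential \<theta>" for n unfolding \<phi>_def using gn[of n] by auto
  define N where "N n = sqrt (pairing (\<phi> n) (\<phi> n))" for n
  define P where "P n = power_energy (\<phi> n)" for n
  have PN: "P n \<le> N n" for n using \<phi>_normalized_potential[of n] power_energy_normalized_le by (auto simp: P_def N_def)
  have PP: "P n + (p + 1) * (N n - P n) \<le> P (Suc n)" for n
    using power_energy_normalized_ge[OF pos_admissible[of n]] by (simp add: P_def N_def \<phi>_Suc)
  have inc: "P n \<le> P (Suc n)" for n
    using PP[of n] mult_nonneg_nonneg[of "p + 1" "N n - P n"] PN[of n] p1 by linarith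
  have "\<exists>M. P \<longlonglongrightarrow> M \<and> (\<forall>n. P n \<le> M)"
    using incseq_convergent[of P B] inc power_energy_le[OF admissible] by (metis P_def incseq_SucI)
  then obtain M where M: "P \<longlonglongrightarrow> M" "\<And>n. P n \<le> M" by auto
  have M0: "0 < M" using M(2)[of 0] power_energy_pos[OF pos_admissible[of 0]] by (simp add: P_def)
  have "(\<lambda>n. (P (Suc n) - P n) / (p + 1)) \<longlonglongrightarrow> (M - M) / (p + 1)"
    using M(1) LIMSEQ_Suc[OF M(1)] p1 by (intro tendsto_intros) auto
  then have "(\<lambda>n. N n - P n) \<longlonglongrightarrow> 0"
    by (intro tendsto_sandwich[of "\<lambda>_. 0" "\<lambda>n. N n - P n" sequentially "\<lambda>n. (P (Suc n) - P n) / (p + 1)"])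
       (use PN PP p1 in \<open>auto simp: le_divide_eq algebra_simps intro!: always_eventually\<close>)
  from tendsto_add[OF this M(1)] have NM: "N \<longlonglongrightarrow> M" by simp
  have hold: "\<bar>\<phi> n s' - \<phi> n s\<bar> \<le> sqrt \<bar>s' - s\<bar>" if "0 \<le> s" "0 \<le> s'" for n s s'
    using \<phi>_normalized_potential[of n] normalized_potential_holder that by auto
  have zero: "\<phi> n 0 = 0" for n using \<phi>_normalized_potential[of n] by (auto simp: normalized_potential_def source_potential_0)
  obtain g k where gk: "strict_mono (k :: nat \<Rightarrow> nat)"
    "\<And>e. 0 < e \<Longrightarrow> \<exists>N. \<forall>n x. n \<ge> N \<and> x \<in> {0..R} \<longrightarrow> norm (\<phi> (k n) x - g x) < e"
  proof (rule Arzela_Ascoli[of "{0..R}" \<phi> "sqrt R"])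
    show "norm (\<phi> n x) \<le> sqrt R" if "x \<in> {0..R}" for n x
      using order_trans[OF hold[of 0 x n], of "sqrt R"] that zero[of n] by simp
    show "\<exists>d. 0 < d \<and> (\<forall>n y. y \<in> {0..R} \<and> norm (x - y) < d \<longrightarrow> norm (\<phi> n x - \<phi> n y) < e)"
      if "x \<in> {0..R}" "0 < e" for x e
    proof (intro exI[of _ "e\<^sup>2"] conjI allI impI)
      fix n y assume y: "y \<in> {0..R} \<and> norm (x - y) < e\<^sup>2"
      then have "sqrt \<bar>x - y\<bar> < e" using that by (intro real_less_lsqrt) auto
      then show "norm (\<phi> n x - \<phi> n y) < e" using hold[of y x n] y that by auto
    qed (use that in simp)
  qed auto
  have lim0: "(\<lambda>n. \<phi> (k n) t) \<longlonglongrightarrow> g t" if "0 < t" "t \<le> R" for t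
    unfolding LIMSEQ_iff using gk(2) that by (metis atLeastAtMost_iff less_imp_le)
  \<comment> \<open>The Arzela-Ascoli limit g is controlled on [0,R] only. Cutting it off there and
    writing it as \<open>lim\<close> yields a measurable, indeed admissible, function.\<close>
  define f where "f t = lim (\<lambda>n. if 0 < t \<and> t \<le> R then \<phi> (k n) t else 0)" for t
  have f_eq: "f t = (if 0 < t \<and> t \<le> R then g t else 0)" for t
    unfolding f_def using lim0[of t] by (auto intro!: limI)
  have lim: "(\<lambda>n. \<phi> (k n) t) \<longlonglongrightarrow> f t" if "0 < t" "t \<le> R" for t
    using lim0 that by (simp add: f_eq)
  have [measurable]: "\<phi> n \<in> borel_measurable borel" for n using admissible by (simp add: admissible_def)
  have fm: "f \<in> borel_measurable borel" unfolding f_def[abs_def] by measurable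
  have admissible_f: "admissible f"
    unfolding admissible_def
  proof (intro conjI allI impI fm)
    fix t :: real assume t: "0 < t"
    show "0 \<le> f t"
    proof (cases "t \<le> R")
      case True
      show ?thesis by (rule LIMSEQ_le_const[OF lim[OF t True]]) (use admissible t in \<open>auto simp: admissible_def\<close>)
    qed (simp add: f_eq)
    show "f t \<le> t powr (1/2)"
    proof (cases "t \<le> R")
      case True
      show ?thesis by (rule LIMSEQ_le_const2[OF lim[OF t True]]) (use admissible t in \<open>auto simp: admissible_def\<close>)
    qed (simp add: f_eq)
  qed
  \<comment> \<open>The limit of the successors along the same subsequence. It exists for every s
    \<ge> 0, since \<open>source_potential\<close> at any s uses the function on (0,R] only.\<close>
  define \<eta> where "\<eta> s = source_potential f s / M" for s
  have lim2: "(\<lambda>n. \<phi> (Suc (k n)) s) \<longlonglongrightarrow> \<eta> s" if "0 \<le> s" for s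
    unfolding \<phi>_Suc normalized_potential_def \<eta>_def N_def[symmetric]
    using LIMSEQ_subseq_LIMSEQ[OF NM gk(1)] M0
    by (intro tendsto_divide source_potential_limit admissible admissible_f lim that) (auto simp: o_def)
  have admissible_\<eta>: "admissible \<eta>"
    unfolding admissible_def
  proof (intro conjI allI impI)
    show "\<eta> \<in> borel_measurable borel" unfolding \<eta>_def[abs_def] using fm by measurable
    fix t :: real assume t: "0 < t"
    show "0 \<le> \<eta> t" "\<eta> t \<le> t powr (1/2)"
      by (rule LIMSEQ_le_const[OF lim2] LIMSEQ_le_const2[OF lim2]; use admissible t in \<open>auto simp: admissible_def\<close>)+
  qed
  have "(\<lambda>n. P (k n)) \<longlonglongrightarrow> power_energy f"
    unfolding P_def power_energy_eq(1)[OF admissible] power_energy_eq(1)[OF admissible_f]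
        by (intro admissible_integral_limit admissible admissible_f lim)
  moreover have "(\<lambda>n. P (k n)) \<longlonglongrightarrow> M" using LIMSEQ_subseq_LIMSEQ[OF M(1) gk(1)] by (simp add: o_def)
  ultimately have Pf: "power_energy f = M" by (rule LIMSEQ_unique)
  have "(\<lambda>n. P (Suc (k n))) \<longlonglongrightarrow> power_energy \<eta>"
    unfolding P_def power_energy_eq(1)[OF admissible] power_energy_eq(1)[OF admissible_\<eta>]
        by (intro admissible_integral_limit admissible admissible_\<eta> lim2) auto
  moreover have "(\<lambda>n. P (Suc (k n))) \<longlonglongrightarrow> M"
    using LIMSEQ_subseq_LIMSEQ[OF LIMSEQ_Suc[OF M(1)] gk(1)] by (simp add: o_def)
  ultimately have P\<eta>: "power_energy \<eta> = M" by (rule LIMSEQ_unique)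
  have "(\<lambda>n. LINT t|lborel. q t * \<phi> (k n) t powr p * \<phi> (Suc (k n)) t) \<longlonglongrightarrow> (LINT t|lborel. q t * f t powr p * \<eta> t)"
    by (intro admissible_integral_limit admissible admissible_f admissible_\<eta> lim lim2) auto
  moreover have "(\<lambda>n. LINT t|lborel. q t * \<phi> (k n) t powr p * \<phi> (Suc (k n)) t) = (\<lambda>n. N (k n))"
    unfolding \<phi>_Suc N_def using pairing_normalized_potential[OF pos_admissible] by auto
  moreover have "(\<lambda>n. N (k n)) \<longlonglongrightarrow> M" using LIMSEQ_subseq_LIMSEQ[OF NM gk(1)] by (simp add: o_def)
  ultimately have mix: "(LINT t|lborel. q t * f t powr p * \<eta> t) = M" using LIMSEQ_unique by metis
  \<comment> \<open>Every term of the gap is a multiple of M: M - M - (p + 1) (M - M) = 0.\<close>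
  have "(LINT t|lborel. q t * (\<eta> t powr (p + 1) - f t powr (p + 1) - (p + 1) * f t powr p * (\<eta> t - f t))) = 0"
    unfolding power_energy_convex(1)[OF admissible_f admissible_\<eta>, symmetric] by (simp add: mix Pf P\<eta>)
  then have "AE t in lborel. q t * (\<eta> t powr (p + 1) - f t powr (p + 1) - (p + 1) * f t powr p * (\<eta> t - f t)) = 0"
    by (subst (asm) integral_nonneg_eq_0_iff_AE)
       (auto intro: power_energy_convex(2)[OF admissible_f admissible_\<eta>] power_energy_convex(3)[OF admissible_f admissible_\<eta>])
  then have eq: "AE t in lborel. q t = 0 \<or> \<eta> t = f t"
  proof eventually_elim
    case (elim t)
    show ?case
    proof (rule ccontr)
      assume n: "\<not> (q t = 0 \<or> \<eta> t = f t)"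
      then have "0 < t" using q_zero[of t] by (meson not_le)
      then have "0 \<le> f t" "0 \<le> \<eta> t" using admissible_f admissible_\<eta> by (auto simp: admissible_def)
      then show False using powr_bernoulli[of "\<eta> t" "f t" p] n elim p1 by auto
    qed
  qed
  have "source_potential \<eta> s = M * \<eta> s" if "0 \<le> s" for s
  proof -
    have "source_potential \<eta> s = source_potential f s"
      unfolding source_potential_def
    proof (rule integral_cong_AE)
      show "AE t in lborel. min s t * (q t * \<eta> t powr p) = min s t * (q t * f t powr p)"
        using eq by eventually_elim auto
    qed (use admissible_f admissible_\<eta> in \<open>auto simp: admissible_def\<close>)
    then show ?thesis using M0 by (simp add: \<eta>_def)
  qed
  then show ?thesis using that admissible_\<eta> M0 P\<eta> by blast
qed

text \<open>Scaling by l with l^p M = l removes the eigenvalue. The difficulty is the finiteness of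
  \<integral> q w^p, the slope at 0: the bound w \<le> l t^(1/2) controls q w^p only by q t^(p/2),
  which need not be integrable at 0. A bootstrap in the integral equation improves the bound to w
  \<le> 2 C0 s, and then q t^p decides.\<close>

lemma zero_slope_solution:
  assumes qp: "integrable lborel (\<lambda>t. q t * t powr p)"
  obtains w where "w \<in> borel_measurable borel" "\<And>s. 0 < s \<Longrightarrow> 0 \<le> w s"
    "\<And>s. 0 < s \<Longrightarrow> w s = (LINT t|lborel. min s t * (q t * w t powr p))"
    "integrable lborel (\<lambda>t. q t * w t powr p)"
    "0 < (LINT t|lborel. q t * w t powr p)"
proof -
  obtain \<eta> M where \<eta>: "admissible \<eta>" "0 < M" "power_energy \<eta> = M" "\<And>s. 0 \<le> s \<Longrightarrow> source_potential \<eta> s = M * \<eta> s"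
    by (rule eigenfunction) (rule that)
  define l where "l = M powr (- 1 / (p - 1))"
  have l: "0 < l" using \<eta> by (simp add: l_def)
  have lp: "l powr p * M = l"
  proof -
    have "l powr p * M = M powr (- 1 / (p - 1) * p + 1)"
      using powr_add[of M "- 1 / (p - 1) * p" 1] \<eta>(2) by (simp add: l_def powr_powr)
    also have "- 1 / (p - 1) * p + 1 = - 1 / (p - 1)" using p1 by (simp add: field_simps)
    finally show ?thesis by (simp add: l_def)
  qed
  define w where "w s = l * \<eta> s" for s
  have [measurable]: "\<eta> \<in> borel_measurable borel" using \<eta> by (simp add: admissible_def)
  have wm[measurable]: "w \<in> borel_measurable borel" unfolding w_def[abs_def] by measurable
  have w0: "0 \<le> w s" if "0 < s" for s using \<eta>(1) l that by (simp add: w_def admissible_def)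
  have wp: "q t * w t powr p = l powr p * (q t * \<eta> t powr p)" for t
    using \<eta>(1) l q_zero[of t] by (cases "t \<le> 0") (auto simp: w_def admissible_def powr_mult)
  have weq: "w s = (LINT t|lborel. min s t * (q t * w t powr p))" if "0 \<le> s" for s
  proof -
    have "(LINT t|lborel. min s t * (q t * w t powr p)) = (LINT t|lborel. l powr p * (min s t * (q t * \<eta> t powr p)))"
      by (simp add: wp mult_ac)
    also have "\<dots> = l powr p * (M * \<eta> s)" using \<eta>(4)[OF that] by (simp add: source_potential_def)
    finally show ?thesis using lp by (simp add: w_def)
  qed
  have wint: "integrable lborel (\<lambda>t. min s t * (q t * w t powr p))" if "0 \<le> s" for s
  proof -
    have "integrable lborel (\<lambda>t. l powr p * (min s t * (q t * \<eta> t powr p)))"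
      using source_potential_int[OF \<eta>(1) that] by simp
    then show ?thesis by (simp add: wp mult_ac)
  qed
  have wl: "w t \<le> l * t powr (1/2)" if "0 < t" for t using \<eta>(1) l that by (simp add: w_def admissible_def)
  define C1 where "C1 = l powr (p - 1)"
  have C1: "0 < C1" using l by (simp add: C1_def)
  let ?Q = "\<lambda>t. q t * t powr ((p + 1) / 2)"
  \<comment> \<open>The weight carries little mass near 0: this yields s0 with C1 \<integral>_0^s0 q
    t^((p+1)/2) \<le> 1/2, which makes the part of the equation near 0 contracting.\<close>
  have "(\<lambda>n. LINT t|lborel. (if t \<le> 1 / real (Suc n) then ?Q t else 0)) \<longlonglongrightarrow> (LINT t|(lborel :: real measure). (0::real))"
  proof (rule integral_dominated_convergence)
    show "integrable lborel ?Q" by (rule q_int)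
    show "AE t in lborel. (\<lambda>n. if t \<le> 1 / real (Suc n) then ?Q t else 0) \<longlonglongrightarrow> 0"
    proof (intro always_eventually allI)
      fix t show "(\<lambda>n. if t \<le> 1 / real (Suc n) then ?Q t else 0) \<longlonglongrightarrow> 0"
      proof (cases "t \<le> 0")
        case False
        have "(\<lambda>n. 1 / real (Suc n)) \<longlonglongrightarrow> 0" by real_asymp
        then have "\<forall>\<^sub>F n in sequentially. 1 / real (Suc n) < t" using False by (auto intro: order_tendstoD)
        then show ?thesis by (intro tendsto_eventually, eventually_elim) auto
      next
        case True
        then have "q t = 0" using q_zero by blast
        then show ?thesis by (simp cong: if_cong)
      qed
    qed
  qed (auto simp: q_nonneg)
  then have "(\<lambda>n. LINT t|lborel. (if t \<le> 1 / real (Suc n) then ?Q t else 0)) \<longlonglongrightarrow> 0" by simp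
  then have "\<forall>\<^sub>F n in sequentially. (LINT t|lborel. (if t \<le> 1 / real (Suc n) then ?Q t else 0)) < 1 / (2 * C1)"
    using C1 by (intro order_tendstoD) auto
  then obtain n0 where n0: "(LINT t|lborel. (if t \<le> 1 / real (Suc n0) then ?Q t else 0)) < 1 / (2 * C1)"
    by (auto simp: eventually_sequentially)
  define s0 where "s0 = 1 / real (Suc n0)"
  have s0: "0 < s0" by (simp add: s0_def)
  define I where "I = (LINT t|lborel. (if t \<le> s0 then ?Q t else 0))"
  have I: "C1 * I \<le> 1 / 2" using n0 C1 by (simp add: I_def s0_def field_simps)
  have Iint: "integrable lborel (\<lambda>t. if t \<le> s0 then ?Q t else 0)"
    by (rule Bochner_Integration.integrable_bound[OF q_int]) (auto simp: q_nonneg)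
  have I0: "0 \<le> I" unfolding I_def by (intro integral_nonneg_AE) (auto simp: q_nonneg)
  have far: "integrable lborel (\<lambda>t. if s0 < t then q t * w t powr p else 0)"
  proof (rule Bochner_Integration.integrable_bound)
    show "integrable lborel (\<lambda>t. l powr p * s0 powr (-1/2) * ?Q t)" using q_int by simp
    show "AE t in lborel. norm (if s0 < t then q t * w t powr p else 0) \<le> norm (l powr p * s0 powr (-1/2) * ?Q t)"
    proof (intro always_eventually allI)
      fix t
      show "norm (if s0 < t then q t * w t powr p else 0) \<le> norm (l powr p * s0 powr (-1/2) * ?Q t)"
      proof (cases "s0 < t")
        case True
        then have t: "0 < t" using s0 by simp
        have "w t powr p \<le> (l * t powr (1/2)) powr p" using wl[OF t] w0[OF t] p1 by (intro powr_mono2) auto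
        also have "\<dots> = l powr p * (t powr (-1/2) * t powr ((p + 1) / 2))"
          using l t by (simp add: powr_mult powr_powr powr_add[symmetric] add_divide_distrib)
        also have "\<dots> \<le> l powr p * (s0 powr (-1/2) * t powr ((p + 1) / 2))"
          using True s0 by (intro mult_left_mono mult_right_mono powr_mono2') auto
        finally have "q t * w t powr p \<le> q t * (l powr p * (s0 powr (-1/2) * t powr ((p + 1) / 2)))"
          by (intro mult_left_mono q_nonneg)
        then show ?thesis using q_nonneg[of t] by (simp add: mult_ac)
      qed simp
    qed
  qed measurable
  define C0 where "C0 = (LINT t|lborel. (if s0 < t then q t * w t powr p else 0))"
  have C0: "0 \<le> C0" unfolding C0_def by (intro integral_nonneg_AE) (auto simp: q_nonneg)
  \<comment> \<open>One power of w is estimated by the induction hypothesis and the other p - 1 by l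
    t^(1/2). The factor 2 lets the linear term reproduce itself, C0 s + (1/2) 2 C0 s = 2 C0 s, while
    the square root term is halved.\<close>
  have bound: "w s \<le> 2 * C0 * s + l * s powr (1/2) / 2 ^ n" if "0 < s" for n s
    using that
  proof (induction n arbitrary: s)
    case 0
    then show ?case using wl[of s] C0 by (simp add: add_increasing)
  next
    case (Suc n)
    let ?D = "2 * C0 * s + l * s powr (1/2) / 2 ^ n"
    have "w s = (LINT t|lborel. min s t * (q t * w t powr p))" using weq Suc.prems by simp
    also have "\<dots> \<le> (LINT t|lborel. s * (if s0 < t then q t * w t powr p else 0) + C1 * ?D * (if t \<le> s0 then ?Q t else 0))"
    proof (rule integral_mono)
      show "integrable lborel (\<lambda>t. min s t * (q t * w t powr p))" using wint Suc.prems by simp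
      show "integrable lborel (\<lambda>t. s * (if s0 < t then q t * w t powr p else 0) + C1 * ?D * (if t \<le> s0 then ?Q t else 0))"
        using far Iint by (intro Bochner_Integration.integrable_add integrable_mult_right) auto
      fix t
      consider "t \<le> 0" | "s0 < t" | "0 < t" "t \<le> s0" by linarith
      then show "min s t * (q t * w t powr p) \<le> s * (if s0 < t then q t * w t powr p else 0) + C1 * ?D * (if t \<le>
          s0 then ?Q t else 0)"
      proof cases
        case 2
        then show ?thesis using q_nonneg[of t] by (simp add: mult_right_mono)
      next
        case 3
        have "w t powr p = w t powr (p - 1) * w t"
          using w0[OF 3(1)] by (cases "w t = 0") (auto simp: powr_mult_base[symmetric] powr_diff)
        also have "\<dots> \<le> (l * t powr (1/2)) powr (p - 1) * (2 * C0 * t + l * t powr (1/2) / 2 ^ n)"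
          using w0[OF 3(1)] wl[OF 3(1)] p1 Suc.IH[OF 3(1)] by (intro mult_mono powr_mono2) auto
        also have "(l * t powr (1/2)) powr (p - 1) = C1 * t powr ((p - 1) / 2)"
          using l 3 by (simp add: C1_def powr_mult powr_powr diff_divide_distrib)
        finally have "min s t * w t powr p \<le> min s t * (C1 * t powr ((p - 1) / 2) * (2 * C0 * t + l * t powr (1/2) / 2 ^ n))"
          using Suc.prems 3 by (intro mult_left_mono) auto
        also have "\<dots> = C1 * (2 * C0 * (min s t * (t powr ((p - 1) / 2) * t)) + l / 2 ^ n * (min s t * (t powr ((p - 1) /
            2) * t powr (1/2))))"
          by (simp add: algebra_simps)
        also have "\<dots> \<le> C1 * (2 * C0 * (s * t powr ((p + 1) / 2)) + l / 2 ^ n * (s powr (1/2) * t powr ((p + 1) / 2)))"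
        proof (intro mult_left_mono add_mono)
          have e1: "t powr ((p - 1) / 2) * t = t powr ((p + 1) / 2)"
          proof -
            have "(p - 1) / 2 + 1 = (p + 1) / 2" by (simp add: field_simps)
            then have "t powr ((p + 1) / 2) = t powr ((p - 1) / 2) * t powr 1" by (metis powr_add)
            then show ?thesis using 3 by simp
          qed
          show "min s t * (t powr ((p - 1) / 2) * t) \<le> s * t powr ((p + 1) / 2)"
            unfolding e1 by (intro mult_right_mono) auto
          have "min s t * (t powr ((p - 1) / 2) * t powr (1/2)) \<le>
              (s powr (1/2) * t powr (1/2)) * (t powr ((p - 1) / 2) * t powr (1/2))"
            using min_powr_le[of s t] Suc.prems 3 by (intro mult_right_mono) auto
          also have "\<dots> = s powr (1/2) * (t powr (1/2) * t powr ((p - 1) / 2) * t powr (1/2))" by simp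
          also have "t powr (1/2) * t powr ((p - 1) / 2) * t powr (1/2) = t powr ((p + 1) / 2)"
            by (simp add: powr_add[symmetric] add_divide_distrib diff_divide_distrib)
          finally show "min s t * (t powr ((p - 1) / 2) * t powr (1/2)) \<le> s powr (1/2) * t powr ((p + 1) / 2)" .
        qed (use C0 C1 l in auto)
        also have "\<dots> = C1 * ?D * t powr ((p + 1) / 2)" by (simp add: algebra_simps)
        finally have "q t * (min s t * w t powr p) \<le> q t * (C1 * ?D * t powr ((p + 1) / 2))"
          by (intro mult_left_mono q_nonneg)
        then show ?thesis using 3 by (simp add: mult_ac)
      qed (simp add: q_zero)
    qed
    also have "\<dots> = s * C0 + C1 * ?D * I"
      unfolding C0_def I_def using far Iint
      by (subst Bochner_Integration.integral_add) (simp_all only: integrable_mult_right integral_mult_right_zero)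
    also have "\<dots> \<le> s * C0 + 1 / 2 * ?D"
      using mult_right_mono[OF I, of ?D] C0 l Suc.prems by (simp add: mult_ac)
    also have "\<dots> = 2 * C0 * s + l * s powr (1/2) / 2 ^ Suc n" by (simp add: field_simps)
    finally show ?case .
  qed
  have lin: "w s \<le> 2 * C0 * s" if "0 < s" for s
  proof -
    have "(\<lambda>n. 2 * C0 * s + l * s powr (1/2) / 2 ^ n) \<longlonglongrightarrow> 2 * C0 * s + 0"
      by (intro tendsto_intros) (auto intro!: LIMSEQ_divide_realpow_zero)
    then have "w s \<le> 2 * C0 * s + 0" by (rule LIMSEQ_le_const) (use bound[OF that] in blast)
    then show ?thesis by simp
  qed
  have wpi: "integrable lborel (\<lambda>t. q t * w t powr p)"
  proof (rule Bochner_Integration.integrable_bound)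
    show "integrable lborel (\<lambda>t. (2 * C0) powr p * (q t * t powr p))" using qp by simp
    show "AE t in lborel. norm (q t * w t powr p) \<le> norm ((2 * C0) powr p * (q t * t powr p))"
    proof (intro always_eventually allI)
      fix t
      show "norm (q t * w t powr p) \<le> norm ((2 * C0) powr p * (q t * t powr p))"
      proof (cases "t \<le> 0")
        case False
        then have t: "0 < t" by simp
        have "w t powr p \<le> (2 * C0 * t) powr p" using lin[OF t] w0[OF t] p1 by (intro powr_mono2) auto
        also have "\<dots> = (2 * C0) powr p * t powr p" using C0 t by (simp add: powr_mult)
        finally have "q t * w t powr p \<le> q t * ((2 * C0) powr p * t powr p)" by (intro mult_left_mono q_nonneg)
        then show ?thesis using q_nonneg[of t] by (simp add: mult_ac)
      qed (simp add: q_zero)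
    qed
  qed measurable
  have "(LINT t|lborel. q t * w t powr p) \<noteq> 0"
  proof
    assume "(LINT t|lborel. q t * w t powr p) = 0"
    then have "AE t in lborel. q t * w t powr p = 0"
      using wpi q_nonneg by (subst (asm) integral_nonneg_eq_0_iff_AE) auto
    then have "AE t in lborel. q t * \<eta> t powr (p + 1) = 0"
      by eventually_elim (use l in \<open>auto simp: w_def\<close>)
    then have "power_energy \<eta> = 0" unfolding power_energy_def by (simp add: integral_eq_zero_AE)
    then show False using \<eta> by simp
  qed
  moreover have "0 \<le> (LINT t|lborel. q t * w t powr p)" by (intro integral_nonneg_AE) (auto simp: q_nonneg)
  ultimately have "0 < (LINT t|lborel. q t * w t powr p)" by simp
  then show ?thesis using that[OF wm w0 _ wpi] weq by auto
qed

end

section \<open>The radial integral equation\<close>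

lemma potential_deriv:
  fixes \<phi> :: "real \<Rightarrow> real"
  assumes i: "integrable lborel \<phi>" and c: "continuous_on {0<..} \<phi>" and z: "\<And>t. t \<le> 0 \<Longrightarrow> \<phi> t = 0" and s: "0 < s"
  shows "((\<lambda>s. k * s + (LINT t|lborel. min s t * \<phi> t)) has_real_derivative (k + (LINT t|lborel. (if s < t then \<phi> t else
      0)))) (at s)"
proof -
  have [measurable]: "\<phi> \<in> borel_measurable borel" using i by auto
  \<comment> \<open>t \<phi>(t) need not be integrable at infinity. For x \<le> b only t \<le> x
    \<le> b occurs in the first part of the kernel, where t may be replaced by min t b.\<close>
  define b where "b = s + 1"
  define \<psi> where "\<psi> t = min t b * \<phi> t" for t
  have pi: "integrable lborel \<psi>"
  proof (rule Bochner_Integration.integrable_bound[of lborel "\<lambda>t. b * \<phi> t"])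
    show "integrable lborel (\<lambda>t. b * \<phi> t)" using i by simp
    show "AE t in lborel. norm (\<psi> t) \<le> norm (b * \<phi> t)"
    proof (intro always_eventually allI)
      fix t show "norm (\<psi> t) \<le> norm (b * \<phi> t)"
        using z[of t] s by (cases "t \<le> 0") (auto simp: \<psi>_def abs_mult b_def intro!: mult_right_mono)
    qed
  qed (simp add: \<psi>_def[abs_def])
  have pc: "continuous_on {0<..} \<psi>" unfolding \<psi>_def by (intro continuous_intros c)
  have tail: "(LINT t|lborel. (if x < t then \<phi> t else 0)) = integral\<^sup>L lborel \<phi> - primitive \<phi> x" for x
  proof -
    have "integral\<^sup>L lborel \<phi> = (LINT t|lborel. (if t \<le> x then \<phi> t else 0) + (if x < t then \<phi> t else 0))"
      by (intro Bochner_Integration.integral_cong) auto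
    also have "\<dots> = primitive \<phi> x + (LINT t|lborel. (if x < t then \<phi> t else 0))"
      unfolding primitive_def by (intro Bochner_Integration.integral_add integrable_if_pred[OF i]) measurable
    finally show ?thesis by simp
  qed
  have eq: "k * x + (LINT t|lborel. min x t * \<phi> t) =
      k * x + (primitive \<psi> x + x * (integral\<^sup>L lborel \<phi> - primitive \<phi> x))" if "x \<le> b" for x
  proof -
    have "(LINT t|lborel. min x t * \<phi> t) = (LINT t|lborel. (if t \<le> x then \<psi> t else 0) + x * (if x < t then \<phi> t else 0))"
      using that by (intro Bochner_Integration.integral_cong) (auto simp: \<psi>_def)
    also have "\<dots> = primitive \<psi> x + x * (LINT t|lborel. (if x < t then \<phi> t else 0))"
    proof -
      have "integrable lborel (\<lambda>t. if t \<le> x then \<psi> t else 0)" by (rule integrable_if_pred[OF pi]) measurable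
      moreover have "integrable lborel (\<lambda>t. if x < t then \<phi> t else 0)" by (rule integrable_if_pred[OF i]) measurable
      ultimately show ?thesis unfolding primitive_def
        by (subst Bochner_Integration.integral_add) (simp_all only: integrable_mult_right integral_mult_right_zero)
    qed
    finally show ?thesis by (simp add: tail)
  qed
  have "((\<lambda>x. k * x + (primitive \<psi> x + x * (integral\<^sup>L lborel \<phi> - primitive \<phi> x))) has_real_derivative
      (k + (\<psi> s + (1 * (integral\<^sup>L lborel \<phi> - primitive \<phi> s) + (0 - \<phi> s) * s)))) (at s)"
    by (intro DERIV_add DERIV_mult DERIV_diff DERIV_const DERIV_ident primitive_deriv[OF pi pc s] primitive_deriv[OF i c
        s] DERIV_cmult_Id)
  also have "k + (\<psi> s + (1 * (integral\<^sup>L lborel \<phi> - primitive \<phi> s) + (0 - \<phi> s) * s)) =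
      k + (LINT t|lborel. (if s < t then \<phi> t else 0))"
    by (simp add: tail \<psi>_def b_def)
  finally have D: "((\<lambda>x. k * x + (primitive \<psi> x + x * (integral\<^sup>L lborel \<phi> - primitive \<phi> x))) has_real_derivative
      (k + (LINT t|lborel. (if s < t then \<phi> t else 0)))) (at s)" .
  show ?thesis
    by (rule has_field_derivative_transform_within_open[OF D, of "{..<b}"]) (use eq in \<open>auto simp: b_def\<close>)
qed

text \<open>The half-line equation, freed from the geometry. The role of \<open>crit_slope\<close>
  is the last assumption: there the lower bound b - m b^p for the slope at infinity exceeds
  k.\<close>

locale emden_fowler =
  fixes q :: "real \<Rightarrow> real" and p k crit_slope :: real
  assumes q_meas [measurable]: "q \<in> borel_measurable borel"
    and q_cont: "continuous_on {0<..} q"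
    and q_nonneg: "\<And>t. 0 \<le> q t"
    and q_zero: "\<And>t. t \<le> 0 \<Longrightarrow> q t = 0"
    and q_int_p: "integrable lborel (\<lambda>t. q t * t powr p)"
    and q_int: "integrable lborel (\<lambda>t. q t * t powr ((p + 1) / 2))"
    and q_pos: "\<exists>t>0. q t \<noteq> 0"
    and p1: "1 < p" and k_pos: "0 < k" and crit_slope_pos: "0 < crit_slope"
    and k_less: "k < crit_slope - (LINT t|lborel. q t * t powr p) * crit_slope powr p"
begin

definition mass :: real where "mass = (LINT t|lborel. q t * t powr p)"

lemma mass_nonneg: "0 \<le> mass" unfolding mass_def by (intro integral_nonneg_AE) (auto simp: q_nonneg)

text \<open>Dividing by b leaves 1 - m b^(p-1), which is nonincreasing in b and positive at
  \<open>crit_slope\<close>. This excludes a slope b0 \<le> \<open>crit_slope\<close> with K b0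
  \<le> 0.\<close>

lemma mass_less: "0 < b \<Longrightarrow> b \<le> crit_slope \<Longrightarrow> 0 < b - mass * b powr p"
proof -
  assume b: "0 < b" "b \<le> crit_slope"
  have pw: "x powr p = x * x powr (p - 1)" if "0 < x" for x :: real
    using that by (simp add: powr_mult_base)
  have "0 < crit_slope - mass * crit_slope powr p" using k_less k_pos by (simp add: mass_def)
  then have "0 < crit_slope * (1 - mass * crit_slope powr (p - 1))" using pw[OF crit_slope_pos] by (simp add: algebra_simps)
  then have "mass * crit_slope powr (p - 1) < 1" using crit_slope_pos by (simp add: zero_less_mult_iff)
  moreover have "mass * b powr (p - 1) \<le> mass * crit_slope powr (p - 1)"
    using b p1 mass_nonneg by (intro mult_left_mono powr_mono2) auto
  ultimately have "0 < b * (1 - mass * b powr (p - 1))" using b by (intro mult_pos_pos) auto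
  then show "0 < b - mass * b powr p" using pw[OF b(1)] by (simp add: algebra_simps)
qed

sublocale vt: volterra "\<lambda>t. q t * t powr p" p
  by unfold_locales (auto simp: q_int_p q_nonneg q_zero p1 intro!: continuous_intros q_cont)

lemma source_bound:
  assumes h: "\<And>t. 0 < t \<Longrightarrow> 0 \<le> h t" "\<And>t. 0 < t \<Longrightarrow> h t \<le> c * t" and c: "0 \<le> c"
  shows "0 \<le> q t * h t powr p" "q t * h t powr p \<le> c powr p * (q t * t powr p)"
proof -
  show "0 \<le> q t * h t powr p" using q_nonneg by simp
  show "q t * h t powr p \<le> c powr p * (q t * t powr p)"
  proof (cases "t \<le> 0")
    case False
    then have "h t powr p \<le> (c * t) powr p" using h p1 by (intro powr_mono2) auto
    also have "\<dots> = c powr p * t powr p" using False c by (simp add: powr_mult)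
    finally have "q t * h t powr p \<le> q t * (c powr p * t powr p)" by (intro mult_left_mono q_nonneg)
    then show ?thesis by (simp add: mult_ac)
  qed (simp add: q_zero)
qed

lemma source_integrable:
  assumes [measurable]: "h \<in> borel_measurable borel"
    and h: "\<And>t. 0 < t \<Longrightarrow> 0 \<le> h t" "\<And>t. 0 < t \<Longrightarrow> h t \<le> c * t" and c: "0 \<le> c"
  shows "integrable lborel (\<lambda>t. q t * h t powr p)"
    and "0 \<le> s \<Longrightarrow> integrable lborel (\<lambda>t. min s t * (q t * h t powr p))"
    and "0 \<le> s \<Longrightarrow> 0 \<le> min s t * (q t * h t powr p)"
    and "0 \<le> s \<Longrightarrow> min s t * (q t * h t powr p) \<le> s * (c powr p * (q t * t powr p))"
    and "0 \<le> s \<Longrightarrow> (LINT t|lborel. min s t * (q t * h t powr p)) \<le> s * (c powr p * mass)"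
proof -
  have ci: "integrable lborel (\<lambda>t. c powr p * (q t * t powr p))" using q_int_p by simp
  show si: "integrable lborel (\<lambda>t. q t * h t powr p)"
    by (rule Bochner_Integration.integrable_bound[OF ci])
       (use source_bound[OF h c] q_nonneg in auto)
  show n: "0 \<le> min s t * (q t * h t powr p)" if "0 \<le> s" for t
    using source_bound(1)[OF h c, of t] q_zero[of t] that by (cases "t \<le> 0") auto
  show le: "min s t * (q t * h t powr p) \<le> s * (c powr p * (q t * t powr p))" if "0 \<le> s" for t
  proof (cases "t \<le> 0")
    case False
    have "min s t * (q t * h t powr p) \<le> s * (q t * h t powr p)"
      using source_bound(1)[OF h c, of t] by (intro mult_right_mono) auto
    also have "\<dots> \<le> s * (c powr p * (q t * t powr p))"
      using source_bound(2)[OF h c, of t] that by (rule mult_left_mono)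
    finally show ?thesis .
  qed (simp add: q_zero)
  show mi: "integrable lborel (\<lambda>t. min s t * (q t * h t powr p))" if "0 \<le> s"
  proof (rule Bochner_Integration.integrable_bound)
    show "integrable lborel (\<lambda>t. s * (c powr p * (q t * t powr p)))" using ci by simp
    show "AE t in lborel. norm (min s t * (q t * h t powr p)) \<le> norm (s * (c powr p * (q t * t powr p)))"
      using n[OF that] le[OF that] that q_nonneg by (intro always_eventually allI) (simp add: abs_of_nonneg)
  qed measurable
  show "(LINT t|lborel. min s t * (q t * h t powr p)) \<le> s * (c powr p * mass)" if "0 \<le> s"
  proof -
    have "(LINT t|lborel. min s t * (q t * h t powr p)) \<le> (LINT t|lborel. s * (c powr p * (q t * t powr p)))"
      by (rule integral_mono) (use mi[OF that] ci le[OF that] in auto)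
    then show ?thesis by (simp add: mass_def)
  qed
qed

definition integral_op :: "(real \<Rightarrow> real) \<Rightarrow> real \<Rightarrow> real" where
  "integral_op h s = k * s + (LINT t|lborel. min s t * (q t * h t powr p))"

lemma integral_op_measurable [measurable]:
  assumes [measurable]: "h \<in> borel_measurable borel"
  shows "integral_op h \<in> borel_measurable borel"
  unfolding integral_op_def[abs_def] by measurable

lemma integral_op_mono:
  assumes [measurable]: "g \<in> borel_measurable borel" "h \<in> borel_measurable borel"
    and g: "\<And>t. 0 < t \<Longrightarrow> 0 \<le> g t" and gh: "\<And>t. 0 < t \<Longrightarrow> g t \<le> h t"
    and h: "\<And>t. 0 < t \<Longrightarrow> h t \<le> c * t" and c: "0 \<le> c" and s: "0 \<le> s"
  shows "integral_op g s \<le> integral_op h s"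
proof -
  have g': "g t \<le> c * t" and h': "0 \<le> h t" if "0 < t" for t using g[OF that] gh[OF that] h[OF that] by auto
  have "(LINT t|lborel. min s t * (q t * g t powr p)) \<le> (LINT t|lborel. min s t * (q t * h t powr p))"
  proof (rule integral_mono)
    fix t show "min s t * (q t * g t powr p) \<le> min s t * (q t * h t powr p)"
    proof (cases "t \<le> 0")
      case False
      then have "q t * g t powr p \<le> q t * h t powr p" using g gh p1 q_nonneg by (intro mult_left_mono powr_mono2) auto
      then show ?thesis by (rule mult_left_mono) (use False s in simp)
    qed (simp add: q_zero)
  qed (use source_integrable(2)[OF _ g g' c s] source_integrable(2)[OF _ h' h c s] in auto)
  then show ?thesis by (simp add: integral_op_def)
qed

section \<open>The minimal profile by monotone iteration\<close>

definition approx :: "nat \<Rightarrow> real \<Rightarrow> real" where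
  "approx n = (integral_op ^^ n) (\<lambda>s. k * s)"

lemma approx_0: "approx 0 s = k * s" and approx_Suc: "approx (Suc n) = integral_op (approx n)"
  by (simp_all add: approx_def)

lemma approx_measurable [measurable]: "approx n \<in> borel_measurable borel"
  by (induction n) (simp_all add: approx_Suc, simp add: approx_def)

text \<open>k < l - m l^p holds strictly at \<open>crit_slope\<close>, hence also slightly to its
  left. For such l the line l s is a supersolution: \<open>integral_op\<close> maps it below k s + m
  l^p s \<le> l s. The strict inequality l < \<open>crit_slope\<close> later separates the two
  solutions.\<close>

lemma subcritical_slope: "\<exists>l. 0 < l \<and> l < crit_slope \<and> k + mass * l powr p \<le> l"
proof -
  have "((\<lambda>l. l - mass * l powr p) \<longlongrightarrow> crit_slope - mass * crit_slope powr p) (at_left crit_slope)"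
    using crit_slope_pos by (intro tendsto_intros) auto
  then have "\<forall>\<^sub>F l in at_left crit_slope. k < l - mass * l powr p"
    using k_less by (intro order_tendstoD) (auto simp: mass_def)
  moreover have "\<forall>\<^sub>F l in at_left crit_slope. l \<in> {0<..<crit_slope}" using crit_slope_pos by (rule eventually_at_left_real)
  ultimately have "\<forall>\<^sub>F l in at_left crit_slope. 0 < l \<and> l < crit_slope \<and> k + mass * l powr p \<le> l"
    by eventually_elim auto
  then show ?thesis using eventually_happens' trivial_limit_at_left_real by blast
qed

definition super_slope :: real where "super_slope = (SOME l. 0 < l \<and> l < crit_slope \<and> k + mass * l powr p \<le> l)"

lemma super_slope: "0 < super_slope" "super_slope < crit_slope" "k + mass * super_slope powr p \<le> super_slope"
  using someI_ex[OF subcritical_slope] by (auto simp: super_slope_def)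

lemma approx_bounds: "0 \<le> s \<Longrightarrow> k * s \<le> approx n s \<and> approx n s \<le> super_slope * s"
proof (induction n arbitrary: s)
  case 0
  have "0 \<le> mass * super_slope powr p" using mass_nonneg by simp
  then have "k \<le> super_slope" using super_slope(3) by linarith
  then show ?case using 0 by (simp add: approx_0 mult_right_mono)
next
  case (Suc n)
  have b: "0 \<le> approx n t" "approx n t \<le> super_slope * t" if "0 < t" for t
    using Suc.IH[of t] that mult_pos_pos[OF k_pos that] by linarith+
  have "0 \<le> (LINT t|lborel. min s t * (q t * approx n t powr p))"
    using source_integrable(3)[OF _ b less_imp_le[OF super_slope(1)] Suc.prems] by (intro integral_nonneg_AE) auto
  moreover have "(LINT t|lborel. min s t * (q t * approx n t powr p)) \<le> s * (super_slope powr p * mass)"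
    using source_integrable(5)[OF _ b less_imp_le[OF super_slope(1)] Suc.prems] by auto
  moreover have "k * s + s * (super_slope powr p * mass) \<le> super_slope * s"
    using mult_right_mono[OF super_slope(3) Suc.prems] by (simp add: algebra_simps)
  ultimately show ?case by (auto simp: approx_Suc integral_op_def)
qed

lemma approx_b: "0 < t \<Longrightarrow> 0 \<le> approx n t" "0 < t \<Longrightarrow> approx n t \<le> super_slope * t"
  using approx_bounds[of t n] mult_pos_pos[OF k_pos, of t] by linarith+

lemma approx_mono: "0 \<le> s \<Longrightarrow> approx n s \<le> approx (Suc n) s"
proof (induction n arbitrary: s)
  case 0
  then show ?case using approx_bounds[of s 1] by (simp add: approx_0)
next
  case (Suc n)
  show ?case unfolding approx_Suc[of "Suc n"] approx_Suc[of n]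
    by (rule integral_op_mono[of _ _ super_slope]) (use Suc super_slope approx_b approx_b[of _ "Suc n"] in \<open>auto simp
        flip: approx_Suc\<close>)
qed

text \<open>The branch for s \<le> 0 gives the value 0 at 0, so that the composition with \<Gamma>
  vanishes at the origin, where \<Gamma> is 0.\<close>

definition min_profile :: "real \<Rightarrow> real" where "min_profile s = (if 0 < s then lim (\<lambda>n. approx n s) else k * s)"

lemma min_profile_measurable [measurable]: "min_profile \<in> borel_measurable borel"
  unfolding min_profile_def[abs_def] by measurable

lemma min_profile_lim: "0 < s \<Longrightarrow> (\<lambda>n. approx n s) \<longlonglongrightarrow> min_profile s"
  and min_profile_ge: "0 < s \<Longrightarrow> approx n s \<le> min_profile s"
  and min_profile_le: "0 < s \<Longrightarrow> min_profile s \<le> super_slope * s"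
proof -
  assume s: "0 < s"
  obtain L where L: "(\<lambda>n. approx n s) \<longlonglongrightarrow> L" "\<And>n. approx n s \<le> L"
    using incseq_convergent[of "\<lambda>n. approx n s" "super_slope * s"] approx_mono[of s] approx_b(2)[OF s] s
    by (metis incseq_SucI less_imp_le)
  then have e: "min_profile s = L" using s by (simp add: min_profile_def limI)
  show "(\<lambda>n. approx n s) \<longlonglongrightarrow> min_profile s" "approx n s \<le> min_profile s" using L e by auto
  show "min_profile s \<le> super_slope * s" unfolding e by (rule LIMSEQ_le_const2[OF L(1)]) (use approx_b(2)[OF s] in auto)
qed

lemma min_profile_0: "0 < s \<Longrightarrow> k * s \<le> min_profile s" using min_profile_ge[of s 0] by (simp add: approx_0)

lemma min_profile_b: "0 < s \<Longrightarrow> 0 \<le> min_profile s" using min_profile_0[of s] k_pos mult_pos_pos[of k s] by linarith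

lemma min_profile_eq:
  assumes s: "0 < s" shows "min_profile s = integral_op min_profile s"
proof -
  have "(\<lambda>n. LINT t|lborel. min s t * (q t * approx n t powr p)) \<longlonglongrightarrow> (LINT t|lborel. min s t * (q t * min_profile t powr p))"
  proof (rule integral_dominated_convergence)
    show "integrable lborel (\<lambda>t. s * (super_slope powr p * (q t * t powr p)))" using q_int_p by simp
    show "AE t in lborel. (\<lambda>n. min s t * (q t * approx n t powr p)) \<longlonglongrightarrow> min s t * (q t * min_profile t powr p)"
    proof (intro always_eventually allI)
      fix t
      show "(\<lambda>n. min s t * (q t * approx n t powr p)) \<longlonglongrightarrow> min s t * (q t * min_profile t powr p)"
      proof (cases "t \<le> 0")
        case False
        then show ?thesis using p1 approx_b(1)[of t]
          by (intro tendsto_intros tendsto_powr2 min_profile_lim) auto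
      qed (simp add: q_zero)
    qed
    show "AE t in lborel. norm (min s t * (q t * approx n t powr p)) \<le> s * (super_slope powr p * (q t * t powr p))" for n
    proof (intro always_eventually allI)
      fix t
      show "norm (min s t * (q t * approx n t powr p)) \<le> s * (super_slope powr p * (q t * t powr p))"
      proof -
        have "0 \<le> min s t * (q t * approx n t powr p)"
          by (rule source_integrable(3)[of _ super_slope]) (use approx_b super_slope s in auto)
        moreover have "min s t * (q t * approx n t powr p) \<le> s * (super_slope powr p * (q t * t powr p))"
          by (rule source_integrable(4)) (use approx_b super_slope s in auto)
        ultimately show ?thesis by simp
      qed
    qed
  qed measurable
  then have "(\<lambda>n. approx (Suc n) s) \<longlonglongrightarrow> integral_op min_profile s"
    unfolding approx_Suc integral_op_def by (intro tendsto_intros)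
  with LIMSEQ_Suc[OF min_profile_lim[OF s]] show ?thesis by (rule LIMSEQ_unique)
qed

section \<open>The second profile by shooting\<close>

text \<open>Cutting \<open>q\<close> off at \<open>R\<close> confines the compactness argument for the maximizer to a bounded interval.\<close>

lemma zero_slope_parameter:
  obtains b0 w0 R where "0 < b0" "w0 \<in> borel_measurable borel" "0 < R"
    "\<And>s. 0 < s \<Longrightarrow> 0 \<le> w0 s"
    "\<And>s. 0 < s \<Longrightarrow> w0 s = (LINT t|lborel. min s t * ((if t \<le> R then q t else 0) * w0 t powr p))"
    "integrable lborel (\<lambda>t. (if t \<le> R then q t else 0) * w0 t powr p)"
    "b0 = (LINT t|lborel. (if t \<le> R then q t else 0) * w0 t powr p)"
proof -
  obtain t0 where t0: "0 < t0" "q t0 \<noteq> 0" using q_pos by blast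
  \<comment> \<open>Any R beyond a point with q \<noteq> 0 will do: by continuity the cut-off weight
    is then nonzero on an open set, and the variational problem is not trivial.\<close>
  define R where "R = t0 + 1"
  define qR where "qR t = (if t \<le> R then q t else 0)" for t
  have R: "0 < R" using t0 by (simp add: R_def)
  have bound: "integrable lborel (\<lambda>t. qR t * t powr a)" if "integrable lborel (\<lambda>t. q t * t powr a)" for a
  proof -
    have "(\<lambda>t. qR t * t powr a) = (\<lambda>t. if t \<le> R then q t * t powr a else 0)" by (auto simp: qR_def)
    then show ?thesis using integrable_if_pred[OF that, of "\<lambda>t. t \<le> R"] by simp
  qed
  have nt: "\<not> (AE t in lborel. qR t = 0)"
  proof
    assume ae: "AE t in lborel. qR t = 0"
    have "isCont q t0" using q_cont t0 by (simp add: continuous_on_eq_continuous_at)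
    then have "(q \<longlongrightarrow> q t0) (nhds t0)" by (simp add: isCont_def tendsto_at_iff_tendsto_nhds)
    then have "\<forall>\<^sub>F t in nhds t0. q t \<noteq> 0" using t0(2) by (rule tendsto_imp_eventually_ne)
    moreover have "\<forall>\<^sub>F t in nhds t0. t < R" by (rule order_tendstoD(2)[OF filterlim_ident]) (simp add: R_def)
    ultimately have "\<forall>\<^sub>F t in nhds t0. q t \<noteq> 0 \<and> t < R" by eventually_elim auto
    then obtain S where S: "open S" "t0 \<in> S" "\<And>t. t \<in> S \<Longrightarrow> q t \<noteq> 0 \<and> t < R" by (auto simp: eventually_nhds)
    have "AE t in lborel. t \<notin> S" using ae by eventually_elim (use S(3) in \<open>force simp: qR_def\<close>)
    then have "S \<in> null_sets lborel" using S(1) by (subst (asm) AE_iff_null) auto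
    then have "negligible S" by (simp add: negligible_iff_null_sets null_sets_completionI)
    then show False using S open_not_negligible by blast
  qed
  interpret sw: subcritical_weight qR p R
  proof
    show "qR \<in> borel_measurable borel" unfolding qR_def[abs_def] by measurable
  qed (use q_nonneg q_zero bound[OF q_int] nt p1 in \<open>auto simp: qR_def\<close>)
  obtain w where w: "w \<in> borel_measurable borel" "\<And>s. 0 < s \<Longrightarrow> 0 \<le> w s"
    "\<And>s. 0 < s \<Longrightarrow> w s = (LINT t|lborel. min s t * (qR t * w t powr p))"
    "integrable lborel (\<lambda>t. qR t * w t powr p)" "0 < (LINT t|lborel. qR t * w t powr p)"
    by (rule sw.zero_slope_solution[OF bound[OF q_int_p]]) (rule that)
  show ?thesis
    by (rule that[OF w(5) w(1) R w(2)]) (use w(3,4) in \<open>simp_all add: qR_def\<close>)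
qed

text \<open>The shooting uses the clipped equation, which is solvable for every b; so K is defined
  and Lipschitz before any solution is known to be positive. Positivity, and with it the removal of
  the clipping, comes afterwards, for the one b with K b = k.\<close>

lemma second_solution:
  obtains w b where "w \<in> borel_measurable borel" "0 < b" "\<And>s. 0 < s \<Longrightarrow> k * s \<le> w s" "\<And>s. 0 < s \<Longrightarrow> w s \<le> b * s"
    "\<And>s. 0 < s \<Longrightarrow> w s = integral_op w s" "w 0 = 0" "\<And>s. 0 < s \<Longrightarrow> min_profile s < w s"
proof -
  obtain b0 w0 R where b0: "0 < b0" and [measurable]: "w0 \<in> borel_measurable borel" and R: "0 < R"
    and w0n: "\<And>s. 0 < s \<Longrightarrow> 0 \<le> w0 s"
    and w0: "\<And>s. 0 < s \<Longrightarrow> w0 s = (LINT t|lborel. min s t * ((if t \<le> R then q t else 0) * w0 t powr p))"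
    and w0i: "integrable lborel (\<lambda>t. (if t \<le> R then q t else 0) * w0 t powr p)"
    and b0eq: "b0 = (LINT t|lborel. (if t \<le> R then q t else 0) * w0 t powr p)"
    by (rule zero_slope_parameter) (rule that)
  define M where "M = max crit_slope b0"
  have M: "0 < M" "crit_slope \<le> M" "b0 \<le> M" using crit_slope_pos by (auto simp: M_def)
  let ?f = "\<lambda>t. q t * t powr p"
  have "\<exists>y. y \<in> borel_measurable borel \<and> (\<forall>s>0. y s = vt.volterra_op M b y s)" for b
    using vt.volterra_exists[OF M(1), of b] by blast
  then obtain Y where Ym[measurable]: "\<And>b. Y b \<in> borel_measurable borel" and Y: "\<And>b s. 0 < s \<Longrightarrow> Y b s = vt.volterra_op M b (Y b) s"
    by metis
  define c where "c b t = ?f t * vt.clip M (Y b t)" for b t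
  have cm[measurable]: "c b \<in> borel_measurable borel" for b unfolding c_def[abs_def] by measurable
  have ci: "integrable lborel (c b)" for b
    unfolding c_def[abs_def] by (rule vt.weighted_integrable[of _ "M powr p"]) (use vt.clip_bounded M in auto)
  have cn: "0 \<le> c b t" for b t using q_nonneg vt.clip_nonneg by (simp add: c_def)
  \<comment> \<open>w'(s) is b minus the mass of the source on (0,s], so this is the slope at
    infinity.\<close>
  define K where "K b = b - (LINT t|lborel. c b t)" for b
  have Yle: "Y b s \<le> b" if "0 < s" for b s using vt.volterra_op_bounds(1)[OF Ym M(1) that] Y[OF that] by simp
  have Kcont: "continuous_on S K" for S
  proof -
    define L where "L = p * M powr (p - 1)"
    have L0: "0 \<le> L" using p1 by (simp add: L_def)
    define E where "E = exp (2 * L * integral\<^sup>L lborel ?f)"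
    have d: "\<bar>K b - K b'\<bar> \<le> (1 + L * (2 * E) * mass) * \<bar>b - b'\<bar>" for b b'
    proof -
      have "\<bar>LINT t|lborel. c b t - c b' t\<bar> \<le> (LINT t|lborel. (L * (2 * \<bar>b - b'\<bar> * E)) * ?f t)"
      proof (rule integral_abs_bound_integral)
        fix t
        show "\<bar>c b t - c b' t\<bar> \<le> (L * (2 * \<bar>b - b'\<bar> * E)) * ?f t"
        proof (cases "t \<le> 0")
          case False
          then have t: "0 < t" by simp
          have "\<bar>Y b t - Y b' t\<bar> \<le> 2 * \<bar>b - b'\<bar> * exp (2 * L * vt.F t)"
            unfolding L_def by (rule vt.volterra_dependence[OF Ym Ym M(1) _ _ t order_refl]) (auto intro: Y)
          also have "\<dots> \<le> 2 * \<bar>b - b'\<bar> * E"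
            unfolding E_def using vt.F_le[of t] L0 by (intro mult_left_mono) (auto intro: mult_left_mono)
          finally have "\<bar>vt.clip M (Y b t) - vt.clip M (Y b' t)\<bar> \<le> L * (2 * \<bar>b - b'\<bar> * E)"
            using vt.clip_lipschitz[of M "Y b t" "Y b' t"] M L0 mult_left_mono[of "\<bar>Y b t - Y b' t\<bar>" "2 * \<bar>b - b'\<bar> * E" L]
            unfolding L_def[symmetric] by linarith
          then have "?f t * \<bar>vt.clip M (Y b t) - vt.clip M (Y b' t)\<bar> \<le> ?f t * (L * (2 * \<bar>b - b'\<bar> * E))"
            using q_nonneg by (intro mult_left_mono) auto
          moreover have "\<bar>c b t - c b' t\<bar> = ?f t * \<bar>vt.clip M (Y b t) - vt.clip M (Y b' t)\<bar>"
            using q_nonneg[of t] by (simp add: c_def abs_mult flip: right_diff_distrib)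
          ultimately show ?thesis by (simp add: mult_ac)
        qed (simp add: c_def q_zero)
      qed (use ci q_int_p in auto)
      also have "\<dots> = (L * (2 * \<bar>b - b'\<bar> * E)) * mass" unfolding mass_def by simp
      finally have "\<bar>(LINT t|lborel. c b t) - (LINT t|lborel. c b' t)\<bar> \<le> (L * (2 * \<bar>b - b'\<bar> * E)) * mass"
        using ci by simp
      then show ?thesis unfolding K_def by (simp add: algebra_simps)
    qed
    have "(1 + L * (2 * E) * mass)-lipschitz_on S K"
      by (rule lipschitz_onI) (use d L0 mass_nonneg in \<open>auto simp: dist_real_def E_def\<close>)
    then show ?thesis by (rule lipschitz_on_continuous_on)
  qed
  have Kge: "b - mass * b powr p \<le> K b" if b: "0 < b" "b \<le> M" for b
  proof -
    have "(LINT t|lborel. c b t) \<le> (LINT t|lborel. b powr p * ?f t)"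
    proof (rule integral_mono[OF ci])
      fix t show "c b t \<le> b powr p * ?f t"
      proof (cases "t \<le> 0")
        case False
        then have "vt.clip M (Y b t) \<le> b powr p"
          unfolding vt.clip_def using Yle[of t b] b p1 by (intro powr_mono2) auto
        then have "?f t * vt.clip M (Y b t) \<le> ?f t * b powr p" using q_nonneg[of t] by (intro mult_left_mono) auto
        then show ?thesis by (simp only: c_def mult.commute[of "b powr p"])
      qed (simp add: c_def q_zero)
    qed (use q_int_p in simp)
    then show ?thesis by (simp add: K_def mass_def mult.commute)
  qed
  \<comment> \<open>On \<open>(0,R]\<close> the solution with initial slope \<open>b0\<close> is the zero slope solution \<open>w0\<close>, whose source has mass \<open>b0\<close>.\<close>
  have K0: "K b0 \<le> 0"
  proof -
    define y0 where "y0 s = w0 s / s" for s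
    have [measurable]: "y0 \<in> borel_measurable borel" unfolding y0_def[abs_def] by measurable
    let ?qR = "\<lambda>t. if t \<le> R then q t else 0"
    have qn: "0 \<le> ?qR t * w0 t powr p" for t using q_nonneg by simp
    have mi: "integrable lborel (\<lambda>t. min s t * (?qR t * w0 t powr p))" if "0 < s" for s
    proof (rule Bochner_Integration.integrable_bound)
      show "integrable lborel (\<lambda>t. s * (?qR t * w0 t powr p))" using w0i by (rule integrable_mult_right)
      show "AE t in lborel. norm (min s t * (?qR t * w0 t powr p)) \<le> norm (s * (?qR t * w0 t powr p))"
      proof (intro always_eventually allI)
        fix t show "norm (min s t * (?qR t * w0 t powr p)) \<le> norm (s * (?qR t * w0 t powr p))"
          using that q_zero[of t] by (cases "t \<le> 0") (auto simp: abs_mult intro!: mult_right_mono)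
      qed
    qed measurable
    have w0le: "w0 s \<le> s * b0" if "0 < s" for s
    proof -
      have "(LINT t|lborel. min s t * (?qR t * w0 t powr p)) \<le> (LINT t|lborel. s * (?qR t * w0 t powr p))"
      proof (rule integral_mono[OF mi[OF that] integrable_mult_right[OF w0i]])
        fix t show "min s t * (?qR t * w0 t powr p) \<le> s * (?qR t * w0 t powr p)"
          using qn[of t] by (intro mult_right_mono) auto
      qed
      then show ?thesis using w0[OF that] b0eq by simp
    qed
    have y0b: "0 \<le> y0 s" "y0 s \<le> M" if "0 < s" for s
    proof -
      show "0 \<le> y0 s" using w0n[OF that] that by (simp add: y0_def)
      have "y0 s \<le> b0" using w0le[OF that] that by (simp add: y0_def divide_le_eq mult.commute)
      then show "y0 s \<le> M" using M by simp
    qed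
    have cl: "?f t * vt.clip M (y0 t) = q t * w0 t powr p" if "0 < t" for t
    proof -
      have "vt.clip M (y0 t) = y0 t powr p" unfolding vt.clip_def using y0b[OF that] by simp
      moreover have "t powr p * y0 t powr p = w0 t powr p"
        using that w0n[OF that] by (simp add: y0_def powr_divide)
      ultimately show ?thesis by (simp add: mult.assoc)
    qed
    have y0eq: "y0 s = vt.volterra_op M b0 y0 s" if s: "0 < s" "s \<le> R" for s
    proof -
      have e: "max 0 (1 - t / s) * ?f t * vt.clip M (y0 t) = (?qR t * w0 t powr p) - (min s t * (?qR t * w0 t powr p)) / s" for t
      proof -
        consider "t \<le> 0" | "0 < t" "t \<le> s" | "s < t" by linarith
        then show ?thesis
        proof cases
          case 2
          then have "max 0 (1 - t / s) = 1 - t / s" "t \<le> R" "min s t = t" using s by auto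
          moreover have "max 0 (1 - t / s) * ?f t * vt.clip M (y0 t) = max 0 (1 - t / s) * (q t * w0 t powr p)"
            unfolding cl[OF 2(1), symmetric] by (simp only: mult.assoc)
          ultimately show ?thesis using s by (simp add: algebra_simps)
        next
          case 3
          then have "max 0 (1 - t / s) = 0" using s by simp
          then show ?thesis using 3 s by simp
        qed (simp add: q_zero)
      qed
      have "vt.volterra_op M b0 y0 s = b0 - (LINT t|lborel. (?qR t * w0 t powr p) - (min s t * (?qR t * w0 t powr p)) / s)"
        unfolding vt.volterra_op_def e ..
      also have "\<dots> = b0 - (b0 - w0 s / s)"
        using w0i mi[OF s(1)] by (subst Bochner_Integration.integral_diff) (simp_all only: integrable_divide_zero
            integral_divide_zero flip: b0eq w0[OF s(1)])
      finally show ?thesis by (simp add: y0_def)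
    qed
    have same: "Y b0 s = y0 s" if s: "0 < s" "s \<le> R" for s
    proof -
      have "\<bar>Y b0 s - y0 s\<bar> \<le> 2 * \<bar>b0 - b0\<bar> * exp (2 * (p * M powr (p - 1)) * vt.F s)"
        by (rule vt.volterra_dependence[OF Ym _ M(1) _ y0eq s]) (auto intro: Y)
      then show ?thesis by simp
    qed
    \<comment> \<open>Beyond R the cut-off source vanishes while \<open>c b0\<close> is nonnegative,
      so restoring the full weight can only lower the slope at infinity below the value 0 of the
      zero slope solution.\<close>
    have "b0 \<le> (LINT t|lborel. c b0 t)"
      unfolding b0eq
    proof (rule integral_mono[OF w0i ci])
      fix t
      consider "t \<le> 0" | "0 < t" "t \<le> R" | "R < t" by linarith
      then show "?qR t * w0 t powr p \<le> c (LINT t|lborel. ?qR t * w0 t powr p) t"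
        unfolding b0eq[symmetric]
      proof cases
        case 2
        have "c b0 t = ?qR t * w0 t powr p"
          unfolding c_def same[OF 2] cl[OF 2(1)] using 2 by simp
        then show "?qR t * w0 t powr p \<le> c b0 t" by simp
      qed (use cn in \<open>auto simp: q_zero c_def\<close>)
    qed
    then show ?thesis by (simp add: K_def)
  qed
  \<comment> \<open>The lower bound for K is positive on (0,\<open>crit_slope\<close>] by
    \<open>mass_less\<close>, whereas K b0 \<le> 0.\<close>
  have bsb0: "crit_slope < b0"
  proof (rule ccontr)
    assume "\<not> crit_slope < b0"
    then show False using mass_less[OF b0] Kge[OF b0 M(3)] K0 by simp
  qed
  have "\<exists>b\<ge>crit_slope. b \<le> b0 \<and> K b = k"
    using IVT2'[of K b0 k crit_slope] Kcont K0 k_pos Kge[OF crit_slope_pos M(2)] k_less bsb0 by (auto simp: mass_def)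
  then obtain b where b: "crit_slope \<le> b" "b \<le> b0" "K b = k" by blast
  have bM: "0 < b" "b \<le> M" using b crit_slope_pos M by auto
  have bk: "b = k + (LINT t|lborel. c b t)" using b(3) by (simp add: K_def)
  define w where "w s = (if 0 < s then s * Y b s else 0)" for s
  have [measurable]: "w \<in> borel_measurable borel" unfolding w_def[abs_def] by measurable
  have mic: "integrable lborel (\<lambda>t. min s t * c b t)" if "0 < s" for s
  proof (rule Bochner_Integration.integrable_bound)
    show "integrable lborel (\<lambda>t. s * c b t)" using ci by (rule integrable_mult_right)
    show "AE t in lborel. norm (min s t * c b t) \<le> norm (s * c b t)"
    proof (intro always_eventually allI)
      fix t show "norm (min s t * c b t) \<le> norm (s * c b t)"
        using that q_zero[of t] by (cases "t \<le> 0") (auto simp: abs_mult c_def intro!: mult_right_mono)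
    qed
  qed measurable
  \<comment> \<open>For s, t > 0 the kernel (1 - t/s)^+ equals 1 - min s t / s, and b = k +
    \<integral> c. So the equation with prescribed slope b at 0 turns into the one with prescribed
    slope k at infinity, still with the clipped source.\<close>
  have w1: "w s = k * s + (LINT t|lborel. min s t * c b t)" if s: "0 < s" for s
  proof -
    have e: "max 0 (1 - t / s) * ?f t * vt.clip M (Y b t) = c b t - (min s t * c b t) / s" for t
    proof -
      consider "t \<le> 0" | "0 < t" "t \<le> s" | "s < t" by linarith
      then show ?thesis
      proof cases
        case 2
        then have "max 0 (1 - t / s) = 1 - t / s" "min s t = t" using s by auto
        then show ?thesis using s by (simp add: c_def algebra_simps)
      next
        case 3
        then have "max 0 (1 - t / s) = 0" using s by simp
        then show ?thesis using 3 s by simp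
      qed (simp add: q_zero c_def)
    qed
    have "Y b s = b - (LINT t|lborel. c b t - (min s t * c b t) / s)"
      unfolding Y[OF s] vt.volterra_op_def e ..
    also have "\<dots> = b - ((LINT t|lborel. c b t) - (LINT t|lborel. min s t * c b t) / s)"
      using ci mic[OF s] by (subst Bochner_Integration.integral_diff) auto
    also have "\<dots> = k + (LINT t|lborel. min s t * c b t) / s" using bk by simp
    finally show ?thesis using s by (simp add: w_def algebra_simps)
  qed
  \<comment> \<open>Positivity comes from k > 0: the clipped source is nonnegative, so w \<ge> k s.
    Hence the clipping at 0 is inactive, as the one at M is by y \<le> b \<le> M.\<close>
  have wk: "k * s \<le> w s" if "0 < s" for s
  proof -
    have "0 \<le> min s t * c b t" for t using cn[of b t] that by (cases "t \<le> 0") (auto simp: c_def q_zero)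
    then have "0 \<le> (LINT t|lborel. min s t * c b t)" by (intro integral_nonneg_AE) auto
    then show ?thesis using w1[OF that] by simp
  qed
  have wpos: "0 \<le> w s" if "0 < s" for s using wk[OF that] mult_pos_pos[OF k_pos that] by linarith
  have wb: "w s \<le> b * s" if "0 < s" for s using Yle[OF that, of b] that by (simp add: w_def mult.commute)
  have cw: "c b t = q t * w t powr p" for t
  proof (cases "t \<le> 0")
    case False
    then have t: "0 < t" by simp
    have Yp: "0 \<le> Y b t" using wpos[OF t] t by (simp add: w_def zero_le_mult_iff)
    then have "vt.clip M (Y b t) = Y b t powr p" unfolding vt.clip_def using Yle[OF t, of b] bM by simp
    then show ?thesis using t Yp by (simp add: c_def w_def powr_mult)
  qed (simp add: c_def q_zero)
  have wT: "w s = integral_op w s" if "0 < s" for s using w1[OF that] by (simp add: integral_op_def cw)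
  have aw: "approx n s \<le> w s" if "0 < s" for n s
    using that
  proof (induction n arbitrary: s)
    case (Suc n)
    have "integral_op (approx n) s \<le> integral_op w s"
      by (rule integral_op_mono[of _ _ b]) (use Suc wb approx_b bM in auto)
    then show ?case using wT[OF Suc.prems] by (simp add: approx_Suc)
  qed (simp add: approx_0 wk)
  have vw: "min_profile s \<le> w s" if "0 < s" for s
    by (rule LIMSEQ_le_const2[OF min_profile_lim[OF that]]) (use aw[OF that] in auto)
  \<comment> \<open>The difference of w and \<open>min_profile\<close> is nondecreasing, because the
    kernel increases with s and the difference of the sources is nonnegative. If it vanished at s it
    would vanish on (0,s], and w(x)/x would stay below \<open>super_slope\<close> there; but w(x)/x
    tends to b \<ge> \<open>crit_slope\<close> at 0.\<close>
  have strict: "min_profile s < w s" if s: "0 < s" for s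
  proof (rule ccontr)
    assume "\<not> min_profile s < w s"
    then have eq: "w s - min_profile s = 0" using vw[OF s] by simp
    have vb: "min_profile t \<le> b * t" if "0 < t" for t using vw[OF that] wb[OF that] by simp
    have diff: "w x - min_profile x =
        (LINT t|lborel. min x t * (q t * w t powr p) - min x t * (q t * min_profile t powr p))" if "0 < x" for x
      using wT[OF that] min_profile_eq[OF that] source_integrable(2)[OF _ wpos wb, of x] source_integrable(2)[OF _
          min_profile_b vb, of x] bM that
      by (simp add: integral_op_def)
    have mono: "w x - min_profile x \<le> w s - min_profile s" if x: "0 < x" "x \<le> s" for x
      unfolding diff[OF x(1)] diff[OF s]
    proof (rule integral_mono)
      show "integrable lborel (\<lambda>t. min x t * (q t * w t powr p) - min x t * (q t * min_profile t powr p))"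
        "integrable lborel (\<lambda>t. min s t * (q t * w t powr p) - min s t * (q t * min_profile t powr p))"
        using source_integrable(2)[OF _ wpos wb] source_integrable(2)[OF _ min_profile_b vb] bM x s by auto
      fix t
      show "min x t * (q t * w t powr p) - min x t * (q t * min_profile t powr p) \<le>
          min s t * (q t * w t powr p) - min s t * (q t * min_profile t powr p)"
      proof (cases "t \<le> 0")
        case False
        then have "q t * min_profile t powr p \<le> q t * w t powr p" using vw min_profile_b p1 q_nonneg
            by (intro mult_left_mono powr_mono2) auto
        then have "min x t * (q t * w t powr p - q t * min_profile t powr p) \<le>
            min s t * (q t * w t powr p - q t * min_profile t powr p)"
          using x by (intro mult_right_mono) auto
        then show ?thesis by (simp add: right_diff_distrib)
      qed (simp add: q_zero)
    qed
    have same: "w x = min_profile x" if "0 < x" "x \<le> s" for x using mono[OF that] vw[OF that(1)] eq by simp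
    have Yl: "Y b x \<le> super_slope" if "0 < x" "x \<le> s" for x
    proof -
      have "x * Y b x \<le> x * super_slope" using same[OF that] min_profile_le[OF that(1)] that by (simp add: w_def mult.commute)
      then show ?thesis using that(1) by (rule mult_left_le_imp_le)
    qed
    define x where "x n = s / (real n + 1)" for n
    have xs: "0 < x n" "x n \<le> s" for n using s by (auto simp: x_def divide_le_eq)
    have x0: "x \<longlonglongrightarrow> 0" unfolding x_def[abs_def] by real_asymp
    have "(\<lambda>n. LINT t|lborel. max 0 (1 - t / x n) * ?f t * vt.clip M (Y b t)) \<longlonglongrightarrow> (LINT t|(lborel::real measure). 0)"
    proof (rule integral_dominated_convergence)
      show "integrable lborel (c b)" by (rule ci)
      show "AE t in lborel. (\<lambda>n. max 0 (1 - t / x n) * ?f t * vt.clip M (Y b t)) \<longlonglongrightarrow> 0"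
      proof (intro always_eventually allI)
        fix t
        show "(\<lambda>n. max 0 (1 - t / x n) * ?f t * vt.clip M (Y b t)) \<longlonglongrightarrow> 0"
        proof (cases "t \<le> 0")
          case False
          then have "\<forall>\<^sub>F n in sequentially. x n < t" using x0 by (intro order_tendstoD) auto
          then have "\<forall>\<^sub>F n in sequentially. max 0 (1 - t / x n) * ?f t * vt.clip M (Y b t) = 0"
            by eventually_elim (use xs in simp)
          then show ?thesis by (rule tendsto_eventually)
        qed (simp add: q_zero)
      qed
      show "AE t in lborel. norm (max 0 (1 - t / x n) * ?f t * vt.clip M (Y b t)) \<le> c b t" for n
      proof (intro always_eventually allI)
        fix t
        show "norm (max 0 (1 - t / x n) * ?f t * vt.clip M (Y b t)) \<le> c b t"
        proof (cases "t \<le> 0")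
          case False
          then have "max 0 (1 - t / x n) \<le> 1" using xs[of n] by simp
          then have "max 0 (1 - t / x n) * c b t \<le> 1 * c b t" using cn by (intro mult_right_mono) auto
          moreover have "0 \<le> max 0 (1 - t / x n) * c b t" using cn by simp
          ultimately show ?thesis unfolding c_def by (simp add: mult.assoc)
        qed (simp add: q_zero c_def)
      qed
    qed measurable
    then have "(\<lambda>n. b - (LINT t|lborel. max 0 (1 - t / x n) * ?f t * vt.clip M (Y b t))) \<longlonglongrightarrow> b - 0"
      by (intro tendsto_intros) simp
    then have "(\<lambda>n. Y b (x n)) \<longlonglongrightarrow> b" using Y[OF xs(1)] by (simp add: vt.volterra_op_def)
    then have "b \<le> super_slope" by (rule LIMSEQ_le_const2) (use Yl xs in auto)
    then show False using super_slope b by simp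
  qed
  have wm: "w \<in> borel_measurable borel" and w0: "w 0 = 0" by measurable (simp add: w_def)
  show ?thesis by (rule that[OF wm bM(1) wk wb wT w0 strict])
qed

end

section \<open>Lipschitz functions and integration by parts\<close>

text \<open>After adding a linear term f becomes an increasing bi-Lipschitz bijection g. The measure
  with distribution function g is absolutely continuous, and the Lebesgue differentiation theorem,
  applied to its Radon-Nikodym density, gives the one-sided derivatives of g.\<close>

lemma right_differentiable_ae_of_lipschitz:
  fixes f :: "real \<Rightarrow> real"
  assumes lip: "L-lipschitz_on UNIV f"
  obtains h N where "negligible N" "\<And>x. x \<notin> N \<Longrightarrow> (f has_real_derivative h x) (at_right x)"
    "\<And>x. x \<notin> N \<Longrightarrow> (f has_real_derivative h x) (at_left x)"
proof -
  have L: "0 \<le> L" using lipschitz_on_nonneg[OF lip] .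
  have lip': "\<bar>f x - f y\<bar> \<le> L * \<bar>x - y\<bar>" for x y
    using lipschitz_onD[OF lip, of x y] by (simp add: dist_real_def)
  \<comment> \<open>The slope L + 1 forces g y - g x \<ge> y - x for x \<le> y, so g is a bijection
    of the line.\<close>
  define g where "g x = f x + (L + 1) * x" for x
  have g_incr: "y - x \<le> g y - g x" if "x \<le> y" for x y
  proof -
    have "f x - f y \<le> L * (y - x)" using lip'[of x y] that by (simp add: abs_minus_commute)
    then show ?thesis by (simp add: g_def algebra_simps)
  qed
  have g_lip: "g y - g x \<le> (2 * L + 1) * (y - x)" if "x \<le> y" for x y
  proof -
    have "f y - f x \<le> L * (y - x)" using lip'[of x y] that by (simp add: abs_minus_commute)
    then show ?thesis by (simp add: g_def algebra_simps)
  qed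
  have f_cont: "continuous_on UNIV f" using lip by (rule lipschitz_on_continuous_on)
  have g_cont: "continuous_on UNIV g" unfolding g_def by (intro continuous_intros f_cont)
  have g_mono: "g x < g y \<longleftrightarrow> x < y" for x y using g_incr[of x y] g_incr[of y x] by (cases "x < y") auto
  have g_mono_le: "g x \<le> g y \<longleftrightarrow> x \<le> y" for x y using g_mono[of y x] by auto
  have inj: "inj g" by (rule injI) (metis g_mono not_less_iff_gr_or_eq)
  have surj: "surj g"
    unfolding surj_def
  proof
    fix z
    define r where "r = \<bar>z - g 0\<bar>"
    have "g (- r) \<le> z" "z \<le> g r" using g_incr[of "-r" 0] g_incr[of 0 r] by (auto simp: r_def)
    then show "\<exists>x. z = g x"
      using IVT'[of g "-r" z r] continuous_on_subset[OF g_cont] by (auto simp: r_def)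
  qed
  define k where "k = inv g"
  have gk[simp]: "g (k x) = x" for x using surj by (simp add: k_def surj_f_inv_f)
  have kg[simp]: "k (g x) = x" for x using inj by (simp add: k_def)
  have k_le: "k x \<le> y \<longleftrightarrow> x \<le> g y" for x y using g_mono_le[of "k x" y] by simp
  have k_meas[measurable]: "k \<in> borel_measurable borel"
    by (rule borel_measurable_mono) (auto simp: mono_def k_le)
  \<comment> \<open>Pushing Lebesgue measure forward by the inverse of g gives the interval (a,b]
    the mass g b - g a.\<close>
  define \<nu> where "\<nu> = distr lborel borel k"
  have \<nu>: "emeasure \<nu> {a<..b} = ennreal (g b - g a)" if "a \<le> b" for a b
  proof -
    have "k -` {a<..b} = {g a<..g b}" using k_le by (auto simp: not_le[symmetric])
    then show ?thesis using that g_mono_le[of a b] by (simp add: \<nu>_def emeasure_distr)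
  qed
  \<comment> \<open>Preimages under the inverse are images under g, and a Lipschitz map of the line
    sends null sets to null sets.\<close>
  have ac: "absolutely_continuous lborel \<nu>"
    unfolding absolutely_continuous_def
  proof
    fix A :: "real set" assume A: "A \<in> null_sets lborel"
    then have [measurable]: "A \<in> sets borel" by auto
    have "negligible A" using A by (simp add: negligible_iff_null_sets null_sets_completionI)
    then have "negligible (g ` A)"
    proof (rule negligible_locally_Lipschitz_image[rotated])
      fix x
      show "\<exists>T B. open T \<and> x \<in> T \<and> (\<forall>y\<in>A \<inter> T. norm (g y - g x) \<le> B * norm (y - x))"
      proof (intro exI conjI ballI)
        fix y
        have "norm (f y - f x) \<le> L * norm (y - x)" using lip'[of y x] by simp
        moreover have "g y - g x = (f y - f x) + (L + 1) * (y - x)" by (simp add: g_def algebra_simps)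
        then have "norm (g y - g x) \<le> norm (f y - f x) + (L + 1) * norm (y - x)"
          using norm_triangle_ineq[of "f y - f x" "(L+1) * (y - x)"] L by (simp add: abs_mult)
        ultimately show "norm (g y - g x) \<le> (2 * L + 1) * norm (y - x)" by (simp add: algebra_simps)
      qed (rule open_UNIV, simp)
    qed simp
    moreover have "k -` A = g ` A" by (auto simp: image_iff) (metis gk)
    moreover have "k -` A \<in> sets borel" using measurable_sets[OF k_meas, of A] by simp
    ultimately have "emeasure lborel (k -` A) = 0"
      by (simp add: negligible_iff_null_sets null_sets_completion_iff null_setsD1)
    then show "A \<in> null_sets \<nu>" by (simp add: \<nu>_def null_sets_def emeasure_distr)
  qed
  obtain d where d[measurable]: "d \<in> borel_measurable lborel" and dd: "density lborel d = \<nu>"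
    using sigma_finite_measure.Radon_Nikodym[OF sigma_finite_lborel ac] by (auto simp: \<nu>_def)
  define h where "h x = enn2real (d x)" for x
  have h_meas[measurable]: "h \<in> borel_measurable borel" unfolding h_def by measurable
  have dint: "(\<integral>\<^sup>+x\<in>{a<..b}. d x \<partial>lborel) = ennreal (g b - g a)" if "a \<le> b" for a b
    using \<nu>[OF that] unfolding dd[symmetric] by (subst (asm) emeasure_density) auto
  have "AE x in lborel. d x < \<infinity>"
  proof -
    have "AE x in lborel. x \<in> {- real n<..real n} \<longrightarrow> d x \<noteq> \<infinity>" for n :: nat
    proof -
      have "AE x in lborel. d x * indicator {- real n<..real n} x \<noteq> \<infinity>"
        by (rule nn_integral_PInf_AE) (use dint[of "- real n" "real n"] in auto)
      then show ?thesis by eventually_elim auto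
    qed
    then have "AE x in lborel. \<forall>n::nat. x \<in> {- real n<..real n} \<longrightarrow> d x \<noteq> \<infinity>"
      unfolding AE_all_countable by blast
    then show ?thesis
    proof eventually_elim
      case (elim x)
      obtain n :: nat where "\<bar>x\<bar> < real n" using reals_Archimedean2 by blast
      then have "x \<in> {- real n<..real n}" by auto
      then show ?case using elim by (auto simp: less_top)
    qed
  qed
  then have hd: "AE x in lborel. ennreal (h x) = d x" by eventually_elim (simp add: h_def)
  have hint: "(h has_integral (g b - g a)) {a..b}" if "a \<le> b" for a b
    unfolding has_integral_restrict_UNIV[of "{a..b}" h, symmetric]
  proof (subst has_integral_iff_nn_integral_lebesgue)
    have "(\<integral>\<^sup>+x. ennreal (if x \<in> {a..b} then h x else 0) \<partial>lborel) = (\<integral>\<^sup>+x\<in>{a<..b}. d x \<partial>lborel)"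
    proof (rule nn_integral_cong_AE)
      have "AE x in lborel. x \<noteq> a" by (rule AE_lborel_singleton)
      with hd show "AE x in lborel. ennreal (if x \<in> {a..b} then h x else 0) = d x * indicator {a<..b} x"
        by eventually_elim (auto simp: indicator_def)
    qed
    then show "(\<lambda>x. if x \<in> {a..b} then h x else 0) \<in> lebesgue \<rightarrow>\<^sub>M borel \<and>
      (\<integral>\<^sup>+x. ennreal (if x \<in> {a..b} then h x else 0) \<partial>lebesgue) = ennreal (g b - g a) \<and> 0 \<le> g b - g a"
      using dint[OF that] that g_mono_le[of a b] by (auto simp: nn_integral_completion intro!: measurable_completion)
  qed (auto simp: h_def)
  have gi: "integral {a..b} h = g b - g a" "h integrable_on {a..b}" if "a \<le> b" for a b
    using hint[OF that] by (auto simp: integral_unique)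
  have h_ii: "h integrable_on cbox a b" for a b :: real
    by (cases "a \<le> b") (use gi in auto)
  obtain N1 where N1: "negligible N1" "\<And>x e. x \<notin> N1 \<Longrightarrow> 0 < e \<Longrightarrow> \<exists>d>0. \<forall>r. 0 < r \<and> r < d \<longrightarrow>
      norm (integral (cbox x (x + r *\<^sub>R One)) h /\<^sub>R r ^ DIM(real) - h x) < e"
    using integrable_ccontinuous_explicit[of h] h_ii by metis
  \<comment> \<open>The differentiation theorem in use averages over intervals with left end x;
    averages to the left of x are obtained from the reflected density.\<close>
  define hm where "hm x = h (- x)" for x
  have hm_ii: "hm integrable_on cbox a b" for a b :: real
    unfolding hm_def[abs_def] using h_ii[of "-b" "-a"] Henstock_Kurzweil_Integration.integrable_reflect_real[of h "-a"
        "-b"] by simp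
  obtain N2 where N2: "negligible N2" "\<And>x e. x \<notin> N2 \<Longrightarrow> 0 < e \<Longrightarrow> \<exists>d>0. \<forall>r. 0 < r \<and> r < d \<longrightarrow>
      norm (integral (cbox x (x + r *\<^sub>R One)) hm /\<^sub>R r ^ DIM(real) - hm x) < e"
    using integrable_ccontinuous_explicit[of hm] hm_ii by metis
  have R: "(g has_real_derivative h x) (at_right x)" if xN: "x \<notin> N1" for x
    unfolding has_field_derivative_iff
  proof (rule tendstoI)
    fix e :: real assume "0 < e"
    then obtain d where d: "d > 0" "\<And>r. 0 < r \<Longrightarrow> r < d \<Longrightarrow> \<bar>integral {x..x + r} h / r - h x\<bar> < e"
      using N1(2)[OF xN \<open>0 < e\<close>] by (auto simp: divide_inverse mult.commute)
    show "\<forall>\<^sub>F y in at_right x. dist ((g y - g x) / (y - x)) (h x) < e"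
      unfolding eventually_at
    proof (intro exI[of _ d] conjI ballI impI)
      fix y assume "y \<in> {x<..}" "y \<noteq> x \<and> dist y x < d"
      then show "dist ((g y - g x) / (y - x)) (h x) < e"
        using d(2)[of "y - x"] gi(1)[of x y] by (auto simp: dist_real_def)
    qed (use d in auto)
  qed
  have Lf: "(g has_real_derivative h x) (at_left x)" if "x \<notin> uminus ` N2" for x
    unfolding has_field_derivative_iff
  proof (rule tendstoI)
    fix e :: real assume "0 < e"
    have "- x \<notin> N2" using that by force
    then obtain d where d: "d > 0" "\<And>r. 0 < r \<Longrightarrow> r < d \<Longrightarrow> \<bar>integral {-x..-x + r} hm / r - hm (-x)\<bar> < e"
      using N2(2)[of "-x", OF _ \<open>0 < e\<close>] by (auto simp: divide_inverse mult.commute)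
    have im: "integral {-x..-x+r} hm = g x - g (x - r)" if "0 < r" for r
    proof -
      have "integral {-x..-(x-r)} hm = integral {x-r..x} h"
        unfolding hm_def[abs_def] by (rule Henstock_Kurzweil_Integration.integral_reflect_real)
      then show ?thesis using gi(1)[of "x - r" x] that by simp
    qed
    show "\<forall>\<^sub>F y in at_left x. dist ((g y - g x) / (y - x)) (h x) < e"
      unfolding eventually_at
    proof (intro exI[of _ d] conjI ballI impI)
      fix y assume y: "y \<in> {..<x}" "y \<noteq> x \<and> dist y x < d"
      have "(g y - g x) / (y - x) = (g x - g y) / (x - y)"
        by (metis minus_diff_eq minus_divide_divide)
      then show "dist ((g y - g x) / (y - x)) (h x) < e"
        using d(2)[of "x - y"] im[of "x - y"] y by (auto simp: dist_real_def hm_def)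
    qed (use d in auto)
  qed
  have f_eq: "f = (\<lambda>x. g x - (L + 1) * x)" by (auto simp: g_def)
  show ?thesis
  proof (rule that[of "N1 \<union> uminus ` N2" "\<lambda>x. h x - (L + 1)"])
    have "negligible (uminus ` N2)"
      by (intro negligible_differentiable_image_negligible[OF order_refl N2(1)])
         (auto simp: differentiable_on_def intro!: derivative_intros)
    then show "negligible (N1 \<union> uminus ` N2)" using N1(1) by (rule negligible_Un[rotated])
    fix x assume x: "x \<notin> N1 \<union> uminus ` N2"
    show "(f has_real_derivative h x - (L + 1)) (at_right x)"
      unfolding f_eq using x by (auto intro!: derivative_eq_intros R)
    show "(f has_real_derivative h x - (L + 1)) (at_left x)"
      unfolding f_eq using x by (auto intro!: derivative_eq_intros Lf)
  qed
qed

lemma lipschitz_imp_ae_differentiable: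
  fixes f :: "real \<Rightarrow> real"
  assumes "L-lipschitz_on UNIV f"
  shows "negligible {x. \<not> f differentiable at x}"
proof -
  obtain h N where N: "negligible N" "\<And>x. x \<notin> N \<Longrightarrow> (f has_real_derivative h x) (at_right x)"
    "\<And>x. x \<notin> N \<Longrightarrow> (f has_real_derivative h x) (at_left x)"
    by (rule right_differentiable_ae_of_lipschitz[OF assms]) (rule that)
  have "(f has_real_derivative h x) (at x)" if "x \<notin> N" for x
    using N(2,3)[OF that] unfolding has_field_derivative_iff by (rule filterlim_split_at_real[rotated])
  then have "{x. \<not> f differentiable at x} \<subseteq> N" by (auto simp: real_differentiable_def)
  then show ?thesis using N(1) negligible_subset by blast
qed

section \<open>Directional derivatives of Lipschitz functions\<close>

lemma lborel_distr_translation: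
  fixes c :: "'a::euclidean_space"
  shows "distr lborel borel (\<lambda>x. x + c) = lborel"
proof -
  have "(\<lambda>x. x + c) = (+) c" by (auto simp: add.commute)
  then show ?thesis using lborel_distr_plus[of c] by simp
qed

text \<open>Fubini without coordinates: the pairs (x,t) with x + t e in D form a null set, so some
  single t is good for almost every x, and translation by t e preserves the measure.\<close>

lemma negligible_lines_imp_AE:
  fixes D :: "'a::euclidean_space set" and e :: 'a
  assumes [measurable]: "D \<in> sets borel"
    and sl: "\<And>x. negligible {t::real. x + t *\<^sub>R e \<in> D}"
  shows "AE x in lborel. x \<notin> D"
proof -
  have "AE x in lborel. AE t in lborel. x + t *\<^sub>R e \<notin> D"
  proof (rule always_eventually, rule allI)
    fix x :: 'a
    have "{t. x + t *\<^sub>R e \<in> D} \<in> sets borel" by measurable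
    then have "{t. x + t *\<^sub>R e \<in> D} \<in> null_sets lborel"
      using sl[of x] by (simp add: negligible_iff_null_sets null_sets_completion_iff)
    then show "AE t in lborel. x + t *\<^sub>R e \<notin> D" by (rule AE_I') auto
  qed
  then have "AE t in lborel. AE x in lborel. x + t *\<^sub>R e \<notin> D"
    by (subst (asm) lborel_pair.AE_commute) measurable
  then have "\<exists>t. AE x in lborel. x + t *\<^sub>R e \<notin> D"
  proof (rule contrapos_pp)
    assume "\<nexists>t. AE x in lborel. x + t *\<^sub>R e \<notin> D"
    moreover have "\<not> (AE t::real in lborel. False)"
      by (subst AE_iff_null) (auto simp: null_sets_def)
    ultimately show "\<not> (AE t in lborel. AE x in lborel. x + t *\<^sub>R e \<notin> D)" by simp
  qed
  then obtain t where t: "AE x in lborel. x + t *\<^sub>R e \<notin> D" by blast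
  have "AE x in distr lborel borel (\<lambda>x. x + t *\<^sub>R e). x \<notin> D"
    using t by (subst AE_distr_iff) auto
  then show ?thesis unfolding lborel_distr_translation .
qed

text \<open>Countably many conditions, so the points of differentiability form a measurable set.\<close>

lemma differentiable_at_0_iff_rat:
  fixes h :: "real \<Rightarrow> real"
  assumes cont: "continuous_on UNIV h"
  shows "h differentiable at 0 \<longleftrightarrow> (\<forall>n::nat. \<exists>m::nat. \<forall>r1 r2::rat.
     0 < \<bar>r1\<bar> \<and> \<bar>r1\<bar> * of_nat (Suc m) < 1 \<and> 0 < \<bar>r2\<bar> \<and> \<bar>r2\<bar> * of_nat (Suc m) < 1 \<longrightarrow>
     \<bar>(h (of_rat r1) - h 0) / of_rat r1 - (h (of_rat r2) - h 0) / of_rat r2\<bar> \<le> 1 / real (Suc n))"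
    (is "_ = (\<forall>n. \<exists>m. ?P n m)")
proof
  assume "h differentiable at 0"
  then obtain l where "(h has_real_derivative l) (at 0)" by (auto simp: real_differentiable_def)
  then have l: "((\<lambda>s. (h s - h 0) / s) \<longlongrightarrow> l) (at 0)" by (simp add: has_field_derivative_iff)
  show "\<forall>n. \<exists>m. ?P n m"
  proof
    fix n
    have "\<forall>\<^sub>F s in at 0. dist ((h s - h 0) / s) l < 1 / real (Suc n) / 2"
      using l by (rule tendstoD) simp
    then obtain d where d: "d > 0" "\<And>s. s \<noteq> 0 \<Longrightarrow> \<bar>s\<bar> < d \<Longrightarrow> \<bar>(h s - h 0) / s - l\<bar> < 1 / real (Suc n) / 2"
      by (auto simp: eventually_at dist_real_def)
    obtain m where m: "1 / real (Suc m) < d" using d(1) by (metis nat_approx_posE)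
    have "?P n m"
    proof (intro allI impI)
      fix r1 r2 :: rat
      assume r: "0 < \<bar>r1\<bar> \<and> \<bar>r1\<bar> * of_nat (Suc m) < 1 \<and> 0 < \<bar>r2\<bar> \<and> \<bar>r2\<bar> * of_nat (Suc m) < 1"
      have *: "\<bar>of_rat x :: real\<bar> < d" if "\<bar>x\<bar> * of_nat (Suc m) < 1" for x :: rat
      proof -
        have "of_rat (\<bar>x\<bar> * of_nat (Suc m)) < (1::real)" using that by simp
        then have "\<bar>of_rat x :: real\<bar> * real (Suc m) < 1" by (simp only: of_rat_mult of_rat_of_nat_eq abs_of_rat)
        then have "\<bar>of_rat x :: real\<bar> < 1 / real (Suc m)" by (simp add: field_simps)
        then show ?thesis using m by linarith
      qed
      show "\<bar>(h (of_rat r1) - h 0) / of_rat r1 - (h (of_rat r2) - h 0) / of_rat r2\<bar> \<le> 1 / real (Suc n)"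
      proof -
        have tri: "\<bar>a - b\<bar> \<le> e" if "\<bar>a - l\<bar> < e / 2" "\<bar>b - l\<bar> < e / 2" for a b e :: real
          using that by linarith
        have z: "of_rat r1 \<noteq> (0::real)" "of_rat r2 \<noteq> (0::real)" using r by auto
        show ?thesis
          using d(2)[OF z(1) *[OF r[THEN conjunct2, THEN conjunct1]]]
            d(2)[OF z(2) *[OF r[THEN conjunct2, THEN conjunct2, THEN conjunct2]]] by (rule tri)
      qed
    qed
    then show "\<exists>m. ?P n m" by blast
  qed
next
  assume C: "\<forall>n. \<exists>m. ?P n m"
  define dq where "dq s = (h s - h 0) / s" for s
  have ext: "\<exists>m. \<forall>s1 s2. 0 < \<bar>s1\<bar> \<and> \<bar>s1\<bar> < 1 / real (Suc m) \<and> 0 < \<bar>s2\<bar> \<and> \<bar>s2\<bar> < 1 / real (Suc m) \<longrightarrow>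
      \<bar>dq s1 - dq s2\<bar> \<le> 1 / real (Suc n)" for n
  proof -
    obtain m where m: "?P n m" using C by blast
    have rs: "\<exists>x. (\<forall>k. 0 < \<bar>x k\<bar> \<and> \<bar>x k\<bar> * of_nat (Suc m) < 1) \<and> (\<lambda>k. dq (of_rat (x k))) \<longlonglongrightarrow> dq s"
      if s: "0 < \<bar>s\<bar>" "\<bar>s\<bar> < 1 / real (Suc m)" for s
    proof -
      \<comment> \<open>The interval (l,u) contains s and stays on one side of 0 and within distance
        1 / Suc m of it, so rationals taken from it satisfy the conditions of the criterion.\<close>
      define l u where "l = (if s > 0 then s / 2 else - 1 / real (Suc m))" and "u = (if s > 0 then 1 / real (Suc m) else s / 2)"
      have lu: "l < s" "s < u" using s by (auto simp: l_def u_def)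
      have "\<exists>r::rat. max l (s - 1 / real (Suc k)) < of_rat r \<and> of_rat r < min u (s + 1 / real (Suc k))" for k
      proof (rule of_rat_dense)
        have "0 < 1 / real (Suc k)" by simp
        then have "s - 1 / real (Suc k) < u" "l < s + 1 / real (Suc k)" "s - 1 / real (Suc k) < s + 1 / real (Suc k)" "l < u"
          using lu by linarith+
        then show "max l (s - 1 / real (Suc k)) < min u (s + 1 / real (Suc k))" by (simp del: of_nat_Suc)
      qed
      then obtain x :: "nat \<Rightarrow> rat" where x: "\<And>k. max l (s - 1 / real (Suc k)) < of_rat (x k)"
          "\<And>k. of_rat (x k) < min u (s + 1 / real (Suc k))" by metis
      have "(\<lambda>k. of_rat (x k)) \<longlonglongrightarrow> s"
      proof (rule tendsto_sandwich)
        show "(\<lambda>k. s - 1 / real (Suc k)) \<longlonglongrightarrow> s" "(\<lambda>k. s + 1 / real (Suc k)) \<longlonglongrightarrow> s" by real_asymp+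
      qed (use x in \<open>auto intro!: always_eventually less_imp_le\<close>)
      then have "(\<lambda>k. dq (of_rat (x k))) \<longlonglongrightarrow> dq s"
        unfolding dq_def using cont s
        by (intro tendsto_intros continuous_on_tendsto_compose[of UNIV h]) auto
      moreover have "0 < \<bar>x k\<bar> \<and> \<bar>x k\<bar> * of_nat (Suc m) < 1" for k
      proof -
        have gen: "0 < \<bar>y\<bar> \<and> \<bar>y\<bar> < 1 / real (Suc m)"
          if "max l (s - 1 / real (Suc k)) < y" "y < min u (s + 1 / real (Suc k))" for y
          using that s by (auto simp: l_def u_def split: if_splits)
        have a: "0 < \<bar>of_rat (x k) :: real\<bar>" "\<bar>of_rat (x k) :: real\<bar> < 1 / real (Suc m)"
          using gen[OF x] by blast+
        then have "\<bar>of_rat (x k) :: real\<bar> * real (Suc m) < 1" by (simp add: field_simps)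
        then have "of_rat (\<bar>x k\<bar> * of_nat (Suc m)) < (of_rat 1 :: real)"
          by (simp only: of_rat_mult of_rat_of_nat_eq abs_of_rat of_rat_1)
        then show ?thesis using a(1) unfolding of_rat_less by auto
      qed
      ultimately show ?thesis by blast
    qed
    have "\<bar>dq s1 - dq s2\<bar> \<le> 1 / real (Suc n)"
      if s1: "0 < \<bar>s1\<bar>" "\<bar>s1\<bar> < 1 / real (Suc m)" and s2: "0 < \<bar>s2\<bar>" "\<bar>s2\<bar> < 1 / real (Suc m)" for s1 s2
    proof -
      obtain x where x: "\<And>k. 0 < \<bar>x k\<bar> \<and> \<bar>x k\<bar> * of_nat (Suc m) < 1" "(\<lambda>k. dq (of_rat (x k))) \<longlonglongrightarrow> dq s1"
        using rs[OF s1] by blast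
      obtain y where y: "\<And>k. 0 < \<bar>y k\<bar> \<and> \<bar>y k\<bar> * of_nat (Suc m) < 1" "(\<lambda>k. dq (of_rat (y k))) \<longlonglongrightarrow> dq s2"
        using rs[OF s2] by blast
      have "(\<lambda>k. \<bar>dq (of_rat (x k)) - dq (of_rat (y k))\<bar>) \<longlonglongrightarrow> \<bar>dq s1 - dq s2\<bar>" by (intro tendsto_intros x y)
      then show ?thesis
        by (rule LIMSEQ_le_const2) (use m x(1) y(1) in \<open>auto simp: dq_def\<close>)
    qed
    then show ?thesis by blast
  qed
  define z where "z k = 1 / (real k + 2)" for k
  have z: "0 < \<bar>z k\<bar>" for k by (simp add: z_def)
  have zs: "\<bar>z k\<bar> < 1 / real (Suc m)" if "m \<le> k" for k m using that by (simp add: z_def field_simps)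
  have "Cauchy (\<lambda>k. dq (z k))"
  proof (rule metric_CauchyI)
    fix e :: real assume "0 < e"
    then obtain n where n: "1 / real (Suc n) < e" by (metis nat_approx_posE)
    obtain m where "\<And>s1 s2. 0 < \<bar>s1\<bar> \<and> \<bar>s1\<bar> < 1 / real (Suc m) \<and> 0 < \<bar>s2\<bar> \<and> \<bar>s2\<bar> < 1 / real (Suc m) \<Longrightarrow>
      \<bar>dq s1 - dq s2\<bar> \<le> 1 / real (Suc n)" using ext[of n] by blast
    then have "\<bar>dq (z i) - dq (z j)\<bar> \<le> 1 / real (Suc n)" if "m \<le> i" "m \<le> j" for i j
      using z zs that by blast
    then show "\<exists>M. \<forall>m\<ge>M. \<forall>n\<ge>M. dist (dq (z m)) (dq (z n)) < e"
      unfolding dist_real_def using le_less_trans[OF _ n] by blast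
  qed
  then obtain l where l: "(\<lambda>k. dq (z k)) \<longlonglongrightarrow> l" using Cauchy_convergent convergent_def by blast
  have "(dq \<longlongrightarrow> l) (at 0)"
  proof (rule tendstoI)
    fix e :: real assume "0 < e"
    then obtain n where n: "1 / real (Suc n) < e" by (metis nat_approx_posE)
    obtain m where m: "\<And>s1 s2. 0 < \<bar>s1\<bar> \<and> \<bar>s1\<bar> < 1 / real (Suc m) \<and> 0 < \<bar>s2\<bar> \<and> \<bar>s2\<bar> < 1 / real (Suc m) \<Longrightarrow>
      \<bar>dq s1 - dq s2\<bar> \<le> 1 / real (Suc n)" using ext[of n] by blast
    have "\<bar>dq s - l\<bar> \<le> 1 / real (Suc n)" if "s \<noteq> 0" "\<bar>s\<bar> < 1 / real (Suc m)" for s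
    proof (rule LIMSEQ_le_const2)
      show "(\<lambda>k. \<bar>dq s - dq (z k)\<bar>) \<longlonglongrightarrow> \<bar>dq s - l\<bar>" by (intro tendsto_intros l)
      show "\<exists>N. \<forall>k\<ge>N. \<bar>dq s - dq (z k)\<bar> \<le> 1 / real (Suc n)"
        using m[of s] z zs that by (intro exI[of _ m] allI impI) auto
    qed
    then show "\<forall>\<^sub>F s in at 0. dist (dq s) l < e"
      unfolding eventually_at
    proof (intro exI[of _ "1 / real (Suc m)"] conjI ballI impI)
      fix s :: real assume "s \<noteq> 0 \<and> dist s 0 < 1 / real (Suc m)"
      then have "\<bar>dq s - l\<bar> \<le> 1 / real (Suc n)"
        using \<open>\<And>s. s \<noteq> 0 \<Longrightarrow> \<bar>s\<bar> < 1 / real (Suc m) \<Longrightarrow> \<bar>dq s - l\<bar> \<le> 1 / real (Suc n)\<close> by (simp add: dist_real_def)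
      then show "dist (dq s) l < e" unfolding dist_real_def using le_less_trans[OF _ n] by blast
    qed simp
  qed
  then have "(h has_real_derivative l) (at 0)" by (simp add: has_field_derivative_iff dq_def[abs_def])
  then show "h differentiable at 0" by (auto simp: real_differentiable_def)
qed

text \<open>Almost everywhere differentiability on each line parallel to e, combined by Fubini. Only
  pure second derivatives of the test function enter the Laplacian, so one direction at a time is
  enough.\<close>

lemma lipschitz_imp_AE_directional:
  fixes f :: "'a::euclidean_space \<Rightarrow> real"
  assumes lip: "L-lipschitz_on UNIV f"
  shows "AE x in lborel. (\<lambda>t. f (x + t *\<^sub>R e)) differentiable at 0"
proof -
  have fc: "continuous_on UNIV f" using lip by (rule lipschitz_on_continuous_on)
  then have [measurable]: "f \<in> borel_measurable borel" by (rule borel_measurable_continuous_onI)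
  define D where "D = {x. \<not> (\<lambda>t. f (x + t *\<^sub>R e)) differentiable at 0}"
  have cl: "continuous_on UNIV (\<lambda>t. f (x + t *\<^sub>R e))" for x
    by (rule continuous_on_compose2[OF fc]) (auto intro!: continuous_intros)
  have "D \<in> sets borel"
    unfolding D_def differentiable_at_0_iff_rat[OF cl] by measurable
  moreover have "negligible {t. x + t *\<^sub>R e \<in> D}" for x
  proof -
    have "(L * norm e)-lipschitz_on UNIV (\<lambda>t. f (x + t *\<^sub>R e))"
    proof (rule lipschitz_onI)
      fix s t :: real
      have "dist (f (x + s *\<^sub>R e)) (f (x + t *\<^sub>R e)) \<le> L * dist (x + s *\<^sub>R e) (x + t *\<^sub>R e)"
        by (rule lipschitz_onD[OF lip]) auto
      also have "dist (x + s *\<^sub>R e) (x + t *\<^sub>R e) = norm e * dist s t"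
        by (simp add: dist_norm flip: scaleR_diff_left)
      finally show "dist (f (x + s *\<^sub>R e)) (f (x + t *\<^sub>R e)) \<le> L * norm e * dist s t" by (simp add: mult_ac)
    qed (use lipschitz_on_nonneg[OF lip] in auto)
    from lipschitz_imp_ae_differentiable[OF this]
    have "negligible {t. \<not> (\<lambda>t. f (x + t *\<^sub>R e)) differentiable at t}" .
    moreover have "(\<lambda>s. f ((x + t *\<^sub>R e) + s *\<^sub>R e)) differentiable at 0" if "(\<lambda>t. f (x + t *\<^sub>R e)) differentiable at t" for t
    proof -
      have "(\<lambda>s. f (x + (s + t) *\<^sub>R e)) differentiable at 0" using that unfolding real_differentiable_def
        using DERIV_shift[of "\<lambda>t. f (x + t *\<^sub>R e)" _ 0 t] by simp
      then show ?thesis by (simp add: algebra_simps)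
    qed
    ultimately show ?thesis unfolding D_def by (auto elim!: negligible_subset)
  qed
  ultimately have "AE x in lborel. x \<notin> D" by (rule negligible_lines_imp_AE)
  then show ?thesis by (simp add: D_def)
qed

section \<open>Integration by parts along one direction\<close>

lemma borel_measurable_lebesgue_AE:
  fixes f g :: "'a::euclidean_space \<Rightarrow> real"
  assumes f: "f \<in> borel_measurable lebesgue" and ae: "AE x in lebesgue. f x = g x"
  shows "g \<in> borel_measurable lebesgue"
proof (rule measurableI)
  fix A :: "real set" assume "A \<in> sets borel"
  then have 1: "f -` A \<inter> space lebesgue \<in> sets lebesgue" using f by (intro measurable_sets) auto
  have 2: "AE x in lebesgue. x \<in> f -` A \<inter> space lebesgue \<longleftrightarrow> x \<in> g -` A \<inter> space lebesgue"
    using ae by eventually_elim auto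
  show "g -` A \<inter> space lebesgue \<in> sets lebesgue"
    by (rule completion.in_sets_AE[OF 2 1]) auto
qed auto

lemma AE_lebesgue_iff: "(AE x in lborel. P x) \<Longrightarrow> (AE x in lebesgue. P x)"
  by (rule AE_completion)

text \<open>Summation by parts at step r: a forward quotient on B and a backward quotient on A add
  up, after a translation, to a difference of A B with its own translate, whose integral is 0. The
  Lipschitz bounds dominate the quotients as r \<rightarrow> 0, so derivatives are needed almost
  everywhere only.\<close>

lemma ibp_directional:
  fixes A B A' B' :: "'a::euclidean_space \<Rightarrow> real" and e :: 'a
  assumes Ac: "continuous_on UNIV A" and Bc: "continuous_on UNIV B"
    and supp: "\<And>x. R \<le> norm x \<Longrightarrow> B x = 0"
    and Al: "\<And>x t. norm x \<le> R \<Longrightarrow> \<bar>t\<bar> \<le> 1 \<Longrightarrow> \<bar>A (x + t *\<^sub>R e) - A x\<bar> \<le> C * \<bar>t\<bar>"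
    and Bl: "\<And>x t. \<bar>B (x + t *\<^sub>R e) - B x\<bar> \<le> C * \<bar>t\<bar>"
    and Ad: "AE x in lebesgue. ((\<lambda>t. A (x + t *\<^sub>R e)) has_real_derivative A' x) (at 0)"
    and Bd: "AE x in lebesgue. ((\<lambda>t. B (x + t *\<^sub>R e)) has_real_derivative B' x) (at 0)"
  shows "integrable lebesgue (\<lambda>x. A x * B' x)" "integrable lebesgue (\<lambda>x. A' x * B x)"
    "(LINT x|lebesgue. A x * B' x) = - (LINT x|lebesgue. A' x * B x)"
proof -
  have C0: "0 \<le> C" using Bl[of 0 1] by simp
  have [measurable]: "A \<in> borel_measurable borel" "B \<in> borel_measurable borel"
    using Ac Bc by (auto intro: borel_measurable_continuous_onI)
  define r where "r k = 1 / (real k + 1)" for k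
  have r: "0 < r k" "\<bar>r k\<bar> \<le> 1" "r k \<noteq> 0" for k by (auto simp: r_def)
  have r0: "r \<longlonglongrightarrow> 0" unfolding r_def[abs_def] by real_asymp
  have fl: "filterlim r (at 0) sequentially"
    unfolding filterlim_at using r0 r by auto
  have flm: "filterlim (\<lambda>k. - r k) (at 0) sequentially"
    unfolding filterlim_at using tendsto_minus[OF r0] r by auto
  \<comment> \<open>Enlarged by norm e so that it also contains the support of B shifted by r k e,
    as r k \<le> 1.\<close>
  define K where "K = cball (0::'a) (R + norm e)"
  have Kil: "integrable lborel (indicat_real K)" unfolding K_def
    by (intro integrable_real_indicator emeasure_lborel_cball_finite) auto
  then have Ki: "integrable lebesgue (indicat_real K)"
    using integrable_completion[of "indicat_real K" lborel] by (simp add: K_def)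
  have K: "compact K" by (simp add: K_def)
  have cpt: "\<exists>M. \<forall>x\<in>K. \<bar>f x\<bar> \<le> M" if "continuous_on UNIV f" for f :: "'a \<Rightarrow> real"
    using compact_imp_bounded[OF compact_continuous_image[OF continuous_on_subset[OF that] K]]
    by (auto simp: bounded_iff)
  obtain MA where MA: "\<And>x. x \<in> K \<Longrightarrow> \<bar>A x\<bar> \<le> MA" using cpt[OF Ac] by blast
  obtain MB where MB: "\<And>x. x \<in> K \<Longrightarrow> \<bar>B x\<bar> \<le> MB" using cpt[OF Bc] by blast
  define s1 where "s1 k x = A x * ((B (x + r k *\<^sub>R e) - B x) / r k)" for k x
  define s2 where "s2 k x = ((A (x + (- r k) *\<^sub>R e) - A x) / (- r k)) * B x" for k x
  have lim1: "AE x in lebesgue. (\<lambda>k. s1 k x) \<longlonglongrightarrow> A x * B' x"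
    using Bd
  proof eventually_elim
    case (elim x)
    then have "((\<lambda>t. (B (x + t *\<^sub>R e) - B x) / t) \<longlongrightarrow> B' x) (at 0)" by (simp add: has_field_derivative_iff)
    from filterlim_compose[OF this fl] show ?case unfolding s1_def by (intro tendsto_intros)
  qed
  have lim2: "AE x in lebesgue. (\<lambda>k. s2 k x) \<longlonglongrightarrow> A' x * B x"
    using Ad
  proof eventually_elim
    case (elim x)
    then have "((\<lambda>t. (A (x + t *\<^sub>R e) - A x) / t) \<longlongrightarrow> A' x) (at 0)" by (simp add: has_field_derivative_iff)
    from filterlim_compose[OF this flm] show ?case unfolding s2_def by (intro tendsto_intros)
  qed
  have b1: "\<bar>s1 k x\<bar> \<le> MA * C * indicator K x" for k x
  proof (cases "x \<in> K")
    case True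
    have "\<bar>(B (x + r k *\<^sub>R e) - B x) / r k\<bar> \<le> C" using Bl[of x "r k"] r[of k] by (simp add: divide_le_eq)
    then have "\<bar>A x\<bar> * \<bar>(B (x + r k *\<^sub>R e) - B x) / r k\<bar> \<le> MA * C"
      using MA[OF True] C0 by (intro mult_mono) auto
    then show ?thesis using True by (simp add: s1_def abs_mult)
  next
    case False
    then have n: "R + norm e < norm x" by (simp add: K_def)
    have "norm x \<le> norm (x + r k *\<^sub>R e) + norm (r k *\<^sub>R e)" using norm_triangle_sub[of x "- r k *\<^sub>R e"] by simp
    also have "norm (r k *\<^sub>R e) \<le> 1 * norm e" unfolding norm_scaleR using r[of k] by (intro mult_right_mono) auto
    finally have "R \<le> norm (x + r k *\<^sub>R e)" using n by simp
    then have "B (x + r k *\<^sub>R e) = 0" "B x = 0" using supp n norm_ge_zero[of e] by (auto intro!: supp simp del: norm_ge_zero)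
    then show ?thesis using False by (simp add: s1_def)
  qed
  have b2: "\<bar>s2 k x\<bar> \<le> C * MB * indicator K x" for k x
  proof (cases "R \<le> norm x")
    case True
    have "0 \<le> MB" if "x \<in> K" using MB[OF that] by linarith
    then show ?thesis using supp[OF True] C0 by (auto simp: s2_def indicator_def)
  next
    case False
    then have xK: "x \<in> K" using norm_ge_zero[of e] by (simp add: K_def del: norm_ge_zero)
    have "\<bar>(A (x + (- r k) *\<^sub>R e) - A x) / (- r k)\<bar> \<le> C" using Al[of x "- r k"] r[of k] False by (simp add: divide_le_eq)
    then have "\<bar>(A (x + (- r k) *\<^sub>R e) - A x) / (- r k)\<bar> * \<bar>B x\<bar> \<le> C * MB"
      using MB[OF xK] C0 by (intro mult_mono) auto
    then show ?thesis using xK by (simp add: s2_def abs_mult)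
  qed
  have m1: "s1 k \<in> borel_measurable lebesgue" and m2: "s2 k \<in> borel_measurable lebesgue" for k
    unfolding s1_def[abs_def] s2_def[abs_def] by (intro measurable_completion; measurable)+
  have lm: "g \<in> borel_measurable lebesgue" if s: "\<And>k. s k \<in> borel_measurable lebesgue"
    and l: "AE x in lebesgue. (\<lambda>k. s k x) \<longlonglongrightarrow> g x" for s :: "nat \<Rightarrow> 'a \<Rightarrow> real" and g
  proof (rule borel_measurable_lebesgue_AE)
    show "(\<lambda>x. lim (\<lambda>k. s k x)) \<in> borel_measurable lebesgue" using s by (rule borel_measurable_lim_metric)
    show "AE x in lebesgue. lim (\<lambda>k. s k x) = g x" using l by eventually_elim (rule limI)
  qed
  have d1: "integrable lebesgue (\<lambda>x. MA * C * indicat_real K x)" "integrable lebesgue (\<lambda>x. C * MB * indicat_real K x)"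
    using Ki by auto
  note m3 = lm[OF m1 lim1] lm[OF m2 lim2]
  have bb: "AE x in lebesgue. norm (s1 k x) \<le> MA * C * indicat_real K x"
    "AE x in lebesgue. norm (s2 k x) \<le> C * MB * indicat_real K x" for k using b1 b2 by auto
  show "integrable lebesgue (\<lambda>x. A x * B' x)"
    by (rule integrable_dominated_convergence[OF m3(1) m1 d1(1) lim1 bb(1)])
  show "integrable lebesgue (\<lambda>x. A' x * B x)"
    by (rule integrable_dominated_convergence[OF m3(2) m2 d1(2) lim2 bb(2)])
  have L1: "(\<lambda>k. LINT x|lebesgue. s1 k x) \<longlonglongrightarrow> (LINT x|lebesgue. A x * B' x)"
    by (rule integral_dominated_convergence[OF m3(1) m1 d1(1) lim1 bb(1)])
  have L2: "(\<lambda>k. LINT x|lebesgue. s2 k x) \<longlonglongrightarrow> (LINT x|lebesgue. A' x * B x)"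
    by (rule integral_dominated_convergence[OF m3(2) m2 d1(2) lim2 bb(2)])
  have "(LINT x|lebesgue. s1 k x) = - (LINT x|lebesgue. s2 k x)" for k
  proof -
    have AB: "integrable lborel (\<lambda>x. A x * B x)"
    proof (rule Bochner_Integration.integrable_bound)
      show "integrable lborel (\<lambda>x. MA * MB * indicat_real K x)" using Kil by auto
      show "AE x in lborel. norm (A x * B x) \<le> norm (MA * MB * indicat_real K x)"
      proof (intro always_eventually allI)
        fix x show "norm (A x * B x) \<le> norm (MA * MB * indicat_real K x)"
        proof (cases "x \<in> K")
          case True
          then have "\<bar>A x\<bar> * \<bar>B x\<bar> \<le> MA * MB" using MA MB by (intro mult_mono) (auto intro: order_trans[OF abs_ge_zero])
          then show ?thesis using True by (simp add: abs_mult[symmetric])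
        next
          case False
          then have "R \<le> norm x" using norm_ge_zero[of e] by (simp add: K_def del: norm_ge_zero)
          then show ?thesis using supp by simp
        qed
      qed
    qed measurable
    define c where "c = r k *\<^sub>R e"
    have s1i: "integrable lborel (s1 k)" and s2i: "integrable lborel (s2 k)"
    proof -
      have "integrable lebesgue (s1 k)"
        by (rule Bochner_Integration.integrable_bound[OF d1(1) m1]) (use b1 in \<open>auto intro: order_trans[OF _ abs_ge_self]\<close>)
      then show "integrable lborel (s1 k)"
        by (subst (asm) integrable_completion) (auto simp: s1_def[abs_def])
      have "integrable lebesgue (s2 k)"
        by (rule Bochner_Integration.integrable_bound[OF d1(2) m2]) (use b2 in \<open>auto intro: order_trans[OF _ abs_ge_self]\<close>)
      then show "integrable lborel (s2 k)"
        by (subst (asm) integrable_completion) (auto simp: s2_def[abs_def])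
    qed
    have tr: "integral\<^sup>L lborel (\<lambda>x. f (x + c)) = integral\<^sup>L lborel f" "integrable lborel f \<Longrightarrow> integrable lborel (\<lambda>x. f (x + c))"
      if [measurable]: "f \<in> borel_measurable borel" for f :: "'a \<Rightarrow> real"
      using integral_distr[of "\<lambda>x. x + c" lborel borel f] integrable_distr_eq[of "\<lambda>x. x + c" lborel borel f]
      by (simp_all add: lborel_distr_translation)
    have "s1 k x + s2 k (x + c) = (A (x + c) * B (x + c) - A x * B x) / r k" for x
      using r[of k] by (simp add: s1_def s2_def c_def field_simps)
    then have "(LINT x|lborel. s1 k x + s2 k (x + c)) = (LINT x|lborel. (A (x + c) * B (x + c) - A x * B x) / r k)" by simp
    also have "\<dots> = 0" using AB tr[of "\<lambda>x. A x * B x"] by simp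
    finally have "(LINT x|lborel. s1 k x) + (LINT x|lborel. s2 k x) = 0"
      using s1i s2i tr[of "s2 k"] by (simp add: s2_def[abs_def])
    moreover have "(LINT x|lebesgue. s1 k x) = (LINT x|lborel. s1 k x)" "(LINT x|lebesgue. s2 k x) = (LINT x|lborel. s2 k x)"
      by (intro integral_completion; simp add: s1_def[abs_def] s2_def[abs_def])+
    ultimately show ?thesis by simp
  qed
  then have "(\<lambda>k. LINT x|lebesgue. s1 k x) \<longlonglongrightarrow> - (LINT x|lebesgue. A' x * B x)"
    using tendsto_minus[OF L2] by simp
  from LIMSEQ_unique[OF L1 this] show "(LINT x|lebesgue. A x * B' x) = - (LINT x|lebesgue. A' x * B x)" .
qed

section \<open>The Laplacian of test functions\<close>

lemma GDERIV_directional: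
  fixes f :: "'a::real_inner \<Rightarrow> real"
  assumes "GDERIV f x :> d"
  shows "((\<lambda>t. f (x + t *\<^sub>R e)) has_real_derivative (e \<bullet> d)) (at 0)"
proof -
  have f: "(f has_derivative (\<lambda>h. h \<bullet> d)) (at (x + 0 *\<^sub>R e))" using assms by (simp add: gderiv_def)
  have "((\<lambda>t. x + t *\<^sub>R e) has_derivative (\<lambda>t. t *\<^sub>R e)) (at 0)"
    by (auto intro!: derivative_eq_intros)
  from has_derivative_compose[OF this f] show ?thesis
    by (simp add: has_field_derivative_def mult.commute[of "e \<bullet> d"] fun_eq_iff ac_simps) (metis (no_types, lifting) ext
        mult_commute_abs)
qed

lemma partial_deriv_GDERIV:
  assumes "GDERIV f x :> d" shows "partial_deriv i f x = d $ i"
  unfolding partial_deriv_def using GDERIV_directional[OF assms, of "axis i 1"]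
  by (simp add: DERIV_imp_deriv inner_axis')

lemma vec_derivative_directional:
  fixes g :: "real^'n \<Rightarrow> real^'n"
  assumes "(g has_derivative (\<lambda>h. H *v h)) (at x)"
  shows "((\<lambda>t. g (x + t *\<^sub>R axis j 1) $ i) has_real_derivative (H $ i $ j)) (at 0)"
proof -
  have f: "(g has_derivative (\<lambda>h. H *v h)) (at (x + 0 *\<^sub>R axis j 1))" using assms by simp
  have "((\<lambda>t. x + t *\<^sub>R axis j 1) has_derivative (\<lambda>t. t *\<^sub>R axis j 1)) (at 0)"
    by (auto intro!: derivative_eq_intros)
  from has_derivative_compose[OF this f]
  have "((\<lambda>t. g (x + t *\<^sub>R axis j 1)) has_derivative (\<lambda>t. H *v (t *\<^sub>R axis j 1))) (at 0)" by simp
  from bounded_linear.has_derivative[OF bounded_linear_vec_nth this, of i]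
  have "((\<lambda>t. g (x + t *\<^sub>R axis j 1) $ i) has_derivative (\<lambda>t. (H *v (t *\<^sub>R axis j 1)) $ i)) (at 0)" .
  moreover have "(H *v (t *\<^sub>R axis j 1)) $ i = H $ i $ j * t" for t
    by (simp add: matrix_vector_mult_scaleR matrix_vector_mult_basis column_def)
  ultimately show ?thesis by (simp add: has_field_derivative_def)
qed

lemma laplacian_C2:
  fixes f :: "real^'n \<Rightarrow> real" and H :: "real^'n \<Rightarrow> real^'n^'n"
  assumes S: "open S" "x \<in> S"
    and d: "\<And>x. x \<in> S \<Longrightarrow> GDERIV f x :> g x" "\<And>x. x \<in> S \<Longrightarrow> (g has_derivative (\<lambda>h. H x *v h)) (at x)"
  shows "laplacian f x = (\<Sum>i\<in>UNIV. H x $ i $ i)"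
  unfolding laplacian_def
proof (rule sum.cong[OF refl])
  fix i
  have "((\<lambda>t::real. x + t *\<^sub>R axis i 1) \<longlongrightarrow> x + 0 *\<^sub>R axis i 1) (nhds 0)"
    by (intro tendsto_intros filterlim_ident)
  then have "\<forall>\<^sub>F t in nhds 0. x + (t::real) *\<^sub>R axis i 1 \<in> S" using S by (auto dest: topological_tendstoD)
  then have "\<forall>\<^sub>F t in nhds 0. partial_deriv i f (x + t *\<^sub>R axis i 1) = g (x + t *\<^sub>R axis i 1) $ i"
    by eventually_elim (intro partial_deriv_GDERIV d)
  then have "((\<lambda>t. partial_deriv i f (x + t *\<^sub>R axis i 1)) has_real_derivative (H x $ i $ i)) (at 0)"
    using vec_derivative_directional[OF d(2)[OF S(2)], of i i]
    by (subst DERIV_cong_ev) auto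
  then show "partial_deriv i (partial_deriv i f) x = H x $ i $ i"
    unfolding partial_deriv_def[of i "partial_deriv i f"] by (rule DERIV_imp_deriv)
qed

lemma ball_path_bound:
  fixes A A' :: "real^'n \<Rightarrow> real"
  assumes d: "\<And>x. ((\<lambda>t. A (x + t *\<^sub>R e)) has_real_derivative A' x) (at 0)"
    and c: "continuous_on UNIV A'" and "norm e \<le> 1"
  shows "\<exists>C. \<forall>x t. norm x \<le> R \<and> \<bar>t\<bar> \<le> 1 \<longrightarrow> \<bar>A (x + t *\<^sub>R e) - A x\<bar> \<le> C * \<bar>t\<bar>"
proof -
  have "bounded (A' ` cball 0 (R + 1))"
    by (intro compact_imp_bounded compact_continuous_image continuous_on_subset[OF c]) auto
  then obtain C where "\<forall>x\<in>cball 0 (R + 1). \<bar>A' x\<bar> \<le> C" by (auto simp: bounded_iff)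
  then have C: "\<bar>A' x\<bar> \<le> C" if "norm x \<le> R + 1" for x using that by simp
  have "\<bar>A (x + t *\<^sub>R e) - A x\<bar> \<le> C * \<bar>t\<bar>" if x: "norm x \<le> R" "\<bar>t\<bar> \<le> 1" for x t
  proof -
    have "norm (A (x + t *\<^sub>R e) - A (x + 0 *\<^sub>R e)) \<le> C * norm (t - 0)"
    proof (rule field_differentiable_bound[where S="{-1..1}" and f'="\<lambda>t. A' (x + t *\<^sub>R e)"])
      fix z :: real assume z: "z \<in> {-1..1}"
      have "((\<lambda>t. A ((x + z *\<^sub>R e) + t *\<^sub>R e)) has_real_derivative A' (x + z *\<^sub>R e)) (at 0)" by (rule d)
      moreover have "(x + z *\<^sub>R e) + t *\<^sub>R e = x + (t + z) *\<^sub>R e" for t by (simp add: algebra_simps)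
      ultimately have "((\<lambda>t. A (x + (t + z) *\<^sub>R e)) has_real_derivative A' (x + z *\<^sub>R e)) (at 0)" by simp
      then have "((\<lambda>t. A (x + t *\<^sub>R e)) has_real_derivative A' (x + z *\<^sub>R e)) (at z)"
        using DERIV_shift[of "\<lambda>t. A (x + t *\<^sub>R e)" _ 0 z] by simp
      then show "((\<lambda>t. A (x + t *\<^sub>R e)) has_real_derivative A' (x + z *\<^sub>R e)) (at z within {-1..1})"
        by (rule has_field_derivative_at_within)
      have "norm (z *\<^sub>R e) \<le> 1 * 1" unfolding norm_scaleR using z assms(3) by (intro mult_mono) auto
      then have "norm (x + z *\<^sub>R e) \<le> R + 1" using x norm_triangle_ineq[of x "z *\<^sub>R e"] by linarith
      then show "norm (A' (x + z *\<^sub>R e)) \<le> C" using C by simp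
    qed (use x in auto)
    then show ?thesis by simp
  qed
  then show ?thesis by blast
qed

lemma C11_data:
  fixes \<xi> :: "real^'n \<Rightarrow> real"
  assumes "C11_compact_support \<xi>"
  obtains g L R where "\<And>x. GDERIV \<xi> x :> g x" "L-lipschitz_on UNIV g" "0 < R"
    "\<And>x. R \<le> norm x \<Longrightarrow> \<xi> x = 0" "\<And>x. R \<le> norm x \<Longrightarrow> g x = 0"
proof -
  obtain g L where g: "\<And>x. GDERIV \<xi> x :> g x" "L-lipschitz_on UNIV g" and c: "compact (closure {x. \<xi> x \<noteq> 0})"
    using assms by (auto simp: C11_compact_support_def)
  obtain R0 where R0: "\<And>x. x \<in> closure {x. \<xi> x \<noteq> 0} \<Longrightarrow> norm x \<le> R0"
    using compact_imp_bounded[OF c] by (auto simp: bounded_iff)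
  define R where "R = max 0 R0 + 1"
  have out: "x \<notin> closure {x. \<xi> x \<noteq> 0}" if "R \<le> norm x" for x using R0[of x] that by (auto simp: R_def)
  have z: "\<xi> x = 0" if "R \<le> norm x" for x using out[OF that] closure_subset[of "{x. \<xi> x \<noteq> 0}"] by auto
  have gz: "g x = 0" if "R \<le> norm x" for x
  proof -
    have o: "open (- closure {x. \<xi> x \<noteq> 0})" by (simp add: open_Compl)
    have "GDERIV \<xi> x :> 0"
      unfolding gderiv_def
    proof (rule has_derivative_transform_within_open[OF _ o])
      show "((\<lambda>_. 0) has_derivative (\<lambda>h. h \<bullet> 0)) (at x)" by simp
      show "0 = \<xi> y" if "y \<in> - closure {x. \<xi> x \<noteq> 0}" for y
        using that closure_subset[of "{x. \<xi> x \<noteq> 0}"] by auto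
    qed (use out[OF that] in auto)
    then have "h \<bullet> g x = 0" for h using g(1)[of x] unfolding gderiv_def
      by (metis has_derivative_unique inner_zero_right)
    from this[of "g x"] show ?thesis by simp
  qed
  show ?thesis by (rule that[OF g _ z gz]) (auto simp: R_def)
qed

lemma GDERIV_continuous_on: "(\<And>x. GDERIV f x :> g x) \<Longrightarrow> continuous_on S f"
  by (meson continuous_at_imp_continuous_on gderiv_def has_derivative_continuous)

lemma lipschitz_nth: "L-lipschitz_on UNIV g \<Longrightarrow> L-lipschitz_on UNIV (\<lambda>x. (g x :: real^'n) $ i)"
  unfolding lipschitz_on_def dist_norm
  by (metis component_le_norm_cart order_trans real_norm_def vector_minus_component)

text \<open>The i-th component of the Lipschitz gradient is differentiable along the i-th axis
  almost everywhere, and at those points the \<open>deriv\<close> in the definition of the Laplacian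
  has its true value.\<close>

lemma C11_laplacian:
  fixes \<xi> :: "real^'n \<Rightarrow> real"
  assumes g: "\<And>x. GDERIV \<xi> x :> g x" and L: "L-lipschitz_on UNIV g"
  shows "AE x in lebesgue. ((\<lambda>t. g (x + t *\<^sub>R axis i 1) $ i) has_real_derivative partial_deriv i (partial_deriv i \<xi>) x) (at 0)"
proof -
  have "AE x in lborel. (\<lambda>t. g (x + t *\<^sub>R axis i 1) $ i) differentiable at 0"
    by (rule lipschitz_imp_AE_directional[OF lipschitz_nth[OF L]])
  from AE_lebesgue_iff[OF this] show ?thesis
  proof eventually_elim
    case (elim x)
    have "partial_deriv i (partial_deriv i \<xi>) x = deriv (\<lambda>t. g (x + t *\<^sub>R axis i 1) $ i) 0"
      unfolding partial_deriv_def[of i "partial_deriv i \<xi>"] by (simp add: partial_deriv_GDERIV[OF g])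
    then show ?case using elim by (simp add: DERIV_deriv_iff_real_differentiable)
  qed
qed

lemma green_identity:
  fixes U \<xi> :: "real^'n \<Rightarrow> real"
  assumes U: "C2_on UNIV U" and xi: "C11_compact_support \<xi>"
  shows "integrable lebesgue (\<lambda>x. U x * laplacian \<xi> x)" "integrable lebesgue (\<lambda>x. laplacian U x * \<xi> x)"
    "(LINT x|lebesgue. U x * laplacian \<xi> x) = (LINT x|lebesgue. laplacian U x * \<xi> x)"
proof -
  obtain g L R where g: "\<And>x. GDERIV \<xi> x :> g x" "L-lipschitz_on UNIV g" "0 < R"
    "\<And>x. R \<le> norm x \<Longrightarrow> \<xi> x = 0" "\<And>x. R \<le> norm x \<Longrightarrow> g x = 0"
    by (rule C11_data[OF xi]) (rule that)
  obtain gU H where gU: "\<And>x. GDERIV U x :> gU x" and H: "\<And>x. (gU has_derivative (\<lambda>h. H x *v h)) (at x)"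
    and Hc: "continuous_on UNIV H"
    using U by (auto simp: C2_on_def)
  have lapU: "laplacian U x = (\<Sum>i\<in>UNIV. H x $ i $ i)" for x
    by (rule laplacian_C2[of UNIV]) (use gU H in auto)
  have gc: "continuous_on UNIV g" using g(2) by (rule lipschitz_on_continuous_on)
  have gUc: "continuous_on UNIV gU" using H by (meson continuous_at_imp_continuous_on has_derivative_continuous)
  have Uc: "continuous_on UNIV U" using gU by (rule GDERIV_continuous_on)
  have xc: "continuous_on UNIV \<xi>" using g(1) by (rule GDERIV_continuous_on)
  let ?P = "\<lambda>i. partial_deriv i (partial_deriv i \<xi>)"
  \<comment> \<open>One coordinate at a time. The first integration by parts takes a derivative off
    \<xi> and uses the almost everywhere derivative of its Lipschitz gradient; the second is between
    functions differentiable everywhere.\<close>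
  have minimal_and_larger_solution: "integrable lebesgue (\<lambda>x. U x * ?P i x) \<and> integrable lebesgue (\<lambda>x. H x $ i $ i * \<xi> x) \<and>
     (LINT x|lebesgue. U x * ?P i x) = (LINT x|lebesgue. H x $ i $ i * \<xi> x)" for i
  proof -
    let ?e = "axis i 1 :: real^'n"
    have ne: "norm ?e \<le> 1" by simp
    have dU: "((\<lambda>t. U (x + t *\<^sub>R ?e)) has_real_derivative gU x $ i) (at 0)" for x
      using GDERIV_directional[OF gU[of x], of ?e] by (simp add: inner_axis')
    have dx: "((\<lambda>t. \<xi> (x + t *\<^sub>R ?e)) has_real_derivative g x $ i) (at 0)" for x
      using GDERIV_directional[OF g(1)[of x], of ?e] by (simp add: inner_axis')
    have dgU: "((\<lambda>t. gU (x + t *\<^sub>R ?e) $ i) has_real_derivative H x $ i $ i) (at 0)" for x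
      by (rule vec_derivative_directional[OF H])
    have cH: "continuous_on UNIV (\<lambda>x. H x $ i $ i)" "continuous_on UNIV (\<lambda>x. gU x $ i)" "continuous_on UNIV (\<lambda>x. g x $ i)"
      by (intro continuous_intros Hc gUc gc)+
    obtain C1 where C1: "\<And>x t. norm x \<le> R \<Longrightarrow> \<bar>t\<bar> \<le> 1 \<Longrightarrow> \<bar>U (x + t *\<^sub>R ?e) - U x\<bar> \<le> C1 * \<bar>t\<bar>"
      using ball_path_bound[OF dU cH(2) ne, of R] by blast
    obtain C2 where C2: "\<And>x t. norm x \<le> R \<Longrightarrow> \<bar>t\<bar> \<le> 1 \<Longrightarrow> \<bar>gU (x + t *\<^sub>R ?e) $ i - gU x $ i\<bar> \<le> C2 * \<bar>t\<bar>"
      using ball_path_bound[OF dgU cH(1) ne, of R] by blast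
    have L3: "\<bar>g (x + t *\<^sub>R ?e) $ i - g x $ i\<bar> \<le> L * \<bar>t\<bar>" for x t
      using lipschitz_onD[OF lipschitz_nth[OF g(2), of i], of "x + t *\<^sub>R ?e" x] by (simp add: dist_real_def dist_norm)
    obtain M where M: "\<And>x. \<bar>g x $ i\<bar> \<le> M" "0 \<le> M"
    proof -
      have "bounded ((\<lambda>x. g x $ i) ` cball 0 R)"
        by (intro compact_imp_bounded compact_continuous_image continuous_on_subset[OF cH(3)]) auto
      then obtain M where "\<forall>x\<in>cball 0 R. \<bar>g x $ i\<bar> \<le> M" by (auto simp: bounded_iff)
      then have M: "\<bar>g x $ i\<bar> \<le> M" if "norm x \<le> R" for x using that by simp
      have "\<bar>g x $ i\<bar> \<le> max 0 M" for x using M[of x] g(5)[of x] by (cases "norm x \<le> R") auto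
      then show ?thesis using that[of "max 0 M"] by simp
    qed
    have L4: "\<bar>\<xi> (x + t *\<^sub>R ?e) - \<xi> x\<bar> \<le> M * \<bar>t\<bar>" for x t
    proof -
      have "norm (\<xi> (x + t *\<^sub>R ?e) - \<xi> (x + 0 *\<^sub>R ?e)) \<le> M * norm (t - 0)"
      proof (rule field_differentiable_bound[where S=UNIV and f'="\<lambda>t. g (x + t *\<^sub>R ?e) $ i"])
        fix z :: real
        have "((\<lambda>t. \<xi> ((x + z *\<^sub>R ?e) + t *\<^sub>R ?e)) has_real_derivative g (x + z *\<^sub>R ?e) $ i) (at 0)" by (rule dx)
        moreover have "(x + z *\<^sub>R ?e) + t *\<^sub>R ?e = x + (t + z) *\<^sub>R ?e" for t by (simp add: algebra_simps)
        ultimately have "((\<lambda>t. \<xi> (x + (t + z) *\<^sub>R ?e)) has_real_derivative g (x + z *\<^sub>R ?e) $ i) (at 0)" by simp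
        then show "((\<lambda>t. \<xi> (x + t *\<^sub>R ?e)) has_real_derivative g (x + z *\<^sub>R ?e) $ i) (at z within UNIV)"
          using DERIV_shift[of "\<lambda>t. \<xi> (x + t *\<^sub>R ?e)" _ 0 z] by simp
      qed (use M in auto)
      then show ?thesis by simp
    qed
    let ?C = "max (max C1 C2) (max L M)"
    have up: "a \<le> c * \<bar>t\<bar> \<Longrightarrow> c \<le> ?C \<Longrightarrow> a \<le> ?C * \<bar>t\<bar>" for a c t :: real
      using mult_right_mono[of c ?C "\<bar>t\<bar>"] by linarith
    have J1: "integrable lebesgue (\<lambda>x. U x * ?P i x)"
         "(LINT x|lebesgue. U x * ?P i x) = - (LINT x|lebesgue. gU x $ i * g x $ i)"
      by (rule ibp_directional[of U "\<lambda>x. g x $ i" R ?e ?C "\<lambda>x. gU x $ i" "?P i"];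
          (use Uc cH g(5) dU C11_laplacian[OF g(1,2)] in \<open>auto intro!: up[OF C1] up[OF L3]\<close>))+
    have J2: "integrable lebesgue (\<lambda>x. H x $ i $ i * \<xi> x)"
         "(LINT x|lebesgue. gU x $ i * g x $ i) = - (LINT x|lebesgue. H x $ i $ i * \<xi> x)"
      by (rule ibp_directional[of "\<lambda>x. gU x $ i" \<xi> R ?e ?C "\<lambda>x. H x $ i $ i" "\<lambda>x. g x $ i"];
          (use xc cH g(4) dgU dx in \<open>auto intro!: up[OF C2] up[OF L4]\<close>))+
    show ?thesis using J1 J2 by simp
  qed
  have e1: "U x * laplacian \<xi> x = (\<Sum>i\<in>UNIV. U x * ?P i x)" for x by (simp add: laplacian_def sum_distrib_left)
  have e2: "laplacian U x * \<xi> x = (\<Sum>i\<in>UNIV. H x $ i $ i * \<xi> x)" for x by (simp add: lapU sum_distrib_right)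
  show "integrable lebesgue (\<lambda>x. U x * laplacian \<xi> x)" "integrable lebesgue (\<lambda>x. laplacian U x * \<xi> x)"
    "(LINT x|lebesgue. U x * laplacian \<xi> x) = (LINT x|lebesgue. laplacian U x * \<xi> x)"
    unfolding e1 e2 using minimal_and_larger_solution by (auto simp: integral_sum)
qed

section \<open>Level sets of the fundamental solution\<close>

text \<open>\<open>ty\<close> only carries the type of the coordinates; N is the dimension as a real
  number, so that exponents and quotients need no conversions.\<close>

locale big_dim =
  fixes ty :: "'n::finite itself" and N :: real
  assumes N_eq: "N = real CARD('n)" and N2: "2 < N"
begin

abbreviation \<Gamma> :: "real^'n \<Rightarrow> real" where "\<Gamma> \<equiv> green_dirac"

definition sphere_area :: real where "sphere_area = N * unit_ball_vol N"
definition green_coeff :: real where "green_coeff = 1 / ((N - 2) * sphere_area)"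
text \<open>The inverse of the map from r to c_N r^(2-N): the radius of the sphere {\<Gamma> =
  s}.\<close>

definition level_radius :: "real \<Rightarrow> real" where "level_radius s = (s / green_coeff) powr (1 / (2 - N))"
text \<open>\<open>level_density\<close> is the density of the image of Lebesgue measure under \<open>\<Gamma>\<close>, which is also \<open>1/|\<nabla>\<Gamma>|\<^sup>2\<close>.\<close>

definition level_density :: "real \<Rightarrow> real" where "level_density s = (sphere_area * level_radius s powr (N - 1))\<^sup>2"

lemma sphere_area_pos: "0 < sphere_area" using N2 by (simp add: sphere_area_def)

lemma green_const_eq: "green_const CARD('n) = green_coeff"
    by (simp add: green_coeff_def green_const_def sphere_area_def mult_ac flip: N_eq)

lemma green_coeff_pos: "0 < green_coeff" using N2 sphere_area_pos by (simp add: green_coeff_def)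

lemma \<Gamma>_eq: "\<Gamma> x = green_coeff * norm x powr (2 - N)" by (simp add: green_dirac_def green_const_eq N_eq)

text \<open>\<open>0 powr (2 - N)\<close> is 0, so the pole of \<Gamma> carries the value 0 and the
  superlevel sets below are punctured balls.\<close>

lemma \<Gamma>_0 [simp]: "\<Gamma> 0 = 0" by (simp add: \<Gamma>_eq)

lemma \<Gamma>_pos: "x \<noteq> 0 \<Longrightarrow> 0 < \<Gamma> x" using green_coeff_pos by (simp add: \<Gamma>_eq)

lemma \<Gamma>_nonneg: "0 \<le> \<Gamma> x" using \<Gamma>_pos[of x] by (cases "x = 0") auto

lemma level_radius_pos: "0 < s \<Longrightarrow> 0 < level_radius s" using green_coeff_pos by (simp add: level_radius_def)

lemma level_radius_powr: "0 < s \<Longrightarrow> green_coeff * level_radius s powr (2 - N) = s"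
  using green_coeff_pos N2 by (simp add: level_radius_def powr_powr)

lemma level_radius_\<Gamma>: "x \<noteq> 0 \<Longrightarrow> level_radius (\<Gamma> x) = norm x"
  using green_coeff_pos N2 by (simp add: level_radius_def \<Gamma>_eq powr_powr)

lemma \<Gamma>_ge_iff: "0 < s \<Longrightarrow> s \<le> \<Gamma> x \<longleftrightarrow> x \<noteq> 0 \<and> norm x \<le> level_radius s"
proof (cases "x = 0")
  case False
  assume s: "0 < s"
  have "s \<le> \<Gamma> x \<longleftrightarrow> level_radius s powr (2 - N) \<le> norm x powr (2 - N)"
    using level_radius_powr[OF s] green_coeff_pos by (metis \<Gamma>_eq mult_le_cancel_left_pos)
  also have "\<dots> \<longleftrightarrow> norm x \<le> level_radius s"
    using powr_less_mono2_neg[of "2 - N" "level_radius s" "norm x"] powr_mono2'[of "2 - N" "norm x" "level_radius s"]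
        level_radius_pos[OF s] False N2
    by (metis diff_less_0_iff_less less_eq_real_def not_less zero_less_norm_iff)
  finally show ?thesis using False by simp
qed auto

lemma \<Gamma>_gt_iff: "0 < s \<Longrightarrow> s < \<Gamma> x \<longleftrightarrow> x \<noteq> 0 \<and> norm x < level_radius s"
proof (cases "x = 0")
  case False
  assume s: "0 < s"
  have "\<Gamma> x \<le> s \<longleftrightarrow> norm x powr (2 - N) \<le> level_radius s powr (2 - N)"
    using level_radius_powr[OF s] green_coeff_pos by (metis \<Gamma>_eq mult_le_cancel_left_pos)
  also have "\<dots> \<longleftrightarrow> level_radius s \<le> norm x"
    using powr_less_mono2_neg[of "2 - N" "norm x" "level_radius s"] powr_mono2'[of "2 - N" "level_radius s" "norm x"]
        level_radius_pos[OF s] False N2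
    by (metis diff_less_0_iff_less less_eq_real_def not_less zero_less_norm_iff)
  finally show ?thesis using False by (simp add: not_le[symmetric])
qed auto

lemma \<Gamma>_measurable [measurable]: "\<Gamma> \<in> borel_measurable borel"
  unfolding \<Gamma>_eq[abs_def] by measurable

lemma level_radius_measurable [measurable]: "level_radius \<in> borel_measurable borel"
  unfolding level_radius_def[abs_def] by measurable

lemma level_density_measurable [measurable]: "level_density \<in> borel_measurable borel"
  unfolding level_density_def[abs_def] by measurable

lemma level_density_nonneg: "0 \<le> level_density s" by (simp add: level_density_def)

lemma level_density_pos: "0 < s \<Longrightarrow> 0 < level_density s" using sphere_area_pos level_radius_pos[of s]
    by (simp add: level_density_def)

lemma level_density_\<Gamma>: "x \<noteq> 0 \<Longrightarrow> level_density (\<Gamma> x) = (sphere_area * norm x powr (N - 1))\<^sup>2"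
  by (simp add: level_density_def level_radius_\<Gamma>)

lemma level_radius_deriv:
  assumes "0 < s" shows "(level_radius has_real_derivative (- sphere_area * level_radius s powr (N - 1))) (at s)"
proof -
  have "(level_radius has_real_derivative (1 / (2 - N) * (s / green_coeff) powr (1 / (2 - N) - 1) * (1 / green_coeff))) (at s)"
    unfolding level_radius_def[abs_def] using assms green_coeff_pos by (auto intro!: derivative_eq_intros)
  also have "1 / (2 - N) * (s / green_coeff) powr (1 / (2 - N) - 1) * (1 / green_coeff) =
      - sphere_area * level_radius s powr (N - 1)"
  proof -
    have "1 / (2 - N) - 1 = (1 / (2 - N)) * (N - 1)" using N2 by (simp add: field_simps)
    then have "(s / green_coeff) powr (1 / (2 - N) - 1) = level_radius s powr (N - 1)" by (simp add: level_radius_def powr_powr)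
    moreover have "1 / (2 - N) * (1 / green_coeff) = - sphere_area" using N2 sphere_area_pos
        by (simp add: green_coeff_def field_simps)
    ultimately show ?thesis by (metis mult.commute mult.left_commute)
  qed
  finally show ?thesis .
qed

lemma level_radius_continuous: "continuous_on {0<..} level_radius"
  using level_radius_deriv by (intro DERIV_continuous_on) (auto intro: has_field_derivative_at_within)

lemma level_density_continuous: "continuous_on {0<..} level_density"
  unfolding level_density_def using level_radius_pos by (intro continuous_intros level_radius_continuous) force

definition superlevel_volume :: "real \<Rightarrow> real" where "superlevel_volume s = unit_ball_vol N * level_radius s powr N"

text \<open>The volume changes at the rate area times dr/ds, and dr/ds is minus the area again;
  hence the square in \<open>level_density\<close>.\<close>

lemma superlevel_volume_deriv:
  assumes "0 < s" shows "(superlevel_volume has_real_derivative (- level_density s)) (at s)"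
proof -
  have "(superlevel_volume has_real_derivative (unit_ball_vol N * (N * level_radius s powr (N - 1) * (- sphere_area *
      level_radius s powr (N - 1))))) (at s)"
    unfolding superlevel_volume_def[abs_def]
    by (rule DERIV_cmult, rule DERIV_chain2[OF has_real_derivative_powr level_radius_deriv[OF assms]])
       (rule level_radius_pos[OF assms])
  then show ?thesis by (simp add: level_density_def sphere_area_def power2_eq_square mult_ac)
qed

lemma level_radius_at_top: "(level_radius \<longlongrightarrow> 0) at_top"
  unfolding level_radius_def
proof (rule tendsto_neg_powr)
  show "1 / (2 - N) < 0" using N2 by simp
  show "filterlim (\<lambda>s. s / green_coeff) at_top at_top" using green_coeff_pos by real_asymp
qed

lemma superlevel_volume_at_top: "(superlevel_volume \<longlongrightarrow> 0) at_top"
proof -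
  have "((\<lambda>s. unit_ball_vol N * level_radius s powr N) \<longlongrightarrow> unit_ball_vol N * 0 powr N) at_top"
    using N2 by (intro tendsto_intros tendsto_powr2 level_radius_at_top) (auto simp: level_radius_def)
  then show ?thesis by (simp add: superlevel_volume_def[abs_def])
qed

lemma emeasure_ball_superlevel_volume:
  assumes "0 < s"
  shows "emeasure lborel {x. s \<le> \<Gamma> x} = ennreal (superlevel_volume s)" "emeasure lborel {x. s < \<Gamma> x} =
      ennreal (superlevel_volume s)"
proof -
  have n0: "{0::real^'n} \<in> null_sets lborel" by (auto simp: null_sets_def)
  have v: "unit_ball_vol N * level_radius s ^ CARD('n) = superlevel_volume s"
    using powr_realpow[OF level_radius_pos[OF assms], of "CARD('n)"] unfolding superlevel_volume_def by (simp flip: N_eq)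
  have d: "DIM(real^'n) = CARD('n)" by simp
  have v': "unit_ball_vol (real CARD('n)) * level_radius s ^ CARD('n) = superlevel_volume s"
    by (subst (1) N_eq[symmetric]) (rule v)
  have r: "0 \<le> level_radius s" using level_radius_pos[OF assms] by simp
  have "emeasure lborel (cball (0::real^'n) (level_radius s) - {0}) = emeasure lborel (cball (0::real^'n) (level_radius s))"
    by (rule emeasure_Diff_null_set[OF n0]) simp
  also have "\<dots> = ennreal (superlevel_volume s)" unfolding emeasure_cball[OF r] d v' ..
  also have "cball (0::real^'n) (level_radius s) - {0} = {x. s \<le> \<Gamma> x}"
    by (rule set_eqI) (simp add: \<Gamma>_ge_iff[OF assms] conj_commute)
  finally show "emeasure lborel {x. s \<le> \<Gamma> x} = ennreal (superlevel_volume s)" .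
  have "emeasure lborel (ball (0::real^'n) (level_radius s) - {0}) = emeasure lborel (ball (0::real^'n) (level_radius s))"
    by (rule emeasure_Diff_null_set[OF n0]) simp
  also have "\<dots> = ennreal (superlevel_volume s)" unfolding emeasure_ball[OF r] d v' ..
  also have "ball (0::real^'n) (level_radius s) - {0} = {x. s < \<Gamma> x}"
    by (rule set_eqI) (simp add: \<Gamma>_gt_iff[OF assms] conj_commute)
  finally show "emeasure lborel {x. s < \<Gamma> x} = ennreal (superlevel_volume s)" .
qed

lemma level_density_tail:
  assumes "0 < a"
  shows "(\<integral>\<^sup>+s. ennreal (level_density s) * indicator {a..} s \<partial>lborel) = ennreal (superlevel_volume a)"
proof -
  have "(\<integral>\<^sup>+s. ennreal (level_density s) * indicator {a..} s \<partial>lborel) = ennreal (0 - (- superlevel_volume a))"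
  proof (rule nn_integral_FTC_atLeast)
    fix s assume "a \<le> s"
    then have "0 < s" using assms by simp
    from DERIV_minus[OF superlevel_volume_deriv[OF this]] show "((\<lambda>s. - superlevel_volume s) has_real_derivative
        level_density s) (at s)" by simp
  next
    show "((\<lambda>s. - superlevel_volume s) \<longlongrightarrow> 0) at_top" using tendsto_minus[OF superlevel_volume_at_top] by simp
  qed (auto simp: level_density_nonneg)
  then show ?thesis by simp
qed

text \<open>The image of Lebesgue measure is infinite near s = 0. Restricted to \<Gamma> \<ge> a it
  is finite on half-lines, and agreement there determines the measure.\<close>

lemma push_trunc:
  assumes "0 < a"
  shows "distr (density lborel (indicator {x. a \<le> \<Gamma> x})) borel \<Gamma> =
      density lborel (\<lambda>s. ennreal (level_density s) * indicator {a..} s)"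
    (is "?M = ?N")
proof (rule measure_eqI_lessThan)
  fix x
  have "emeasure ?M {x<..} = emeasure lborel {z. a \<le> \<Gamma> z \<and> x < \<Gamma> z}"
  proof -
    have "emeasure ?M {x<..} = (\<integral>\<^sup>+z. indicator {z. a \<le> \<Gamma> z} z * indicator (\<Gamma> -` {x<..}) z \<partial>lborel)"
      using measurable_sets[OF \<Gamma>_measurable, of "{x<..}"] by (simp add: emeasure_distr emeasure_density)
    also have "\<dots> = (\<integral>\<^sup>+z. indicator {z. a \<le> \<Gamma> z \<and> x < \<Gamma> z} z \<partial>lborel)"
      by (intro nn_integral_cong) (auto simp: indicator_def)
    finally show ?thesis by simp
  qed
  also have "\<dots> = ennreal (if x < a then superlevel_volume a else superlevel_volume x)"
  proof (cases "x < a")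
    case True
    then have "{z. a \<le> \<Gamma> z \<and> x < \<Gamma> z} = {z. a \<le> \<Gamma> z}" by auto
    then show ?thesis using emeasure_ball_superlevel_volume(1)[OF assms] True by simp
  next
    case False
    then have "{z. a \<le> \<Gamma> z \<and> x < \<Gamma> z} = {z. x < \<Gamma> z}" by auto
    then show ?thesis using emeasure_ball_superlevel_volume(2)[of x] assms False by simp
  qed
  finally have 1: "emeasure ?M {x<..} = ennreal (if x < a then superlevel_volume a else superlevel_volume x)" .
  have "emeasure ?N {x<..} = (\<integral>\<^sup>+s. ennreal (level_density s) * indicator {a..} s * indicator {x<..} s \<partial>lborel)"
    by (simp add: emeasure_density)
  also have "\<dots> = ennreal (if x < a then superlevel_volume a else superlevel_volume x)"
  proof (cases "x < a")
    case True
    then have "(\<integral>\<^sup>+s. ennreal (level_density s) * indicator {a..} s * indicator {x<..} s \<partial>lborel) =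
        (\<integral>\<^sup>+s. ennreal (level_density s) * indicator {a..} s \<partial>lborel)"
      by (intro nn_integral_cong) (auto simp: indicator_def)
    then show ?thesis using level_density_tail[OF assms] True by simp
  next
    case False
    have "AE s in lborel. s \<noteq> x" by (rule AE_lborel_singleton)
    then have "AE s in lborel. ennreal (level_density s) * indicator {a..} s * indicator {x<..} s =
        ennreal (level_density s) * indicator {x..} s"
      by eventually_elim (use False in \<open>auto simp: indicator_def\<close>)
    then have "(\<integral>\<^sup>+s. ennreal (level_density s) * indicator {a..} s * indicator {x<..} s \<partial>lborel) =
        (\<integral>\<^sup>+s. ennreal (level_density s) * indicator {x..} s \<partial>lborel)"
      by (rule nn_integral_cong_AE)
    then show ?thesis using level_density_tail[of x] assms False by simp
  qed
  finally have 2: "emeasure ?N {x<..} = ennreal (if x < a then superlevel_volume a else superlevel_volume x)" .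
  show "emeasure ?M {x<..} < \<infinity>" unfolding 1 by simp
  show "emeasure ?M {x<..} = emeasure ?N {x<..}" unfolding 1 2 ..
qed auto

text \<open>Monotone limit of the truncations as a \<rightarrow> 0. Only the origin lies outside all
  the sets {a \<le> \<Gamma>}, and it is a null set.\<close>

lemma distr_\<Gamma>: "distr lborel borel \<Gamma> = density lborel (\<lambda>s. ennreal (if 0 < s then level_density s else 0))"
proof (rule measure_eqI)
  fix A :: "real set" assume "A \<in> sets (distr lborel borel \<Gamma>)"
  then have A[measurable]: "A \<in> sets borel" by simp
  define a where "a n = 1 / real (Suc n)" for n
  have a: "0 < a n" for n by (simp add: a_def)
  have ex: "\<exists>n. a n \<le> s" if "0 < s" for s using nat_approx_posE[OF that] unfolding a_def by (metis less_imp_le)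
  have amono: "a n \<le> a m" if "m \<le> n" for m n using that by (simp add: a_def field_simps)
  have t: "emeasure lborel {x. a n \<le> \<Gamma> x \<and> \<Gamma> x \<in> A} =
      (\<integral>\<^sup>+s. ennreal (level_density s) * indicator {a n..} s * indicator A s \<partial>lborel)" for n
  proof -
    have "emeasure (distr (density lborel (indicator {x. a n \<le> \<Gamma> x})) borel \<Gamma>) A =
       (\<integral>\<^sup>+x. indicator {x. a n \<le> \<Gamma> x} x * indicator (\<Gamma> -` A) x \<partial>lborel)"
      using measurable_sets[OF \<Gamma>_measurable A] by (simp add: emeasure_distr emeasure_density)
    also have "\<dots> = (\<integral>\<^sup>+x. indicator {x. a n \<le> \<Gamma> x \<and> \<Gamma> x \<in> A} x \<partial>lborel)"
      by (intro nn_integral_cong) (auto simp: indicator_def)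
    also have "\<dots> = emeasure lborel {x. a n \<le> \<Gamma> x \<and> \<Gamma> x \<in> A}" by (rule nn_integral_indicator) measurable
    finally show ?thesis unfolding push_trunc[OF a] by (simp add: emeasure_density)
  qed
  have "emeasure (distr lborel borel \<Gamma>) A = emeasure lborel {x. \<Gamma> x \<in> A}"
    by (simp add: emeasure_distr vimage_def)
  also have "\<dots> = emeasure lborel (\<Union>n. {x. a n \<le> \<Gamma> x \<and> \<Gamma> x \<in> A})"
  proof (rule emeasure_eq_AE)
    have "AE x in lborel. x \<noteq> (0::real^'n)" by (rule AE_lborel_singleton)
    then show "AE x in lborel. (x \<in> {x. \<Gamma> x \<in> A}) = (x \<in> (\<Union>n. {x. a n \<le> \<Gamma> x \<and> \<Gamma> x \<in> A}))"
      by eventually_elim (use ex \<Gamma>_pos in auto)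
  qed auto
  also have "\<dots> = (SUP n. emeasure lborel {x. a n \<le> \<Gamma> x \<and> \<Gamma> x \<in> A})"
    by (rule SUP_emeasure_incseq[symmetric]) (auto simp: incseq_def intro: order_trans[OF amono])
  also have "\<dots> = (SUP n. \<integral>\<^sup>+s. ennreal (level_density s) * indicator {a n..} s * indicator A s \<partial>lborel)" by (simp add: t)
  also have "\<dots> = (\<integral>\<^sup>+s. (SUP n. ennreal (level_density s) * indicator {a n..} s * indicator A s) \<partial>lborel)"
  proof (rule nn_integral_monotone_convergence_SUP[symmetric])
    show "incseq (\<lambda>n s. ennreal (level_density s) * indicator {a n..} s * indicator A s)"
      by (auto simp: incseq_def le_fun_def indicator_def intro: order_trans[OF amono])
  qed measurable
  also have "\<dots> = (\<integral>\<^sup>+s. ennreal (if 0 < s then level_density s else 0) * indicator A s \<partial>lborel)"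
  proof (intro nn_integral_cong)
    fix s
    show "(SUP n. ennreal (level_density s) * indicator {a n..} s * indicator A s) =
        ennreal (if 0 < s then level_density s else 0) * indicator A s"
    proof (cases "0 < s")
      case True
      then obtain n where "a n \<le> s" using ex by blast
      then have "(SUP n. ennreal (level_density s) * indicator {a n..} s * indicator A s) =
          ennreal (level_density s) * indicator A s"
        by (intro antisym SUP_least SUP_upper2[of n]) (auto simp: indicator_def)
      then show ?thesis using True by simp
    next
      case False
      then have "\<not> a n \<le> s" for n using a[of n] by linarith
      then show ?thesis using False by simp
    qed
  qed
  also have "\<dots> = emeasure (density lborel (\<lambda>s. ennreal (if 0 < s then level_density s else 0))) A"
    by (simp add: emeasure_density)
  finally show "emeasure (distr lborel borel \<Gamma>) A =
      emeasure (density lborel (\<lambda>s. ennreal (if 0 < s then level_density s else 0))) A" .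
qed simp

lemma push_integral:
  fixes F :: "real \<Rightarrow> real"
  assumes [measurable]: "F \<in> borel_measurable borel"
  shows "integrable lborel (\<lambda>x. F (\<Gamma> x)) \<longleftrightarrow> integrable lborel (\<lambda>s. (if 0 < s then level_density s else 0) * F s)"
    and "(LINT x|lborel. F (\<Gamma> x)) = (LINT s|lborel. (if 0 < s then level_density s else 0) * F s)"
proof -
  have "integrable lborel (\<lambda>x. F (\<Gamma> x)) \<longleftrightarrow> integrable (distr lborel borel \<Gamma>) F"
    by (simp add: integrable_distr_eq)
  also have "\<dots> \<longleftrightarrow> integrable lborel (\<lambda>s. (if 0 < s then level_density s else 0) * F s)"
    unfolding distr_\<Gamma> by (subst integrable_real_density) (auto simp: level_density_nonneg)
  finally show "integrable lborel (\<lambda>x. F (\<Gamma> x)) \<longleftrightarrow> integrable lborel (\<lambda>s. (if 0 < s then level_density s else 0) * F s)" .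
  have "(LINT x|lborel. F (\<Gamma> x)) = integral\<^sup>L (distr lborel borel \<Gamma>) F" by (simp add: integral_distr)
  also have "\<dots> = (LINT s|lborel. (if 0 < s then level_density s else 0) * F s)"
    unfolding distr_\<Gamma> by (subst integral_real_density) (auto simp: level_density_nonneg)
  finally show "(LINT x|lborel. F (\<Gamma> x)) = (LINT s|lborel. (if 0 < s then level_density s else 0) * F s)" .
qed

end

section \<open>Radial functions\<close>

text \<open>The Hessian is continuous and vanishes outside a ball, hence is bounded, and the
  gradient is globally Lipschitz.\<close>

lemma C2_on_imp_C11_compact_support:
  fixes f :: "real^'n \<Rightarrow> real"
  assumes C2: "C2_on UNIV f" and supp: "\<And>x. R \<le> norm x \<Longrightarrow> f x = 0"
  shows "C11_compact_support f"
proof -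
  obtain g H where g: "\<And>x. GDERIV f x :> g x" and H: "\<And>x. (g has_derivative (\<lambda>h. H x *v h)) (at x)"
    and Hc: "continuous_on UNIV H"
    using C2 by (auto simp: C2_on_def)
  have o: "open {x::real^'n. R < norm x}" by (intro open_Collect_less continuous_intros)
  have g0: "g x = 0" if "R < norm x" for x
  proof -
    have "GDERIV f x :> 0"
      unfolding gderiv_def
    proof (rule has_derivative_transform_within_open[OF _ o])
      show "((\<lambda>_. 0) has_derivative (\<lambda>h. h \<bullet> 0)) (at x)" by simp
    qed (use supp that in auto)
    then have "h \<bullet> g x = 0" for h using g[of x] unfolding gderiv_def
      by (metis has_derivative_unique inner_zero_right)
    from this[of "g x"] show ?thesis by simp
  qed
  have H0: "(\<lambda>h. H x *v h) = (\<lambda>h. 0)" if "R < norm x" for x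
  proof -
    have "(g has_derivative (\<lambda>h. 0)) (at x)"
    proof (rule has_derivative_transform_within_open[OF _ o])
      show "((\<lambda>_. 0) has_derivative (\<lambda>h. 0)) (at x)" by simp
    qed (use g0 that in auto)
    with H[of x] show ?thesis by (rule has_derivative_unique)
  qed
  have "\<exists>B. \<forall>x\<in>cball 0 R. \<bar>H x $ i $ j\<bar> \<le> B" for i j
  proof -
    have "bounded ((\<lambda>x. H x $ i $ j) ` cball 0 R)"
      by (intro compact_imp_bounded compact_continuous_image continuous_on_subset[OF Hc] continuous_intros) auto
    then show ?thesis by (auto simp: bounded_iff)
  qed
  then obtain B where B: "\<And>i j x. x \<in> cball 0 R \<Longrightarrow> \<bar>H x $ i $ j\<bar> \<le> B i j" by metis
  define B0 where "B0 = (\<Sum>i\<in>UNIV. \<Sum>j\<in>UNIV. \<bar>B i j\<bar>)"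
  have B0: "\<bar>B i j\<bar> \<le> B0" for i j
  proof -
    have "\<bar>B i j\<bar> \<le> (\<Sum>j\<in>UNIV. \<bar>B i j\<bar>)" by (rule member_le_sum) auto
    also have "\<dots> \<le> B0" unfolding B0_def by (rule member_le_sum) (auto intro: sum_nonneg)
    finally show ?thesis .
  qed
  define L where "L = real CARD('n) * real CARD('n) * B0"
  have "0 \<le> B0" unfolding B0_def by (intro sum_nonneg) auto
  then have L0: "0 \<le> L" by (simp add: L_def)
  have on: "onorm ((*v) (H x)) \<le> L" for x
  proof (cases "R < norm x")
    case True
    then show ?thesis using H0[OF True] onorm_zero L0 by metis
  next
    case False
    then have "\<bar>H x $ i $ j\<bar> \<le> B0" for i j using B[of x i j] B0[of i j] by (auto intro: order_trans)
    then show ?thesis unfolding L_def by (intro onorm_le_matrix_component) auto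
  qed
  have "L-lipschitz_on UNIV g"
  proof (rule lipschitz_onI)
    fix x y
    have "norm (g x - g y) \<le> L * norm (x - y)"
      by (rule differentiable_bound[of UNIV g "\<lambda>x. (*v) (H x)"]) (use H on in auto)
    then show "dist (g x) (g y) \<le> L * dist x y" by (simp add: dist_norm)
  qed (rule L0)
  moreover have "compact (closure {x. f x \<noteq> 0})"
  proof -
    have "{x. f x \<noteq> 0} \<subseteq> cball 0 R" using supp by (force simp: not_le[symmetric])
    then have "bounded {x. f x \<noteq> 0}" by (rule bounded_subset[OF bounded_cball])
    then show ?thesis by (simp add: compact_closure)
  qed
  ultimately show ?thesis unfolding C11_compact_support_def using g by blast
qed

text \<open>The gradient and Hessian supplied by \<open>C2_on\<close> are unconstrained at 0. They
  are replaced by 0 near the origin, which agrees with them elsewhere by uniqueness of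
  derivatives.\<close>

lemma C2_on_constant_near_0:
  fixes f :: "real^'n \<Rightarrow> real"
  assumes C2: "C2_on (- {0}) f" and d: "0 < d" and c: "\<And>x. norm x < d \<Longrightarrow> f x = K"
  shows "C2_on UNIV f"
proof -
  obtain g H where g: "\<And>x. x \<noteq> 0 \<Longrightarrow> GDERIV f x :> g x"
    and H: "\<And>x. x \<noteq> 0 \<Longrightarrow> (g has_derivative (\<lambda>h. H x *v h)) (at x)"
    and Hc: "continuous_on (- {0}) H"
    using C2 unfolding C2_on_def by auto
  define g' where "g' x = (if norm x < d then 0 else g x)" for x
  define H' where "H' x = (if norm x < d then 0 else H x)" for x
  have o: "open (ball (0::real^'n) d)" by simp
  have gd: "GDERIV f x :> 0" if "norm x < d" for x
    unfolding gderiv_def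
  proof (rule has_derivative_transform_within_open[OF _ o])
    show "((\<lambda>_. K) has_derivative (\<lambda>h. h \<bullet> 0)) (at x)" by simp
  qed (use c that in auto)
  have g0: "g x = 0" if "norm x < d" "x \<noteq> 0" for x
  proof -
    have "h \<bullet> g x = 0" for h using g[OF that(2)] gd[OF that(1)] unfolding gderiv_def
      by (metis has_derivative_unique inner_zero_right)
    from this[of "g x"] show ?thesis by simp
  qed
  have g'eq: "g' x = g x" if "x \<noteq> 0" for x using g0[OF _ that] by (simp add: g'_def)
  have H'd: "(g' has_derivative (\<lambda>h. H' x *v h)) (at x)" for x
  proof (cases "norm x < d")
    case True
    have "(g' has_derivative (\<lambda>h. 0)) (at x)"
    proof (rule has_derivative_transform_within_open[OF _ o])
      show "((\<lambda>_. 0) has_derivative (\<lambda>h. 0)) (at x)" by simp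
    qed (use True in \<open>auto simp: g'_def\<close>)
    then show ?thesis using True by (simp add: H'_def)
  next
    case False
    then have x: "x \<noteq> 0" using d by auto
    have "(g' has_derivative (\<lambda>h. H x *v h)) (at x)"
      by (rule has_derivative_transform_within_open[OF H[OF x], of "- {0}"]) (use x g'eq in \<open>auto simp: open_Compl\<close>)
    then show ?thesis using False by (simp add: H'_def)
  qed
  have H'eq: "H' x = H x" if "x \<noteq> 0" for x
  proof -
    have "(g' has_derivative (\<lambda>h. H x *v h)) (at x)"
      by (rule has_derivative_transform_within_open[OF H[OF that], of "- {0}"]) (use that g'eq in \<open>auto simp: open_Compl\<close>)
    with H'd[of x] have "(\<lambda>h. H' x *v h) = (\<lambda>h. H x *v h)" by (rule has_derivative_unique)
    then show ?thesis by (metis matrix_of_matrix_vector_mul)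
  qed
  have "continuous_on (ball 0 d \<union> - {0}) H'"
  proof (rule continuous_on_open_Un)
    show "continuous_on (ball 0 d) H'"
      by (rule continuous_on_eq[OF continuous_on_const[of _ 0]]) (auto simp: H'_def)
    show "continuous_on (- {0}) H'" by (rule continuous_on_eq[OF Hc]) (auto simp: H'eq)
  qed (auto simp: open_Compl)
  moreover have "ball 0 d \<union> - {0} = (UNIV :: (real^'n) set)" using d by auto
  moreover have "GDERIV f x :> g' x" for x
  proof (cases "norm x < d")
    case False
    then have "x \<noteq> 0" using d by auto
    then show ?thesis using g False by (simp add: g'_def)
  qed (simp add: g'_def gd)
  ultimately show ?thesis unfolding C2_on_def using H'd by (intro exI[of _ g'] exI[of _ H']) auto
qed

section \<open>Derivatives of functions of the fundamental solution\<close>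

context big_dim begin

definition green_grad_coeff :: "real^'n \<Rightarrow> real" where "green_grad_coeff x = - (1 / sphere_area) * norm x powr (- N)"

lemma \<Gamma>_GDERIV:
  assumes "x \<noteq> 0" shows "GDERIV \<Gamma> x :> green_grad_coeff x *\<^sub>R x"
proof -
  have "GDERIV (\<lambda>x. green_coeff * norm x powr (2 - N)) x :> (green_coeff * ((2 - N) * norm x powr (2 - N - 1))) *\<^sub>R sgn x"
    using assms by (intro GDERIV_DERIV_compose[OF GDERIV_norm] DERIV_cmult has_real_derivative_powr) auto
  moreover have "(green_coeff * ((2 - N) * norm x powr (2 - N - 1))) *\<^sub>R sgn x = green_grad_coeff x *\<^sub>R x"
  proof -
    have "norm x powr (2 - N - 1) = norm x powr (- N) * norm x powr 1"
      using powr_add[of "norm x" "- N" 1] by simp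
    then have "norm x powr (2 - N - 1) * inverse (norm x) = norm x powr (- N)" using assms by simp
    moreover have "green_coeff * (2 - N) = - (1 / sphere_area)" using N2 sphere_area_pos
        by (simp add: green_coeff_def field_simps)
    ultimately show ?thesis by (simp add: sgn_div_norm green_grad_coeff_def mult.assoc[symmetric])
  qed
  moreover have "\<Gamma> = (\<lambda>x. green_coeff * norm x powr (2 - N))" by (auto simp: \<Gamma>_eq)
  ultimately show ?thesis by metis
qed

lemma green_grad_coeff_GDERIV:
  assumes "x \<noteq> 0" shows "GDERIV green_grad_coeff x :> (N / sphere_area * norm x powr (- N - 2)) *\<^sub>R x"
proof -
  have "GDERIV (\<lambda>x. - (1 / sphere_area) * norm x powr (- N)) x :> (- (1 / sphere_area) * (- N * norm x powr (- N - 1))) *\<^sub>R sgn x"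
    using assms by (intro GDERIV_DERIV_compose[OF GDERIV_norm] DERIV_cmult has_real_derivative_powr) auto
  moreover have "(- (1 / sphere_area) * (- N * norm x powr (- N - 1))) *\<^sub>R sgn x =
      (N / sphere_area * norm x powr (- N - 2)) *\<^sub>R x"
  proof -
    have "norm x powr (- N - 1) = norm x powr (- N - 2) * norm x powr 1"
    proof -
      have "- N - 2 + 1 = - N - 1" by simp
      then show ?thesis using powr_add[of "norm x" "- N - 2" 1] by metis
    qed
    then have "norm x powr (- N - 1) * inverse (norm x) = norm x powr (- N - 2)" using assms by simp
    then show ?thesis by (simp add: sgn_div_norm)
  qed
  moreover have "green_grad_coeff = (\<lambda>x. - (1 / sphere_area) * norm x powr (- N))" by (auto simp: green_grad_coeff_def)
  ultimately show ?thesis by metis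
qed

text \<open>The left side is |\<nabla>\<Gamma>|^2, since the gradient of \<Gamma> at x is
  \<open>green_grad_coeff x\<close> times x.\<close>

lemma green_grad_coeff_square: "x \<noteq> 0 \<Longrightarrow> (green_grad_coeff x)\<^sup>2 * (norm x)\<^sup>2 = 1 / level_density (\<Gamma> x)"
proof -
  assume x: "x \<noteq> 0"
  have "norm x powr (- N) * norm x = norm x powr (- (N - 1))"
    using powr_add[of "norm x" "- N" 1] x by simp
  then have "green_grad_coeff x * norm x = - (1 / sphere_area) * norm x powr (- (N - 1))" by (simp add: green_grad_coeff_def)
  then have "(green_grad_coeff x * norm x)\<^sup>2 = (1 / (sphere_area * norm x powr (N - 1)))\<^sup>2"
    by (simp only: powr_minus divide_inverse) (simp add: power_mult_distrib)
  then show ?thesis by (simp add: level_density_\<Gamma>[OF x] power_mult_distrib power_one_over)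
qed

lemma green_grad_coeff_continuous: "continuous_on (- {0}) green_grad_coeff"
  unfolding green_grad_coeff_def by (intro continuous_intros) auto

lemma \<Gamma>_continuous: "continuous_on (- {0}) \<Gamma>"
  unfolding \<Gamma>_eq[abs_def] by (intro continuous_intros) auto

text \<open>The Laplacian of W(\<Gamma>) is W''(\<Gamma>) |\<nabla>\<Gamma>|^2 + W'(\<Gamma>)
  \<Delta>\<Gamma>, and \<Gamma> is harmonic off the origin.\<close>

lemma radial_C2:
  assumes W1: "\<And>s. 0 < s \<Longrightarrow> (W has_real_derivative W' s) (at s)"
    and W2: "\<And>s. 0 < s \<Longrightarrow> (W' has_real_derivative W'' s) (at s)"
    and cW: "continuous_on {0<..} W''"
  shows "C2_on (- {0}) (\<lambda>x. W (\<Gamma> x))"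
    and "x \<noteq> 0 \<Longrightarrow> laplacian (\<lambda>x. W (\<Gamma> x)) x = W'' (\<Gamma> x) / level_density (\<Gamma> x)"
proof -
  define g where "g x = (W' (\<Gamma> x) * green_grad_coeff x) *\<^sub>R x" for x
  define a where "a x = W' (\<Gamma> x) * green_grad_coeff x" for x
  define b where "b x = W'' (\<Gamma> x) * (green_grad_coeff x)\<^sup>2 + W' (\<Gamma> x) * (N / sphere_area * norm x powr (- N - 2))" for x
      :: "real^'n"
  \<comment> \<open>The Hessian of a radial function is a multiple of the identity plus a multiple
    of the rank one matrix x x^T; its trace is N a + b |x|^2.\<close>
  define H where "H x = (\<chi> i j. (if i = j then a x else 0) + b x * x $ i * x $ j)" for x :: "real^'n"
  have Hv: "H x *v h = a x *\<^sub>R h + (b x * (h \<bullet> x)) *\<^sub>R x" for x h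
  proof (rule vec_eq_iff[THEN iffD2], rule allI)
    fix i
    have "(H x *v h) $ i = (\<Sum>j\<in>UNIV. (if i = j then a x * h $ j else 0) + b x * x $ i * (h $ j * x $ j))"
      unfolding matrix_vector_mult_def H_def by (simp, intro sum.cong) (auto simp: algebra_simps)
    also have "\<dots> = a x * h $ i + b x * x $ i * (h \<bullet> x)"
      by (simp add: sum.distrib sum_distrib_left inner_vec_def)
    finally show "(H x *v h) $ i = (a x *\<^sub>R h + (b x * (h \<bullet> x)) *\<^sub>R x) $ i" by simp
  qed
  have g: "GDERIV (\<lambda>x. W (\<Gamma> x)) x :> g x" if "x \<noteq> 0" for x
    using GDERIV_DERIV_compose[OF \<Gamma>_GDERIV[OF that] W1[OF \<Gamma>_pos[OF that]]] by (simp add: g_def)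
  have Hd: "(g has_derivative (\<lambda>h. H x *v h)) (at x)" if "x \<noteq> 0" for x
  proof -
    have d1: "((\<lambda>x. W' (\<Gamma> x)) has_derivative (\<lambda>h. h \<bullet> (W'' (\<Gamma> x) *\<^sub>R (green_grad_coeff x *\<^sub>R x)))) (at x)"
      using GDERIV_DERIV_compose[OF \<Gamma>_GDERIV[OF that] W2[OF \<Gamma>_pos[OF that]]] by (simp add: gderiv_def)
    have d2: "(green_grad_coeff has_derivative (\<lambda>h. h \<bullet> ((N / sphere_area * norm x powr (- N - 2)) *\<^sub>R x))) (at x)"
      using green_grad_coeff_GDERIV[OF that] by (simp add: gderiv_def)
    show ?thesis unfolding g_def[abs_def]
      by (rule has_derivative_eq_rhs[OF has_derivative_scaleR[OF has_derivative_mult[OF d1 d2] has_derivative_ident]])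
         (simp add: Hv fun_eq_iff a_def b_def power2_eq_square algebra_simps)
  qed
  have cg: "continuous_on (- {0}) (\<lambda>x. W'' (\<Gamma> x))"
    by (rule continuous_on_compose2[OF cW \<Gamma>_continuous]) (auto intro!: \<Gamma>_pos)
  have "continuous_on {0<..} W'"
    using W2 by (intro DERIV_continuous_on) (auto intro: has_field_derivative_at_within)
  then have cg1: "continuous_on (- {0}) (\<lambda>x. W' (\<Gamma> x))"
    by (rule continuous_on_compose2[OF _ \<Gamma>_continuous]) (auto intro!: \<Gamma>_pos)
  have ca: "continuous_on (- {0}) a" unfolding a_def by (intro continuous_intros cg1 green_grad_coeff_continuous)
  have cb: "continuous_on (- {0}) b" unfolding b_def by (intro continuous_intros cg1 green_grad_coeff_continuous cg) auto
  have cH: "continuous_on (- {0}) H"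
    unfolding H_def
  proof (intro continuous_on_vec_lambda)
    fix i j
    show "continuous_on (- {0}) (\<lambda>x. (if i = j then a x else 0) + b x * x $ i * x $ j)"
      by (cases "i = j") (auto intro!: continuous_intros ca cb)
  qed
  show "C2_on (- {0}) (\<lambda>x. W (\<Gamma> x))"
    unfolding C2_on_def using g Hd cH by (intro exI[of _ g] exI[of _ H]) auto
  assume x: "x \<noteq> 0"
  have "laplacian (\<lambda>x. W (\<Gamma> x)) x = (\<Sum>i\<in>UNIV. H x $ i $ i)"
    by (rule laplacian_C2[of "- {0}"]) (use x g Hd in \<open>auto simp: open_Compl\<close>)
  also have "\<dots> = N * a x + b x * (norm x)\<^sup>2"
    by (simp add: H_def sum.distrib N_eq power2_norm_eq_inner inner_vec_def sum_distrib_left mult.assoc)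
  also have "\<dots> = W'' (\<Gamma> x) * ((green_grad_coeff x)\<^sup>2 * (norm x)\<^sup>2)"
  proof -
    have "norm x powr (- N - 2) * (norm x)\<^sup>2 = norm x powr (- N)"
      using x powr_add[of "norm x" "- N - 2" 2] by (simp add: powr_numeral)
    \<comment> \<open>This cancellation is the harmonicity of \<Gamma>.\<close>
    then have "N * a x + W' (\<Gamma> x) * (N / sphere_area * norm x powr (- N - 2)) * (norm x)\<^sup>2 = 0"
      using sphere_area_pos by (simp add: a_def green_grad_coeff_def field_simps)
    then show ?thesis by (simp add: b_def algebra_simps)
  qed
  finally show "laplacian (\<lambda>x. W (\<Gamma> x)) x = W'' (\<Gamma> x) / level_density (\<Gamma> x)" using green_grad_coeff_square[OF x] by simp
qed

lemma laplacian_const_nbhd: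
  fixes f :: "real^'n \<Rightarrow> real"
  assumes "0 < d" "\<And>x. norm x < d \<Longrightarrow> f x = K"
  shows "laplacian f 0 = 0"
proof -
  have "laplacian f 0 = (\<Sum>i\<in>(UNIV::'n set). (0::real^'n^'n) $ i $ i)"
  proof (rule laplacian_C2[of "ball 0 d" 0 f "\<lambda>_. 0" "\<lambda>_. 0"])
    fix x :: "real^'n" assume x: "x \<in> ball 0 d"
    show "GDERIV f x :> 0" unfolding gderiv_def
    proof (rule has_derivative_transform_within_open[of "\<lambda>_. K" _ _ _ "ball 0 d"])
      show "((\<lambda>_. K) has_derivative (\<lambda>h. h \<bullet> 0)) (at x)" by simp
    qed (use assms x in auto)
  qed (use assms in auto)
  then show ?thesis by simp
qed

text \<open>Flat for large arguments means constant near the origin. As \<Gamma> is 0 there, the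
  value at the origin has to be supplied separately.\<close>

lemma radial_C2_UNIV:
  assumes W1: "\<And>s. 0 < s \<Longrightarrow> (W has_real_derivative W' s) (at s)"
    and W2: "\<And>s. 0 < s \<Longrightarrow> (W' has_real_derivative W'' s) (at s)"
    and cW: "continuous_on {0<..} W''"
    and M: "0 < M" "\<And>s. M \<le> s \<Longrightarrow> W s = K"
  defines "U \<equiv> \<lambda>x. if x = 0 then K else W (\<Gamma> x)"
  shows "C2_on UNIV U"
    and "x \<noteq> 0 \<Longrightarrow> laplacian U x = W'' (\<Gamma> x) / level_density (\<Gamma> x)" "laplacian U 0 = 0"
proof -
  have c: "U x = K" if "norm x < level_radius M" for x
    using that \<Gamma>_gt_iff[OF M(1), of x] M(2)[of "\<Gamma> x"] by (auto simp: U_def)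
  obtain g H where gH: "\<And>x. x \<noteq> 0 \<Longrightarrow> GDERIV (\<lambda>x. W (\<Gamma> x)) x :> g x"
    "\<And>x. x \<noteq> 0 \<Longrightarrow> (g has_derivative (\<lambda>h. H x *v h)) (at x)" "continuous_on (- {0}) H"
    using radial_C2(1)[OF W1 W2 cW] unfolding C2_on_def by auto
  have gU: "GDERIV U x :> g x" if "x \<noteq> 0" for x
    unfolding gderiv_def
    by (rule has_derivative_transform_within_open[OF gH(1)[OF that, unfolded gderiv_def], of "- {0}"])
       (use that in \<open>auto simp: U_def open_Compl\<close>)
  have "C2_on (- {0}) U" unfolding C2_on_def using gU gH by (intro exI[of _ g] exI[of _ H]) auto
  then show "C2_on UNIV U" using level_radius_pos[OF M(1)] c by (rule C2_on_constant_near_0)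
  show "laplacian U 0 = 0" by (rule laplacian_const_nbhd[OF level_radius_pos[OF M(1)] c])
  assume x: "x \<noteq> 0"
  have "laplacian U x = (\<Sum>i\<in>UNIV. H x $ i $ i)"
    by (rule laplacian_C2[of "- {0}"]) (use x gU gH in \<open>auto simp: open_Compl\<close>)
  also have "\<dots> = laplacian (\<lambda>x. W (\<Gamma> x)) x"
    by (rule laplacian_C2[of "- {0}", symmetric]) (use x gH in \<open>auto simp: open_Compl\<close>)
  finally show "laplacian U x = W'' (\<Gamma> x) / level_density (\<Gamma> x)" using radial_C2(2)[OF W1 W2 cW x] by simp
qed

end

section \<open>Radial mollifiers\<close>

lemma DERIV_pos_part_square:
  "((\<lambda>y::real. (max 0 y)\<^sup>2) has_real_derivative 2 * max 0 y) (at y)"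
proof -
  consider "y < 0" | "y = 0" | "0 < y" by linarith
  then show ?thesis
  proof cases
    case 1
    have "((\<lambda>y::real. 0) has_real_derivative 0) (at y)" by simp
    then show ?thesis using 1
      by (subst DERIV_cong_ev[OF refl _ refl, of _ "\<lambda>_. 0"])
         (auto intro!: eventually_nhds_in_open[of "{..<0}" y, THEN eventually_mono])
  next
    case 2
    have "((\<lambda>h::real. ((max 0 h)\<^sup>2 - (max 0 0)\<^sup>2) / (h - 0)) \<longlongrightarrow> 0) (at 0)"
    proof (rule Lim_null_comparison[where g="\<lambda>h. \<bar>h\<bar>"])
      show "\<forall>\<^sub>F h::real in at 0. norm (((max 0 h)\<^sup>2 - (max 0 0)\<^sup>2) / (h - 0)) \<le> \<bar>h\<bar>"
        by (intro always_eventually allI) (auto simp: max_def power2_eq_square)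
      show "((\<lambda>h::real. \<bar>h\<bar>) \<longlongrightarrow> 0) (at 0)" by (intro tendsto_rabs_zero tendsto_ident_at)
    qed
    then show ?thesis using 2 by (simp add: has_field_derivative_iff)
  next
    case 3
    have "((\<lambda>y::real. y\<^sup>2) has_real_derivative 2 * y) (at y)" by (auto intro!: derivative_eq_intros)
    then show ?thesis using 3
      by (subst DERIV_cong_ev[OF refl _ refl, of _ "\<lambda>y. y\<^sup>2"])
         (auto intro!: eventually_nhds_in_open[of "{0<..}" y, THEN eventually_mono])
  qed
qed

text \<open>A C^1 step from 1 on (-\<infinity>,1] to 0 on [2,\<infinity>). One continuous derivative
  is enough, because it enters only as the slope of a profile that has to be C^2.\<close>

definition cutoff :: "real \<Rightarrow> real" where
  "cutoff y = (max 0 (1 - (max 0 (y - 1))\<^sup>2))\<^sup>2"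

definition cutoff' :: "real \<Rightarrow> real" where
  "cutoff' y = - 4 * max 0 (1 - (max 0 (y - 1))\<^sup>2) * max 0 (y - 1)"

lemma cutoff_deriv: "(cutoff has_real_derivative cutoff' y) (at y)"
proof -
  have 1: "((\<lambda>y. 1 - (max 0 (y - 1))\<^sup>2) has_real_derivative (0 - 2 * max 0 (y - 1) * 1)) (at y)"
    by (intro DERIV_diff DERIV_const DERIV_chain2[OF DERIV_pos_part_square]) (auto intro!: derivative_eq_intros)
  show ?thesis
    unfolding cutoff_def[abs_def] cutoff'_def
    by (rule DERIV_cong[OF DERIV_chain2[OF DERIV_pos_part_square 1]]) simp
qed

lemma cutoff_1: "y \<le> 1 \<Longrightarrow> cutoff y = 1" by (simp add: cutoff_def max_def)
lemma cutoff_2: "2 \<le> y \<Longrightarrow> cutoff y = 0"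
proof -
  assume y: "2 \<le> y"
  then have "1 \<le> (y - 1)\<^sup>2" by (simp add: one_le_power)
  then have "max 0 (1 - (y - 1)\<^sup>2) = 0" by linarith
  then show ?thesis using y by (simp add: cutoff_def)
qed
lemma cutoff_nonneg: "0 \<le> cutoff y" by (simp add: cutoff_def)
lemma cutoff_le_1: "cutoff y \<le> 1"
  unfolding cutoff_def by (intro power_le_one) auto
lemma cutoff'_nonpos: "cutoff' y \<le> 0" by (simp add: cutoff'_def)
lemma cutoff'_1: "y \<le> 1 \<Longrightarrow> cutoff' y = 0" by (simp add: cutoff'_def)
lemma cutoff'_2: "2 \<le> y \<Longrightarrow> cutoff' y = 0"
proof -
  assume y: "2 \<le> y"
  then have "1 \<le> (y - 1)\<^sup>2" by (simp add: one_le_power)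
  then have "max 0 (1 - (y - 1)\<^sup>2) = 0" by linarith
  then show ?thesis using y by (simp add: cutoff'_def)
qed
lemma cutoff'_continuous: "continuous_on S cutoff'"
  unfolding cutoff'_def by (intro continuous_intros)
lemma cutoff_continuous: "continuous_on S cutoff"
  unfolding cutoff_def by (intro continuous_intros)
lemma cutoff_antimono: "x \<le> y \<Longrightarrow> cutoff y \<le> cutoff x"
  unfolding cutoff_def by (intro power_mono max.mono diff_left_mono) auto
lemma cutoff_measurable [measurable]: "cutoff \<in> borel_measurable borel" "cutoff' \<in> borel_measurable borel"
  using cutoff_continuous cutoff'_continuous by (auto intro: borel_measurable_continuous_onI)

lemma integrable_continuous_bounded_support:
  fixes f :: "real \<Rightarrow> real"
  assumes [measurable]: "f \<in> borel_measurable borel" and b: "\<And>t. \<bar>f t\<bar> \<le> C"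
    and z: "\<And>t. t \<le> 0 \<or> b \<le> t \<Longrightarrow> f t = 0"
  shows "integrable lborel f"
proof (rule Bochner_Integration.integrable_bound)
  show "integrable lborel (\<lambda>t. C * indicator {0..b} t :: real)"
    by (intro integrable_mult_right integrable_real_indicator) (cases "0 \<le> b"; simp)+
  show "AE t in lborel. norm (f t) \<le> norm (C * indicat_real {0..b} t)"
  proof (intro always_eventually allI)
    fix t show "norm (f t) \<le> norm (C * indicat_real {0..b} t)"
      using b[of t] z[of t] by (cases "t \<in> {0..b}") auto
  qed
qed measurable

context big_dim begin

text \<open>- cutoff'(s/M)/M is a probability density on the half-line; division by
  \<open>level_density\<close> makes it the \<Gamma>-marginal of a radial probability density in
  space. Its support lies in the shell M \<le> \<Gamma> \<le> 2 M, which shrinks to the origin as M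
  \<rightarrow> \<infinity> and escapes to infinity as M \<rightarrow> 0.\<close>

definition mollifier :: "real \<Rightarrow> real^'n \<Rightarrow> real" where
  "mollifier M x = - cutoff' (\<Gamma> x / M) / M / level_density (\<Gamma> x)"

lemma mollifier_measurable [measurable]: "mollifier M \<in> borel_measurable borel"
  unfolding mollifier_def[abs_def] by measurable

lemma mollifier_nonneg: "0 < M \<Longrightarrow> 0 \<le> mollifier M x"
  unfolding mollifier_def using cutoff'_nonpos level_density_nonneg by (intro divide_nonneg_nonneg) auto

lemma mollifier_support: "0 < M \<Longrightarrow> mollifier M x \<noteq> 0 \<Longrightarrow> M < \<Gamma> x \<and> \<Gamma> x < 2 * M"
  using cutoff'_1[of "\<Gamma> x / M"] cutoff'_2[of "\<Gamma> x / M"] by (auto simp: mollifier_def field_simps not_less[symmetric])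

lemma cutoff_mass:
  assumes M: "0 < M"
  shows "integrable lborel (\<lambda>s. - cutoff' (s / M) / M)" "(LINT s|lborel. - cutoff' (s / M) / M) = 1"
proof -
  have ex: "- cutoff' (s / M) / M = indicator {0..2*M} s * (- cutoff' (s / M) / M)" for s
  proof (cases "s \<in> {0..2*M}")
    case False
    then have "s / M \<le> 1 \<or> 2 \<le> s / M" using M by (auto simp: field_simps)
    then show ?thesis using cutoff'_1[of "s / M"] cutoff'_2[of "s / M"] by auto
  qed simp
  have "((\<lambda>s. - cutoff' (s / M) / M) has_integral (- cutoff (2 * M / M) - (- cutoff (0 / M)))) {0..2*M}"
  proof (rule fundamental_theorem_of_calculus)
    fix x
    have "((\<lambda>s. - cutoff (s / M)) has_real_derivative (- cutoff' (x / M) / M)) (at x)"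
      using M by (auto intro!: derivative_eq_intros DERIV_chain2[OF cutoff_deriv])
    then show "((\<lambda>s. - cutoff (s / M)) has_vector_derivative (- cutoff' (x / M) / M)) (at x within {0..2*M})"
      by (simp add: has_field_derivative_at_within has_real_derivative_iff_has_vector_derivative[symmetric])
  qed (use M in auto)
  from integral_unique[OF this] have I: "integral {0..2*M} (\<lambda>s. - cutoff' (s / M) / M) = 1"
    using M by (simp only: cutoff_1 cutoff_2) (simp add: cutoff_1 cutoff_2)
  have si: "set_integrable lborel {0..2*M} (\<lambda>s. - cutoff' (s / M) / M)"
    unfolding set_integrable_def
    by (intro borel_integrable_compact continuous_intros continuous_on_compose2[OF cutoff'_continuous]) (use M in auto)
  have f: "(\<lambda>s. indicat_real {0..2*M} s *\<^sub>R (- cutoff' (s / M) / M)) = (\<lambda>s. - cutoff' (s / M) / M)"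
    using ex by (intro ext) (metis real_scaleR_def)
  show "integrable lborel (\<lambda>s. - cutoff' (s / M) / M)" using si unfolding set_integrable_def f .
  show "(LINT s|lborel. - cutoff' (s / M) / M) = 1"
    using set_borel_integral_eq_integral(2)[OF si] unfolding I set_lebesgue_integral_def f .
qed

lemma mollifier_mass:
  assumes M: "0 < M"
  shows "integrable lborel (mollifier M)" "(LINT x|lborel. mollifier M x) = 1"
proof -
  have "(if 0 < s then level_density s else 0) * (- cutoff' (s / M) / M / level_density s) = - cutoff' (s / M) / M" for s
    using level_density_pos[of s] cutoff'_1[of "s / M"] M by (cases "0 < s") (auto simp: field_simps)
  then show "integrable lborel (mollifier M)" "(LINT x|lborel. mollifier M x) = 1"
    using push_integral[of "\<lambda>s. - cutoff' (s / M) / M / level_density s"] cutoff_mass[OF M]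
    by (simp_all add: mollifier_def[abs_def])
qed

lemma mollifier_bound:
  assumes [measurable]: "h \<in> borel_measurable borel" and M: "0 < M"
    and b: "\<And>x. x \<noteq> 0 \<Longrightarrow> norm x < level_radius M \<Longrightarrow> \<bar>h x\<bar> \<le> e"
  shows "integrable lborel (\<lambda>x. mollifier M x * h x)" "\<bar>LINT x|lborel. mollifier M x * h x\<bar> \<le> e"
proof -
  have *: "\<bar>mollifier M x * h x\<bar> \<le> mollifier M x * e" for x
  proof (cases "mollifier M x = 0")
    case False
    then have "x \<noteq> 0" "norm x < level_radius M" using mollifier_support[OF M] \<Gamma>_gt_iff[OF M, of x] by auto
    then show ?thesis using b[of x] mollifier_nonneg[OF M, of x] by (simp add: abs_mult mult_left_mono)
  qed simp
  show i: "integrable lborel (\<lambda>x. mollifier M x * h x)"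
    by (rule Bochner_Integration.integrable_bound[OF integrable_mult_left[OF mollifier_mass(1)[OF M]]])
       (use * in \<open>auto intro: order_trans[OF _ abs_ge_self]\<close>)
  have "\<bar>LINT x|lborel. mollifier M x * h x\<bar> \<le> (LINT x|lborel. mollifier M x * e)"
    by (rule integral_abs_bound_integral) (use i * mollifier_mass(1)[OF M] in auto)
  then show "\<bar>LINT x|lborel. mollifier M x * h x\<bar> \<le> e" using mollifier_mass(2)[OF M] by simp
qed

text \<open>Approximate identity at the origin: \<Gamma> > M means |x| < level_radius M, which tends
  to 0. The value h(0) never enters.\<close>

lemma mollifier_limit:
  fixes h :: "real^'n \<Rightarrow> real"
  assumes [measurable]: "h \<in> borel_measurable borel" and l: "(h \<longlongrightarrow> l) (at 0)"
  shows "\<forall>\<^sub>F M in at_top. integrable lborel (\<lambda>x. mollifier M x * h x)"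
    "((\<lambda>M. LINT x|lborel. mollifier M x * h x) \<longlongrightarrow> l) at_top"
proof -
  have key: "\<forall>\<^sub>F M in at_top. integrable lborel (\<lambda>x. mollifier M x * h x) \<and> \<bar>(LINT x|lborel. mollifier M x * h x) - l\<bar> \<le>
      e" if e: "0 < e" for e
  proof -
    obtain d where d: "0 < d" "\<And>x. x \<noteq> 0 \<Longrightarrow> norm x < d \<Longrightarrow> \<bar>h x - l\<bar> < e"
      using tendstoD[OF l e] by (auto simp: eventually_at dist_real_def)
    have "\<forall>\<^sub>F M in at_top. level_radius M < d" using level_radius_at_top d(1) by (rule order_tendstoD)
    moreover have "\<forall>\<^sub>F M in at_top. 0 < (M::real)" by (rule eventually_gt_at_top)
    ultimately show ?thesis
    proof eventually_elim
      case (elim M)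
      have b: "integrable lborel (\<lambda>x. mollifier M x * (h x - l))" "\<bar>LINT x|lborel. mollifier M x * (h x - l)\<bar> \<le> e"
      proof -
        have hb: "\<bar>h x - l\<bar> \<le> e" if "x \<noteq> 0" "norm x < level_radius M" for x using d(2)[of x] that elim by simp
        show "integrable lborel (\<lambda>x. mollifier M x * (h x - l))" "\<bar>LINT x|lborel. mollifier M x * (h x - l)\<bar> \<le> e"
          by (rule mollifier_bound[OF _ elim(2) hb]; simp)+
      qed
      have eq: "mollifier M x * h x = mollifier M x * (h x - l) + mollifier M x * l" for x by (simp add: algebra_simps)
      have i2: "integrable lborel (\<lambda>x. mollifier M x * l)" using mollifier_mass(1)[OF elim(2)] by simp
      have "(LINT x|lborel. mollifier M x * h x) = (LINT x|lborel. mollifier M x * (h x - l)) + l"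
        unfolding eq using b(1) i2 mollifier_mass(2)[OF elim(2)] by (subst Bochner_Integration.integral_add) auto
      moreover have "integrable lborel (\<lambda>x. mollifier M x * h x)" unfolding eq using b(1) i2
          by (rule Bochner_Integration.integrable_add)
      ultimately show ?case using b(2) by simp
    qed
  qed
  show "\<forall>\<^sub>F M in at_top. integrable lborel (\<lambda>x. mollifier M x * h x)" using key[of 1] by (auto elim: eventually_mono)
  show "((\<lambda>M. LINT x|lborel. mollifier M x * h x) \<longlongrightarrow> l) at_top"
  proof (rule tendstoI)
    fix e :: real assume "0 < e"
    then have "\<forall>\<^sub>F M in at_top. integrable lborel (\<lambda>x. mollifier M x * h x) \<and> \<bar>(LINT x|lborel. mollifier M x * h x) - l\<bar>
        \<le> e / 2" by (intro key) simp
    then show "\<forall>\<^sub>F M in at_top. dist (LINT x|lborel. mollifier M x * h x) l < e"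
      by eventually_elim (use \<open>0 < e\<close> in \<open>auto simp: dist_real_def\<close>)
  qed
qed

end

section \<open>The weak formulation for radial functions\<close>

lemma integrable_powr_to_inf:
  fixes a e :: real
  assumes "0 < a" "e < -1"
  shows "integrable lborel (\<lambda>x. if a \<le> x then x powr e else 0)"
proof -
  have "(\<lambda>x. x powr e) integrable_on {a..}"
    using has_integral_powr_to_inf[OF assms(2,1)] by blast
  then have "(\<lambda>x. x powr e) absolutely_integrable_on {a..}"
    by (intro nonnegative_absolutely_integrable_1) auto
  moreover have "(\<lambda>x. indicat_real {a..} x *\<^sub>R x powr e) = (\<lambda>x. if a \<le> x then x powr e else 0)"
    by (auto simp: fun_eq_iff indicator_def)
  ultimately have "integrable lebesgue (\<lambda>x. if a \<le> x then x powr e else 0)"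
    unfolding set_integrable_def by metis
  then show ?thesis by (subst (asm) integrable_completion) auto
qed

lemma integrable_powr_from_0:
  fixes a e :: real
  assumes "0 \<le> a" "-1 < e"
  shows "integrable lborel (\<lambda>x. if 0 < x \<and> x \<le> a then x powr e else 0)"
proof -
  have "(\<lambda>x. x powr e) integrable_on {0..a}"
    using has_integral_powr_from_0[OF assms(2,1)] by blast
  then have "(\<lambda>x. x powr e) absolutely_integrable_on {0..a}"
    by (intro nonnegative_absolutely_integrable_1) auto
  moreover have "(\<lambda>x. indicat_real {0..a} x *\<^sub>R x powr e) = (\<lambda>x. if 0 < x \<and> x \<le> a then x powr e else 0)"
    by (auto simp: fun_eq_iff indicator_def)
  ultimately have "integrable lebesgue (\<lambda>x. if 0 < x \<and> x \<le> a then x powr e else 0)"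
    unfolding set_integrable_def by metis
  then show ?thesis by (subst (asm) integrable_completion) auto
qed

lemma C11_laplacian_bound:
  fixes \<xi> :: "real^'n \<Rightarrow> real"
  assumes xi: "C11_compact_support \<xi>"
  obtains B R where "0 < R" "0 \<le> B" "AE x in lebesgue. \<bar>laplacian \<xi> x\<bar> \<le> B * indicator (cball 0 R) x"
    "\<And>x. R \<le> norm x \<Longrightarrow> \<xi> x = 0" "continuous_on UNIV \<xi>" "laplacian \<xi> \<in> borel_measurable lebesgue"
proof -
  obtain g L R where g: "\<And>x. GDERIV \<xi> x :> g x" "L-lipschitz_on UNIV g" "0 < R"
    "\<And>x. R \<le> norm x \<Longrightarrow> \<xi> x = 0" "\<And>x. R \<le> norm x \<Longrightarrow> g x = 0"
    by (rule C11_data[OF xi]) (rule that)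
  have L0: "0 \<le> L" using lipschitz_on_nonneg[OF g(2)] .
  let ?P = "\<lambda>i. partial_deriv i (partial_deriv i \<xi>)"
  have 1: "AE x in lebesgue. \<bar>?P i x\<bar> \<le> L * indicator (cball 0 R) x" for i
    using C11_laplacian[OF g(1,2), of i]
  proof eventually_elim
    case (elim x)
    then have lim: "((\<lambda>t. (g (x + t *\<^sub>R axis i 1) $ i - g x $ i) / t) \<longlongrightarrow> ?P i x) (at 0)"
      by (simp add: has_field_derivative_iff)
    show ?case
    proof (cases "x \<in> cball 0 R")
      case True
      have "\<bar>?P i x\<bar> \<le> L"
      proof (rule tendsto_upperbound[OF tendsto_rabs[OF lim]])
        have "\<bar>(g (x + t *\<^sub>R axis i 1) $ i - g x $ i) / t\<bar> \<le> L" for t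
          using lipschitz_onD[OF lipschitz_nth[OF g(2), of i], of "x + t *\<^sub>R axis i 1" x] L0
          by (cases "t = 0") (auto simp: dist_real_def dist_norm divide_le_eq)
        then show "\<forall>\<^sub>F t in at 0. \<bar>(g (x + t *\<^sub>R axis i 1) $ i - g x $ i) / t\<bar> \<le> L" by simp
      qed simp
      then show ?thesis using True by simp
    next
      case False
      have "((\<lambda>t::real. norm (x + t *\<^sub>R axis i 1)) \<longlongrightarrow> norm (x + 0 *\<^sub>R axis i 1)) (at 0)"
        by (intro tendsto_intros)
      then have "\<forall>\<^sub>F t::real in at 0. R < norm (x + t *\<^sub>R axis i 1)"
        using False by (intro order_tendstoD) auto
      then have "\<forall>\<^sub>F t in at 0. (g (x + t *\<^sub>R axis i 1) $ i - g x $ i) / t = 0"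
        by eventually_elim (use g(5) False in auto)
      then have "((\<lambda>t. (g (x + t *\<^sub>R axis i 1) $ i - g x $ i) / t) \<longlongrightarrow> 0) (at 0)"
        by (rule tendsto_eventually)
      then have "?P i x = 0" using lim by (intro tendsto_unique[OF _ lim]) auto
      then show ?thesis using L0 by simp
    qed
  qed
  have "AE x in lebesgue. \<forall>i\<in>UNIV. \<bar>?P i x\<bar> \<le> L * indicator (cball 0 R) x"
    by (rule AE_finite_allI) (use 1 in auto)
  then have 2: "AE x in lebesgue. \<bar>laplacian \<xi> x\<bar> \<le> (real CARD('n) * L) * indicator (cball 0 R) x"
  proof eventually_elim
    case (elim x)
    have "\<bar>laplacian \<xi> x\<bar> \<le> (\<Sum>i\<in>UNIV. \<bar>?P i x\<bar>)" unfolding laplacian_def by (rule sum_abs)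
    also have "\<dots> \<le> (\<Sum>i\<in>(UNIV::'n set). L * indicator (cball 0 R) x)" by (rule sum_mono) (use elim in auto)
    finally show ?case by simp
  qed
  \<comment> \<open>The measurability of the Laplacian, which is defined through
    \<open>deriv\<close>, is read off from Green's identity with the constant function 1.\<close>
  have "C2_on UNIV (\<lambda>_::real^'n. 1::real)"
    unfolding C2_on_def gderiv_def

  proof (rule exI[of _ "\<lambda>_. 0"], rule exI[of _ "\<lambda>_. 0"])
    have "(*v) (0::real^'n^'n) = (\<lambda>_. 0)" by (auto simp: fun_eq_iff)
    then show "(\<forall>x\<in>UNIV. FDERIV (\<lambda>_::real^'n. 1::real) x :> (\<lambda>h. h \<bullet> 0) \<and> FDERIV (\<lambda>_. 0) x :> (*v) (0::real^'n^'n)) \<and>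
      continuous_on UNIV (\<lambda>_::real^'n. 0::real^'n^'n)" by simp
  qed
  from green_identity(1)[OF this xi] have "laplacian \<xi> \<in> borel_measurable lebesgue" by auto
  then show ?thesis using that[of R "real CARD('n) * L"] g 2 L0 GDERIV_continuous_on[OF g(1)] by auto
qed

context big_dim begin

lemma level_density_eq: "0 < s \<Longrightarrow> level_density s =
    sphere_area\<^sup>2 * (1 / green_coeff) powr (2 * (N - 1) / (2 - N)) * s powr (2 * (N - 1) / (2 - N))"
proof -
  assume s: "0 < s"
  have sq: "(x powr y)\<^sup>2 = x powr (2 * y)" for x y :: real
    by (simp add: power2_eq_square flip: powr_add)
  have "level_density s = sphere_area\<^sup>2 * ((1 / green_coeff) * s) powr (2 * (N - 1) / (2 - N))"
    unfolding level_density_def level_radius_def power_mult_distrib sq powr_powr by simp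
  then show ?thesis using s green_coeff_pos by (simp only: powr_mult)
qed

text \<open>On the half-line the integrand is s times the density, a multiple of s^(-N/(N-2)) on
  [s0,\<infinity>), with exponent below -1.\<close>

lemma \<Gamma>_integrable_ball:
  "integrable lborel (\<lambda>x. \<Gamma> x * indicator (cball 0 R) x)"
proof -
  define R' where "R' = max R 1"
  define s0 where "s0 = green_coeff * R' powr (2 - N)"
  have R': "0 < R'" "R \<le> R'" by (auto simp: R'_def)
  have s0: "0 < s0" using green_coeff_pos R' by (simp add: s0_def)
  have rs: "level_radius s0 = R'" using green_coeff_pos N2 R' by (simp add: level_radius_def s0_def powr_powr)
  let ?F = "\<lambda>s. if s0 \<le> s then s else 0"
  have e: "1 + 2 * (N - 1) / (2 - N) < -1" using N2 by (simp add: field_simps)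
  define K where "K = sphere_area\<^sup>2 * (1 / green_coeff) powr (2 * (N - 1) / (2 - N))"
  have "integrable lborel (\<lambda>s. K * (if s0 \<le> s then s powr (1 + 2 * (N - 1) / (2 - N)) else 0))"
    using integrable_powr_to_inf[OF s0 e] by simp
  moreover have "(if 0 < s then level_density s else 0) * ?F s = K * (if s0 \<le>
      s then s powr (1 + 2 * (N - 1) / (2 - N)) else 0)" for s
    using s0 by (auto simp: level_density_eq K_def powr_add)
  ultimately have "integrable lborel (\<lambda>x. ?F (\<Gamma> x))"
    by (subst push_integral) auto
  moreover have [measurable]: "cball (0::real^'n) R \<in> sets borel" by simp
  ultimately show ?thesis
  proof (rule_tac Bochner_Integration.integrable_bound)
    show "AE x in lborel. norm (\<Gamma> x * indicator (cball 0 R) x) \<le> norm (?F (\<Gamma> x))"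
    proof (intro always_eventually allI)
      fix x
      show "norm (\<Gamma> x * indicator (cball 0 R) x) \<le> norm (?F (\<Gamma> x))"
      proof (cases "x = 0 \<or> x \<notin> cball 0 R")
        case False
        then have "s0 \<le> \<Gamma> x" using \<Gamma>_ge_iff[OF s0, of x] rs R' by simp
        then show ?thesis using False by simp
      qed auto
    qed
  qed measurable
qed

lemma \<Gamma>_at_0: "filterlim \<Gamma> at_top (at 0)"
  unfolding filterlim_at_top_dense
proof
  fix Z :: real
  define s where "s = max Z 1"
  have s: "0 < s" "Z \<le> s" by (auto simp: s_def)
  show "\<forall>\<^sub>F x in at 0. Z < \<Gamma> x"
    unfolding eventually_at
  proof (intro exI[of _ "level_radius s"] conjI ballI impI)
    fix x :: "real^'n" assume "x \<noteq> 0 \<and> dist x 0 < level_radius s"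
    then have "s < \<Gamma> x" using \<Gamma>_gt_iff[OF s(1), of x] by (simp add: dist_norm)
    then show "Z < \<Gamma> x" using s by simp
  qed (rule level_radius_pos[OF s(1)])
qed

text \<open>W and \<phi> are linked only by W' = k + tail of \<phi>: this is the linear problem with
  source \<phi>, so the formula applies to solutions and to iterates. The Dirac mass appears as the
  limit k of W' at infinity.\<close>

lemma weak_formula:
  fixes W \<phi> :: "real \<Rightarrow> real"
  assumes \<phi>c: "continuous_on {0<..} \<phi>" and \<phi>i: "integrable lborel \<phi>" and \<phi>z: "\<And>t. t \<le> 0 \<Longrightarrow> \<phi> t = 0" and \<phi>n: "\<And>t. 0 \<le> \<phi> t"
    and k: "0 \<le> k"
    and W1: "\<And>s. 0 < s \<Longrightarrow> (W has_real_derivative (k + (LINT t|lborel. (if s < t then \<phi> t else 0)))) (at s)"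
    and Wb: "\<And>s. 0 < s \<Longrightarrow> 0 \<le> W s" "\<And>s. 0 < s \<Longrightarrow> W s \<le> C * s"
    and Wm [measurable]: "W \<in> borel_measurable borel"
    and xi: "C11_compact_support \<xi>"
  shows "integrable lebesgue (\<lambda>x. W (\<Gamma> x) * laplacian \<xi> x)"
    "integrable lborel (\<lambda>x. \<phi> (\<Gamma> x) / level_density (\<Gamma> x) * \<xi> x)"
    "(LINT x|lebesgue. W (\<Gamma> x) * laplacian \<xi> x) = - (LINT x|lborel. \<phi> (\<Gamma> x) / level_density (\<Gamma> x) * \<xi> x) - k * \<xi> 0"
proof -
  obtain B R where R: "0 < R" "0 \<le> B" and Bd: "AE x in lebesgue. \<bar>laplacian \<xi> x\<bar> \<le> B * indicator (cball 0 R) x"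
    and xz: "\<And>x. R \<le> norm x \<Longrightarrow> \<xi> x = 0" and xc: "continuous_on UNIV \<xi>" and lm: "laplacian \<xi> \<in> borel_measurable lebesgue"
    by (rule C11_laplacian_bound[OF xi]) (rule that)
  have [measurable]: "\<phi> \<in> borel_measurable borel" using \<phi>i by auto
  have xm[measurable]: "\<xi> \<in> borel_measurable borel" using xc by (rule borel_measurable_continuous_onI)
  have "bounded (\<xi> ` cball 0 R)"
    by (intro compact_imp_bounded compact_continuous_image continuous_on_subset[OF xc]) auto
  then obtain X where X: "\<forall>x\<in>cball 0 R. \<bar>\<xi> x\<bar> \<le> X" by (auto simp: bounded_iff)
  have X0: "0 \<le> X" using X[rule_format, of 0] R by simp
  have Xb: "\<bar>\<xi> x\<bar> \<le> X" for x using X X0 xz[of x] by (cases "norm x \<le> R") auto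
  define W' where "W' s = k + (LINT t|lborel. (if s < t then \<phi> t else 0))" for s
  have W'm[measurable]: "W' \<in> borel_measurable borel" unfolding W'_def[abs_def] by measurable
  have \<phi>if: "integrable lborel (\<lambda>t. if s < t then \<phi> t else 0)" for s
    by (rule integrable_if_pred[OF \<phi>i]) measurable
  have W'eq: "W' s = k + (integral\<^sup>L lborel \<phi> - primitive \<phi> s)" for s
  proof -
    have "integral\<^sup>L lborel \<phi> = (LINT t|lborel. (if t \<le> s then \<phi> t else 0) + (if s < t then \<phi> t else 0))"
      by (intro Bochner_Integration.integral_cong) auto
    also have "\<dots> = primitive \<phi> s + (LINT t|lborel. (if s < t then \<phi> t else 0))"
      unfolding primitive_def by (intro Bochner_Integration.integral_add \<phi>if integrable_if_pred[OF \<phi>i]) measurable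
    finally show ?thesis by (simp add: W'_def)
  qed
  have W'b: "0 \<le> W' s" "W' s \<le> k + integral\<^sup>L lborel \<phi>" for s
  proof -
    have "0 \<le> (LINT t|lborel. (if s < t then \<phi> t else 0))" by (intro integral_nonneg_AE) (auto simp: \<phi>n)
    then show "0 \<le> W' s" using k by (simp add: W'_def)
    have "(LINT t|lborel. (if s < t then \<phi> t else 0)) \<le> integral\<^sup>L lborel \<phi>"
      by (rule integral_mono[OF \<phi>if \<phi>i]) (auto simp: \<phi>n)
    then show "W' s \<le> k + integral\<^sup>L lborel \<phi>" by (simp add: W'_def)
  qed
  have W'd: "(W' has_real_derivative (- \<phi> s)) (at s)" if "0 < s" for s
    unfolding W'eq[abs_def] using primitive_deriv[OF \<phi>i \<phi>c that] by (auto intro!: derivative_eq_intros)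
  have W'top: "(W' \<longlongrightarrow> k) at_top"
  proof -
    have "((\<lambda>s. LINT t|lborel. (if s < t then \<phi> t else 0)) \<longlongrightarrow> (LINT t|(lborel :: real measure). 0)) at_top"
    proof (rule integral_dominated_convergence_at_top)
      show "integrable lborel \<phi>" by (rule \<phi>i)
      show "AE t in lborel. ((\<lambda>s. if s < t then \<phi> t else 0) \<longlongrightarrow> 0) at_top"
      proof (intro always_eventually allI)
        fix t
        have "\<forall>\<^sub>F s in at_top. (if s < t then \<phi> t else 0) = 0"
          using eventually_ge_at_top[of t] by eventually_elim auto
        then show "((\<lambda>s. if s < t then \<phi> t else 0) \<longlongrightarrow> 0) at_top" by (rule tendsto_eventually)
      qed
    qed (auto simp: \<phi>n)
    then have "((\<lambda>s. LINT t|lborel. (if s < t then \<phi> t else 0)) \<longlongrightarrow> 0) at_top" by simp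
    from tendsto_add[OF tendsto_const[of k] this] show ?thesis by (simp add: W'_def[abs_def])
  qed
  \<comment> \<open>Cut off the slope of \<open>W\<close> at level \<open>M\<close>; the Laplacian gains a mollifier which carries the mass \<open>k\<close> as \<open>M \<rightarrow> \<infinity>\<close>.\<close>
  define f where "f M t = (if 0 < t then W' t * cutoff (t / M) else 0)" for M t
  define f' where "f' M t = - \<phi> t * cutoff (t / M) + W' t * (cutoff' (t / M) / M)" for M t
  have fm[measurable]: "f M \<in> borel_measurable borel" for M unfolding f_def[abs_def] by measurable
  have fi: "integrable lborel (f M)" if "0 < M" for M
  proof (rule integrable_continuous_bounded_support[where b="2 * M"])
    show "\<bar>f M t\<bar> \<le> k + integral\<^sup>L lborel \<phi>" for t
      using W'b[of t] cutoff_nonneg[of "t / M"] cutoff_le_1[of "t / M"] mult_mono[of "W' t" "k + integral\<^sup>L lborel \<phi>"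
          "cutoff (t / M)" 1]
        order_trans[OF W'b(1)[of t] W'b(2)[of t]]
      by (auto simp: f_def abs_mult)
    show "f M t = 0" if "t \<le> 0 \<or> 2 * M \<le> t" for t
      using that \<open>0 < M\<close> cutoff_2[of "t / M"] by (auto simp: f_def field_simps)
  qed measurable
  have fd: "(f M has_real_derivative f' M s) (at s)" if "0 < M" "0 < s" for M s
  proof -
    have "((\<lambda>t. W' t * cutoff (t / M)) has_real_derivative f' M s) (at s)"
      unfolding f'_def using that by (auto intro!: derivative_eq_intros W'd DERIV_chain2[OF cutoff_deriv])
    then show ?thesis
      by (rule has_field_derivative_transform_within_open[where S="{0<..}"]) (use that in \<open>auto simp: f_def\<close>)
  qed
  have fc: "continuous_on {0<..} (f M)" if "0 < M" for M
    using fd[OF that] by (intro DERIV_continuous_on) (auto intro: has_field_derivative_at_within)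
  have W'c: "continuous_on {0<..} W'"
    using W'd by (intro DERIV_continuous_on) (auto intro: has_field_derivative_at_within)
  have f'c: "continuous_on {0<..} (f' M)" if "0 < M" for M
    unfolding f'_def using that
    by (intro continuous_intros \<phi>c W'c continuous_on_compose2[OF cutoff_continuous] continuous_on_compose2[OF
        cutoff'_continuous]) auto
  \<comment> \<open>The additive constant makes V M and W agree at M, hence on (0,M], where the
    cut-off is 1.\<close>
  define V where "V M s = primitive (f M) s + (W M - primitive (f M) M)" for M s
  have Vd: "(V M has_real_derivative f M s) (at s)" if "0 < M" "0 < s" for M s
    unfolding V_def using primitive_deriv[OF fi[OF that(1)] fc[OF that(1)] that(2)] by (auto intro!: derivative_eq_intros)
  have Vconst: "V M s = V M (2 * M)" if "0 < M" "2 * M \<le> s" for M s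
  proof -
    have "primitive (f M) s = primitive (f M) (2 * M)"
      unfolding primitive_def using that cutoff_2
      by (intro Bochner_Integration.integral_cong) (auto simp: f_def field_simps)
    then show ?thesis by (simp add: V_def)
  qed
  have VM: "V M M = W M" for M by (simp add: V_def)
  have VW: "V M s = W s" if "0 < M" "0 < s" "s \<le> M" for M s
  proof (cases "s = M")
    case False
    have "(\<lambda>s. V M s - W s) M = (\<lambda>s. V M s - W s) s"
    proof (rule DERIV_isconst_end[where f="\<lambda>s. V M s - W s" and a=s and b=M])
      show "s < M" using that False by simp
      have D: "((\<lambda>s. V M s - W s) has_real_derivative (f M x - W' x)) (at x)" if "0 < x" for x
        using Vd[OF \<open>0 < M\<close> that] W1[OF that] by (auto intro!: derivative_eq_intros simp: W'_def)
      show "continuous_on {s..M} (\<lambda>s. V M s - W s)"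
        using D that by (intro DERIV_continuous_on[where D="\<lambda>x. f M x - W' x"]) (auto intro: has_field_derivative_at_within)
      fix x assume "s < x" "x < M"
      then have "0 < x" "f M x = W' x" using that cutoff_1[of "x / M"] by (auto simp: f_def)
      then show "((\<lambda>s. V M s - W s) has_real_derivative 0) (at x)" using D[of x] by simp
    qed
    then show ?thesis using VM[of M] by simp
  qed (simp add: VM)
  \<comment> \<open>A bound uniform in M: beyond M the slope of V M lies between 0 and that of W.
    Thus C \<Gamma> dominates in the limit M \<rightarrow> \<infinity>.\<close>
  have Vb: "0 \<le> V M s \<and> V M s \<le> C * s" if "0 < M" "0 < s" for M s
  proof (cases "s \<le> M")
    case False
    then have Ms: "M \<le> s" by simp
    have "V M M \<le> V M s"
    proof (rule DERIV_nonneg_imp_nondecreasing[OF Ms])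
      fix x assume "M \<le> x" "x \<le> s"
      then have x0: "0 < x" using that by simp
      have "0 \<le> f M x" using W'b(1)[of x] cutoff_nonneg by (simp add: f_def)
      then show "\<exists>y. (V M has_real_derivative y) (at x) \<and> 0 \<le> y" using Vd[OF that(1) x0] by blast
    qed
    moreover have "(\<lambda>s. W s - V M s) M \<le> (\<lambda>s. W s - V M s) s"
    proof (rule DERIV_nonneg_imp_nondecreasing[OF Ms, where f="\<lambda>s. W s - V M s"])
      fix x assume x: "M \<le> x" "x \<le> s"
      then have x0: "0 < x" using that by simp
      have "((\<lambda>s. W s - V M s) has_real_derivative (W' x - f M x)) (at x)"
        using Vd[OF \<open>0 < M\<close> x0] W1[OF x0] by (auto intro!: derivative_eq_intros simp: W'_def)
      moreover have "f M x \<le> W' x"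
        using W'b(1)[of x] cutoff_le_1[of "x / M"] x0 by (simp add: f_def mult_left_le)
      ultimately show "\<exists>y. ((\<lambda>s. W s - V M s) has_real_derivative y) (at x) \<and> 0 \<le> y" by (intro exI[of _ "W' x - f M x"]) auto
    qed
    ultimately show ?thesis using VM[of M] Wb[OF that(1)] Wb(2)[OF that(2)] by auto
  qed (use VW that Wb in auto)
  define U where "U M x = (if x = 0 then V M (2 * M) else V M (\<Gamma> x))" for M and x :: "real^'n"
  have M2: "0 < 2 * M" if "0 < M" for M :: real using that by simp
  have UC: "C2_on UNIV (U M)" and Ul: "\<And>x. x \<noteq> 0 \<Longrightarrow> laplacian (U M) x = f' M (\<Gamma> x) / level_density (\<Gamma> x)" if M: "0 < M" for M
    unfolding U_def
    using radial_C2_UNIV[OF Vd[OF M] fd[OF M] f'c[OF M] M2[OF M] Vconst[OF M]] by auto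
  define m where "m n = real n + 1" for n :: nat
  have m: "0 < m n" for n by (simp add: m_def)
  have mtop: "filterlim m at_top sequentially" unfolding m_def by real_asymp
  have n0: "AE x in lebesgue. x \<noteq> (0::real^'n)" by (intro AE_completion AE_lborel_singleton)
  have dom: "integrable lebesgue (\<lambda>x. C * B * (\<Gamma> x * indicator (cball 0 R) x))"
    using \<Gamma>_integrable_ball[of R] by (subst integrable_completion) auto
  have WG: "(\<lambda>x. W (\<Gamma> x) * laplacian \<xi> x) \<in> borel_measurable lebesgue"
    by (intro borel_measurable_times lm measurable_completion) measurable
  have C0: "0 \<le> C" using Wb(1)[of 1] Wb(2)[of 1] by simp
  have bnd: "\<bar>v * laplacian \<xi> x\<bar> \<le> C * B * (\<Gamma> x * indicator (cball 0 R) x)"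
    if "\<bar>laplacian \<xi> x\<bar> \<le> B * indicator (cball 0 R) x" "0 \<le> v" "v \<le> C * \<Gamma> x" for v x
  proof -
    have "\<bar>v * laplacian \<xi> x\<bar> \<le> (C * \<Gamma> x) * (B * indicator (cball 0 R) x)"
      unfolding abs_mult using that C0 \<Gamma>_nonneg[of x] by (intro mult_mono) auto
    then show ?thesis by (simp add: mult_ac)
  qed
  show WI: "integrable lebesgue (\<lambda>x. W (\<Gamma> x) * laplacian \<xi> x)"
  proof (rule Bochner_Integration.integrable_bound[OF dom WG])
    show "AE x in lebesgue. norm (W (\<Gamma> x) * laplacian \<xi> x) \<le> norm (C * B * (\<Gamma> x * indicator (cball 0 R) x))"
      using Bd n0
    proof eventually_elim
      case (elim x)
      show ?case using bnd[OF elim(1) Wb[OF \<Gamma>_pos[OF elim(2)]]] by (auto intro: order_trans[OF _ abs_ge_self])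
    qed
  qed
  have UL: "integrable lebesgue (\<lambda>x. U (m n) x * laplacian \<xi> x)"
     "(LINT x|lebesgue. U (m n) x * laplacian \<xi> x) = (LINT x|lebesgue. laplacian (U (m n)) x * \<xi> x)" for n
    using green_identity[OF UC[OF m] xi] by auto
  have lim1: "(\<lambda>n. LINT x|lebesgue. U (m n) x * laplacian \<xi> x) \<longlonglongrightarrow> (LINT x|lebesgue. W (\<Gamma> x) * laplacian \<xi> x)"
  proof (rule integral_dominated_convergence[OF WG _ dom])
    show "(\<lambda>x. U (m n) x * laplacian \<xi> x) \<in> borel_measurable lebesgue" for n using UL(1) by auto
    show "AE x in lebesgue. (\<lambda>n. U (m n) x * laplacian \<xi> x) \<longlonglongrightarrow> W (\<Gamma> x) * laplacian \<xi> x"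
      using n0
    proof eventually_elim
      case (elim x)
      have "\<forall>\<^sub>F n in sequentially. \<Gamma> x \<le> m n" using mtop by (simp add: filterlim_at_top)
      then have "\<forall>\<^sub>F n in sequentially. U (m n) x * laplacian \<xi> x = W (\<Gamma> x) * laplacian \<xi> x"
        by eventually_elim (use elim VW[OF m \<Gamma>_pos[OF elim]] in \<open>auto simp: U_def\<close>)
      then show ?case by (rule tendsto_eventually)
    qed
    fix n
    show "AE x in lebesgue. norm (U (m n) x * laplacian \<xi> x) \<le> C * B * (\<Gamma> x * indicator (cball 0 R) x)"
      using Bd n0
    proof eventually_elim
      case (elim x)
      show ?case using bnd[OF elim(1), of "U (m n) x"] Vb[OF m \<Gamma>_pos[OF elim(2)], of n] elim(2) by (auto simp: U_def)
    qed
  qed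
  have \<phi>push: "integrable lborel (\<lambda>x. \<phi> (\<Gamma> x) / level_density (\<Gamma> x))"
  proof -
    have "(if 0 < s then level_density s else 0) * (\<phi> s / level_density s) = \<phi> s" for s
      using level_density_pos[of s] \<phi>z[of s] by (cases "0 < s") auto
    then show ?thesis using push_integral(1)[of "\<lambda>s. \<phi> s / level_density s"] \<phi>i by simp
  qed
  have bnd2: "\<bar>\<phi> (\<Gamma> x) / level_density (\<Gamma> x) * c * \<xi> x\<bar> \<le> X * (\<phi> (\<Gamma> x) / level_density (\<Gamma> x))" if "0 \<le> c" "c \<le> 1" for x c
  proof -
    have p: "0 \<le> \<phi> (\<Gamma> x) / level_density (\<Gamma> x)" using \<phi>n level_density_nonneg by simp
    have "\<bar>\<phi> (\<Gamma> x) / level_density (\<Gamma> x) * c * \<xi> x\<bar> = (\<phi> (\<Gamma> x) / level_density (\<Gamma> x)) * (c * \<bar>\<xi> x\<bar>)"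
      using abs_of_nonneg[OF p] that by (simp only: abs_mult mult.assoc abs_of_nonneg[of c])
    also have "\<dots> \<le> (\<phi> (\<Gamma> x) / level_density (\<Gamma> x)) * (1 * X)"
      using that Xb[of x] X0 p by (intro mult_left_mono mult_mono) auto
    finally show ?thesis by (simp add: mult_ac)
  qed
  have \<phi>b: "integrable lborel (\<lambda>x. X * (\<phi> (\<Gamma> x) / level_density (\<Gamma> x)))" using \<phi>push by (rule integrable_mult_right)
  have i2: "integrable lborel (\<lambda>x. \<phi> (\<Gamma> x) / level_density (\<Gamma> x) * c x * \<xi> x)"
    if [measurable]: "c \<in> borel_measurable borel" and "\<And>x. 0 \<le> c x" "\<And>x. c x \<le> 1" for c
  proof (rule Bochner_Integration.integrable_bound[OF \<phi>b])
    show "AE x in lborel. norm (\<phi> (\<Gamma> x) / level_density (\<Gamma> x) * c x * \<xi> x) \<le> norm (X * (\<phi> (\<Gamma> x) / level_density (\<Gamma> x)))"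
      unfolding real_norm_def
      by (intro always_eventually allI order_trans[OF bnd2[OF that(2,3)] abs_ge_self])
  qed measurable
  show "integrable lborel (\<lambda>x. \<phi> (\<Gamma> x) / level_density (\<Gamma> x) * \<xi> x)" using i2[of "\<lambda>_. 1"] by simp
  have lim2: "(\<lambda>n. LINT x|lborel. \<phi> (\<Gamma> x) / level_density (\<Gamma> x) * cutoff (\<Gamma> x / m n) * \<xi> x) \<longlonglongrightarrow> (LINT x|lborel. \<phi> (\<Gamma> x) /
      level_density (\<Gamma> x) * \<xi> x)"
  proof (rule integral_dominated_convergence[OF _ _ \<phi>b])
    show "AE x in lborel. (\<lambda>n. \<phi> (\<Gamma> x) / level_density (\<Gamma> x) * cutoff (\<Gamma> x / m n) * \<xi> x) \<longlonglongrightarrow> \<phi> (\<Gamma> x) / level_density (\<Gamma> x) * \<xi> x"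
    proof (intro always_eventually allI)
      fix x
      have "\<forall>\<^sub>F n in sequentially. \<Gamma> x \<le> m n" using mtop by (simp add: filterlim_at_top)
      then have "\<forall>\<^sub>F n in sequentially. \<phi> (\<Gamma> x) / level_density (\<Gamma> x) * cutoff (\<Gamma> x / m n) * \<xi> x =
          \<phi> (\<Gamma> x) / level_density (\<Gamma> x) * \<xi> x"
      proof eventually_elim
        case (elim n)
        then have "cutoff (\<Gamma> x / m n) = 1" using m[of n] by (intro cutoff_1) simp
        then show ?case by simp
      qed
      then show "(\<lambda>n. \<phi> (\<Gamma> x) / level_density (\<Gamma> x) * cutoff (\<Gamma> x / m n) * \<xi> x) \<longlonglongrightarrow> \<phi> (\<Gamma> x) / level_density (\<Gamma> x) * \<xi> x"
        by (rule tendsto_eventually)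
    qed
    show "AE x in lborel. norm (\<phi> (\<Gamma> x) / level_density (\<Gamma> x) * cutoff (\<Gamma> x / m n) * \<xi> x) \<le>
        X * (\<phi> (\<Gamma> x) / level_density (\<Gamma> x))" for n
      unfolding real_norm_def by (intro always_eventually allI bnd2[OF cutoff_nonneg cutoff_le_1])
  qed measurable
  \<comment> \<open>The factor that multiplies the mollifier. It tends to k \<xi>(0) at the origin,
    because \<Gamma> tends to infinity there and W' to k.\<close>
  define h where "h x = W' (\<Gamma> x) * \<xi> x" for x
  have [measurable]: "h \<in> borel_measurable borel" unfolding h_def[abs_def] by measurable
  have "(\<xi> \<longlongrightarrow> \<xi> 0) (at 0)" using xc by (simp add: continuous_on_eq_continuous_at isCont_def)
  then have hl: "(h \<longlongrightarrow> k * \<xi> 0) (at 0)"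
    unfolding h_def by (intro tendsto_mult filterlim_compose[OF W'top \<Gamma>_at_0])
  have e3: "\<forall>\<^sub>F n in sequentially. integrable lborel (\<lambda>x. mollifier (m n) x * h x)"
    using mollifier_limit(1)[OF _ hl] mtop by (auto dest: eventually_compose_filterlim)
  have lim3: "(\<lambda>n. LINT x|lborel. mollifier (m n) x * h x) \<longlonglongrightarrow> k * \<xi> 0"
    using filterlim_compose[OF mollifier_limit(2)[OF _ hl] mtop] by simp
  have "\<forall>\<^sub>F n in sequentially. (LINT x|lebesgue. laplacian (U (m n)) x * \<xi> x) =
     - (LINT x|lborel. \<phi> (\<Gamma> x) / level_density (\<Gamma> x) * cutoff (\<Gamma> x / m n) * \<xi> x) - (LINT x|lborel. mollifier (m n) x * h x)"
    using e3
  proof eventually_elim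
    case (elim n)
    let ?g = "\<lambda>x. - (\<phi> (\<Gamma> x) / level_density (\<Gamma> x) * cutoff (\<Gamma> x / m n) * \<xi> x) - mollifier (m n) x * h x"
    have "(LINT x|lebesgue. laplacian (U (m n)) x * \<xi> x) = (LINT x|lebesgue. ?g x)"
    proof (rule integral_cong_AE)
      show "(\<lambda>x. laplacian (U (m n)) x * \<xi> x) \<in> borel_measurable lebesgue" using green_identity(2)[OF UC[OF m] xi] by auto
      show "?g \<in> borel_measurable lebesgue" by (intro measurable_completion) measurable
      show "AE x in lebesgue. laplacian (U (m n)) x * \<xi> x = ?g x"
        using n0
      proof eventually_elim
        case (elim x)
        show ?case unfolding Ul[OF m elim] f'_def mollifier_def h_def using level_density_pos[OF \<Gamma>_pos[OF elim]] m[of n]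
          by (simp add: field_simps)
      qed
    qed
    also have "\<dots> = (LINT x|lborel. ?g x)" by (rule integral_completion) measurable
    also have "\<dots> = - (LINT x|lborel. \<phi> (\<Gamma> x) / level_density (\<Gamma> x) * cutoff (\<Gamma> x / m n) * \<xi> x) - (LINT x|lborel.
        mollifier (m n) x * h x)"
      using elim i2[of "\<lambda>x. cutoff (\<Gamma> x / m n)"] cutoff_nonneg cutoff_le_1
      by (subst Bochner_Integration.integral_diff) auto
    finally show ?case .
  qed
  then have "(\<lambda>n. LINT x|lebesgue. U (m n) x * laplacian \<xi> x) \<longlonglongrightarrow> - (LINT x|lborel. \<phi> (\<Gamma> x) / level_density (\<Gamma> x) * \<xi> x) - k * \<xi> 0"
    unfolding UL(2)
    by (rule Lim_transform_eventually[OF tendsto_diff[OF tendsto_minus[OF lim2] lim3] eventually_mono]) (rule sym)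
  with lim1 show "(LINT x|lebesgue. W (\<Gamma> x) * laplacian \<xi> x) = - (LINT x|lborel. \<phi> (\<Gamma> x) / level_density (\<Gamma> x) * \<xi> x) - k * \<xi> 0"
    by (rule LIMSEQ_unique)
qed

end

section \<open>Comparison with weak solutions\<close>

text \<open>If {H < 0} had positive measure inside some ball, it would contain a non-null closed set
  T. The continuous functions max 0 (1 - j dist(y,T)) decrease to the indicator of T, so the
  integral of H over T would be nonnegative although H < 0 on T.\<close>

lemma AE_nonneg_from_tests:
  fixes H :: "'a::euclidean_space \<Rightarrow> real"
  assumes Hm [measurable]: "H \<in> borel_measurable borel"
    and Hl: "\<And>R. integrable lborel (\<lambda>y. H y * indicator (cball 0 R) y)"
    and test: "\<And>\<zeta> R. continuous_on UNIV \<zeta> \<Longrightarrow> (\<And>y. 0 \<le> \<zeta> y) \<Longrightarrow> (\<And>y. R \<le> norm y \<Longrightarrow> \<zeta> y = 0) \<Longrightarrow> 0 \<le> (LINT y|lborel. H y * \<zeta> y)"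
  shows "AE y in lborel. 0 \<le> H y"
proof -
  have nul: "{y. H y < 0 \<and> norm y \<le> real n} \<in> null_sets lborel" for n
  proof (rule ccontr)
    let ?S = "{y. H y < 0 \<and> norm y \<le> real n}"
    assume nn: "?S \<notin> null_sets lborel"
    have Sm: "?S \<in> sets borel" by measurable
    have sub: "?S \<subseteq> cball 0 (real n)" by auto
    have fin: "emeasure lborel ?S < \<infinity>"
      by (rule le_less_trans[OF emeasure_mono[OF sub] emeasure_lborel_cball_finite]) simp
    define e where "e = measure lborel ?S"
    have ee: "emeasure lborel ?S = ennreal e" unfolding e_def using fin by (intro emeasure_eq_ennreal_measure) auto
    then have unit_vec: "0 < e" using nn Sm by (auto simp: null_sets_def e_def zero_less_measure_iff)
    have Sl: "?S \<in> sets lebesgue" using Sm by (simp add: sets_completionI_sets)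
    obtain T where T: "closed T" "T \<subseteq> ?S" "?S - T \<in> lmeasurable" "emeasure lebesgue (?S - T) < ennreal e"
      by (rule sets_lebesgue_inner_closed[OF Sl unit_vec]) (rule that)
    have Tm[measurable]: "T \<in> sets borel" using T(1) by simp
    have Tn: "T \<notin> null_sets lborel"
    proof
      assume "T \<in> null_sets lborel"
      then have "emeasure lborel (?S - T) = emeasure lborel ?S" using Sm by (intro emeasure_Diff_null_set) auto
      moreover have "emeasure lebesgue (?S - T) = emeasure lborel (?S - T)"
        using Sm by (simp add: emeasure_completion main_part_sets)
      ultimately show False using T(4) ee by simp
    qed
    have T0: "T \<noteq> {}" using Tn by auto
    define \<zeta> where "\<zeta> j y = max 0 (1 - real (Suc j) * infdist y T)" for j y
    have \<zeta>c: "continuous_on UNIV (\<zeta> j)" for j unfolding \<zeta>_def by (intro continuous_intros)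
    have \<zeta>1: "\<zeta> j y \<le> 1" "0 \<le> \<zeta> j y" for j y
      using infdist_nonneg[of y T] by (auto simp: \<zeta>_def)
    have \<zeta>s: "\<zeta> j y = 0" if "real n + 1 \<le> norm y" for j y
    proof -
      obtain a where a: "a \<in> T" "infdist y T = dist y a" using infdist_attains_inf[OF T(1) T0] by blast
      then have "norm a \<le> real n" using T(2) by auto
      then have "1 \<le> infdist y T" using that a(2) norm_triangle_ineq2[of y a] by (simp add: dist_norm)
      then have "1 * 1 \<le> real (Suc j) * infdist y T" by (intro mult_mono) auto
      then show ?thesis by (simp add: \<zeta>_def)
    qed
    have bd: "norm (H y * \<zeta> j y) \<le> norm (H y * indicator (cball 0 (real n + 1)) y)" for j y
      using \<zeta>1[of j y] \<zeta>s[of y j] mult_left_mono[of "\<zeta> j y" 1 "\<bar>H y\<bar>"] by (cases "norm y \<le> real n + 1") (auto simp: abs_mult)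
    have "(\<lambda>j. LINT y|lborel. H y * \<zeta> j y) \<longlonglongrightarrow> (LINT y|lborel. H y * indicator T y)"
    proof (rule integral_dominated_convergence)
      show "integrable lborel (\<lambda>y. norm (H y * indicator (cball 0 (real n + 1)) y))" using Hl by (rule integrable_norm)
      show "AE y in lborel. (\<lambda>j. H y * \<zeta> j y) \<longlonglongrightarrow> H y * indicator T y"
      proof (intro always_eventually allI)
        fix y
        have "(\<lambda>j. \<zeta> j y) \<longlonglongrightarrow> indicator T y"
        proof (cases "y \<in> T")
          case True
          then show ?thesis by (simp add: \<zeta>_def)
        next
          case False
          then have "0 < infdist y T" using infdist_pos_not_in_closed[OF T(1) T0] by blast
          then have "filterlim (\<lambda>j. real (Suc j) * infdist y T) at_top sequentially"
            by (intro filterlim_at_top_mult_tendsto_pos[OF tendsto_const] filterlim_compose[OF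
                filterlim_real_sequentially filterlim_Suc])
          then have "\<forall>\<^sub>F j in sequentially. 1 \<le> real (Suc j) * infdist y T" by (simp add: filterlim_at_top)
          then have "\<forall>\<^sub>F j in sequentially. \<zeta> j y = indicator T y"
            by eventually_elim (use False in \<open>auto simp: \<zeta>_def\<close>)
          then show ?thesis by (rule tendsto_eventually)
        qed
        then show "(\<lambda>j. H y * \<zeta> j y) \<longlonglongrightarrow> H y * indicator T y" by (intro tendsto_intros)
      qed
      show "AE y in lborel. norm (H y * \<zeta> j y) \<le> norm (H y * indicator (cball 0 (real n + 1)) y)" for j using bd by auto
      show "(\<lambda>y. H y * \<zeta> j y) \<in> borel_measurable lborel" for j
        using borel_measurable_continuous_onI[OF \<zeta>c[of j]] by simp
    qed measurable
    then have ge: "0 \<le> (LINT y|lborel. H y * indicator T y)"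
      by (rule LIMSEQ_le_const) (use test[OF \<zeta>c \<zeta>1(2) \<zeta>s] in blast)
    have Ti: "integrable lborel (\<lambda>y. H y * indicator T y)"
    proof (rule Bochner_Integration.integrable_bound[OF Hl[of "real n"]])
      show "AE y in lborel. norm (H y * indicator T y) \<le> norm (H y * indicator (cball 0 (real n)) y)"
        using T(2) by (auto simp: indicator_def)
    qed measurable
    have neg: "0 \<le> - (H y * indicator T y)" for y using T(2) by (auto simp: indicator_def)
    have "(LINT y|lborel. - (H y * indicator T y)) = 0"
    proof (rule antisym)
      show "0 \<le> (LINT y|lborel. - (H y * indicator T y))" by (intro integral_nonneg_AE always_eventually allI neg)
    qed (use ge in simp)
    then have "AE y in lborel. - (H y * indicator T y) = 0"
      by (subst (asm) integral_nonneg_eq_0_iff_AE) (use Ti neg in auto)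
    then have "AE y in lborel. y \<notin> T" by eventually_elim (use T(2) in \<open>auto simp: indicator_def split: if_splits\<close>)
    then have "T \<in> null_sets lborel" by (subst (asm) AE_iff_null) auto
    with Tn show False ..
  qed
  have "AE y in lborel. \<forall>n::nat. y \<notin> {y. H y < 0 \<and> norm y \<le> real n}"
    unfolding AE_all_countable using AE_not_in[OF nul] by blast
  then show ?thesis
  proof eventually_elim
    case (elim y)
    obtain n :: nat where "norm y \<le> real n" using real_arch_simple by blast
    then show ?case using elim[rule_format, of n] by auto
  qed
qed

lemma lborel_distr_reflection:
  fixes y :: "'a::euclidean_space"
  shows "distr lborel borel (\<lambda>z. y - z) = lborel"
  using lborel_affine[of "-1" y] by (simp add: density_1)

lemma partial_deriv_translate: "partial_deriv i (\<lambda>y. f (y - c)) y = partial_deriv i f (y - c)"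
proof -
  have "(\<lambda>t. f (y + t *\<^sub>R axis i 1 - c)) = (\<lambda>t. f (y - c + t *\<^sub>R axis i 1))" by (simp add: algebra_simps)
  then show ?thesis by (simp add: partial_deriv_def)
qed

lemma laplacian_translate: "laplacian (\<lambda>y. f (y - c)) y = laplacian f (y - c)"
proof -
  have "partial_deriv i (\<lambda>y. f (y - c)) = (\<lambda>y. partial_deriv i f (y - c))" for i
    by (rule ext) (rule partial_deriv_translate)
  then show ?thesis by (simp add: laplacian_def partial_deriv_translate)
qed

lemma C2_on_translate:
  assumes "C2_on UNIV f" shows "C2_on UNIV (\<lambda>y. f (y - c))"
proof -
  obtain g H where g: "\<And>x. GDERIV f x :> g x" and H: "\<And>x. (g has_derivative (\<lambda>h. H x *v h)) (at x)"
    and Hc: "continuous_on UNIV H"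
    using assms by (auto simp: C2_on_def)
  have s: "((\<lambda>y. y - c) has_derivative (\<lambda>h. h)) (at x)" for x by (auto intro!: derivative_eq_intros)
  have "GDERIV (\<lambda>y. f (y - c)) x :> g (x - c)" for x
    using has_derivative_compose[OF s g[unfolded gderiv_def]] by (simp add: gderiv_def)
  moreover have "((\<lambda>y. g (y - c)) has_derivative (\<lambda>h. H (x - c) *v h)) (at x)" for x
    using has_derivative_compose[OF s H] by simp
  moreover have "continuous_on UNIV (\<lambda>x. H (x - c))"
    by (rule continuous_on_compose2[OF Hc]) (auto intro!: continuous_intros)
  ultimately show ?thesis unfolding C2_on_def
    by (intro exI[of _ "\<lambda>x. g (x - c)"] exI[of _ "\<lambda>x. H (x - c)"]) auto
qed

section \<open>Test functions built from two mollifiers\<close>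

context big_dim begin

lemma level_radius_antimono: "0 < s \<Longrightarrow> s \<le> t \<Longrightarrow> level_radius t \<le> level_radius s"
  unfolding level_radius_def using N2 green_coeff_pos by (intro powr_mono2') (auto intro: divide_right_mono)

lemma mollifier_le: "0 < M \<Longrightarrow> mollifier M x \<le> (4 / M / level_density (2 * M)) * indicator (cball 0 (level_radius M)) x"
proof (cases "mollifier M x = 0")
  case True
  assume "0 < M"
  then show ?thesis using True level_density_pos[of "2 * M"] by (auto simp: indicator_def)
next
  case False
  assume M: "0 < M"
  have G: "M < \<Gamma> x" "\<Gamma> x < 2 * M" using mollifier_support[OF M False] by auto
  then have "norm x \<le> level_radius M" using \<Gamma>_gt_iff[OF M, of x] by simp
  then have ind: "indicator (cball 0 (level_radius M)) x = (1::real)" by simp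
  have "level_radius (2 * M) powr (N - 1) \<le> level_radius (\<Gamma> x) powr (N - 1)"
    using level_radius_antimono[of "\<Gamma> x" "2 * M"] level_radius_pos[of "2 * M"] G M N2 by (intro powr_mono2) auto
  then have "level_density (2 * M) \<le> level_density (\<Gamma> x)"
    unfolding level_density_def using sphere_area_pos by (intro power_mono mult_left_mono) auto
  moreover have "- cutoff' (\<Gamma> x / M) \<le> 4"
  proof -
    have y: "\<Gamma> x / M \<le> 2" "1 \<le> \<Gamma> x / M" using G M by (auto simp: field_simps)
    have "max 0 (1 - (max 0 (\<Gamma> x / M - 1))\<^sup>2) * max 0 (\<Gamma> x / M - 1) \<le> 1 * 1"
      using y by (intro mult_mono) auto
    then show ?thesis by (simp add: cutoff'_def mult.assoc)
  qed
  ultimately have "- cutoff' (\<Gamma> x / M) / M / level_density (\<Gamma> x) \<le> 4 / M / level_density (2 * M)"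
    using M level_density_pos[of "2 * M"] by (intro frac_le divide_right_mono) auto
  then show ?thesis by (simp add: ind mollifier_def)
qed

text \<open>Both mollifiers have mass 1, so a function whose Laplacian is
  \<open>mollifier \<sigma> - mollifier S\<close> can have compact support; this is its derivative
  with respect to \<Gamma>. It is nonnegative since \<sigma> < S and \<open>cutoff\<close>
  decreases, and it vanishes for t \<le> \<sigma>, that is, far from the origin.\<close>

definition bump_profile :: "real \<Rightarrow> real \<Rightarrow> real \<Rightarrow> real" where
  "bump_profile S \<sigma> t = (if 0 < t then cutoff (t / S) - cutoff (t / \<sigma>) else 0)"

definition bump :: "real \<Rightarrow> real \<Rightarrow> real^'n \<Rightarrow> real" where
  "bump S \<sigma> x = (if x = 0 then primitive (bump_profile S \<sigma>) (2 * S) else primitive (bump_profile S \<sigma>) (\<Gamma> x))"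

lemma bump:
  assumes s: "0 < \<sigma>" "\<sigma> < S"
  shows "C2_on UNIV (bump S \<sigma>)" "0 \<le> bump S \<sigma> x" "level_radius \<sigma> \<le> norm x \<Longrightarrow> bump S \<sigma> x = 0"
    "x \<noteq> 0 \<Longrightarrow> laplacian (bump S \<sigma>) x = mollifier \<sigma> x - mollifier S x"
proof -
  have S: "0 < S" using s by simp
  let ?f = "bump_profile S \<sigma>"
  define f' where "f' t = cutoff' (t / S) / S - cutoff' (t / \<sigma>) / \<sigma>" for t
  have fm: "?f \<in> borel_measurable borel" unfolding bump_profile_def[abs_def] by measurable
  have f0: "0 \<le> ?f t" for t
  proof -
    have "t / S \<le> t / \<sigma>" if "0 < t" using that s by (intro divide_left_mono) auto
    then show ?thesis using cutoff_antimono by (auto simp: bump_profile_def)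
  qed
  have f1: "\<bar>?f t\<bar> \<le> 1" for t using f0[of t] cutoff_le_1[of "t / S"] cutoff_nonneg[of "t / \<sigma>"] by (auto simp: bump_profile_def)
  have fz: "?f t = 0" if "t \<le> 0 \<or> 2 * S \<le> t" for t
    using that s cutoff_2[of "t / S"] cutoff_2[of "t / \<sigma>"] by (auto simp: bump_profile_def field_simps)
  have fz2: "?f t = 0" if "t \<le> \<sigma>" for t
    using that s cutoff_1[of "t / S"] cutoff_1[of "t / \<sigma>"] by (auto simp: bump_profile_def field_simps)
  have fi: "integrable lborel ?f" by (rule integrable_continuous_bounded_support[OF fm f1 fz])
  have fd: "(?f has_real_derivative f' t) (at t)" if "0 < t" for t
  proof -
    have "((\<lambda>t. cutoff (t / S) - cutoff (t / \<sigma>)) has_real_derivative f' t) (at t)"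
      unfolding f'_def using s S by (auto intro!: derivative_eq_intros DERIV_chain2[OF cutoff_deriv])
    then show ?thesis
      by (rule has_field_derivative_transform_within_open[where S="{0<..}"]) (use that in \<open>auto simp: bump_profile_def\<close>)
  qed
  have fc: "continuous_on {0<..} ?f"
    using fd by (intro DERIV_continuous_on) (auto intro: has_field_derivative_at_within)
  have f'c: "continuous_on {0<..} f'"
    unfolding f'_def using s by (intro continuous_intros continuous_on_compose2[OF cutoff'_continuous]) auto
  have const: "primitive ?f t = primitive ?f (2 * S)" if "2 * S \<le> t" for t
    unfolding primitive_def using that fz by (intro Bochner_Integration.integral_cong) auto
  have S2: "0 < 2 * S" using S by simp
  have be: "bump S \<sigma> = (\<lambda>x. if x = 0 then primitive ?f (2 * S) else primitive ?f (\<Gamma> x))"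
    by (rule ext) (simp add: bump_def)
  note R = radial_C2_UNIV[OF primitive_deriv[OF fi fc] fd f'c S2 const, folded be]
  show "C2_on UNIV (bump S \<sigma>)" by (rule R(1); assumption)
  have "0 \<le> primitive ?f t" for t unfolding primitive_def using f0 by (intro integral_nonneg_AE) auto
  then show "0 \<le> bump S \<sigma> x" by (simp add: bump_def)
  show "bump S \<sigma> x = 0" if "level_radius \<sigma> \<le> norm x"
  proof -
    have x: "x \<noteq> 0" using that level_radius_pos[OF s(1)] by auto
    then have "\<Gamma> x \<le> \<sigma>" using \<Gamma>_gt_iff[OF s(1), of x] that by simp
    then have "(if t \<le> \<Gamma> x then ?f t else 0) = 0" for t using fz2[of t] by auto
    then show ?thesis using x by (simp add: bump_def primitive_def)
  qed
  show "laplacian (bump S \<sigma>) x = mollifier \<sigma> x - mollifier S x" if "x \<noteq> 0"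
  proof -
    have "laplacian (bump S \<sigma>) x = f' (\<Gamma> x) / level_density (\<Gamma> x)" by (rule R(2)[OF _ _ _ that]; assumption)
    then show ?thesis by (simp add: f'_def mollifier_def diff_divide_distrib)
  qed
qed

text \<open>Integrate the hypothesis against \<zeta>(x) and exchange the integrals. The mollifier
  then acts on the continuous function \<zeta>, where it converges everywhere as S \<rightarrow>
  \<infinity>, so H itself is never evaluated pointwise.\<close>

lemma mollifier_nonneg_imp_AE_nonneg:
  fixes H :: "real^'n \<Rightarrow> real"
  assumes Hm [measurable]: "H \<in> borel_measurable borel"
    and Hl: "\<And>R. integrable lborel (\<lambda>y. H y * indicator (cball 0 R) y)"
    and nn: "\<And>S x. 0 < S \<Longrightarrow> 0 \<le> (LINT y|lborel. H y * mollifier S (y - x))"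
  shows "AE y in lborel. 0 \<le> H y"
proof (rule AE_nonneg_from_tests[OF Hm Hl])
  fix \<zeta> :: "real^'n \<Rightarrow> real" and R
  assume \<zeta>c: "continuous_on UNIV \<zeta>" and \<zeta>n: "\<And>y. 0 \<le> \<zeta> y" and \<zeta>s: "\<And>y. R \<le> norm y \<Longrightarrow> \<zeta> y = 0"
  have [measurable]: "\<zeta> \<in> borel_measurable borel" using \<zeta>c by (rule borel_measurable_continuous_onI)
  have "bounded (\<zeta> ` cball 0 R)"
    by (intro compact_imp_bounded compact_continuous_image continuous_on_subset[OF \<zeta>c]) auto
  then obtain Z where Z: "\<forall>x\<in>cball 0 R. \<bar>\<zeta> x\<bar> \<le> Z" by (auto simp: bounded_iff)
  define Z' where "Z' = max Z 0"
  have \<zeta>b: "\<zeta> x \<le> Z' * indicator (cball 0 R) x" for x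
    using Z \<zeta>s[of x] by (cases "norm x \<le> R") (force simp: Z'_def)+
  have Z'0: "0 \<le> Z'" by (simp add: Z'_def)
  have \<zeta>b': "\<zeta> x \<le> Z'" for x using \<zeta>b[of x] Z'0 by (cases "x \<in> cball 0 R") auto
  have conv: "0 \<le> (LINT y|lborel. H y * (LINT z|lborel. mollifier S z * \<zeta> (y - z)))" if S: "0 < S" for S
  proof -
    define m where "m = 4 / S / level_density (2 * S)"
    have m0: "0 \<le> m" using S level_density_nonneg by (simp add: m_def)
    define r where "r = \<bar>R\<bar> + level_radius S"
    have bd: "norm (\<zeta> x * (H y * mollifier S (y - x))) \<le>
        (Z' * m * indicator (cball 0 R) x) * norm (H y * indicator (cball 0 r) y)" for x y
    proof (cases "x \<in> cball 0 R \<and> y - x \<in> cball 0 (level_radius S)")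
      case True
      then have "norm y \<le> r" using norm_triangle_ineq[of x "y - x"] by (auto simp: r_def)
      moreover have "mollifier S (y - x) \<le> m" using mollifier_le[OF S, of "y - x"] True by (simp add: m_def)
      then have "\<zeta> x * (\<bar>H y\<bar> * mollifier S (y - x)) \<le> Z' * (\<bar>H y\<bar> * m)"
        using \<zeta>b' Z'0 \<zeta>n mollifier_nonneg[OF S] m0 by (intro mult_mono mult_left_mono) auto
      ultimately show ?thesis using True \<zeta>n mollifier_nonneg[OF S, of "y - x"] by (simp add: abs_mult mult_ac)
    next
      case False
      then have "\<zeta> x = 0 \<or> mollifier S (y - x) = 0"
        using \<zeta>b[of x] \<zeta>n[of x] mollifier_le[OF S, of "y - x"] mollifier_nonneg[OF S, of "y - x"] by auto
      then show ?thesis using m0 Z'0 by auto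
    qed
    have [measurable]: "cball (0::real^'n) R \<in> sets borel" "cball (0::real^'n) r \<in> sets borel" by simp_all
    let ?F = "\<lambda>(x, y). \<zeta> x * (H y * mollifier S (y - x))"
    have i1: "integrable lborel (\<lambda>x. Z' * m * indicator (cball (0::real^'n) R) x)"
      by (intro integrable_mult_right integrable_real_indicator emeasure_lborel_cball_finite) auto
    have i2: "integrable lborel (\<lambda>y. norm (H y * indicator (cball 0 r) y))" using Hl by (rule integrable_norm)
    have ii: "integrable (lborel \<Otimes>\<^sub>M lborel) (\<lambda>z. (Z' * m * indicator (cball (0::real^'n) R) (fst z)) * norm (H (snd z)
        * indicator (cball 0 r) (snd z)))"
    proof (rule lborel_pair.Fubini_integrable)
      show "integrable lborel (\<lambda>x. \<integral>y. norm ((Z' * m * indicator (cball (0::real^'n) R) (fst (x, y))) * norm (H (snd (x,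
          y)) * indicator (cball 0 r) (snd (x, y)))) \<partial>lborel)"
        using i1 m0 Z'0 by (simp add: abs_mult integrable_mult_left)
      show "AE x in lborel. integrable lborel (\<lambda>y. (Z' * m * indicator (cball (0::real^'n) R) (fst (x, y))) * norm (H
          (snd (x, y)) * indicator (cball 0 r) (snd (x, y))))"
        unfolding fst_conv snd_conv by (intro always_eventually allI integrable_mult_right i2)
    qed measurable
    have Fi: "integrable (lborel \<Otimes>\<^sub>M lborel) ?F"
    proof (rule Bochner_Integration.integrable_bound[OF ii])
      show "AE z in lborel \<Otimes>\<^sub>M lborel. norm (?F z) \<le>
          norm ((Z' * m * indicator (cball (0::real^'n) R) (fst z)) * norm (H (snd z) * indicator (cball 0 r) (snd z)))"
        using bd by (intro always_eventually allI) (auto intro: order_trans[OF _ abs_ge_self] simp del: norm_mult split: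
            prod.split)
    qed measurable
    have "0 \<le> (LINT x|lborel. LINT y|lborel. \<zeta> x * (H y * mollifier S (y - x)))"
    proof (rule integral_nonneg_AE, rule always_eventually, rule allI)
      fix x
      have "(LINT y|lborel. \<zeta> x * (H y * mollifier S (y - x))) = \<zeta> x * (LINT y|lborel. H y * mollifier S (y - x))"
        by (rule integral_mult_right_zero)
      then show "0 \<le> (LINT y|lborel. \<zeta> x * (H y * mollifier S (y - x)))" using nn[OF S, of x] \<zeta>n[of x] by simp
    qed
    also have "\<dots> = (LINT y|lborel. LINT x|lborel. \<zeta> x * (H y * mollifier S (y - x)))"
      by (rule lborel_pair.Fubini_integral[symmetric]) (rule Fi)
    also have "\<dots> = (LINT y|lborel. H y * (LINT z|lborel. mollifier S z * \<zeta> (y - z)))"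
    proof (rule Bochner_Integration.integral_cong[OF refl])
      fix y
      have "(LINT x|lborel. \<zeta> x * (H y * mollifier S (y - x))) = H y * (LINT x|lborel. \<zeta> x * mollifier S (y - x))"
        by (simp only: mult.left_commute[of _ "H y"] integral_mult_right_zero)
      also have "(LINT x|lborel. \<zeta> x * mollifier S (y - x)) = (LINT z|lborel. mollifier S z * \<zeta> (y - z))"
      proof -
        have "distr lborel borel (\<lambda>z. y - z) = (lborel :: (real^'n) measure)"
          using lborel_distr_reflection .
        then have "(LINT x|lborel. \<zeta> x * mollifier S (y - x)) =
            (LINT x|distr lborel borel (\<lambda>z. y - z). \<zeta> x * mollifier S (y - x))" by simp
        also have "\<dots> = (LINT z|lborel. \<zeta> (y - z) * mollifier S (y - (y - z)))" by (rule integral_distr) measurable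
        finally show ?thesis by (simp add: mult.commute)
      qed
      finally show "(LINT x|lborel. \<zeta> x * (H y * mollifier S (y - x))) = H y * (LINT z|lborel. mollifier S z * \<zeta> (y - z))" .
    qed
    finally show ?thesis .
  qed
  define m where "m n = real n + 1" for n :: nat
  have m: "0 < m n" "1 \<le> m n" for n by (auto simp: m_def)
  have mtop: "filterlim m at_top sequentially" unfolding m_def by real_asymp
  define r where "r = \<bar>R\<bar> + level_radius 1"
  have bd: "norm (H y * (LINT z|lborel. mollifier (m n) z * \<zeta> (y - z))) \<le> Z' * norm (H y * indicator (cball 0 r) y)" for n y
  proof -
    have z: "\<bar>\<zeta> (y - z)\<bar> \<le> Z' * indicator (cball 0 r) y" if "norm z < level_radius (m n)" for z
    proof (cases "norm (y - z) \<le> R")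
      case True
      have "level_radius (m n) \<le> level_radius 1" using m[of n] by (intro level_radius_antimono) auto
      then have "norm y \<le> r" using True that norm_triangle_ineq[of "y - z" z] by (simp add: r_def)
      then show ?thesis using \<zeta>b'[of "y - z"] \<zeta>n[of "y - z"] by simp
    next
      case False
      then show ?thesis using \<zeta>s[of "y - z"] Z'0 by simp
    qed
    have "\<bar>LINT z|lborel. mollifier (m n) z * \<zeta> (y - z)\<bar> \<le> Z' * indicator (cball 0 r) y"
      by (rule mollifier_bound(2)) (use m z in auto)
    then have "\<bar>H y\<bar> * \<bar>LINT z|lborel. mollifier (m n) z * \<zeta> (y - z)\<bar> \<le> \<bar>H y\<bar> * (Z' * indicator (cball 0 r) y)"
      by (intro mult_left_mono) auto
    then show ?thesis by (simp add: abs_mult mult_ac)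
  qed
  have "(\<lambda>n. LINT y|lborel. H y * (LINT z|lborel. mollifier (m n) z * \<zeta> (y - z))) \<longlonglongrightarrow> (LINT y|lborel. H y * \<zeta> y)"
  proof (rule integral_dominated_convergence)
    show "integrable lborel (\<lambda>y. Z' * norm (H y * indicator (cball 0 r) y))"
      using Hl by (intro integrable_mult_right integrable_norm)
    show "AE y in lborel. (\<lambda>n. H y * (LINT z|lborel. mollifier (m n) z * \<zeta> (y - z))) \<longlonglongrightarrow> H y * \<zeta> y"
    proof (intro always_eventually allI)
      fix y
      have "((\<lambda>z. \<zeta> (y - z)) \<longlongrightarrow> \<zeta> (y - 0)) (at 0)"
      proof (rule continuous_on_tendsto_compose[OF \<zeta>c])
        show "((\<lambda>z. y - z) \<longlongrightarrow> y - 0) (at 0)" by (intro tendsto_intros)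
      qed auto
      from filterlim_compose[OF mollifier_limit(2)[OF _ this] mtop]
      show "(\<lambda>n. H y * (LINT z|lborel. mollifier (m n) z * \<zeta> (y - z))) \<longlonglongrightarrow> H y * \<zeta> y" by (intro tendsto_intros) simp
    qed
    show "AE y in lborel. norm (H y * (LINT z|lborel. mollifier (m n) z * \<zeta> (y - z))) \<le>
        Z' * norm (H y * indicator (cball 0 r) y)" for n
      using bd by (intro always_eventually allI)
  qed measurable
  then show "0 \<le> (LINT y|lborel. H y * \<zeta> y)"
    by (rule LIMSEQ_le_const) (use conv[OF m(1)] in blast)
qed

end

context big_dim begin

lemma locally_integrable_mollifier:
  assumes [measurable]: "g \<in> borel_measurable borel"
    and g: "\<And>R. integrable lborel (\<lambda>y. g y * indicator (cball 0 R) y)" and S: "0 < S"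
  shows "integrable lborel (\<lambda>y. g y * mollifier S (y - x))"
proof -
  define m where "m = 4 / S / level_density (2 * S)"
  have m0: "0 \<le> m" using S level_density_nonneg by (simp add: m_def)
  have "integrable lborel (\<lambda>y. m * (g y * indicator (cball 0 (norm x + level_radius S)) y))" using g
      by (rule integrable_mult_right)
  then show ?thesis
  proof (rule Bochner_Integration.integrable_bound)
    show "AE y in lborel. norm (g y * mollifier S (y - x)) \<le> norm (m * (g y * indicator (cball 0 (norm x + level_radius S)) y))"
    proof (intro always_eventually allI)
      fix y
      show "norm (g y * mollifier S (y - x)) \<le> norm (m * (g y * indicator (cball 0 (norm x + level_radius S)) y))"
      proof (cases "y - x \<in> cball 0 (level_radius S)")
        case True
        then have "norm y \<le> norm x + level_radius S" using norm_triangle_ineq[of x "y - x"] by simp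
        moreover have "\<bar>mollifier S (y - x)\<bar> \<le> m"
            using mollifier_le[OF S, of "y - x"] mollifier_nonneg[OF S, of "y - x"] True by (simp add: m_def)
        ultimately show ?thesis using m0 mult_right_mono[of "\<bar>mollifier S (y - x)\<bar>" m "\<bar>g y\<bar>"]
            by (simp add: abs_mult mult.commute)
      next
        case False
        then have "mollifier S (y - x) = 0" using mollifier_le[OF S, of "y - x"] mollifier_nonneg[OF S, of "y - x"] by simp
        then show ?thesis by simp
      qed
    qed
  qed measurable
qed

text \<open>In H = u - W(\<Gamma>) the Dirac masses cancel, so H is superharmonic in the weak sense
  across the origin as well. Its radial means about any x grow as the shells contract; on shells
  near infinity they are almost nonnegative, because u \<ge> 0 and W(\<Gamma>) tends to 0.\<close>

lemma comparison:
  fixes k C :: real and W \<phi> :: "real \<Rightarrow> real" and u f :: "real^'n \<Rightarrow> real"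
  assumes \<phi>c: "continuous_on {0<..} \<phi>" and \<phi>i: "integrable lborel \<phi>" and \<phi>z: "\<And>t. t \<le> 0 \<Longrightarrow> \<phi> t = 0" and \<phi>n: "\<And>t. 0 \<le> \<phi> t"
    and k: "0 \<le> k"
    and W1: "\<And>s. 0 < s \<Longrightarrow> (W has_real_derivative (k + (LINT t|lborel. (if s < t then \<phi> t else 0)))) (at s)"
    and Wb: "\<And>s. 0 < s \<Longrightarrow> 0 \<le> W s" "\<And>s. 0 < s \<Longrightarrow> W s \<le> C * s"
    and Wm [measurable]: "W \<in> borel_measurable borel"
    and u0: "\<And>x::real^'n. 0 \<le> u x" and uL: "L1_loc u" and fi: "integrable lebesgue f"
    and uw: "\<And>\<xi> :: real^'n \<Rightarrow> real. C11_compact_support \<xi> \<Longrightarrow>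
        (LINT x|(lebesgue :: (real^'n) measure). u x * (- laplacian \<xi> x)) =
            (LINT x|(lebesgue :: (real^'n) measure). f x * \<xi> x) + k * \<xi> 0"
    and le: "AE x in (lebesgue :: (real^'n) measure). \<phi> (\<Gamma> x) / level_density (\<Gamma> x) \<le> f x"
  shows "AE x in (lebesgue :: (real^'n) measure). W (\<Gamma> x) \<le> u x"
proof -
  have uI: "integrable lebesgue (\<lambda>x. indicator (cball 0 R) x *\<^sub>R u x)" for R
    using uL[unfolded L1_loc_def set_integrable_def, rule_format, of "cball 0 R"] by simp
  have um: "u \<in> borel_measurable lebesgue"
  proof (rule borel_measurable_LIMSEQ_real)
    show "(\<lambda>x. indicator (cball 0 (real i)) x *\<^sub>R u x) \<in> borel_measurable lebesgue" for i
        by (rule borel_measurable_integrable[OF uI])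
    fix x :: "real^'n"
    obtain n0 :: nat where n0: "norm x \<le> real n0" using real_arch_simple by blast
    have "\<forall>\<^sub>F i in sequentially. indicator (cball 0 (real i)) x *\<^sub>R u x = u x"
      using eventually_ge_at_top[of n0] by eventually_elim (use n0 in auto)
    then show "(\<lambda>i. indicator (cball 0 (real i)) x *\<^sub>R u x) \<longlonglongrightarrow> u x" by (rule tendsto_eventually)
  qed
  \<comment> \<open>A Borel representative of u, so that the integrals can be moved to
    \<open>lborel\<close>, where translation and Fubini are applied.\<close>
  obtain u' where u'm[measurable]: "u' \<in> borel_measurable lborel" and uu': "AE x in lborel. u x = u' x"
    using completion_ex_borel_measurable_real[OF um] by blast
  have uu'l: "AE x in lebesgue. u x = u' x" using uu' by (rule AE_completion)
  have u'm2[measurable]: "u' \<in> borel_measurable borel" using u'm by simp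
  have cbm[measurable]: "cball (0::real^'n) R \<in> sets borel" for R by simp
  have u'I: "integrable lborel (\<lambda>y. u' y * indicator (cball 0 R) y)" for R
  proof -
    have m: "(\<lambda>y. u' y * indicat_real (cball 0 R) y) \<in> borel_measurable lborel" by measurable
    have "integrable lebesgue (\<lambda>y. u' y * indicator (cball 0 R) y)"
    proof (rule integrable_cong_AE_imp[OF uI[of R]])
      show "(\<lambda>y. u' y * indicat_real (cball 0 R) y) \<in> borel_measurable lebesgue" using m by (rule measurable_completion)
      show "AE x in lebesgue. indicat_real (cball 0 R) x *\<^sub>R u x = u' x * indicat_real (cball 0 R) x"
          using uu'l by eventually_elim (simp add: mult.commute)
    qed
    then show ?thesis using integrable_completion[OF m] by simp
  qed
  have C0: "0 \<le> C" using Wb(1)[of 1] Wb(2)[of 1] by simp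
  have WI: "integrable lborel (\<lambda>y. W (\<Gamma> y) * indicator (cball 0 R) y)" for R
  proof (rule Bochner_Integration.integrable_bound)
    show "integrable lborel (\<lambda>x. (C + \<bar>W 0\<bar>) * (\<Gamma> x * indicator (cball 0 R) x))" using \<Gamma>_integrable_ball[of R]
        by (rule integrable_mult_right)
    have "AE y in lborel. y \<noteq> (0::real^'n)" by (rule AE_lborel_singleton)
    then show "AE y in lborel. norm (W (\<Gamma> y) * indicator (cball 0 R) y) \<le> norm ((C + \<bar>W 0\<bar>) * (\<Gamma> y * indicator (cball 0 R) y))"
    proof eventually_elim
      case (elim y)
      have "W (\<Gamma> y) \<le> (C + \<bar>W 0\<bar>) * \<Gamma> y" using Wb(2)[OF \<Gamma>_pos[OF elim]] \<Gamma>_nonneg[of y]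
          by (simp add: distrib_right add_increasing2)
      then show ?case using Wb(1)[OF \<Gamma>_pos[OF elim]] C0 \<Gamma>_nonneg[of y] by (auto simp: indicator_def)
    qed
  qed measurable
  define H where "H y = u' y - W (\<Gamma> y)" for y
  have Hm[measurable]: "H \<in> borel_measurable borel" unfolding H_def[abs_def] by measurable
  have HI: "integrable lborel (\<lambda>y. H y * indicator (cball 0 R) y)" for R
    unfolding H_def left_diff_distrib by (intro Bochner_Integration.integrable_diff u'I WI)
  \<comment> \<open>The equation for u and the weak formula for W are tested with the translated
    bump. Since the bump is nonnegative, the ordering of the sources gives the sign, and its
    Laplacian is a difference of two mollifiers about x.\<close>
  have mono: "(LINT y|lborel. H y * mollifier \<sigma> (y - x)) \<le>
      (LINT y|lborel. H y * mollifier S (y - x))" if s: "0 < \<sigma>" "\<sigma> < S" for x \<sigma> S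
  proof -
    have S: "0 < S" using s by simp
    define \<xi> where "\<xi> y = bump S \<sigma> (y - x)" for y
    have C2: "C2_on UNIV \<xi>" unfolding \<xi>_def by (rule C2_on_translate) (rule bump[OF s])
    have \<xi>0: "0 \<le> \<xi> y" for y unfolding \<xi>_def by (rule bump[OF s])
    have \<xi>s: "\<xi> y = 0" if "norm x + level_radius \<sigma> \<le> norm y" for y
      unfolding \<xi>_def using that norm_triangle_sub[of y x] by (intro bump(3)[OF s]) simp
    have C11: "C11_compact_support \<xi>" by (rule C2_on_imp_C11_compact_support[OF C2 \<xi>s])
    have lap: "- laplacian \<xi> y = mollifier S (y - x) - mollifier \<sigma> (y - x)" if "y \<noteq> x" for y
      using that bump(4)[OF s, of "y - x"] by (simp add: \<xi>_def[abs_def] laplacian_translate)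
    have \<xi>c: "continuous_on UNIV \<xi>"
      using C2 unfolding C2_on_def by (metis UNIV_I GDERIV_continuous_on)
    have [measurable]: "\<xi> \<in> borel_measurable borel" using \<xi>c by (rule borel_measurable_continuous_onI)
    have "bounded (\<xi> ` cball 0 (norm x + level_radius \<sigma>))"
      by (intro compact_imp_bounded compact_continuous_image continuous_on_subset[OF \<xi>c]) auto
    then obtain X where X: "\<forall>y\<in>cball 0 (norm x + level_radius \<sigma>). \<bar>\<xi> y\<bar> \<le> X" by (auto simp: bounded_iff)
    have X0: "0 \<le> X" using X[rule_format, of 0] level_radius_pos[OF s(1)] by simp
    have Xb: "\<bar>\<xi> y\<bar> \<le> X" for y using X X0 \<xi>s[of y] by (cases "norm y \<le> norm x + level_radius \<sigma>") auto
    have \<xi>ml: "\<xi> \<in> borel_measurable lebesgue" by (rule measurable_completion) measurable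
    have f\<xi>: "integrable lebesgue (\<lambda>y. f y * \<xi> y)"
    proof (rule Bochner_Integration.integrable_bound)
      show "integrable lebesgue (\<lambda>y. X * f y)" using fi by (rule integrable_mult_right)
      show "(\<lambda>y. f y * \<xi> y) \<in> borel_measurable lebesgue" using fi \<xi>ml by (intro borel_measurable_times) auto
      show "AE y in lebesgue. norm (f y * \<xi> y) \<le> norm (X * f y)"
      proof (intro always_eventually allI)
        fix y show "norm (f y * \<xi> y) \<le> norm (X * f y)"
          using mult_right_mono[OF Xb[of y], of "\<bar>f y\<bar>"] X0 by (simp add: abs_mult mult.commute)
      qed
    qed
    note wf = weak_formula[OF \<phi>c \<phi>i \<phi>z \<phi>n k W1 Wb Wm C11]
    have [measurable]: "\<phi> \<in> borel_measurable borel" using \<phi>i by auto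
    have \<phi>ml: "(\<lambda>y. \<phi> (\<Gamma> y) / level_density (\<Gamma> y) * \<xi> y) \<in> borel_measurable lborel" by measurable
    have \<phi>\<xi>: "integrable lebesgue (\<lambda>y. \<phi> (\<Gamma> y) / level_density (\<Gamma> y) * \<xi> y)"
      using integrable_completion[OF \<phi>ml] wf(2) by simp
    have i1: "(LINT y|lborel. \<phi> (\<Gamma> y) / level_density (\<Gamma> y) * \<xi> y) \<le> (LINT y|lebesgue. f y * \<xi> y)"
      unfolding integral_completion[OF \<phi>ml, symmetric]
    proof (rule integral_mono_AE[OF \<phi>\<xi> f\<xi>])
      show "AE y in lebesgue. \<phi> (\<Gamma> y) / level_density (\<Gamma> y) * \<xi> y \<le> f y * \<xi> y"
        using le by eventually_elim (intro mult_right_mono \<xi>0)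
    qed
    have i2: "(LINT y|lebesgue. u y * (- laplacian \<xi> y)) + (LINT y|lebesgue. W (\<Gamma> y) * laplacian \<xi> y) \<ge> 0"
      using uw[OF C11] wf(3) i1 by simp
    have mi: "integrable lborel (\<lambda>y. g y * mollifier S (y - x) - g y * mollifier \<sigma> (y - x))"
       "(LINT y|lborel. g y * mollifier S (y - x) - g y * mollifier \<sigma> (y - x)) =
           (LINT y|lborel. g y * mollifier S (y - x)) - (LINT y|lborel. g y * mollifier \<sigma> (y - x))"
      if "g \<in> borel_measurable borel" "\<And>R. integrable lborel (\<lambda>y. g y * indicator (cball 0 R) y)" for g
      using locally_integrable_mollifier[OF that S, of x] locally_integrable_mollifier[OF that s(1), of x] by auto
    have WGm: "(\<lambda>y. W (\<Gamma> y)) \<in> borel_measurable borel" by measurable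
    have nx: "AE y in lebesgue. y \<noteq> x" by (intro AE_completion AE_lborel_singleton)
    have lm: "laplacian \<xi> \<in> borel_measurable lebesgue" by (rule C11_laplacian_bound[OF C11])
    have e1: "(LINT y|lebesgue. u y * (- laplacian \<xi> y)) =
        (LINT y|lborel. u' y * mollifier S (y - x) - u' y * mollifier \<sigma> (y - x))"
    proof -
      have "(LINT y|lebesgue. u y * (- laplacian \<xi> y)) =
          (LINT y|lebesgue. u' y * mollifier S (y - x) - u' y * mollifier \<sigma> (y - x))"
      proof (rule integral_cong_AE)
        show "(\<lambda>y. u y * (- laplacian \<xi> y)) \<in> borel_measurable lebesgue"
            by (intro borel_measurable_times borel_measurable_uminus um lm)
        show "(\<lambda>y. u' y * mollifier S (y - x) - u' y * mollifier \<sigma> (y - x)) \<in> borel_measurable lebesgue"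
            by (rule measurable_completion) measurable
        show "AE y in lebesgue. u y * (- laplacian \<xi> y) = u' y * mollifier S (y - x) - u' y * mollifier \<sigma> (y - x)"
          using uu'l nx
        proof eventually_elim
          case (elim y)
          show ?case unfolding lap[OF elim(2)] elim(1) by (rule right_diff_distrib)
        qed
      qed
      also have "\<dots> = (LINT y|lborel. u' y * mollifier S (y - x) - u' y * mollifier \<sigma> (y - x))"
          by (rule integral_completion) measurable
      finally show ?thesis .
    qed
    have e2: "(LINT y|lebesgue. W (\<Gamma> y) * laplacian \<xi> y) =
        - (LINT y|lborel. W (\<Gamma> y) * mollifier S (y - x) - W (\<Gamma> y) * mollifier \<sigma> (y - x))"
    proof -
      have "(LINT y|lebesgue. W (\<Gamma> y) * laplacian \<xi> y) =
          (LINT y|lebesgue. - (W (\<Gamma> y) * mollifier S (y - x) - W (\<Gamma> y) * mollifier \<sigma> (y - x)))"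
      proof (rule integral_cong_AE)
        show "(\<lambda>y. W (\<Gamma> y) * laplacian \<xi> y) \<in> borel_measurable lebesgue" using wf(1) by auto
        show "(\<lambda>y. - (W (\<Gamma> y) * mollifier S (y - x) - W (\<Gamma> y) * mollifier \<sigma> (y - x))) \<in> borel_measurable lebesgue"
            by (rule measurable_completion) measurable
        show "AE y in lebesgue. W (\<Gamma> y) * laplacian \<xi> y = - (W (\<Gamma> y) * mollifier S (y - x) - W (\<Gamma> y) * mollifier \<sigma> (y - x))"
          using nx
        proof eventually_elim
          case (elim y)
          have "laplacian \<xi> y = - (mollifier S (y - x) - mollifier \<sigma> (y - x))" using lap[OF elim] by simp
          then show ?case by (simp only: right_diff_distrib mult_minus_right)
        qed
      qed
      also have "\<dots> = (LINT y|lborel. - (W (\<Gamma> y) * mollifier S (y - x) - W (\<Gamma> y) * mollifier \<sigma> (y - x)))"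
          by (rule integral_completion) measurable
      also have "\<dots> = - (LINT y|lborel. W (\<Gamma> y) * mollifier S (y - x) - W (\<Gamma> y) * mollifier \<sigma> (y - x))" by (rule integral_minus)
      finally show ?thesis .
    qed
    have Hs: "(LINT y|lborel. H y * mollifier M (y - x)) =
        (LINT y|lborel. u' y * mollifier M (y - x)) - (LINT y|lborel. W (\<Gamma> y) * mollifier M (y - x))" if "0 < M" for M
      unfolding H_def left_diff_distrib
      by (intro Bochner_Integration.integral_diff locally_integrable_mollifier that u'm2 u'I WGm WI)
    show ?thesis using i2 unfolding e1 e2 mi(2)[OF u'm2 u'I] mi(2)[OF WGm WI] Hs[OF S] Hs[OF s(1)] by simp
  qed
  have nn: "0 \<le> (LINT y|lborel. H y * mollifier S (y - x))" if S: "0 < S" for S x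
  proof (rule field_le_epsilon)
    fix e :: real assume e: "0 < e"
    \<comment> \<open>Where \<Gamma> \<le> d, W(\<Gamma>) is at most C d \<le> e; the denominator C
      + 1 covers C = 0.\<close>
    define d where "d = e / (C + 1)"
    have d: "0 < d" "C * d \<le> e" using e C0 by (auto simp: d_def field_simps)
    define r where "r = norm x + level_radius d"
    have r: "0 < r" using level_radius_pos[OF d(1)] by (simp add: r_def add_nonneg_pos)
    \<comment> \<open>So small that the shell about x carrying the mollifier stays at distance at
      least r from x, hence outside the ball about the origin where \<Gamma> may exceed d; and
      \<sigma> < S, as \<open>mono\<close> requires.\<close>
    define \<sigma> where "\<sigma> = min (green_coeff * r powr (2 - N) / 2) (S / 2)"
    have s: "0 < \<sigma>" "\<sigma> < S" using S r green_coeff_pos by (auto simp: \<sigma>_def)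
    have "level_radius (green_coeff * r powr (2 - N)) = r" using green_coeff_pos N2 r by (simp add: level_radius_def powr_powr)
    then have rs: "r \<le> level_radius (2 * \<sigma>)" using level_radius_antimono[of "2 * \<sigma>" "green_coeff * r powr (2 - N)"] s
        by (auto simp: \<sigma>_def)
    have u'0: "AE y in lborel. 0 \<le> u' y" using uu' by eventually_elim (use u0 in metis)
    have low: "AE y in lborel. - e * mollifier \<sigma> (y - x) \<le> H y * mollifier \<sigma> (y - x)"
      using u'0 AE_lborel_singleton[of x] AE_lborel_singleton[of 0]
    proof eventually_elim
      case (elim y)
      show ?case
      proof (cases "mollifier \<sigma> (y - x) = 0")
        case False
        have "\<Gamma> (y - x) < 2 * \<sigma>" using mollifier_support[OF s(1) False] by simp
        then have "level_radius (2 * \<sigma>) \<le> norm (y - x)" using \<Gamma>_ge_iff[of "2 * \<sigma>" "y - x"] s elim(2) by simp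
        then have "level_radius d \<le> norm y" using rs norm_triangle_ineq4[of y x] by (simp add: r_def)
        then have "\<Gamma> y \<le> d" using \<Gamma>_gt_iff[OF d(1), of y] by simp
        then have "W (\<Gamma> y) \<le> e" using Wb(2)[OF \<Gamma>_pos[OF elim(3)]] mult_left_mono[of "\<Gamma> y" d C] C0 d(2) by simp
        then have "- e \<le> H y" using elim(1) by (simp add: H_def)
        then show ?thesis using mollifier_nonneg[OF s(1)] by (intro mult_right_mono)
      qed simp
    qed
    have tm: "integrable lborel (\<lambda>y. mollifier \<sigma> (y - x))" "(LINT y|lborel. mollifier \<sigma> (y - x)) = 1"
    proof -
      have dd: "distr lborel borel (\<lambda>y. y - x) = lborel" using lborel_distr_translation[of "- x"] by simp
      have "integrable (distr lborel borel (\<lambda>y. y - x)) (mollifier \<sigma>)" unfolding dd using mollifier_mass[OF s(1)] by simp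
      then show "integrable lborel (\<lambda>y. mollifier \<sigma> (y - x))" by (subst (asm) integrable_distr_eq) auto
      have "(LINT y|distr lborel borel (\<lambda>y. y - x). mollifier \<sigma> y) = 1" unfolding dd using mollifier_mass[OF s(1)] by simp
      then show "(LINT y|lborel. mollifier \<sigma> (y - x)) = 1" by (subst (asm) integral_distr) auto
    qed
    have "(LINT y|lborel. - e * mollifier \<sigma> (y - x)) \<le> (LINT y|lborel. H y * mollifier \<sigma> (y - x))"
      by (rule integral_mono_AE[OF integrable_mult_right[OF tm(1)] locally_integrable_mollifier[OF Hm HI s(1)] low])
    then have "- e \<le> (LINT y|lborel. H y * mollifier \<sigma> (y - x))" by (simp add: tm(2))
    then show "0 \<le> (LINT y|lborel. H y * mollifier S (y - x)) + e" using mono[OF s, of x] by simp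
  qed
  have "AE y in lborel. 0 \<le> H y" by (rule mollifier_nonneg_imp_AE_nonneg[OF Hm HI nn])
  then have "AE y in lborel. W (\<Gamma> y) \<le> u y" using uu' by eventually_elim (simp add: H_def)
  then show ?thesis by (rule AE_completion)
qed

end

section \<open>The singular problem\<close>

locale singular_problem = big_dim ty N for ty :: "'n::finite itself" and N +
  fixes V :: "real^'n \<Rightarrow> real" and c1 a0 ainf p c2 k :: real
  assumes V_radial: "radially_symmetric V"
    and V_lip: "locally_lipschitz_on (- {0}) V"
    and V_nonneg: "\<And>x. x \<noteq> 0 \<Longrightarrow> 0 \<le> V x"
    and V_nontriv: "\<exists>x. x \<noteq> 0 \<and> V x \<noteq> 0"
    and c1_pos: "0 < c1"
    and a_less: "a0 < ainf"
    and V_le: "\<And>x. x \<noteq> 0 \<Longrightarrow> V x \<le> c1 / (norm x powr a0 * (1 + norm x powr (ainf - a0)))"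
    and p1: "1 < p"
    and p_lower: "(N - ainf) / (N - 2) < p" and p_upper: "p < (N - a0) / (N - 2)"
    and p_sub: "two_star CARD('n) ainf - 1 < p"
    and c2_pos: "0 < c2"
    and green_le: "\<And>x. x \<noteq> 0 \<Longrightarrow> green_op (\<lambda>y. V y * green_dirac y powr p) x \<le> c2 * green_dirac x"
    and k_pos: "0 < k" and k_le: "k < k_threshold c2 p"
begin

section \<open>From the potential V to the weight q\<close>

lemma V_cont: "continuous_on (- {0}) V"
proof (rule continuous_at_imp_continuous_on, rule ballI)
  fix x :: "real^'n" assume x: "x \<in> - {0}"
  obtain r L where r: "r > 0" "L-lipschitz_on (ball x r \<inter> - {0}) V"
    using V_lip x unfolding locally_lipschitz_on_def by blast
  have "continuous_on (ball x r \<inter> - {0}) V" using r(2) by (rule lipschitz_on_continuous_on)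
  moreover have "open (ball x r \<inter> - {0})" by (auto simp: open_Compl)
  ultimately show "isCont V x" using r(1) x by (simp add: continuous_on_eq_continuous_at)
qed

lemma V_meas [measurable]: "V \<in> borel_measurable borel"
  by (rule borel_measurable_continuous_countable_exceptions[of "{0}"]) (auto simp: V_cont)

definition unit_vec :: "real^'n" where "unit_vec = axis undefined 1"
definition radial_profile :: "real \<Rightarrow> real" where "radial_profile r = V (r *\<^sub>R unit_vec)"
definition q :: "real \<Rightarrow> real" where "q s = (if 0 < s then radial_profile (level_radius s) * level_density s else 0)"

lemma norm_unit_vec: "norm unit_vec = 1" by (simp add: unit_vec_def)

lemma V_eq_radial_profile: "V x = radial_profile (norm x)"
  unfolding radial_profile_def by (rule V_radial[unfolded radially_symmetric_def, rule_format]) (simp add: norm_unit_vec)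

lemma q_\<Gamma>: "x \<noteq> 0 \<Longrightarrow> q (\<Gamma> x) = V x * level_density (\<Gamma> x)"
  using \<Gamma>_pos[of x] by (simp add: q_def level_radius_\<Gamma> V_eq_radial_profile)

lemma scaled_unit_vec_nonzero: "0 < r \<Longrightarrow> r *\<^sub>R unit_vec \<noteq> 0" using norm_unit_vec by auto

lemma radial_profile_nonneg: "0 < r \<Longrightarrow> 0 \<le> radial_profile r" unfolding radial_profile_def
    by (intro V_nonneg scaled_unit_vec_nonzero)

lemma q_nonneg: "0 \<le> q s" using radial_profile_nonneg level_radius_pos level_density_nonneg by (simp add: q_def)

lemma q_zero: "s \<le> 0 \<Longrightarrow> q s = 0" by (simp add: q_def)

lemma q_cont: "continuous_on {0<..} q"
proof -
  have "continuous_on {0<..} (\<lambda>s. V (level_radius s *\<^sub>R unit_vec))"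
    by (rule continuous_on_compose2[OF V_cont]) (auto intro!: continuous_intros level_radius_continuous simp:
        scaled_unit_vec_nonzero[OF level_radius_pos] simp del: scaleR_eq_0_iff)
  then have "continuous_on {0<..} (\<lambda>s. radial_profile (level_radius s) * level_density s)"
    unfolding radial_profile_def by (intro continuous_intros level_density_continuous)
  then show ?thesis by (rule continuous_on_eq) (simp add: q_def)
qed

lemma q_meas [measurable]: "q \<in> borel_measurable borel"
proof -
  have "(\<lambda>s. indicator {0<..} s *\<^sub>R q s) \<in> borel_measurable borel"
    by (rule borel_measurable_continuous_on_indicator[OF _ q_cont]) simp
  moreover have "(\<lambda>s. indicator {0<..} s *\<^sub>R q s) = q" by (auto simp: fun_eq_iff indicator_def q_def)
  ultimately show ?thesis by metis
qed

text \<open>The denominator is |x|^a0 + |x|^ainf, so either power alone bounds it from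
  below.\<close>

lemma V_powr_le:
  assumes x: "x \<noteq> 0" and a: "a = a0 \<or> a = ainf"
  shows "V x \<le> c1 * norm x powr (- a)"
proof -
  let ?n = "norm x"
  have n: "0 < ?n" using x by simp
  have "?n powr a \<le> ?n powr a0 * (1 + ?n powr (ainf - a0))"
    using a by (auto simp: distrib_left powr_add[symmetric])
  then have "c1 / (?n powr a0 * (1 + ?n powr (ainf - a0))) \<le> c1 / ?n powr a"
    using c1_pos n by (intro divide_left_mono) (auto intro!: mult_pos_pos add_pos_pos)
  also have "\<dots> = c1 * ?n powr (- a)" by (simp add: powr_minus divide_inverse)
  finally show ?thesis using V_le[OF x] by simp
qed

text \<open>On {\<Gamma> = s} the norm is proportional to s^(-1/(N-2)). Hence |x|^(-a) contributes
  s^(a/(N-2)) and the level density s^(-2(N-1)/(N-2)).\<close>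

lemma q_le:
  assumes a: "a = a0 \<or> a = ainf"
  obtains K where "0 \<le> K" "\<And>s. 0 < s \<Longrightarrow> q s \<le> K * s powr ((a - 2 * (N - 1)) / (N - 2))"
proof -
  define K where "K = c1 * (1 / green_coeff) powr (a / (N - 2)) * (sphere_area\<^sup>2 * (1 / green_coeff) powr (2 * (N - 1) /
      (2 - N)))"
  have "q s \<le> K * s powr ((a - 2 * (N - 1)) / (N - 2))" if s: "0 < s" for s
  proof -
    have nr: "norm (level_radius s *\<^sub>R unit_vec) = level_radius s" using norm_unit_vec level_radius_pos[OF s] by simp
    have "radial_profile (level_radius s) \<le> c1 * level_radius s powr (- a)"
      using V_powr_le[OF scaled_unit_vec_nonzero[OF level_radius_pos[OF s]] a] unfolding nr by (simp add: radial_profile_def)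
    also have "level_radius s powr (- a) = ((1 / green_coeff) * s) powr (a / (N - 2))"
    proof -
      have "1 / (2 - N) * - a = a / (N - 2)" using N2 by (simp add: field_simps)
      then show ?thesis by (simp add: level_radius_def powr_powr)
    qed
    also have "((1 / green_coeff) * s) powr (a / (N - 2)) = (1 / green_coeff) powr (a / (N - 2)) * s powr (a / (N - 2))"
      using s green_coeff_pos by (simp only: powr_mult)
    finally have "radial_profile (level_radius s) * level_density s \<le>
        (c1 * ((1 / green_coeff) powr (a / (N - 2)) * s powr (a / (N - 2)))) * level_density s"
      using level_density_nonneg by (intro mult_right_mono)
    also have "\<dots> = K * (s powr (a / (N - 2)) * s powr (2 * (N - 1) / (2 - N)))"
      by (simp add: level_density_eq[OF s] K_def)
    also have "s powr (a / (N - 2)) * s powr (2 * (N - 1) / (2 - N)) = s powr ((a - 2 * (N - 1)) / (N - 2))"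
    proof -
      have "a / (N - 2) + 2 * (N - 1) / (2 - N) = (a - 2 * (N - 1)) / (N - 2)" using N2
          by (simp add: divide_simps) (simp add: algebra_simps)
      then show ?thesis by (simp add: powr_add[symmetric])
    qed
    finally show ?thesis using s by (simp add: q_def)
  qed
  moreover have "0 \<le> K" using c1_pos by (simp add: K_def)
  ultimately show ?thesis using that by blast
qed

text \<open>\<Gamma> reverses the ends: small s is spatial infinity, where the decay rate ainf is
  used, and large s is the origin, where a0 is used.\<close>

lemma q_integrable:
  assumes lo: "-1 < (ainf - 2 * (N - 1)) / (N - 2) + r" and up: "(a0 - 2 * (N - 1)) / (N - 2) + r < -1"
  shows "integrable lborel (\<lambda>t. q t * t powr r)"
proof -
  obtain K0 where K0: "0 \<le> K0" "\<And>s. 0 < s \<Longrightarrow> q s \<le> K0 * s powr ((a0 - 2 * (N - 1)) / (N - 2))"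
    by (rule q_le[of a0]) (auto intro: that)
  obtain K1 where K1: "0 \<le> K1" "\<And>s. 0 < s \<Longrightarrow> q s \<le> K1 * s powr ((ainf - 2 * (N - 1)) / (N - 2))"
    by (rule q_le[of ainf]) (auto intro: that)
  let ?lo = "\<lambda>x::real. if 0 < x \<and> x \<le> 1 then x powr ((ainf - 2 * (N - 1)) / (N - 2) + r) else 0"
  let ?up = "\<lambda>x::real. if 1 \<le> x then x powr ((a0 - 2 * (N - 1)) / (N - 2) + r) else 0"
  have "integrable lborel (\<lambda>x. K1 * ?lo x + K0 * ?up x)"
    using integrable_powr_from_0[of 1, OF _ lo] integrable_powr_to_inf[of 1, OF _ up]
    by (intro Bochner_Integration.integrable_add integrable_mult_right) auto
  then show ?thesis
  proof (rule Bochner_Integration.integrable_bound)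
    show "AE t in lborel. norm (q t * t powr r) \<le> norm (K1 * ?lo t + K0 * ?up t)"
    proof (intro always_eventually allI)
      fix t
      have nn: "0 \<le> K1 * ?lo t" "0 \<le> K0 * ?up t" using K0 K1 by auto
      have "q t * t powr r \<le> K1 * ?lo t + K0 * ?up t"
      proof -
        consider "t \<le> 0" | "0 < t" "t \<le> 1" | "1 < t" by linarith
        then show ?thesis
        proof cases
          case 2
          have "q t * t powr r \<le> K1 * t powr ((ainf - 2 * (N - 1)) / (N - 2)) * t powr r"
            using K1(2)[OF 2(1)] by (intro mult_right_mono) auto
          also have "\<dots> = K1 * ?lo t" using 2 by (simp add: powr_add)
          finally show ?thesis using nn by simp
        next
          case 3
          then have t: "0 < t" by simp
          have "q t * t powr r \<le> K0 * t powr ((a0 - 2 * (N - 1)) / (N - 2)) * t powr r"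
            using K0(2)[OF t] by (intro mult_right_mono) auto
          also have "\<dots> = K0 * ?up t" using 3 by (simp add: powr_add)
          finally show ?thesis using nn by simp
        qed (use nn in \<open>simp add: q_zero\<close>)
      qed
      then show "norm (q t * t powr r) \<le> norm (K1 * ?lo t + K0 * ?up t)" using q_nonneg[of t] nn by simp
    qed
  qed measurable
qed

text \<open>The exponent equals -(N - a)/(N - 2) - 1, so the interval for p given by (N - ainf)/(N -
  2) and (N - a0)/(N - 2) is the condition for q t^p to be integrable at both ends.\<close>

lemma exponent_p: "(a0 - 2 * (N - 1)) / (N - 2) + p < -1" "-1 < (ainf - 2 * (N - 1)) / (N - 2) + p"
proof -
  have e: "(a - 2 * (N - 1)) / (N - 2) = - ((N - a) / (N - 2)) - 1" for a using N2 by (simp add: field_simps)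
  show "(a0 - 2 * (N - 1)) / (N - 2) + p < -1" "-1 < (ainf - 2 * (N - 1)) / (N - 2) + p"
    unfolding e using p_lower p_upper by auto
qed

lemma q_int_p: "integrable lborel (\<lambda>t. q t * t powr p)"
  by (rule q_integrable[OF exponent_p(2,1)])

text \<open>At large s, (p + 1)/2 \<le> p reduces the condition to the one for q t^p. At small s it
  reads p + 1 > 2(N - ainf)/(N - 2), which is the bound on p by \<open>two_star\<close>.\<close>

lemma q_int_half: "integrable lborel (\<lambda>t. q t * t powr ((p + 1) / 2))"
proof (rule q_integrable)
  show "(a0 - 2 * (N - 1)) / (N - 2) + (p + 1) / 2 < - 1"
  proof -
    have "(p + 1) / 2 \<le> p" using p1 by simp
    then show ?thesis using exponent_p(1) by linarith
  qed
  have e: "(ainf - 2 * (N - 1)) / (N - 2) = - ((N - ainf) / (N - 2)) - 1" using N2 by (simp add: field_simps)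
  have "two_star CARD('n) ainf = 2 * ((N - ainf) / (N - 2))" by (simp add: two_star_def N_eq)
  then show "- 1 < (ainf - 2 * (N - 1)) / (N - 2) + (p + 1) / 2" unfolding e using p_sub by (simp only:) argo
qed

section \<open>The Green potential bound and the threshold\<close>

definition green_source :: "real^'n \<Rightarrow> real" where "green_source y = V y * \<Gamma> y powr p"

lemma green_source_eq: "green_source y = q (\<Gamma> y) / level_density (\<Gamma> y) * \<Gamma> y powr p"
proof (cases "y = 0")
  case False
  then show ?thesis using q_\<Gamma>[OF False] level_density_pos[OF \<Gamma>_pos[OF False]] by (simp add: green_source_def)
qed (simp add: green_source_def)

lemma green_source_nonneg: "0 \<le> green_source y" using V_nonneg[of y] by (cases "y = 0") (auto simp: green_source_def)

lemma green_source_measurable [measurable]: "green_source \<in> borel_measurable borel"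
  unfolding green_source_def[abs_def] by measurable

lemma push_q:
  assumes [measurable]: "h \<in> borel_measurable borel"
  shows "integrable lborel (\<lambda>y. q (\<Gamma> y) / level_density (\<Gamma> y) * h (\<Gamma> y)) \<longleftrightarrow> integrable lborel (\<lambda>t. q t * h t)"
    "(LINT y|lborel. q (\<Gamma> y) / level_density (\<Gamma> y) * h (\<Gamma> y)) = (LINT t|lborel. q t * h t)"
proof -
  have "(if 0 < s then level_density s else 0) * (q s / level_density s * h s) = q s * h s" for s
    using level_density_pos[of s] by (cases "0 < s") (auto simp: q_zero)
  then show "integrable lborel (\<lambda>y. q (\<Gamma> y) / level_density (\<Gamma> y) * h (\<Gamma> y)) \<longleftrightarrow> integrable lborel (\<lambda>t. q t * h t)"
    "(LINT y|lborel. q (\<Gamma> y) / level_density (\<Gamma> y) * h (\<Gamma> y)) = (LINT t|lborel. q t * h t)"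
    using push_integral[of "\<lambda>s. q s / level_density s * h s"] by simp_all
qed

lemma green_source_int: "integrable lborel green_source" "(LINT y|lborel. green_source y) = (LINT t|lborel. q t * t powr p)"
  using push_q[of "\<lambda>t. t powr p"] q_int_p by (simp_all add: green_source_eq[abs_def])

text \<open>Near the pole y = x the source is bounded, and elsewhere the kernel is. Integrability is
  what gives content to the bound on \<open>green_op\<close>: a Bochner integral that does not exist
  has the value 0.\<close>

lemma green_integrable:
  assumes x: "x \<noteq> 0"
  shows "integrable lborel (\<lambda>y. \<Gamma> (x - y) * green_source y)"
proof -
  \<comment> \<open>Half the distance to the origin, so that the ball about x avoids the singularity
    of the source.\<close>
  define r where "r = norm x / 2"
  have r: "0 < r" using x by (simp add: r_def)
  have sym: "\<Gamma> (x - y) = \<Gamma> (y - x)" for y by (simp add: \<Gamma>_eq norm_minus_commute)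
  define K where "K = cball (0::real^'n) (3 * r) - ball 0 r"
  have "continuous_on (- {0}) green_source" unfolding green_source_def using \<Gamma>_pos
    by (intro continuous_intros V_cont \<Gamma>_continuous) force
  then have "continuous_on K green_source" by (rule continuous_on_subset) (use r in \<open>auto simp: K_def\<close>)
  moreover have "compact K" unfolding K_def by (rule compact_diff) auto
  ultimately have "bounded (green_source ` K)" by (intro compact_imp_bounded compact_continuous_image)
  then obtain B where B: "\<forall>y\<in>K. \<bar>green_source y\<bar> \<le> B" by (auto simp: bounded_iff)
  have xK: "x \<in> K" using r by (simp add: K_def r_def)
  then have B0: "0 \<le> B" using B by (meson abs_ge_zero order_trans)
  have cbm[measurable]: "cball (0::real^'n) r \<in> sets borel" by simp
  have dd: "distr lborel borel (\<lambda>y. y - x) = lborel" using lborel_distr_translation[of "- x"] by simp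
  have "integrable (distr lborel borel (\<lambda>y. y - x)) (\<lambda>z. \<Gamma> z * indicator (cball 0 r) z)"
    unfolding dd by (rule \<Gamma>_integrable_ball)
  then have "integrable lborel (\<lambda>y. \<Gamma> (y - x) * indicator (cball 0 r) (y - x))"
    by (subst (asm) integrable_distr_eq) auto
  then have "integrable lborel (\<lambda>y. B * (\<Gamma> (y - x) * indicator (cball 0 r) (y - x)) + green_coeff * r powr (2 - N) *
      green_source y)"
    using green_source_int(1) by (intro Bochner_Integration.integrable_add integrable_mult_right)
  then show ?thesis
  proof (rule Bochner_Integration.integrable_bound)
    show "AE y in lborel. norm (\<Gamma> (x - y) * green_source y) \<le>
        norm (B * (\<Gamma> (y - x) * indicator (cball 0 r) (y - x)) + green_coeff * r powr (2 - N) * green_source y)"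
    proof (intro always_eventually allI)
      fix y
      have n: "0 \<le> \<Gamma> (y - x)" "0 \<le> green_source y" "0 \<le> green_coeff * r powr (2 - N) * green_source y"
          using \<Gamma>_nonneg green_source_nonneg green_coeff_pos by auto
      have "\<Gamma> (y - x) * green_source y \<le>
          B * (\<Gamma> (y - x) * indicator (cball 0 r) (y - x)) + green_coeff * r powr (2 - N) * green_source y"
      proof (cases "norm (y - x) \<le> r")
        case True
        have "norm y \<le> 3 * r" using norm_triangle_ineq[of x "y - x"] True by (simp add: r_def)
        moreover have "r \<le> norm y" using norm_triangle_sub[of x y] True by (simp add: r_def norm_minus_commute)
        ultimately have "y \<in> K" by (simp add: K_def)
        then have "green_source y \<le> B" using B by force
        then have "\<Gamma> (y - x) * green_source y \<le> \<Gamma> (y - x) * B" using n by (intro mult_left_mono)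
        then show ?thesis using True n by (simp add: mult.commute)
      next
        case False
        then have "norm (y - x) powr (2 - N) \<le> r powr (2 - N)" using r N2 by (intro powr_mono2') auto
        then have "\<Gamma> (y - x) \<le> green_coeff * r powr (2 - N)" using green_coeff_pos by (simp add: \<Gamma>_eq)
        then have "\<Gamma> (y - x) * green_source y \<le> green_coeff * r powr (2 - N) * green_source y" using n by (intro mult_right_mono)
        then show ?thesis using False by simp
      qed
      then show "norm (\<Gamma> (x - y) * green_source y) \<le>
          norm (B * (\<Gamma> (y - x) * indicator (cball 0 r) (y - x)) + green_coeff * r powr (2 - N) * green_source y)"
        unfolding sym using n B0 by (simp add: abs_mult)
    qed
  qed measurable
qed

text \<open>Divide the bound on the Green potential by \<open>\<Gamma>(x)\<close> and let \<open>|x| \<rightarrow> \<infinity>\<close>.\<close>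

lemma mass_le: "(LINT t|lborel. q t * t powr p) \<le> c2"
proof -
  \<comment> \<open>Points tending to infinity along a ray; for fixed y the quotient \<Gamma>(x n -
    y) / \<Gamma>(x n) tends to 1.\<close>
  define x where "x n = real (Suc n) *\<^sub>R unit_vec" for n
  have x0: "x n \<noteq> 0" for n unfolding x_def by (rule scaled_unit_vec_nonzero) simp
  define g where "g n y = \<Gamma> (x n - y) / \<Gamma> (x n) * green_source y" for n y
  have [measurable]: "g n \<in> borel_measurable borel" for n unfolding g_def[abs_def] by measurable
  have gn: "0 \<le> g n y" for n y unfolding g_def using \<Gamma>_nonneg green_source_nonneg
      by (intro mult_nonneg_nonneg divide_nonneg_nonneg)
  have geq: "g n y = \<Gamma> (x n - y) * green_source y / \<Gamma> (x n)" for n y by (simp add: g_def)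
  have gi: "integrable lborel (g n)" for n
    unfolding geq[abs_def] using green_integrable[OF x0] by (rule integrable_divide_zero[rotated])
  have gI: "(LINT y|lborel. g n y) \<le> c2" for n
  proof -
    have "green_op (\<lambda>y. V y * green_dirac y powr p) (x n) = (LINT y|lebesgue. \<Gamma> (x n - y) * green_source y)"
      unfolding green_op_def by (simp add: green_kernel_def green_dirac_def green_source_def)
    also have "\<dots> = (LINT y|lborel. \<Gamma> (x n - y) * green_source y)" by (rule integral_completion) measurable
    finally have "(LINT y|lborel. \<Gamma> (x n - y) * green_source y) \<le> c2 * \<Gamma> (x n)" using green_le[OF x0, of n] by simp
    then show ?thesis unfolding geq using \<Gamma>_pos[OF x0, of n] by (simp add: divide_le_eq)
  qed
  have lim: "(\<lambda>n. g n y) \<longlonglongrightarrow> green_source y" for y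
  proof -
    have "(\<lambda>n. norm (unit_vec - (1 / real (Suc n)) *\<^sub>R y)) \<longlonglongrightarrow> norm (unit_vec - 0 *\<^sub>R y)"
      by (intro tendsto_intros LIMSEQ_Suc[OF lim_1_over_n])
    then have "(\<lambda>n. norm (unit_vec - (1 / real (Suc n)) *\<^sub>R y) powr (2 - N)) \<longlonglongrightarrow> 1 powr (2 - N)"
      by (intro tendsto_powr tendsto_const) (auto simp: norm_unit_vec)
    moreover have "\<Gamma> (x n - y) / \<Gamma> (x n) = norm (unit_vec - (1 / real (Suc n)) *\<^sub>R y) powr (2 - N)" for n
    proof -
      have "x n - y = real (Suc n) *\<^sub>R (unit_vec - (1 / real (Suc n)) *\<^sub>R y)" by (simp add: x_def scaleR_diff_right)
      then have "norm (x n - y) = real (Suc n) * norm (unit_vec - (1 / real (Suc n)) *\<^sub>R y)"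
          by (simp only: norm_scaleR abs_of_nat)
      then have "norm (x n - y) powr (2 - N) =
          real (Suc n) powr (2 - N) * norm (unit_vec - (1 / real (Suc n)) *\<^sub>R y) powr (2 - N)"
        by (simp only: powr_mult of_nat_0_le_iff norm_ge_zero)
      moreover have "norm (x n) = real (Suc n)" using norm_unit_vec by (simp add: x_def)
      ultimately show ?thesis using green_coeff_pos unfolding \<Gamma>_eq by simp
    qed
    ultimately have "(\<lambda>n. \<Gamma> (x n - y) / \<Gamma> (x n)) \<longlonglongrightarrow> 1" by simp
    from tendsto_mult_right[OF this, of "green_source y"] show ?thesis by (simp add: g_def)
  qed
  \<comment> \<open>Fatou's lemma: the moving pole y = x n leaves no evident dominating function,
    and an upper bound for the limit is all that is wanted.\<close>
  have "ennreal (LINT y|lborel. green_source y) = (\<integral>\<^sup>+y. ennreal (green_source y) \<partial>lborel)"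
    using green_source_int(1) green_source_nonneg by (intro nn_integral_eq_integral[symmetric]) auto
  also have "\<dots> = (\<integral>\<^sup>+y. liminf (\<lambda>n. ennreal (g n y)) \<partial>lborel)"
  proof (intro nn_integral_cong)
    fix y
    have "(\<lambda>n. ennreal (g n y)) \<longlonglongrightarrow> ennreal (green_source y)" using lim by (rule tendsto_ennrealI)
    then show "ennreal (green_source y) = liminf (\<lambda>n. ennreal (g n y))" by (intro lim_imp_Liminf[symmetric]) auto
  qed
  also have "\<dots> \<le> liminf (\<lambda>n. \<integral>\<^sup>+y. ennreal (g n y) \<partial>lborel)" by (rule nn_integral_liminf) measurable
  also have "\<dots> \<le> liminf (\<lambda>n::nat. ennreal c2)"
  proof (rule Liminf_mono, rule always_eventually, rule allI)
    fix n
    have "(\<integral>\<^sup>+y. ennreal (g n y) \<partial>lborel) = ennreal (LINT y|lborel. g n y)"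
      using gi gn by (intro nn_integral_eq_integral) auto
    then show "(\<integral>\<^sup>+y. ennreal (g n y) \<partial>lborel) \<le> ennreal c2" using gI[of n] by (simp add: ennreal_leI)
  qed
  also have "\<dots> = ennreal c2" by (simp add: Liminf_const)
  finally show ?thesis using c2_pos green_source_int(2) by simp
qed

definition crit_slope :: real where "crit_slope = (c2 * p) powr (- 1 / (p - 1))"

lemma crit_slope_pos: "0 < crit_slope" using c2_pos p1 by (simp add: crit_slope_def)

text \<open>At \<open>crit_slope\<close> the derivative 1 - c2 p b^(p-1) of b - c2 b^p vanishes, so
  the value there is b (1 - 1/p) = \<open>k_threshold c2 p\<close>; \<open>mass_le\<close> allows c2
  to be replaced by the mass.\<close>

lemma crit_slope_gain: "k < crit_slope - (LINT t|lborel. q t * t powr p) * crit_slope powr p"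
proof -
  have "crit_slope powr (p - 1) = (c2 * p) powr (- 1)" using p1 by (simp add: crit_slope_def powr_powr)
  also have "\<dots> = 1 / (c2 * p)" using c2_pos p1 by (simp add: powr_minus divide_inverse)
  finally have b1: "crit_slope powr (p - 1) = 1 / (c2 * p)" .
  have "crit_slope powr p = crit_slope * crit_slope powr (p - 1)" using crit_slope_pos by (simp add: powr_mult_base)
  then have "c2 * crit_slope powr p = crit_slope / p" using b1 c2_pos by simp
  moreover have "k_threshold c2 p = crit_slope * ((p - 1) / p)" by (simp add: k_threshold_def crit_slope_def)
  moreover have "crit_slope * ((p - 1) / p) = crit_slope - crit_slope / p" using p1 by (simp add: field_simps)
  ultimately have "crit_slope - c2 * crit_slope powr p = k_threshold c2 p" by simp
  moreover have "(LINT t|lborel. q t * t powr p) * crit_slope powr p \<le> c2 * crit_slope powr p" using mass_le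
      by (rule mult_right_mono) simp
  ultimately show ?thesis using k_le by simp
qed

lemma q_pos: "\<exists>t>0. q t \<noteq> 0"
proof -
  obtain x where x: "x \<noteq> 0" "V x \<noteq> 0" using V_nontriv by blast
  then have "q (\<Gamma> x) \<noteq> 0" using q_\<Gamma>[OF x(1)] level_density_pos[OF \<Gamma>_pos[OF x(1)]] by simp
  then show ?thesis using \<Gamma>_pos[OF x(1)] by blast
qed

sublocale ef: emden_fowler q p k crit_slope
  by unfold_locales (auto simp: q_cont q_nonneg q_zero q_int_p q_int_half q_pos p1 k_pos crit_slope_pos crit_slope_gain)

section \<open>From profiles on the half-line to solutions in space\<close>

lemma source_data:
  assumes [measurable]: "h \<in> borel_measurable borel" and hc: "continuous_on {0<..} h"
    and hb: "\<forall>t>0. 0 \<le> h t \<and> h t \<le> c * t" and c: "0 \<le> c"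
  shows "continuous_on {0<..} (\<lambda>t. q t * h t powr p)" "integrable lborel (\<lambda>t. q t * h t powr p)"
    "\<And>t. t \<le> 0 \<Longrightarrow> q t * h t powr p = 0" "\<And>t. 0 \<le> q t * h t powr p"
    "\<And>s. 0 < s \<Longrightarrow> (ef.integral_op h has_real_derivative (k + (LINT t|lborel. (if s < t then q t * h t powr p else 0)))) (at s)"
    "\<And>s. 0 < s \<Longrightarrow> 0 \<le> ef.integral_op h s" "\<And>s. 0 < s \<Longrightarrow> ef.integral_op h s \<le> (k + c powr p * ef.mass) * s"
    "\<And>x. x \<noteq> 0 \<Longrightarrow> q (\<Gamma> x) * h (\<Gamma> x) powr p / level_density (\<Gamma> x) = V x * h (\<Gamma> x) powr p"
proof -
  have h: "0 \<le> h t" "h t \<le> c * t" if "0 < t" for t using hb that by auto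
  show c1: "continuous_on {0<..} (\<lambda>t. q t * h t powr p)"
    using h(1) p1 by (intro continuous_intros q_cont continuous_on_powr' hc) auto
  show i1: "integrable lborel (\<lambda>t. q t * h t powr p)" by (rule ef.source_integrable(1)[OF _ h c]) measurable
  show z: "q t * h t powr p = 0" if "t \<le> 0" for t using q_zero[OF that] by simp
  show "0 \<le> q t * h t powr p" for t using q_nonneg by simp
  show "(ef.integral_op h has_real_derivative (k + (LINT t|lborel. (if s < t then q t * h t powr p else 0)))) (at s)"
      if "0 < s" for s
    unfolding ef.integral_op_def[abs_def] by (rule potential_deriv[OF i1 c1 z that])
  fix s :: real assume s: "0 < s"
  have "0 \<le> (LINT t|lborel. min s t * (q t * h t powr p))"
    by (intro integral_nonneg_AE always_eventually allI ef.source_integrable(3)[OF _ h c]) (use s in auto)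
  then show "0 \<le> ef.integral_op h s" using k_pos s by (simp add: ef.integral_op_def)
  have "(LINT t|lborel. min s t * (q t * h t powr p)) \<le> s * (c powr p * ef.mass)"
    by (rule ef.source_integrable(5)[OF _ h c]) (use s in auto)
  then show "ef.integral_op h s \<le> (k + c powr p * ef.mass) * s" by (simp add: ef.integral_op_def algebra_simps)
next
  fix x :: "real^'n" assume x: "x \<noteq> 0"
  show "q (\<Gamma> x) * h (\<Gamma> x) powr p / level_density (\<Gamma> x) = V x * h (\<Gamma> x) powr p"
    using q_\<Gamma>[OF x] level_density_pos[OF \<Gamma>_pos[OF x]] by simp
qed

text \<open>|min s t - min s' t| \<le> |s - s'|, so the image is Lipschitz with constant k plus the
  total mass of the source.\<close>

lemma integral_op_continuous:
  assumes [measurable]: "h \<in> borel_measurable borel"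
    and h: "\<And>t. 0 < t \<Longrightarrow> 0 \<le> h t" "\<And>t. 0 < t \<Longrightarrow> h t \<le> c * t" and c: "0 \<le> c"
  shows "continuous_on {0<..} (ef.integral_op h)"
proof -
  let ?\<phi> = "\<lambda>t. q t * h t powr p"
  have i1: "integrable lborel ?\<phi>" by (rule ef.source_integrable(1)[OF _ h c]) measurable
  have n1: "0 \<le> ?\<phi> t" for t using q_nonneg by simp
  have I0: "0 \<le> integral\<^sup>L lborel ?\<phi>" using n1 by (intro integral_nonneg_AE) auto
  have "(k + integral\<^sup>L lborel ?\<phi>)-lipschitz_on {0<..} (ef.integral_op h)"
  proof (rule lipschitz_onI)
    fix s s' :: real assume s: "s \<in> {0<..}" "s' \<in> {0<..}"
    have mi: "integrable lborel (\<lambda>t. min s t * ?\<phi> t)" "integrable lborel (\<lambda>t. min s' t * ?\<phi> t)"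
      by (rule ef.source_integrable(2)[OF _ h c]; use s in auto)+
    have "\<bar>LINT t|lborel. min s t * ?\<phi> t - min s' t * ?\<phi> t\<bar> \<le> (LINT t|lborel. \<bar>s - s'\<bar> * ?\<phi> t)"
    proof (rule integral_abs_bound_integral)
      fix t
      have "\<bar>min s t - min s' t\<bar> * ?\<phi> t \<le> \<bar>s - s'\<bar> * ?\<phi> t" using n1 by (intro mult_right_mono) auto
      moreover have "\<bar>min s t * ?\<phi> t - min s' t * ?\<phi> t\<bar> = \<bar>min s t - min s' t\<bar> * ?\<phi> t"
        using abs_of_nonneg[OF n1[of t]] by (simp only: left_diff_distrib[symmetric] abs_mult)
      ultimately show "\<bar>min s t * ?\<phi> t - min s' t * ?\<phi> t\<bar> \<le> \<bar>s - s'\<bar> * ?\<phi> t" by simp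
    qed (use mi i1 in auto)
    then have "\<bar>(LINT t|lborel. min s t * ?\<phi> t) - (LINT t|lborel. min s' t * ?\<phi> t)\<bar> \<le> \<bar>s - s'\<bar> * integral\<^sup>L lborel ?\<phi>"
      using mi by simp
    then have "\<bar>k * (s - s') + ((LINT t|lborel. min s t * ?\<phi> t) - (LINT t|lborel. min s' t * ?\<phi> t))\<bar> \<le>
        \<bar>k * (s - s')\<bar> + \<bar>s - s'\<bar> * integral\<^sup>L lborel ?\<phi>"
      by linarith
    also have "\<bar>k * (s - s')\<bar> = k * \<bar>s - s'\<bar>" using k_pos by (simp add: abs_mult)
    finally show "dist (ef.integral_op h s) (ef.integral_op h s') \<le> (k + integral\<^sup>L lborel ?\<phi>) * dist s s'"
      by (simp add: dist_real_def ef.integral_op_def algebra_simps)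
  qed (use I0 k_pos in auto)
  then show ?thesis by (rule lipschitz_on_continuous_on)
qed

lemma \<Gamma>_at_infinity: "(\<Gamma> \<longlongrightarrow> 0) at_infinity"
proof (rule tendstoI)
  fix e :: real assume e: "0 < e"
  have "\<forall>\<^sub>F x::real^'n in at_infinity. level_radius (e / 2) \<le> norm x"
    unfolding eventually_at_infinity by blast
  then show "\<forall>\<^sub>F x in at_infinity. dist (\<Gamma> x) 0 < e"
  proof eventually_elim
    case (elim x)
    then have "\<Gamma> x \<le> e / 2" using \<Gamma>_gt_iff[of "e / 2" x] e by simp
    then show ?case using \<Gamma>_nonneg[of x] e by (simp add: dist_real_def)
  qed
qed

text \<open>Applied to both profiles. W(0) = 0 matches \<Gamma>(0) = 0, so 0 \<le> W(\<Gamma>) \<le>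
  c \<Gamma> holds at every x; this bound yields local integrability and both forms of decay at
  infinity.\<close>

lemma fixed_point_solution:
  assumes Wm [measurable]: "W \<in> borel_measurable borel"
    and W: "\<And>t. 0 < t \<Longrightarrow> 0 \<le> W t" "\<And>t. 0 < t \<Longrightarrow> W t \<le> c * t" and c: "0 \<le> c"
    and fp: "\<And>s. 0 < s \<Longrightarrow> W s = ef.integral_op W s" and W0: "W 0 = 0"
  shows "weak_solution V p k (\<lambda>x. W (\<Gamma> x))" "classical_solution V p (\<lambda>x. W (\<Gamma> x))"
proof -
  have Wc: "continuous_on {0<..} W"
    by (rule continuous_on_eq[OF integral_op_continuous[OF Wm W c]]) (use fp in auto)
  have Wcb: "\<forall>t>0. 0 \<le> W t \<and> W t \<le> c * t" using W by simp
  note sd = source_data[OF Wm Wc Wcb c]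
  let ?\<phi> = "\<lambda>t. q t * W t powr p"
  have Wd: "(W has_real_derivative (k + (LINT t|lborel. (if s < t then ?\<phi> t else 0)))) (at s)" if "0 < s" for s
    by (rule has_field_derivative_transform_within_open[OF sd(5)[OF that], of "{0<..}"]) (use that fp in auto)
  define W' where "W' s = k + (LINT t|lborel. (if s < t then ?\<phi> t else 0))" for s
  have W'eq: "W' s = k + (integral\<^sup>L lborel ?\<phi> - primitive ?\<phi> s)" for s
  proof -
    have "integral\<^sup>L lborel ?\<phi> = (LINT t|lborel. (if t \<le> s then ?\<phi> t else 0) + (if s < t then ?\<phi> t else 0))"
      by (intro Bochner_Integration.integral_cong) auto
    also have "\<dots> = primitive ?\<phi> s + (LINT t|lborel. (if s < t then ?\<phi> t else 0))"
      unfolding primitive_def by (intro Bochner_Integration.integral_add integrable_if_pred[OF sd(2)]) measurable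
    finally show ?thesis by (simp add: W'_def)
  qed
  have W'd: "(W' has_real_derivative (- ?\<phi> s)) (at s)" if "0 < s" for s
    unfolding W'eq[abs_def] using primitive_deriv[OF sd(2) sd(1) that] by (auto intro!: derivative_eq_intros)
  have Wd': "(W has_real_derivative W' s) (at s)" if "0 < s" for s using Wd[OF that] by (simp add: W'_def)
  have \<phi>'c: "continuous_on {0<..} (\<lambda>s. - ?\<phi> s)" using sd(1) by (rule continuous_on_minus)
  note rc = radial_C2[OF Wd' W'd \<phi>'c]
  have Wb: "0 \<le> W (\<Gamma> x)" "W (\<Gamma> x) \<le> c * \<Gamma> x" for x
    using W[OF \<Gamma>_pos[of x]] W0 by (cases "x = 0"; simp)+
  have src: "?\<phi> (\<Gamma> x) / level_density (\<Gamma> x) = V x * W (\<Gamma> x) powr p" for x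
    using sd(8)[of x] W0 p1 by (cases "x = 0") (auto simp: q_zero)
  have lim0: "((\<lambda>x. W (\<Gamma> x)) \<longlongrightarrow> 0) at_infinity"
  proof (rule tendsto_sandwich[of "\<lambda>_. 0" _ _ "\<lambda>x. c * \<Gamma> x"])
    show "((\<lambda>x. c * \<Gamma> x) \<longlongrightarrow> 0) at_infinity" using tendsto_mult_left[OF \<Gamma>_at_infinity, of c] by simp
  qed (use Wb in auto)
  show "classical_solution V p (\<lambda>x. W (\<Gamma> x))"
    unfolding classical_solution_def
  proof (intro conjI allI impI)
    show "C2_on (- {0}) (\<lambda>x. W (\<Gamma> x))" by (rule rc(1); assumption)
    fix x :: "real^'n" assume x: "x \<noteq> 0"
    have "laplacian (\<lambda>x. W (\<Gamma> x)) x = - ?\<phi> (\<Gamma> x) / level_density (\<Gamma> x)" by (rule rc(2)[OF _ _ x]; assumption)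
    then show "- laplacian (\<lambda>x. W (\<Gamma> x)) x = V x * W (\<Gamma> x) powr p" using src[of x] by simp
  qed (rule lim0)
  have srcm: "(\<lambda>x. V x * W (\<Gamma> x) powr p) \<in> borel_measurable lborel" by measurable
  show "weak_solution V p k (\<lambda>x. W (\<Gamma> x))"
    unfolding weak_solution_def
  proof (intro conjI allI impI)
    show "0 \<le> W (\<Gamma> x)" for x by (rule Wb)
    show "L1_loc (\<lambda>x. W (\<Gamma> x))"
      unfolding L1_loc_def
    proof (intro allI impI)
      fix K :: "(real^'n) set" assume K: "compact K"
      obtain R where R: "\<And>x. x \<in> K \<Longrightarrow> norm x \<le> R" using compact_imp_bounded[OF K] by (auto simp: bounded_iff)
      have Km[measurable]: "K \<in> sets borel" using K by (simp add: compact_imp_closed)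
      have "integrable lborel (\<lambda>x. indicator K x *\<^sub>R W (\<Gamma> x))"
      proof (rule Bochner_Integration.integrable_bound)
        show "integrable lborel (\<lambda>x. c * (\<Gamma> x * indicator (cball 0 R) x))" using \<Gamma>_integrable_ball by (rule integrable_mult_right)
        show "AE x in lborel. norm (indicator K x *\<^sub>R W (\<Gamma> x)) \<le> norm (c * (\<Gamma> x * indicator (cball 0 R) x))"
        proof (intro always_eventually allI)
          fix x show "norm (indicator K x *\<^sub>R W (\<Gamma> x)) \<le> norm (c * (\<Gamma> x * indicator (cball 0 R) x))"
            using Wb[of x] R[of x] c \<Gamma>_nonneg[of x] by (auto simp: indicator_def abs_mult)
        qed
      qed measurable
      then show "set_integrable lebesgue K (\<lambda>x. W (\<Gamma> x))"
        unfolding set_integrable_def by (subst integrable_completion) auto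
    qed
    show "integrable lebesgue (\<lambda>x. V x * W (\<Gamma> x) powr p)"
    proof -
      have "integrable lborel (\<lambda>y. q (\<Gamma> y) / level_density (\<Gamma> y) * W (\<Gamma> y) powr p)"
        using push_q(1)[of "\<lambda>t. W t powr p"] sd(2) by simp
      then have "integrable lborel (\<lambda>x. V x * W (\<Gamma> x) powr p)" by (simp flip: src)
      then show ?thesis using integrable_completion[OF srcm] by simp
    qed
    show "((\<lambda>r. SUP x\<in>- ball 0 r. ereal (W (\<Gamma> x))) \<longlongrightarrow> 0) at_top"
    proof (rule tendsto_sandwich[of "\<lambda>_. 0" _ _ "\<lambda>r. ereal (c * (green_coeff * r powr (2 - N)))"])
      show "\<forall>\<^sub>F r in at_top. 0 \<le> (SUP x\<in>- ball (0::real^'n) r. ereal (W (\<Gamma> x)))"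
      proof (intro always_eventually allI)
        fix r :: real
        have "(\<bar>r\<bar> + 1) *\<^sub>R unit_vec \<in> - ball 0 r" using norm_unit_vec by simp
        then show "0 \<le> (SUP x\<in>- ball (0::real^'n) r. ereal (W (\<Gamma> x)))" by (rule SUP_upper2) (simp add: Wb(1))
      qed
      show "\<forall>\<^sub>F r in at_top. (SUP x\<in>- ball (0::real^'n) r. ereal (W (\<Gamma> x))) \<le> ereal (c * (green_coeff * r powr (2 - N)))"
        using eventually_gt_at_top[of 0]
      proof eventually_elim
        case (elim r)
        show ?case
        proof (rule SUP_least)
          fix x :: "real^'n" assume "x \<in> - ball 0 r"
          then have "r \<le> norm x" by simp
          then have "norm x powr (2 - N) \<le> r powr (2 - N)" using elim N2 by (intro powr_mono2') auto
          then have "\<Gamma> x \<le> green_coeff * r powr (2 - N)" using green_coeff_pos by (simp add: \<Gamma>_eq)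
          then show "ereal (W (\<Gamma> x)) \<le> ereal (c * (green_coeff * r powr (2 - N)))"
            using Wb(2)[of x] mult_left_mono[of "\<Gamma> x" "green_coeff * r powr (2 - N)" c] c by simp
        qed
      qed
      have "((\<lambda>r. r powr (2 - N)) \<longlongrightarrow> 0) at_top" using N2 by (intro tendsto_neg_powr filterlim_ident) simp
      then have "((\<lambda>r. c * (green_coeff * r powr (2 - N))) \<longlongrightarrow> c * (green_coeff * 0)) at_top" by (intro tendsto_intros)
      then show "((\<lambda>r. ereal (c * (green_coeff * r powr (2 - N)))) \<longlongrightarrow> 0) at_top" by (simp add: zero_ereal_def)
    qed simp
    fix \<xi> :: "real^'n \<Rightarrow> real" assume xi: "C11_compact_support \<xi>"
    note wf = weak_formula[OF sd(1,2,3,4) less_imp_le[OF k_pos] Wd W Wm xi]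
    have \<xi>m[measurable]: "\<xi> \<in> borel_measurable borel"
      by (rule C11_laplacian_bound[OF xi]) (rule borel_measurable_continuous_onI)
    have m: "(\<lambda>x. V x * W (\<Gamma> x) powr p * \<xi> x) \<in> borel_measurable lborel" by measurable
    have "(LINT x|lebesgue. W (\<Gamma> x) * - laplacian \<xi> x) = - (LINT x|lebesgue. W (\<Gamma> x) * laplacian \<xi> x)" by simp
    also have "\<dots> = (LINT x|lborel. ?\<phi> (\<Gamma> x) / level_density (\<Gamma> x) * \<xi> x) + k * \<xi> 0" using wf(3) by simp
    also have "(LINT x|lborel. ?\<phi> (\<Gamma> x) / level_density (\<Gamma> x) * \<xi> x) = (LINT x|lebesgue. V x * W (\<Gamma> x) powr p * \<xi> x)"
      unfolding src integral_completion[OF m] ..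
    finally show "(LINT x|lebesgue. W (\<Gamma> x) * - laplacian \<xi> x) = (LINT x|lebesgue. V x * W (\<Gamma> x) powr p * \<xi> x) + k * \<xi> 0" .
  qed
qed

text \<open>If u lies above h(\<Gamma>), then V u^p lies above V h(\<Gamma>)^p, so u is a
  supersolution of the linear problem solved by \<open>integral_op h\<close>. This carries one step
  of the iteration over to nonradial weak solutions.\<close>

lemma weak_solution_ge_step:
  assumes u: "weak_solution V p k u"
    and hm [measurable]: "h \<in> borel_measurable borel" and hc: "continuous_on {0<..} h"
    and h: "\<And>t. 0 < t \<Longrightarrow> 0 \<le> h t" "\<And>t. 0 < t \<Longrightarrow> h t \<le> c * t" and c: "0 \<le> c"
    and le: "AE x in lebesgue. h (\<Gamma> x) \<le> u x"
  shows "AE x in lebesgue. ef.integral_op h (\<Gamma> x) \<le> u x"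
proof -
  have hb: "\<forall>t>0. 0 \<le> h t \<and> h t \<le> c * t" using h by simp
  note sd = source_data[OF hm hc hb c]
  have Tm: "ef.integral_op h \<in> borel_measurable borel" by measurable
  show ?thesis
  proof (rule comparison[OF sd(1,2,3,4) less_imp_le[OF k_pos] sd(5,6,7) Tm])
    show "0 \<le> u x" for x using u by (simp add: weak_solution_def)
    show "L1_loc u" "integrable lebesgue (\<lambda>x. V x * u x powr p)" using u by (simp_all add: weak_solution_def)
    show "(LINT x|lebesgue. u x * (- laplacian \<xi> x)) = (LINT x|lebesgue. V x * u x powr p * \<xi> x) + k * \<xi> 0"
      if "C11_compact_support \<xi>" for \<xi> using u that by (simp add: weak_solution_def)
    have n0: "AE x in lebesgue. x \<noteq> (0::real^'n)" by (intro AE_completion AE_lborel_singleton)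
    show "AE x in lebesgue. q (\<Gamma> x) * h (\<Gamma> x) powr p / level_density (\<Gamma> x) \<le> V x * u x powr p"
      using le n0
    proof eventually_elim
      case (elim x)
      have "h (\<Gamma> x) powr p \<le> u x powr p" using h(1)[OF \<Gamma>_pos[OF elim(2)]] elim(1) p1 by (intro powr_mono2) auto
      then have "V x * h (\<Gamma> x) powr p \<le> V x * u x powr p" using V_nonneg[OF elim(2)] by (rule mult_left_mono)
      then show ?case unfolding sd(8)[OF elim(2)] .
    qed
  qed
qed

text \<open>The induction starts from u \<ge> 0: since \<open>0 powr p\<close> is 0,
  \<open>integral_op\<close> maps the zero profile to k s, so the comparison gives u \<ge> k
  \<Gamma>.\<close>

lemma approx_le_weak_solution:
  assumes u: "weak_solution V p k u"
  shows "AE x in lebesgue. ef.approx n (\<Gamma> x) \<le> u x"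
proof (induction n)
  case 0
  have "AE x in lebesgue. ef.integral_op (\<lambda>_. 0) (\<Gamma> x) \<le> u x"
    by (rule weak_solution_ge_step[OF u, where c=0]) (use u in \<open>auto simp: weak_solution_def\<close>)
  then show ?case using p1 by (simp add: ef.integral_op_def ef.approx_0)
next
  case (Suc n)
  have "continuous_on {0<..} (ef.approx n)"
  proof (cases n)
    case 0
    have "ef.approx 0 = (\<lambda>s. k * s)" by (auto simp: ef.approx_0)
    then show ?thesis unfolding 0 by (simp add: continuous_intros)
  next
    case (Suc m)
    show ?thesis unfolding Suc ef.approx_Suc
      by (rule integral_op_continuous[OF _ ef.approx_b less_imp_le[OF ef.super_slope(1)]]) auto
  qed
  then show ?case unfolding ef.approx_Suc
    by (rule weak_solution_ge_step[OF u _ _ ef.approx_b less_imp_le[OF ef.super_slope(1)] Suc.IH, rotated]) auto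
qed

theorem minimal_and_larger_solution:
  "\<exists>u v. minimal_solution V p k v \<and> weak_solution V p k u \<and> radially_symmetric u \<and>
     (\<forall>x. x \<noteq> 0 \<longrightarrow> v x < u x) \<and> classical_solution V p u \<and> classical_solution V p v"
proof -
  obtain w b where wm: "w \<in> borel_measurable borel" and b: "0 < b" and wk: "\<And>s. 0 < s \<Longrightarrow> k * s \<le> w s"
    and wb: "\<And>s. 0 < s \<Longrightarrow> w s \<le> b * s"
    and wT: "\<And>s. 0 < s \<Longrightarrow> w s = ef.integral_op w s" and w0: "w 0 = 0" and vw: "\<And>s. 0 < s \<Longrightarrow> ef.min_profile s < w s"
    by (rule ef.second_solution) (rule that)
  define u where "u x = w (\<Gamma> x)" for x
  define v where "v x = ef.min_profile (\<Gamma> x)" for x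
  have wpos: "0 \<le> w s" if "0 < s" for s using wk[OF that] mult_pos_pos[OF k_pos that] by linarith
  have su: "weak_solution V p k u" "classical_solution V p u"
    unfolding u_def[abs_def] by (rule fixed_point_solution[OF wm wpos wb less_imp_le[OF b] wT w0]; assumption)+
  have v0: "ef.min_profile 0 = 0" by (simp add: ef.min_profile_def)
  have sv: "weak_solution V p k v" "classical_solution V p v"
    unfolding v_def[abs_def]
    by (rule fixed_point_solution[OF ef.min_profile_measurable ef.min_profile_b ef.min_profile_le less_imp_le[OF
        ef.super_slope(1)] ef.min_profile_eq v0]; assumption)+
  have "minimal_solution V p k v"
    unfolding minimal_solution_def positive_weak_solution_def
  proof (intro conjI allI impI)
    show "weak_solution V p k v" by (rule sv)
    fix x :: "real^'n" assume x: "x \<noteq> 0"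
    show "0 < v x" using ef.min_profile_0[OF \<Gamma>_pos[OF x]] mult_pos_pos[OF k_pos \<Gamma>_pos[OF x]] by (simp add: v_def)
  next
    fix u' :: "real^'n \<Rightarrow> real"
    assume "weak_solution V p k u' \<and> (\<forall>x. x \<noteq> 0 \<longrightarrow> 0 < u' x)"
    then have u': "weak_solution V p k u'" by simp
    \<comment> \<open>The exceptional sets depend on n but are countably many, so the limit n
      \<rightarrow> \<infinity> may be taken at almost every x.\<close>
    have "AE x in lebesgue. \<forall>n. ef.approx n (\<Gamma> x) \<le> u' x"
      unfolding AE_all_countable using approx_le_weak_solution[OF u'] by blast
    moreover have "AE x in lebesgue. x \<noteq> (0::real^'n)" by (intro AE_completion AE_lborel_singleton)
    ultimately show "AE x in lebesgue. v x \<le> u' x"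
    proof eventually_elim
      case (elim x)
      show ?case unfolding v_def by (rule LIMSEQ_le_const2[OF ef.min_profile_lim[OF \<Gamma>_pos[OF elim(2)]]]) (use elim in blast)
    qed
  qed
  moreover have "radially_symmetric u" by (simp add: radially_symmetric_def u_def \<Gamma>_eq)
  moreover have "\<forall>x. x \<noteq> 0 \<longrightarrow> v x < u x" using vw[OF \<Gamma>_pos] by (simp add: u_def v_def)
  ultimately show ?thesis using su sv by blast
qed

end

theorem theorem1p4:
  fixes V :: "real^'n \<Rightarrow> real"
    and c1 a0 ainf p c2 k :: real
  assumes "CARD('n) > 2"
    and "radially_symmetric V"
    and "locally_lipschitz_on (- {0}) V"
    and "\<And>x. x \<noteq> 0 \<Longrightarrow> 0 \<le> V x"
    and "\<exists>x. x \<noteq> 0 \<and> V x \<noteq> 0"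
    and "c1 > 0"
    and "a0 < 2"
    and "ainf > max 0 (1 + a0 / 2)"
    and "\<And>x. x \<noteq> 0 \<Longrightarrow> V x \<le> c1 / (norm x powr a0 * (1 + norm x powr (ainf - a0)))"
    and "p > 1"
    and "p \<in> {(real CARD('n) - ainf) / (real CARD('n) - 2)
               <..< (real CARD('n) - a0) / (real CARD('n) - 2)} \<inter>
             {max (two_star CARD('n) ainf - 1) 0 <..< two_star CARD('n) a0 - 1}"
    and "c2 > 0"
    and "\<And>x. x \<noteq> 0 \<Longrightarrow>
           green_op (\<lambda>y. V y * green_dirac y powr p) x \<le> c2 * green_dirac x"
    and "k \<in> {0 <..< k_threshold c2 p}"
  shows "\<exists>u v. minimal_solution V p k v \<and>
               weak_solution V p k u \<and>
               radially_symmetric u \<and>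
               (\<forall>x. x \<noteq> 0 \<longrightarrow> v x < u x) \<and>
               classical_solution V p u \<and>
               classical_solution V p v"
proof -
  interpret singular_problem "TYPE('n)" "real CARD('n)" V c1 a0 ainf p c2 k
  proof
    \<comment> \<open>From a0 < 2 follows a0 < 1 + a0/2 < ainf.\<close>
    show "a0 < ainf" using assms(7,8) by simp
    show "x \<noteq> 0 \<Longrightarrow> 0 \<le> V x" for x by (rule assms)
    show "x \<noteq> 0 \<Longrightarrow> V x \<le> c1 / (norm x powr a0 * (1 + norm x powr (ainf - a0)))" for x by (rule assms)
    show "x \<noteq> 0 \<Longrightarrow> green_op (\<lambda>y. V y * green_dirac y powr p) x \<le> c2 * green_dirac x" for x by (rule assms)
  qed (use assms(1-3,5,6,10-12,14) in auto)
  show ?thesis by (rule minimal_and_larger_solution)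
qed

end
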